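(* Let $d\ge 1$, $\sigma\in\mathbb N$, $\alpha\in\mathbb C$, and let $s>s'>\frac d2$. Let $W$ be a real-valued one-dimensional Brownian motion on a filtered probability space $(\Omega,\mathcal F,\mathbb F,\mathbb P)$ satisfying the standard conditions. Let $\phi:H^{s'}\to H^{-s-1}$ be a map such that: (a) $\phi$ maps $H^s$ into $H^s$ and $\phi:H^s\to H^s$ is bounded on balls; (b) $\phi:H^{s'}\to H^{-s-1}$ is continuous and bounded on balls; (c) for every $n\in\mathbb N$ the map $P_n\phi:H_n\to H_n$ is locally Lipschitz continuous; (d) there exists a measurable, locally bounded (i.e. bounded on bounded sets) function $\psi:\mathbb R^+\times\mathbb R^+\to\mathbb R^+$ such that $\|\phi(u)-\phi(v)\|_s\le \psi(\|u\|_s,\|v\|_s)\|u-v\|_s$ for all $u,v\in H^s$; (e) there exist $r>1$ and $B\in\mathbb R$ such that $$|\alpha|K\|u\|_{L^\infty}^{2\sigma}+\frac12\frac{\|\phi(u)\|_s^2}{\|u\|_s^2}-\frac{[\Re(u,\phi(u))_s]^2}{\|u\|_s^4}\le B\qquad\text{for all }u\in H^s\text{ with }\|u\|_s\ge r.$$ Then for any initial datum $u^0\in H^s$ there exists a unique global-in-time strong solution $u$ of $$\mathrm d u(t)+\mathrm i\,[-Au(t)+\alpha F(u(t))]\,\mathrm dt=\phi(u(t))\,\mathrm dW(t),\quad t>0,\qquad u(0)=u^0,$$ with $\mathbb P$-a.s. paths in $C([0,\infty);H^s)$.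
   Context: $\mathbb N=\{1,2,\dots\}$, $\mathbb R^+=[0,\infty)$. $\mathbb T^d=(\mathbb R/2\pi\mathbb Z)^d$; all functions are complex-valued on $\mathbb T^d$. For $k\in\mathbb Z^d$, $e_k(x)=(2\pi)^{-d/2}e^{\mathrm i k\cdot x}$, $\widehat u(k)=(2\pi)^{-d/2}\int_{\mathbb T^d}u(x)e^{-\mathrm i k\cdot x}\,dx$, $\langle k\rangle=\sqrt{1+|k|^2}$. For $r\in\mathbb R$, $H^r$ is the $L^2$-based Sobolev space with inner product $(u,v)_r=\sum_{k}\langle k\rangle^{2r}\widehat u(k)\overline{\widehat v(k)}$ and norm $\|\cdot\|_r$; $H=H^0=L^2$. $A=-\Delta$ and $F(u)=|u|^{2\sigma}u$. $H_n=\mathrm{span}\{e_k:|k|\le n\}$ and $P_nu=\sum_{|k|\le n}(u,e_k)_0e_k$, extended to negative order Sobolev spaces by duality. $K=K(s,\sigma,d)>0$ is a fixed constant such that $\|F(u)\|_s\le K\|u\|_{L^\infty}^{2\sigma}\|u\|_s$ for all $u\in H^s\cap L^\infty$ (such a constant exists). Standard conditions: the filtration $\mathbb F=(\mathcal F_t)_{t\ge0}$ is right-continuous and all $\mathbb P$-negligible sets of $\mathcal F$ belong to $\mathcal F_0$. $C_w([0,\infty);H^s)$ is the space of weakly continuous $H^s$-valued functions. A strong solution on $[0,\infty)$ with initial datum $u^0$ (for the given stochastic basis and Brownian motion $W$) is an $H$-valued continuous $\mathbb F$-adapted process $u$ with $\mathbb P$-almost all paths in $C_w([0,\infty);H^s)$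 such that for every $t\ge 0$ $$u(t)=u^0+\mathrm i\int_0^t[Au(\rho)-\alpha F(u(\rho))]\,d\rho+\int_0^t\phi(u(\rho))\,dW(\rho)$$ holds $\mathbb P$-a.s. in $H^{-s-1}$. *)

theory Defs
  imports "HOL-Probability.Probability"
begin

section \<open>The Hilbert space of square-summable families\<close>

text \<open>A type-class copy of \<open>\<ell>\<^sup>2\<close> makes the library's Borel measurability and Bochner
  integration available for Sobolev-valued maps.\<close>

typedef 'i ell2 = "{f :: 'i \<Rightarrow> complex. (\<lambda>i. (cmod (f i))\<^sup>2) summable_on UNIV}"
  morphisms ell2_nth Abs_ell2
  by (rule exI[of _ "\<lambda>_. 0"]) simp

setup_lifting type_definition_ell2

lemma ell2_sq_summable: "(\<lambda>i. (cmod (ell2_nth x i))\<^sup>2) summable_on UNIV"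
  using ell2_nth[of x] by simp

lemma sq_summable_add:
  fixes f g :: "'i \<Rightarrow> complex"
  assumes "(\<lambda>i. (cmod (f i))\<^sup>2) summable_on UNIV" "(\<lambda>i. (cmod (g i))\<^sup>2) summable_on UNIV"
  shows "(\<lambda>i. (cmod (f i + g i))\<^sup>2) summable_on UNIV"
proof (rule summable_on_comparison_test)
  show "(\<lambda>i. 2 * ((cmod (f i))\<^sup>2 + (cmod (g i))\<^sup>2)) summable_on UNIV"
    using assms by (intro summable_on_cmult_right summable_on_add)
  fix i
  have "(cmod (f i + g i))\<^sup>2 \<le> (cmod (f i) + cmod (g i))\<^sup>2"
    by (intro power_mono norm_triangle_ineq) auto
  also have "\<dots> \<le> 2 * ((cmod (f i))\<^sup>2 + (cmod (g i))\<^sup>2)"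
    using sum_squares_bound[of "cmod (f i)" "cmod (g i)"] by (simp add: power2_sum)
  finally show "(cmod (f i + g i))\<^sup>2 \<le> 2 * ((cmod (f i))\<^sup>2 + (cmod (g i))\<^sup>2)" .
qed auto

lemma sq_summable_scale:
  fixes f :: "'i \<Rightarrow> complex"
  assumes "(\<lambda>i. (cmod (f i))\<^sup>2) summable_on UNIV"
  shows "(\<lambda>i. (cmod (c * f i))\<^sup>2) summable_on UNIV"
  using summable_on_cmult_right[OF assms, of "(cmod c)\<^sup>2"]
  by (simp add: norm_mult power_mult_distrib)

lemma mult_le_sum_squares: "a * b \<le> a\<^sup>2 + b\<^sup>2" if "0 \<le> a" "0 \<le> b" for a b :: real
proof -
  have "0 \<le> a * b" using that by simp
  then show ?thesis using sum_squares_bound[of a b] by (simp add: mult.assoc)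
qed

lemma ell2_inner_summable:
  "(\<lambda>i. ell2_nth x i \<bullet> ell2_nth y i) summable_on UNIV"
proof -
  have "(\<lambda>i. (cmod (ell2_nth x i))\<^sup>2 + (cmod (ell2_nth y i))\<^sup>2) summable_on UNIV"
    by (intro summable_on_add ell2_sq_summable)
  then have "(\<lambda>i. norm (ell2_nth x i \<bullet> ell2_nth y i)) summable_on UNIV"
  proof (rule summable_on_comparison_test)
    fix i
    have "norm (ell2_nth x i \<bullet> ell2_nth y i) \<le> cmod (ell2_nth x i) * cmod (ell2_nth y i)"
      unfolding real_norm_def by (rule Cauchy_Schwarz_ineq2)
    also have "\<dots> \<le> (cmod (ell2_nth x i))\<^sup>2 + (cmod (ell2_nth y i))\<^sup>2"
      by (rule mult_le_sum_squares) auto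
    finally show "norm (ell2_nth x i \<bullet> ell2_nth y i)
        \<le> (cmod (ell2_nth x i))\<^sup>2 + (cmod (ell2_nth y i))\<^sup>2" .
  qed auto
  then show ?thesis by (rule abs_summable_summable)
qed

instantiation ell2 :: (type) real_inner
begin

lift_definition zero_ell2 :: "'i ell2" is "\<lambda>_. 0" by simp
lift_definition plus_ell2 :: "'i ell2 \<Rightarrow> 'i ell2 \<Rightarrow> 'i ell2" is "\<lambda>f g i. f i + g i"
  by (rule sq_summable_add)
lift_definition uminus_ell2 :: "'i ell2 \<Rightarrow> 'i ell2" is "\<lambda>f i. - f i" by simp
lift_definition minus_ell2 :: "'i ell2 \<Rightarrow> 'i ell2 \<Rightarrow> 'i ell2" is "\<lambda>f g i. f i - g i"
  subgoal for f g using sq_summable_add[of f "\<lambda>i. - g i"] by simp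
  done
lift_definition scaleR_ell2 :: "real \<Rightarrow> 'i ell2 \<Rightarrow> 'i ell2" is "\<lambda>c f i. c *\<^sub>R f i"
  subgoal for c f using sq_summable_scale[of f "of_real c"] by (simp add: scaleR_conv_of_real)
  done

definition inner_ell2 :: "'i ell2 \<Rightarrow> 'i ell2 \<Rightarrow> real"
  where "inner_ell2 x y = (\<Sum>\<^sub>\<infinity>i. ell2_nth x i \<bullet> ell2_nth y i)"
definition norm_ell2 :: "'i ell2 \<Rightarrow> real"
  where "norm_ell2 x = sqrt (x \<bullet> x)"
definition dist_ell2 :: "'i ell2 \<Rightarrow> 'i ell2 \<Rightarrow> real"
  where "dist_ell2 x y = norm (x - y)"
definition sgn_ell2 :: "'i ell2 \<Rightarrow> 'i ell2"
  where "sgn_ell2 x = inverse (norm x) *\<^sub>R x"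
definition uniformity_ell2 :: "('i ell2 \<times> 'i ell2) filter"
  where "uniformity_ell2 = (INF e\<in>{0<..}. principal {(x, y). dist x y < e})"
definition open_ell2 :: "'i ell2 set \<Rightarrow> bool"
  where "open_ell2 U = (\<forall>x\<in>U. \<forall>\<^sub>F (x', y) in uniformity. x' = x \<longrightarrow> y \<in> U)"

instance
proof
  fix x y z :: "'i ell2" and a b :: real and U :: "'i ell2 set"
  show "x + y + z = x + (y + z)" by transfer (simp add: algebra_simps)
  show "x + y = y + x" by transfer (simp add: algebra_simps)
  show "0 + x = x" by transfer simp
  show "- x + x = 0" by transfer simp
  show "x - y = x + - y" by transfer simp
  show "a *\<^sub>R (x + y) = a *\<^sub>R x + a *\<^sub>R y" by transfer (simp add: algebra_simps)
  show "(a + b) *\<^sub>R x = a *\<^sub>R x + b *\<^sub>R x" by transfer (simp add: algebra_simps)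
  show "a *\<^sub>R b *\<^sub>R x = (a * b) *\<^sub>R x" by transfer simp
  show "1 *\<^sub>R x = x" by transfer simp
  show "dist x y = norm (x - y)" by (rule dist_ell2_def)
  show "sgn x = inverse (norm x) *\<^sub>R x" by (rule sgn_ell2_def)
  show "uniformity = (INF e\<in>{0<..}. principal {(x::'i ell2, y). dist x y < e})"
    by (rule uniformity_ell2_def)
  show "open U = (\<forall>x\<in>U. \<forall>\<^sub>F (x', y) in uniformity. x' = x \<longrightarrow> y \<in> U)"
    by (rule open_ell2_def)
  show "x \<bullet> y = y \<bullet> x" by (simp add: inner_ell2_def inner_commute)
  show "(x + y) \<bullet> z = x \<bullet> z + y \<bullet> z"
    unfolding inner_ell2_def plus_ell2.rep_eq inner_add_left
    by (rule infsum_add[OF ell2_inner_summable ell2_inner_summable])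
  show "a *\<^sub>R x \<bullet> y = a * (x \<bullet> y)"
    unfolding inner_ell2_def scaleR_ell2.rep_eq inner_scaleR_left
    by (rule infsum_cmult_right') 
  show "0 \<le> x \<bullet> x" by (auto simp: inner_ell2_def intro!: infsum_nonneg)
  show "x \<bullet> x = 0 \<longleftrightarrow> x = 0"
  proof
    assume "x \<bullet> x = 0"
    then have "ell2_nth x i \<bullet> ell2_nth x i = 0" for i
      using nonneg_infsum_le_0D[of "\<lambda>i. ell2_nth x i \<bullet> ell2_nth x i" UNIV i]
        ell2_inner_summable[of x x] by (simp add: inner_ell2_def)
    then show "x = 0" by (intro ell2_nth_inject[THEN iffD1] ext) (simp add: zero_ell2.rep_eq)
  qed (simp add: inner_ell2_def zero_ell2.rep_eq)
  show "norm x = sqrt (x \<bullet> x)" by (rule norm_ell2_def)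
qed

end

lemma norm_ell2_sq: "(norm x)\<^sup>2 = (\<Sum>\<^sub>\<infinity>i. (cmod (ell2_nth x i))\<^sup>2)"
  by (simp add: power2_norm_eq_inner inner_ell2_def)

lemma sum_le_norm_ell2_sq:
  assumes "finite S"
  shows "(\<Sum>i\<in>S. (cmod (ell2_nth x i))\<^sup>2) \<le> (norm x)\<^sup>2"
  unfolding norm_ell2_sq by (rule finite_sum_le_infsum[OF ell2_sq_summable assms]) auto

lemma cmod_ell2_nth_le: "cmod (ell2_nth x i) \<le> norm x"
  by (rule power2_le_imp_le) (use sum_le_norm_ell2_sq[of "{i}" x] in auto)

instance ell2 :: (type) banach
proof
  fix X :: "nat \<Rightarrow> 'i ell2"
  assume X: "Cauchy X"
  have "Cauchy (\<lambda>n. ell2_nth (X n) i)" for i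
  proof (rule metric_CauchyI)
    fix e :: real assume "0 < e"
    then obtain N where N: "\<forall>m\<ge>N. \<forall>n\<ge>N. dist (X m) (X n) < e"
      using X by (meson metric_CauchyD)
    have "dist (ell2_nth (X m) i) (ell2_nth (X n) i) \<le> dist (X m) (X n)" for m n
      using cmod_ell2_nth_le[of "X m - X n" i] by (simp add: dist_norm minus_ell2.rep_eq)
    then show "\<exists>N. \<forall>m\<ge>N. \<forall>n\<ge>N. dist (ell2_nth (X m) i) (ell2_nth (X n) i) < e"
      using N by (meson le_less_trans)
  qed
  then have "\<exists>l. (\<lambda>n. ell2_nth (X n) i) \<longlonglongrightarrow> l" for i
    by (simp add: Cauchy_convergent_iff convergent_def)
  then obtain l where l: "\<And>i. (\<lambda>n. ell2_nth (X n) i) \<longlonglongrightarrow> l i" by metis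
  have tail: "\<exists>N. \<forall>m\<ge>N. \<forall>S. finite S \<longrightarrow> (\<Sum>i\<in>S. (cmod (ell2_nth (X m) i - l i))\<^sup>2) \<le> e\<^sup>2"
    if "0 < e" for e
  proof -
    obtain N where N: "\<forall>m\<ge>N. \<forall>n\<ge>N. dist (X m) (X n) < e"
      using X \<open>0 < e\<close> by (meson metric_CauchyD)
    have "(\<Sum>i\<in>S. (cmod (ell2_nth (X m) i - l i))\<^sup>2) \<le> e\<^sup>2" if "N \<le> m" "finite S" for m S
    proof (rule tendsto_upperbound)
      show "(\<lambda>n. \<Sum>i\<in>S. (cmod (ell2_nth (X m) i - ell2_nth (X n) i))\<^sup>2)
          \<longlonglongrightarrow> (\<Sum>i\<in>S. (cmod (ell2_nth (X m) i - l i))\<^sup>2)"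
        by (intro tendsto_intros l)
      have "(\<Sum>i\<in>S. (cmod (ell2_nth (X m) i - ell2_nth (X n) i))\<^sup>2) \<le> e\<^sup>2" if "N \<le> n" for n
      proof -
        have "(\<Sum>i\<in>S. (cmod (ell2_nth (X m) i - ell2_nth (X n) i))\<^sup>2) \<le> (norm (X m - X n))\<^sup>2"
          using sum_le_norm_ell2_sq[OF \<open>finite S\<close>, of "X m - X n"] by (simp add: minus_ell2.rep_eq)
        also have "\<dots> \<le> e\<^sup>2"
          using N \<open>N \<le> m\<close> \<open>N \<le> n\<close> by (intro power_mono) (auto simp: dist_norm less_imp_le)
        finally show ?thesis .
      qed
      then show "\<forall>\<^sub>F n in sequentially.
          (\<Sum>i\<in>S. (cmod (ell2_nth (X m) i - ell2_nth (X n) i))\<^sup>2) \<le> e\<^sup>2"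
        by (auto simp: eventually_sequentially)
    qed simp
    then show ?thesis by blast
  qed
  have diff_summable: "(\<lambda>i. (cmod (ell2_nth (X m) i - l i))\<^sup>2) summable_on UNIV"
    if "\<And>S. finite S \<Longrightarrow> (\<Sum>i\<in>S. (cmod (ell2_nth (X m) i - l i))\<^sup>2) \<le> e\<^sup>2" for m and e :: real
    using that by (intro nonneg_bdd_above_summable_on bdd_aboveI[of _ "e\<^sup>2"]) auto
  obtain N where N: "\<And>S. finite S \<Longrightarrow> (\<Sum>i\<in>S. (cmod (ell2_nth (X N) i - l i))\<^sup>2) \<le> 1\<^sup>2"
    using tail[of 1] by auto
  have "(\<lambda>i. (cmod (l i))\<^sup>2) summable_on UNIV"
    using sq_summable_add[OF ell2_sq_summable[of "X N"]
        sq_summable_scale[OF diff_summable[OF N], of "-1"]]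
    by simp
  then have L: "ell2_nth (Abs_ell2 l) = l" by (simp add: Abs_ell2_inverse)
  have "X \<longlonglongrightarrow> Abs_ell2 l"
  proof (rule metric_LIMSEQ_I)
    fix e :: real assume "0 < e"
    obtain N where N: "\<And>m S. N \<le> m \<Longrightarrow> finite S
        \<Longrightarrow> (\<Sum>i\<in>S. (cmod (ell2_nth (X m) i - l i))\<^sup>2) \<le> (e / 2)\<^sup>2"
      using tail[of "e / 2"] \<open>0 < e\<close> by auto
    have "dist (X m) (Abs_ell2 l) < e" if "N \<le> m" for m
    proof -
      have bound: "(\<Sum>i\<in>S. (cmod (ell2_nth (X m) i - l i))\<^sup>2) \<le> (e / 2)\<^sup>2" if "finite S" for S
        using N \<open>N \<le> m\<close> that by blast
      have "(\<lambda>i. (cmod (ell2_nth (X m) i - l i))\<^sup>2) summable_on UNIV"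
        by (rule diff_summable) (rule bound)
      then have "(\<Sum>\<^sub>\<infinity>i. (cmod (ell2_nth (X m) i - l i))\<^sup>2) \<le> (e / 2)\<^sup>2"
        by (rule infsum_le_finite_sums) (rule bound)
      then have "(norm (X m - Abs_ell2 l))\<^sup>2 \<le> (e / 2)\<^sup>2"
        by (simp add: norm_ell2_sq minus_ell2.rep_eq L)
      then have "norm (X m - Abs_ell2 l) \<le> e / 2"
        by (rule power2_le_imp_le) (use \<open>0 < e\<close> in simp)
      then show ?thesis using \<open>0 < e\<close> by (simp add: dist_norm)
    qed
    then show "\<exists>N. \<forall>m\<ge>N. dist (X m) (Abs_ell2 l) < e" by (intro exI[of _ N]) simp
  qed
  then show "convergent X" by (auto simp: convergent_def)
qed


instance ell2 :: (countable) second_countable_topology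
proof
  define Q where "Q = {z :: complex. Re z \<in> \<rat> \<and> Im z \<in> \<rat>}"
  define D :: "'a ell2 set" where
    "D = {x. finite {i. ell2_nth x i \<noteq> 0} \<and> range (ell2_nth x) \<subseteq> Q}"
  have "Q \<subseteq> (\<lambda>p. Complex (fst p) (snd p)) ` (\<rat> \<times> \<rat>)"
  proof
    fix z assume "z \<in> Q"
    then show "z \<in> (\<lambda>p. Complex (fst p) (snd p)) ` (\<rat> \<times> \<rat>)"
      by (intro image_eqI[of _ _ "(Re z, Im z)"]) (auto simp: Q_def)
  qed
  then have "countable Q"
    by (rule countable_subset) (intro countable_image countable_SIGMA countable_rat)
  have "0 \<in> Q" by (simp add: Q_def)
  have Q_dense: "\<exists>q\<in>Q. cmod (z - q) < e" if "0 < e" for z e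
  proof -
    obtain a where a: "a \<in> \<rat>" "Re z < a" "a < Re z + e / 2"
      using Rats_dense_in_real[of "Re z" "Re z + e / 2"] \<open>0 < e\<close> by auto
    obtain b where b: "b \<in> \<rat>" "Im z < b" "b < Im z + e / 2"
      using Rats_dense_in_real[of "Im z" "Im z + e / 2"] \<open>0 < e\<close> by auto
    have "cmod (z - Complex a b) \<le> \<bar>Re (z - Complex a b)\<bar> + \<bar>Im (z - Complex a b)\<bar>"
      by (rule cmod_le)
    also have "\<dots> < e" using a b by simp
    finally show ?thesis using a b by (intro bexI[of _ "Complex a b"]) (auto simp: Q_def)
  qed
  have "countable {f :: 'a \<Rightarrow> complex. (\<forall>i. f i \<in> Q) \<and> finite {i. f i \<noteq> 0}}"
    using countable_product_event_const[OF \<open>countable Q\<close>, of 0] by simp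
  then have "countable (Abs_ell2 ` {f :: 'a \<Rightarrow> complex. (\<forall>i. f i \<in> Q) \<and> finite {i. f i \<noteq> 0}})"
    by simp
  moreover have "D \<subseteq> Abs_ell2 ` {f. (\<forall>i. f i \<in> Q) \<and> finite {i. f i \<noteq> 0}}"
  proof
    fix x assume "x \<in> D"
    then show "x \<in> Abs_ell2 ` {f. (\<forall>i. f i \<in> Q) \<and> finite {i. f i \<noteq> 0}}"
      by (intro image_eqI[of _ _ "ell2_nth x"]) (auto simp: D_def ell2_nth_inverse)
  qed
  ultimately have "countable D" by (rule countable_subset[rotated])
  have D_dense: "\<exists>y\<in>D. dist x y < e" if "0 < e" for x :: "'a ell2" and e
  proof -
    obtain S where S: "finite S"
      "dist (\<Sum>i\<in>S. (cmod (ell2_nth x i))\<^sup>2) (\<Sum>\<^sub>\<infinity>i. (cmod (ell2_nth x i))\<^sup>2) \<le> e\<^sup>2 / 4"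
      using infsum_finite_approximation[OF ell2_sq_summable, of "e\<^sup>2 / 4" x] \<open>0 < e\<close> by auto
    define \<delta> where "\<delta> = e / (2 * sqrt (real (Suc (card S))))"
    have "0 < \<delta>" using \<open>0 < e\<close> by (simp add: \<delta>_def)
    have \<delta>2: "real (card S) * \<delta>\<^sup>2 \<le> e\<^sup>2 / 4"
    proof -
      have "real (card S) * \<delta>\<^sup>2 = (real (card S) / real (Suc (card S))) * (e\<^sup>2 / 4)"
        by (simp add: \<delta>_def power_divide power_mult_distrib)
      also have "\<dots> \<le> 1 * (e\<^sup>2 / 4)" by (intro mult_right_mono) auto
      finally show ?thesis by simp
    qed
    have "\<forall>i. \<exists>q. q \<in> Q \<and> cmod (ell2_nth x i - q) < \<delta>"
      using Q_dense[OF \<open>0 < \<delta>\<close>] by blast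
    from choice[OF this] obtain q where "\<forall>i. q i \<in> Q \<and> cmod (ell2_nth x i - q i) < \<delta>"
      by blast
    then have q: "\<And>i. q i \<in> Q" "\<And>i. cmod (ell2_nth x i - q i) < \<delta>" by auto
    define g where "g = (\<lambda>i. if i \<in> S then q i else 0)"
    have "finite {i. g i \<noteq> 0}" by (rule finite_subset[OF _ \<open>finite S\<close>]) (auto simp: g_def)
    have "(\<lambda>i. (cmod (g i))\<^sup>2) summable_on UNIV \<longleftrightarrow> (\<lambda>i. (cmod (g i))\<^sup>2) summable_on S"
      by (rule summable_on_cong_neutral) (auto simp: g_def)
    then have "(\<lambda>i. (cmod (g i))\<^sup>2) summable_on UNIV" using \<open>finite S\<close> by simp
    then have g: "ell2_nth (Abs_ell2 g) = g" by (simp add: Abs_ell2_inverse)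
    have g_nth: "ell2_nth (Abs_ell2 g) i = (if i \<in> S then q i else 0)" for i
      unfolding g by (simp add: g_def)
    have "Abs_ell2 g \<in> D"
      using \<open>finite {i. g i \<noteq> 0}\<close> q \<open>0 \<in> Q\<close> by (auto simp: D_def g) (auto simp: g_def)
    have bound: "(\<Sum>i\<in>T. (cmod (ell2_nth (x - Abs_ell2 g) i))\<^sup>2) \<le> e\<^sup>2 / 2" if "finite T" for T
    proof -
      have "(\<Sum>i\<in>T. (cmod (ell2_nth (x - Abs_ell2 g) i))\<^sup>2)
          = (\<Sum>i\<in>T \<inter> S. (cmod (ell2_nth (x - Abs_ell2 g) i))\<^sup>2)
            + (\<Sum>i\<in>T - S. (cmod (ell2_nth (x - Abs_ell2 g) i))\<^sup>2)"
        by (rule sum.Int_Diff[OF that])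
      also have "(\<Sum>i\<in>T \<inter> S. (cmod (ell2_nth (x - Abs_ell2 g) i))\<^sup>2) \<le> (\<Sum>i\<in>T \<inter> S. \<delta>\<^sup>2)"
        using q(2) by (intro sum_mono power_mono) (auto simp: minus_ell2.rep_eq g_nth less_imp_le)
      also have "\<dots> \<le> real (card S) * \<delta>\<^sup>2"
        using card_mono[OF \<open>finite S\<close>, of "T \<inter> S"] by (simp add: mult_right_mono)
      also have "\<dots> \<le> e\<^sup>2 / 4" by (rule \<delta>2)
      also have "(\<Sum>i\<in>T - S. (cmod (ell2_nth (x - Abs_ell2 g) i))\<^sup>2)
          = (\<Sum>i\<in>T - S. (cmod (ell2_nth x i))\<^sup>2)"
        by (intro sum.cong) (auto simp: minus_ell2.rep_eq g_nth)
      also have "\<dots> \<le> e\<^sup>2 / 4"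
      proof -
        have "(\<Sum>i\<in>S. (cmod (ell2_nth x i))\<^sup>2) + (\<Sum>i\<in>T - S. (cmod (ell2_nth x i))\<^sup>2)
            = (\<Sum>i\<in>S \<union> (T - S). (cmod (ell2_nth x i))\<^sup>2)"
          using that \<open>finite S\<close> by (intro sum.union_disjoint[symmetric]) auto
        also have "\<dots> \<le> (\<Sum>\<^sub>\<infinity>i. (cmod (ell2_nth x i))\<^sup>2)"
          using that \<open>finite S\<close> by (intro finite_sum_le_infsum ell2_sq_summable) auto
        finally show ?thesis using S(2) unfolding dist_real_def by linarith
      qed
      finally show ?thesis by simp
    qed
    have "(norm (x - Abs_ell2 g))\<^sup>2 \<le> e\<^sup>2 / 2"
      unfolding norm_ell2_sq by (rule infsum_le_finite_sums[OF ell2_sq_summable bound])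
    also have "\<dots> < e\<^sup>2" using \<open>0 < e\<close> by simp
    finally have "dist x (Abs_ell2 g) < e"
      unfolding dist_norm by (rule power_less_imp_less_base) (use \<open>0 < e\<close> in simp)
    then show ?thesis using \<open>Abs_ell2 g \<in> D\<close> by blast
  qed
  show "\<exists>B :: 'a ell2 set set. countable B \<and> open = generate_topology B"
  proof (intro exI conjI)
    let ?B = "(\<lambda>(x, n). ball x (inverse (real (Suc n)))) ` (D \<times> UNIV)"
    show "countable ?B" using \<open>countable D\<close> by blast
    have "topological_basis ?B"
    proof (rule topological_basisI)
      fix U :: "'a ell2 set" and x assume "open U" "x \<in> U"
      then obtain e where e: "0 < e" "ball x e \<subseteq> U" by (meson open_contains_ball)
      obtain n where n: "inverse (real (Suc n)) < e / 2"
        using reals_Archimedean[of "e / 2"] e by auto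
      obtain y where y: "y \<in> D" "dist x y < inverse (real (Suc n))"
        using D_dense[of "inverse (real (Suc n))" x] by auto
      have "ball y (inverse (real (Suc n))) \<subseteq> ball x e"
      proof
        fix z assume "z \<in> ball y (inverse (real (Suc n)))"
        then show "z \<in> ball x e" using dist_triangle[of x z y] y n by simp
      qed
      then show "\<exists>B\<in>?B. x \<in> B \<and> B \<subseteq> U"
        using y e by (intro bexI[of _ "ball y (inverse (real (Suc n)))"]) (auto simp: dist_commute)
    qed auto
    then show "open = generate_topology ?B" by (rule topological_basis_imp_subbasis)
  qed
qed


section \<open>Periodic distributions and Sobolev spaces on the torus\<close>

text \<open>
  The index type \<open>'d\<close> stands for \<open>{1, \<dots>, d}\<close>, so \<open>d = CARD('d)\<close> and \<open>int ^ 'd\<close> is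
  \<open>\<int>\<^sup>d\<close>. A periodic distribution is represented by its family of Fourier coefficients
  \<open>u k = \<langle>u, e\<^sub>k\<rangle>\<close>; this makes all the spaces \<open>H\<^sup>r\<close>, including those of negative order, subsets
  of one type.
\<close>

type_synonym 'd coeffs = "int ^ 'd \<Rightarrow> complex"

definition freq :: "int ^ 'd::finite \<Rightarrow> real ^ 'd"
  where "freq k = (\<chi> i. real_of_int (k $ i))"

definition japanese :: "int ^ 'd::finite \<Rightarrow> real"
  where "japanese k = sqrt (1 + (norm (freq k))\<^sup>2)"

definition sob :: "real \<Rightarrow> 'd::finite coeffs set"
  where "sob r = {u. (\<lambda>k. japanese k powr (2 * r) * (cmod (u k))\<^sup>2) summable_on UNIV}"

definition sob_inner :: "real \<Rightarrow> 'd::finite coeffs \<Rightarrow> 'd coeffs \<Rightarrow> complex"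
  where "sob_inner r u v = (\<Sum>\<^sub>\<infinity>k. complex_of_real (japanese k powr (2 * r)) * u k * cnj (v k))"

definition sob_norm :: "real \<Rightarrow> 'd::finite coeffs \<Rightarrow> real"
  where "sob_norm r u = sqrt (Re (sob_inner r u u))"

definition sob_dist :: "real \<Rightarrow> 'd::finite coeffs \<Rightarrow> 'd coeffs \<Rightarrow> real"
  where "sob_dist r u v = sob_norm r (\<lambda>k. u k - v k)"

definition sob_topology :: "real \<Rightarrow> 'd::finite coeffs topology"
  where "sob_topology r = Metric_space.mtopology (sob r) (sob_dist r)"

text \<open>The isometric isomorphism \<open>H\<^sup>r \<rightarrow> \<ell>\<^sup>2\<close> and its inverse.\<close>

definition to_ell2 :: "real \<Rightarrow> 'd::finite coeffs \<Rightarrow> (int ^ 'd) ell2"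
  where "to_ell2 r u =
    (if u \<in> sob r then Abs_ell2 (\<lambda>k. complex_of_real (japanese k powr r) * u k) else 0)"

definition of_ell2 :: "real \<Rightarrow> (int ^ 'd::finite) ell2 \<Rightarrow> 'd coeffs"
  where "of_ell2 r x = (\<lambda>k. complex_of_real (japanese k powr (- r)) * ell2_nth x k)"

lemma japanese_pos: "0 < japanese k"
  by (simp add: japanese_def add_pos_nonneg)

lemma japanese_neq_0 [simp]: "japanese k \<noteq> 0"
  using japanese_pos[of k] by simp

lemma japanese_powr_sq: "(japanese k powr r)\<^sup>2 = japanese k powr (2 * r)"
  by (simp add: power2_eq_square flip: powr_add)

lemma ell2_nth_to_ell2:
  assumes "u \<in> sob r"
  shows "ell2_nth (to_ell2 r u) k = complex_of_real (japanese k powr r) * u k"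
  using assms
  by (simp add: to_ell2_def Abs_ell2_inverse sob_def norm_mult power_mult_distrib japanese_powr_sq)

lemma norm_to_ell2:
  assumes "u \<in> sob r"
  shows "norm (to_ell2 r u) = sob_norm r u"
proof -
  have eq: "complex_of_real (japanese k powr (2 * r)) * u k * cnj (u k)
      = complex_of_real (japanese k powr (2 * r) * (cmod (u k))\<^sup>2)" for k
    by (simp add: complex_norm_square mult.assoc del: of_real_power)
  have "(\<lambda>k. japanese k powr (2 * r) * (cmod (u k))\<^sup>2) summable_on UNIV"
    using assms by (simp add: sob_def)
  then have "sob_inner r u u = complex_of_real (\<Sum>\<^sub>\<infinity>k. japanese k powr (2 * r) * (cmod (u k))\<^sup>2)"
    unfolding sob_inner_def eq by (intro infsumI has_sum_of_real has_sum_infsum)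
  moreover have "(norm (to_ell2 r u))\<^sup>2 = (\<Sum>\<^sub>\<infinity>k. japanese k powr (2 * r) * (cmod (u k))\<^sup>2)"
    by (simp add: norm_ell2_sq ell2_nth_to_ell2[OF assms] norm_mult power_mult_distrib
        japanese_powr_sq)
  ultimately have "Re (sob_inner r u u) = (norm (to_ell2 r u))\<^sup>2" by simp
  then show ?thesis by (simp add: sob_norm_def)
qed

lemma of_ell2_in_sob: "of_ell2 r x \<in> sob r"
proof -
  have "japanese k powr (2 * r) * (cmod (of_ell2 r x k))\<^sup>2 = (cmod (ell2_nth x k))\<^sup>2" for k
    by (simp add: of_ell2_def norm_mult norm_inverse power_mult_distrib power_inverse
        japanese_powr_sq powr_minus)
  then show ?thesis by (simp add: sob_def ell2_sq_summable)
qed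

lemma of_ell2_to_ell2: "u \<in> sob r \<Longrightarrow> of_ell2 r (to_ell2 r u) = u"
  by (intro ext) (simp add: of_ell2_def ell2_nth_to_ell2 powr_minus)

lemma to_ell2_of_ell2: "to_ell2 r (of_ell2 r x) = x"
proof (intro ell2_nth_inject[THEN iffD1] ext)
  fix k
  show "ell2_nth (to_ell2 r (of_ell2 r x)) k = ell2_nth x k"
    by (simp add: ell2_nth_to_ell2[OF of_ell2_in_sob]) (simp add: of_ell2_def powr_minus)
qed

lemma sob_diff:
  assumes "u \<in> sob r" "v \<in> sob r"
  shows "(\<lambda>k. u k - v k) \<in> sob r"
    and "to_ell2 r (\<lambda>k. u k - v k) = to_ell2 r u - to_ell2 r v"
proof -
  have eq: "(\<lambda>k. u k - v k) = of_ell2 r (to_ell2 r u - to_ell2 r v)"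
    using of_ell2_to_ell2[OF assms(1)] of_ell2_to_ell2[OF assms(2)]
    by (auto simp: of_ell2_def minus_ell2.rep_eq fun_eq_iff right_diff_distrib)
  show "(\<lambda>k. u k - v k) \<in> sob r" unfolding eq by (rule of_ell2_in_sob)
  show "to_ell2 r (\<lambda>k. u k - v k) = to_ell2 r u - to_ell2 r v"
    unfolding eq by (rule to_ell2_of_ell2)
qed

lemma sob_dist_eq:
  "u \<in> sob r \<Longrightarrow> v \<in> sob r \<Longrightarrow> sob_dist r u v = dist (to_ell2 r u) (to_ell2 r v)"
  by (simp add: sob_dist_def dist_norm flip: sob_diff(2) norm_to_ell2[OF sob_diff(1)])

lemma Metric_space_sob: "Metric_space (sob r) (sob_dist r :: 'd::finite coeffs \<Rightarrow> _)"
proof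
  fix u v w :: "'d coeffs"
  have summand: "complex_of_real (japanese k powr (2 * r)) * z * cnj z
      = complex_of_real (japanese k powr (2 * r) * (cmod z)\<^sup>2)" for k :: "int ^ 'd" and z
    by (simp add: complex_norm_square mult.assoc del: of_real_power)
  have "0 \<le> Re (sob_inner r x x)" for x :: "'d coeffs"
  proof (cases "(\<lambda>k. complex_of_real (japanese k powr (2 * r)) * x k * cnj (x k)) summable_on UNIV")
    case True
    then have "Re (sob_inner r x x)
        = (\<Sum>\<^sub>\<infinity>k. Re (complex_of_real (japanese k powr (2 * r)) * x k * cnj (x k)))"
      unfolding sob_inner_def by (rule infsum_Re[symmetric])
    also have "\<dots> \<ge> 0" unfolding summand by (rule infsum_nonneg) simp
    finally show ?thesis .
  qed (simp add: sob_inner_def infsum_not_exists)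
  then show "0 \<le> sob_dist r u v" by (simp add: sob_dist_def sob_norm_def)
  show "sob_dist r u v = sob_dist r v u"
    unfolding sob_dist_def sob_norm_def sob_inner_def summand by (simp add: norm_minus_commute)
  {
    assume uv: "u \<in> sob r" "v \<in> sob r"
    then show "sob_dist r u v = 0 \<longleftrightarrow> u = v"
      by (metis sob_dist_eq dist_eq_0_iff of_ell2_to_ell2)
    assume "w \<in> sob r"
    with uv show "sob_dist r u w \<le> sob_dist r u v + sob_dist r v w"
      by (simp add: sob_dist_eq dist_triangle)
  }
qed


subsection \<open>Functions on the torus\<close>

text \<open>Functions on \<open>\<T>\<^sup>d\<close> are functions on \<open>\<real>\<^sup>d\<close>, integrated over one period cell.\<close>

definition cell :: "(real ^ 'd::finite) set"
  where "cell = cbox 0 (\<chi> i. 2 * pi)"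

definition fourier_coeff :: "(real ^ 'd::finite \<Rightarrow> complex) \<Rightarrow> 'd coeffs"
  where "fourier_coeff f = (\<lambda>k. complex_of_real ((2 * pi) powr (- (real CARD('d) / 2))) *
    (LINT x | lebesgue_on cell. f x * cis (- (freq k \<bullet> x))))"

text \<open>The function with Fourier coefficients \<open>u\<close>. It is only applied to \<open>u \<in> H\<^sup>s\<close> with
  \<open>s > d / 2\<close>, where the Fourier series converges absolutely and uniformly.\<close>

definition fourier_fun :: "'d::finite coeffs \<Rightarrow> real ^ 'd \<Rightarrow> complex"
  where "fourier_fun u x =
    (\<Sum>\<^sub>\<infinity>k. u k * (complex_of_real ((2 * pi) powr (- (real CARD('d) / 2))) * cis (freq k \<bullet> x)))"

definition Linf_norm :: "(real ^ 'd::finite \<Rightarrow> complex) \<Rightarrow> ereal"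
  where "Linf_norm f = esssup (lebesgue_on cell) (\<lambda>x. ereal (cmod (f x)))"

definition neg_laplace :: "'d::finite coeffs \<Rightarrow> 'd coeffs"
  where "neg_laplace u = (\<lambda>k. complex_of_real ((norm (freq k))\<^sup>2) * u k)"

definition power_nonlin :: "nat \<Rightarrow> 'd::finite coeffs \<Rightarrow> 'd coeffs"
  where "power_nonlin \<sigma> u = fourier_coeff
    (\<lambda>x. complex_of_real (cmod (fourier_fun u x) ^ (2 * \<sigma>)) * fourier_fun u x)"

text \<open>\<open>H\<^sub>n\<close>, the span of the finitely many modes \<open>e\<^sub>k\<close> with \<open>\<bar>k\<bar> \<le> n\<close>, and \<open>P\<^sub>n\<close>.\<close>

definition trig_space :: "nat \<Rightarrow> 'd::finite coeffs set"
  where "trig_space n = {u. \<forall>k. norm (freq k) > real n \<longrightarrow> u k = 0}"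

definition trig_proj :: "nat \<Rightarrow> 'd::finite coeffs \<Rightarrow> 'd coeffs"
  where "trig_proj n u = (\<lambda>k. if norm (freq k) \<le> real n then u k else 0)"

definition locally_lipschitz_trig ::
    "nat \<Rightarrow> ('d::finite coeffs \<Rightarrow> 'd coeffs) \<Rightarrow> bool"
  where "locally_lipschitz_trig n f \<longleftrightarrow>
    (\<forall>u\<in>trig_space n. \<exists>\<delta>>0. \<exists>L. \<forall>v\<in>trig_space n. \<forall>w\<in>trig_space n.
      sob_dist 0 u v < \<delta> \<longrightarrow> sob_dist 0 u w < \<delta> \<longrightarrow>
      sob_dist 0 (f v) (f w) \<le> L * sob_dist 0 v w)"

definition bounded_on_balls ::
    "real \<Rightarrow> real \<Rightarrow> ('d::finite coeffs \<Rightarrow> 'd coeffs) \<Rightarrow> bool"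
  where "bounded_on_balls r q f \<longleftrightarrow>
    (\<forall>R. \<exists>C. \<forall>u\<in>sob r. sob_norm r u \<le> R \<longrightarrow> sob_norm q (f u) \<le> C)"

text \<open>The \<open>H\<^sup>r\<close>-valued Bochner integral.\<close>

definition sob_integrable :: "real \<Rightarrow> real set \<Rightarrow> (real \<Rightarrow> 'd::finite coeffs) \<Rightarrow> bool"
  where "sob_integrable r S f \<longleftrightarrow>
    (\<forall>t\<in>S. f t \<in> sob r) \<and> set_integrable lborel S (\<lambda>t. to_ell2 r (f t))"

definition sob_integral :: "real \<Rightarrow> real set \<Rightarrow> (real \<Rightarrow> 'd::finite coeffs) \<Rightarrow> 'd coeffs"
  where "sob_integral r S f = of_ell2 r (LINT t:S|lborel. to_ell2 r (f t))"

definition sob_weakly_continuous :: "real \<Rightarrow> (real \<Rightarrow> 'd::finite coeffs) \<Rightarrow> bool"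
  where "sob_weakly_continuous r f \<longleftrightarrow>
    (\<forall>t\<ge>0. f t \<in> sob r) \<and> (\<forall>v\<in>sob r. continuous_on {0..} (\<lambda>t. sob_inner r (f t) v))"

definition sob_continuous :: "real \<Rightarrow> (real \<Rightarrow> 'd::finite coeffs) \<Rightarrow> bool"
  where "sob_continuous r f \<longleftrightarrow> continuous_map (top_of_set {0..}) (sob_topology r) f"


section \<open>Brownian motion and the Ito integral\<close>

text \<open>Filtrations are indexed by the nonnegative reals; values at negative times are ignored.\<close>

definition standard_filtration :: "'a measure \<Rightarrow> (real \<Rightarrow> 'a measure) \<Rightarrow> bool"
  where "standard_filtration M \<F> \<longleftrightarrow>
    (\<forall>t\<ge>0. subalgebra M (\<F> t)) \<and>
    (\<forall>r t. 0 \<le> r \<longrightarrow> r \<le> t \<longrightarrow> sets (\<F> r) \<subseteq> sets (\<F> t)) \<and>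
    (\<forall>t\<ge>0. sets (\<F> t) = (\<Inter>u\<in>{t<..}. sets (\<F> u))) \<and>
    null_sets M \<subseteq> sets (\<F> 0)"

definition brownian_motion ::
    "'a measure \<Rightarrow> (real \<Rightarrow> 'a measure) \<Rightarrow> (real \<Rightarrow> 'a \<Rightarrow> real) \<Rightarrow> bool"
  where "brownian_motion M \<F> W \<longleftrightarrow>
    (\<forall>t\<ge>0. W t \<in> borel_measurable (\<F> t)) \<and>
    (AE \<omega> in M. W 0 \<omega> = 0) \<and>
    (AE \<omega> in M. continuous_on {0..} (\<lambda>t. W t \<omega>)) \<and>
    (\<forall>r t. 0 \<le> r \<longrightarrow> r < t \<longrightarrow>
      distributed M lborel (\<lambda>\<omega>. W t \<omega> - W r \<omega>) (normal_density 0 (sqrt (t - r))) \<and>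
      prob_space.indep_set M (sets (\<F> r))
        (sets (vimage_algebra (space M) (\<lambda>\<omega>. W t \<omega> - W r \<omega>) borel)))"

definition progressively_measurable ::
    "(real \<Rightarrow> 'a measure) \<Rightarrow> (real \<Rightarrow> 'a \<Rightarrow> 'b::topological_space) \<Rightarrow> bool"
  where "progressively_measurable \<F> X \<longleftrightarrow>
    (\<forall>t\<ge>0. case_prod X \<in> borel_measurable (restrict_space borel {0..t} \<Otimes>\<^sub>M \<F> t))"

text \<open>Bounded elementary processes \<open>\<Sum>\<^bsub>i<n\<^esub> \<xi>\<^sub>i 1\<^bsub>(\<tau>\<^sub>i, \<tau>\<^bsub>i+1\<^esub>]\<^esub>\<close>, given by their data \<open>(n, \<tau>, \<xi>)\<close>.\<close>

definition elementary ::
    "'a measure \<Rightarrow> (real \<Rightarrow> 'a measure) \<Rightarrow> nat \<Rightarrow> (nat \<Rightarrow> real) \<Rightarrow>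
      (nat \<Rightarrow> 'a \<Rightarrow> 'b::real_normed_vector) \<Rightarrow> bool"
  where "elementary M \<F> n \<tau> \<xi> \<longleftrightarrow>
    0 \<le> \<tau> 0 \<and> (\<forall>i<n. \<tau> i \<le> \<tau> (Suc i)) \<and>
    (\<forall>i<n. \<xi> i \<in> borel_measurable (\<F> (\<tau> i)) \<and> bounded (\<xi> i ` space M))"

definition elementary_process ::
    "nat \<Rightarrow> (nat \<Rightarrow> real) \<Rightarrow> (nat \<Rightarrow> 'a \<Rightarrow> 'b::real_normed_vector) \<Rightarrow> real \<Rightarrow> 'a \<Rightarrow> 'b"
  where "elementary_process n \<tau> \<xi> t \<omega> = (\<Sum>i<n. indicator {\<tau> i<..\<tau> (Suc i)} t *\<^sub>R \<xi> i \<omega>)"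

definition elementary_integral ::
    "(real \<Rightarrow> 'a \<Rightarrow> real) \<Rightarrow> nat \<Rightarrow> (nat \<Rightarrow> real) \<Rightarrow>
      (nat \<Rightarrow> 'a \<Rightarrow> 'b::real_normed_vector) \<Rightarrow> real \<Rightarrow> 'a \<Rightarrow> 'b"
  where "elementary_integral W n \<tau> \<xi> t \<omega> =
    (\<Sum>i<n. (W (min t (\<tau> (Suc i))) \<omega> - W (min t (\<tau> i)) \<omega>) *\<^sub>R \<xi> i \<omega>)"

text \<open>
  \<open>I = \<integral>\<^sub>0\<^sup>t X dW\<close>: some elementary processes \<open>X\<^sub>j\<close> satisfy
  \<open>\<integral>\<^sub>0\<^sup>t \<parallel>X\<^sub>j - X\<parallel>\<^sup>2 d\<rho> \<rightarrow> 0\<close> and \<open>\<integral>\<^sub>0\<^sup>t X\<^sub>j dW \<rightarrow> I\<close> in probability. This determines \<open>I\<close>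
  almost surely, and such \<open>X\<^sub>j\<close>, \<open>I\<close> exist for every progressively measurable \<open>X\<close> with
  \<open>\<integral>\<^sub>0\<^sup>t \<parallel>X\<parallel>\<^sup>2 d\<rho> < \<infinity>\<close> almost surely. The process \<open>X\<close> itself need only agree with a progressively
  measurable \<open>Y\<close> off a null set of outcomes: below, \<open>X = \<phi>(u)\<close> is meaningful only on the paths of
  \<open>u\<close> lying in the domain of \<open>\<phi>\<close>.
\<close>

definition has_ito_integral ::
    "'a measure \<Rightarrow> (real \<Rightarrow> 'a measure) \<Rightarrow> (real \<Rightarrow> 'a \<Rightarrow> real) \<Rightarrow> real \<Rightarrow>
      (real \<Rightarrow> 'a \<Rightarrow> 'b::{banach, second_countable_topology}) \<Rightarrow> ('a \<Rightarrow> 'b) \<Rightarrow> bool"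
  where "has_ito_integral M \<F> W t X I \<longleftrightarrow>
    I \<in> borel_measurable M \<and>
    (\<exists>Y n \<tau> \<xi>.
      progressively_measurable \<F> Y \<and>
      (AE \<omega> in M. \<forall>\<rho>\<in>{0..t}. X \<rho> \<omega> = Y \<rho> \<omega>) \<and>
      (\<forall>j. elementary M \<F> (n j) (\<tau> j) (\<xi> j)) \<and>
      (\<forall>\<epsilon>>0. (\<lambda>j. measure M {\<omega> \<in> space M.
          (\<integral>\<^sup>+\<rho>\<in>{0..t}. ennreal ((norm (elementary_process (n j) (\<tau> j) (\<xi> j) \<rho> \<omega> - Y \<rho> \<omega>))\<^sup>2) \<partial>lborel)
            > ennreal \<epsilon>}) \<longlonglongrightarrow> 0) \<and>
      (\<forall>\<epsilon>>0. (\<lambda>j. measure M {\<omega> \<in> space M.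
          norm (elementary_integral W (n j) (\<tau> j) (\<xi> j) t \<omega> - I \<omega>) > \<epsilon>}) \<longlonglongrightarrow> 0))"

definition sob_has_ito_integral ::
    "real \<Rightarrow> 'a measure \<Rightarrow> (real \<Rightarrow> 'a measure) \<Rightarrow> (real \<Rightarrow> 'a \<Rightarrow> real) \<Rightarrow> real \<Rightarrow>
      (real \<Rightarrow> 'a \<Rightarrow> 'd::finite coeffs) \<Rightarrow> ('a \<Rightarrow> 'd coeffs) \<Rightarrow> bool"
  where "sob_has_ito_integral r M \<F> W t X I \<longleftrightarrow>
    (AE \<omega> in M. \<forall>\<rho>\<in>{0..t}. X \<rho> \<omega> \<in> sob r) \<and> (\<forall>\<omega>\<in>space M. I \<omega> \<in> sob r) \<and>
    has_ito_integral M \<F> W t (\<lambda>\<rho> \<omega>. to_ell2 r (X \<rho> \<omega>)) (\<lambda>\<omega>. to_ell2 r (I \<omega>))"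


section \<open>Strong solutions\<close>

text \<open>The equation is an identity in \<open>H\<^bsup>-s-1\<^esup>\<close>, expressed through the Fourier coefficients;
  all of its terms are elements of that space.\<close>

definition strong_solution ::
    "'a measure \<Rightarrow> (real \<Rightarrow> 'a measure) \<Rightarrow> (real \<Rightarrow> 'a \<Rightarrow> real) \<Rightarrow> real \<Rightarrow> nat \<Rightarrow> complex \<Rightarrow>
      ('d::finite coeffs \<Rightarrow> 'd coeffs) \<Rightarrow> 'd coeffs \<Rightarrow> (real \<Rightarrow> 'a \<Rightarrow> 'd coeffs) \<Rightarrow> bool"
  where "strong_solution M \<F> W s \<sigma> \<alpha> \<phi> u0 u \<longleftrightarrow>
    (\<forall>\<omega>\<in>space M. sob_continuous 0 (\<lambda>t. u t \<omega>)) \<and>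
    (\<forall>t\<ge>0. (\<lambda>\<omega>. to_ell2 0 (u t \<omega>)) \<in> borel_measurable (\<F> t)) \<and>
    (AE \<omega> in M. sob_weakly_continuous s (\<lambda>t. u t \<omega>)) \<and>
    (\<forall>t\<ge>0. \<exists>I.
      sob_has_ito_integral (- s - 1) M \<F> W t (\<lambda>\<rho> \<omega>. \<phi> (u \<rho> \<omega>)) I \<and>
      (AE \<omega> in M.
        sob_integrable (- s - 1) {0..t}
          (\<lambda>\<rho> k. neg_laplace (u \<rho> \<omega>) k - \<alpha> * power_nonlin \<sigma> (u \<rho> \<omega>) k) \<and>
        u t \<omega> = (\<lambda>k. u0 k
          + \<i> * sob_integral (- s - 1) {0..t}
              (\<lambda>\<rho> k. neg_laplace (u \<rho> \<omega>) k - \<alpha> * power_nonlin \<sigma> (u \<rho> \<omega>) k) k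
          + I \<omega> k)))"

end

theory Submission imports Defs "HOL-Computational_Algebra.Polynomial" begin

text \<open>Identify \<open>H\<^sup>s\<close> with \<open>\<ell>\<^sup>2\<close>. The twist \<open>w(t) = S(-t) u(t)\<close> by the isometric free flow \<open>S\<close> removes
  the unbounded operator: \<open>w\<close> solves an equation with locally Lipschitz coefficients in \<open>\<ell>\<^sup>2\<close>, and the
  Lyapunov condition (e) is invariant under the twist. Truncated coefficients are globally Lipschitz, so
  Picard iteration applies. Condition (e) bounds the drift of \<open>log (norm w)\<^sup>2\<close>; estimated along an Euler
  scheme, where only the moments of Brownian increments enter and no Ito formula is needed, it makes the
  probability that \<open>w\<close> reaches norm \<open>n\<close> before a fixed time of order \<open>1 / log n\<close>. Hence the truncated
  solutions agree up to exit times that tend to infinity, and they glue to a global one.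

  An arbitrary strong solution is only weakly continuous in \<open>H\<^sup>s\<close> and solves the equation in
  \<open>H\<^sup>-\<^sup>s\<^sup>-\<^sup>1\<close>. Spectral cut-offs turn it, after the twist, into an Ito process in \<open>\<ell>\<^sup>2\<close>; a Gronwall argument
  localised by predictable cut-offs survives the limit of the cut-offs and gives uniqueness.\<close>

text \<open>Formally log |w|^2 has the drift (2 (w,b) + |g|^2) / |w|^2 - 2 (w,g)^2 / |w|^4, which
  for the twisted coefficients is at most twice the left side of (e). It survives the twist because
  (e) sees the drift only through a norm and the noise only through a norm and an inner product. No
  Lipschitz bound on F is given. It is extracted from the growth bound with K, as F is a polynomial
  of degree 2 \<sigma> + 1 along every line. The integral is defined by convergence in probability,
  so estimates on it are localised: the integrand is multiplied by a decreasing 0-1 process, which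
  does not affect Riemann sums as long as it equals 1. Along a weakly continuous path the
  \<open>H^s\<close> norm need not be continuous; it is a supremum of continuous functions, which
  keeps its sublevel sets in time closed and suffices to build such a process. The coefficients of
  the Euler scheme are taken along the exact solution. This avoids a stability analysis of the
  scheme, at the price of a small perturbation of the Lyapunov inequality.\<close>

notation scaleR (infixr "*R" 75)
abbreviation (input) LS (infixr "---->" 60) where "X ----> l == X \<longlonglongrightarrow> l"
abbreviation nnl (binder "NL " 10) where "nnl f == nn_integral lborel f"
abbreviation (in prob_space) nnE (binder "EE " 10) where "nnE f == nn_integral M f"
abbreviation NI where "NI t f == NL r. f r * indicator {0..t::real} r"
abbreviation nsq where "nsq x == ennreal ((norm x)^2)"
class sep_normed = real_normed_vector + second_countable_topology
class sep_inner = real_inner + second_countable_topology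
subclass (in sep_inner) sep_normed ..
instance real :: sep_inner ..
instance ell2 :: (countable) sep_inner ..

section \<open>Dyadic time grids\<close>

text \<open>Rounding down keeps a sampled process adapted, and the grids are nested, so samples
  taken on two meshes can both be read on the finer one (\<open>kap_kap\<close>).\<close>

definition kap :: "nat => real => real" where "kap p t = real_of_int \<lfloor>t * 2 ^ p\<rfloor> / 2 ^ p"

lemma kap_le: "kap p t <= t" by (simp add: kap_def divide_le_eq)

lemma kap_gt: "t - 1 / 2 ^ p < kap p t"
proof -
 have "t * 2 ^ p - 1 < real_of_int \<lfloor>t * 2 ^ p\<rfloor>" by linarith
 then have "(t * 2 ^ p - 1) / 2 ^ p < real_of_int \<lfloor>t * 2 ^ p\<rfloor> / 2 ^ p" by (intro divide_strict_right_mono) auto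
 then show ?thesis by (simp add: kap_def diff_divide_distrib)
qed

lemma kap_nonneg: "0 <= t ==> 0 <= kap p t" by (simp add: kap_def)

lemma kap_grid [simp]: "kap p (real i / 2 ^ p) = real i / 2 ^ p" by (simp add: kap_def)

lemma kap_0 [simp]: "kap p 0 = 0" by (simp add: kap_def)

lemma kap_eqI: assumes "real i / 2 ^ p <= t" "t < real (Suc i) / 2 ^ p" shows "kap p t = real i / 2 ^ p"
proof -
 have "\<lfloor>t * 2 ^ p\<rfloor> = int i" using assms by (intro floor_unique) (auto simp: field_simps)
 then show ?thesis by (simp add: kap_def)
qed

lemma kap_kap: assumes "q <= p" shows "kap q (kap p t) = kap q t"
proof -
 have "\<lfloor>real_of_int \<lfloor>t * 2 ^ p\<rfloor> / 2 ^ p * 2 ^ q\<rfloor> = \<lfloor>t * 2 ^ q\<rfloor>"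
 proof -
  have eq: "(2::real) ^ p = 2 ^ q * 2 ^ (p - q)" using assms by (simp flip: power_add)
  have "real_of_int \<lfloor>t * 2 ^ p\<rfloor> / 2 ^ p * 2 ^ q = real_of_int \<lfloor>t * 2 ^ p\<rfloor> / real_of_int (2 ^ (p - q))"
   by (simp add: eq)
  then have "\<lfloor>real_of_int \<lfloor>t * 2 ^ p\<rfloor> / 2 ^ p * 2 ^ q\<rfloor> = \<lfloor>t * 2 ^ p\<rfloor> div 2 ^ (p - q)"
   by (metis floor_divide_of_int_eq)
  also have "... = \<lfloor>t * 2 ^ p / real_of_int (2 ^ (p - q))\<rfloor>" by (metis floor_divide_real_eq_div zero_le_numeral zero_le_power)
  also have "t * 2 ^ p / real_of_int (2 ^ (p - q)) = t * 2 ^ q" by (simp add: eq)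
  finally show ?thesis .
 qed
 then show ?thesis by (simp add: kap_def)
qed

lemma kap_lim: "(%p. kap p t) ----> t"
proof (rule tendsto_sandwich)
 show "(%p. t - 1 / 2 ^ p) ----> t" using tendsto_diff[OF tendsto_const LIMSEQ_inverse_realpow_zero[of 2], of t]
  by (simp add: inverse_eq_divide)
 show "(%p. t) ----> t" by simp
qed (auto intro: always_eventually less_imp_le kap_gt kap_le)

lemma kap_measurable [measurable]: "kap p : borel_measurable borel" unfolding kap_def by measurable

lemma nat_ceiling_le_iff: "0 <= t ==> nat \<lceil>t * 2 ^ p\<rceil> <= N \<longleftrightarrow> t <= real N / 2 ^ p"
 by (simp add: field_simps nat_le_iff ceiling_le_iff)

lemma less_nat_ceiling_iff: "0 <= t ==> i < nat \<lceil>t * 2 ^ p\<rceil> \<longleftrightarrow> real i / 2 ^ p < t"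
 using nat_ceiling_le_iff[of t p i] by linarith

text \<open>The cells are closed on the left, as the floor demands, and the last one is cut at
  \<open>t\<close>; the point \<open>t\<close> itself is Lebesgue null. This is the link between the
  discrete isometry and time integrals.\<close>

lemma nn_integral_step: fixes h :: "real => ennreal" assumes "0 <= t" shows "NI t (%r. h (kap p r))
  = (\<Sum>i<nat \<lceil>t * 2 ^ p\<rceil>. ennreal (min t (real (Suc i) / 2 ^ p) - real i / 2 ^ p) * h (real i / 2 ^ p))"
proof -
 let ?N = "nat \<lceil>t * 2 ^ p\<rceil>"
 have eq: "h (kap p r) * indicator {0..<t} r = (\<Sum>i<?N. h (real i / 2 ^ p) * indicator {real i / 2 ^ p..<min t (real (Suc i) / 2 ^ p)} r)" for r
 proof (cases "r : {0..<t}")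
  case True
  define j where "j = nat \<lfloor>r * 2 ^ p\<rfloor>"
  have j1: "real j <= r * 2 ^ p" "r * 2 ^ p < real (Suc j)" using True by (auto simp: j_def) linarith+
  then have j: "real j / 2 ^ p <= r" "r < real (Suc j) / 2 ^ p" by (auto simp: field_simps)
  have uniq: "r : {real i / 2 ^ p..<min t (real (Suc i) / 2 ^ p)} \<longleftrightarrow> i = j" for i
  proof
   assume "r : {real i / 2 ^ p..<min t (real (Suc i) / 2 ^ p)}"
   then have "real i <= r * 2 ^ p" "r * 2 ^ p < real (Suc i)" by (auto simp: field_simps)
   with j1 show "i = j" by linarith
  qed (use j True in auto)
  have "j < ?N" using j(1) True by (subst less_nat_ceiling_iff) auto
  have "(\<Sum>i<?N. h (real i / 2 ^ p) * indicator {real i / 2 ^ p..<min t (real (Suc i) / 2 ^ p)} r)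
   = (\<Sum>i<?N. if i = j then h (real j / 2 ^ p) else 0)"
   using uniq unfolding indicator_def of_bool_def by (intro sum.cong refl) (simp del: atLeastLessThan_iff of_nat_Suc)
  also have "... = h (kap p r)" using \<open>j < ?N\<close> by (simp add: kap_eqI[OF j])
  finally show ?thesis using True by simp
 next
  case False
  have "h (real i / 2 ^ p) * indicator {real i / 2 ^ p..<min t (real (Suc i) / 2 ^ p)} r = 0" for i
  proof -
   have "r ~: {real i / 2 ^ p..<min t (real (Suc i) / 2 ^ p)}"
   proof
    assume *: "r : {real i / 2 ^ p..<min t (real (Suc i) / 2 ^ p)}"
    have "0 <= real i / 2 ^ p" by simp
    also have "... <= r" using * by simp
    finally have "0 <= r" "r < t" using * by auto
    with False show False by simp
   qed
   then show ?thesis by simp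
  qed
  then have "(\<Sum>i<?N. h (real i / 2 ^ p) * indicator {real i / 2 ^ p..<min t (real (Suc i) / 2 ^ p)} r) = 0" by (simp only: sum.neutral_const)
  moreover have "indicator {0..<t} r = (0::ennreal)" using False by (rule indicator_simps(2))
  ultimately show ?thesis by (simp only: mult_zero_right)
 qed
 have "NI t (%r. h (kap p r)) = (NL r. h (kap p r) * indicator {0..<t} r)"
  using AE_lborel_singleton[of t] by (intro nn_integral_cong_AE) (auto simp: indicator_def)
 also have "... = (NL r. (\<Sum>i<?N. h (real i / 2 ^ p) * indicator {real i / 2 ^ p..<min t (real (Suc i) / 2 ^ p)} r))"
  unfolding eq ..
 also have "... = (\<Sum>i<?N. (NL r. h (real i / 2 ^ p) * indicator {real i / 2 ^ p..<min t (real (Suc i) / 2 ^ p)} r))"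
  by (rule nn_integral_sum) auto
 also have "... = (\<Sum>i<?N. ennreal (min t (real (Suc i) / 2 ^ p) - real i / 2 ^ p) * h (real i / 2 ^ p))"
 proof (intro sum.cong refl)
  fix i assume "i : {..<?N}"
  then have "real i / 2 ^ p <= min t (real (Suc i) / 2 ^ p)" using less_nat_ceiling_iff[OF assms, of i p] by (auto simp: divide_right_mono)
  then show "(NL r. h (real i / 2 ^ p) * indicator {real i / 2 ^ p..<min t (real (Suc i) / 2 ^ p)} r)
   = ennreal (min t (real (Suc i) / 2 ^ p) - real i / 2 ^ p) * h (real i / 2 ^ p)" by (subst nn_integral_cmult_indicator) (auto simp: mult.commute)
 qed
 finally show ?thesis .
qed

section \<open>Brownian increments and discrete stochastic sums\<close>

text \<open>Normality and independence of the increments are used only through these moments against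
  weights known at time \<open>r\<close>. The fourth and sixth moments serve the remainder of the
  Euler estimate. Every path is continuous here, so that Riemann sums need no exceptional
  set.\<close>

locale wiener = prob_space M for M :: "'a measure" + fixes \<F> :: "real => 'a measure" and W :: "real => 'a => real"
 assumes filtration: "standard_filtration M \<F>" and W_adapted: "0 <= t ==> W t : borel_measurable (\<F> t)"
  and W_cont: "z : space M ==> continuous_on {0..} (%t. W t z)"
  and W_moment1: "0 <= r ==> r <= t ==> ze : borel_measurable (\<F> r) ==> integrable M ze ==> has_bochner_integral M (%z. ze z * (W t z - W r z)) 0"
  and W_moment2: "0 <= r ==> r <= t ==> ze : borel_measurable (\<F> r) ==> integrable M ze ==>
   has_bochner_integral M (%z. ze z * (W t z - W r z)^2) ((t - r) * expectation ze)"
  and W_moment4: "0 <= r ==> r <= t ==> has_bochner_integral M (%z. (W t z - W r z) ^ 4) (3 * (t - r) ^ 2)"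
  and W_moment6: "0 <= r ==> r <= t ==> has_bochner_integral M (%z. (W t z - W r z) ^ 6) (15 * (t - r) ^ 3)"
begin

lemma F_subalgebra: "0 <= t ==> subalgebra M (\<F> t)" using filtration unfolding standard_filtration_def by blast

lemma space_F: "0 <= t ==> space (\<F> t) = space M" using F_subalgebra[of t] by (simp add: subalgebra_def)

lemma sets_F_M: "0 <= t ==> sets (\<F> t) \<subseteq> sets M" using F_subalgebra[of t] by (simp add: subalgebra_def)

lemma sets_F_mono: "0 <= r ==> r <= t ==> sets (\<F> r) \<subseteq> sets (\<F> t)" using filtration unfolding standard_filtration_def by blast

lemma null_sets_F: assumes "0 <= t" "N : null_sets M" shows "N : sets (\<F> t)"
proof -
 have "null_sets M \<subseteq> sets (\<F> 0)" using filtration unfolding standard_filtration_def by blast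
 then show ?thesis using sets_F_mono[of 0 t] assms by blast
qed

lemma F_mono: "f : measurable (\<F> r) N ==> 0 <= r ==> r <= t ==> f : measurable (\<F> t) N"
 using sets_F_mono[of r t] space_F[of r] space_F[of t] by (auto simp: measurable_def)

lemma F_M: "f : measurable (\<F> t) N ==> 0 <= t ==> f : measurable M N" using sets_F_M[of t] space_F[of t] by (auto simp: measurable_def)

lemma W_measurable: "0 <= r ==> r <= t ==> W r : borel_measurable (\<F> t)" using F_mono[OF W_adapted] .

lemma W_measurable_M: "0 <= r ==> W r : borel_measurable M" using F_M[OF W_adapted] .

definition grid_sum :: "(nat => real) => (nat => 'a => 'b::real_normed_vector) => nat => 'a => 'b"
 where "grid_sum ta xi n w = (\<Sum>i<n. (W (ta (Suc i)) w - W (ta i) w) *R xi i w)"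

text \<open>When one increment is added, the cross term is a weight measurable at time
  \<open>ta n\<close> times that increment, so its mean is zero. The bound on \<open>xi\<close>
  makes the weight integrable by Young's inequality.\<close>

lemma grid_sum_isometry: fixes xi :: "nat => 'a => 'b::sep_inner"
 assumes ta: "!!i. i <= n ==> 0 <= ta i" "!!i. i < n ==> ta i <= ta (Suc i)" and xi: "!!i. i < n ==> xi i : borel_measurable (\<F> (ta i))"
  and bnd: "!!i w. i < n ==> w : space M ==> norm (xi i w) <= C i"
 shows "grid_sum ta xi n : borel_measurable (\<F> (ta n)) & has_bochner_integral M (%w. (norm (grid_sum ta xi n w))^2)
   (\<Sum>i<n. (ta (Suc i) - ta i) * expectation (%w. (norm (xi i w))^2))"
 using assms
proof (induction n)
 case 0
 show ?case unfolding grid_sum_def by (auto intro: has_bochner_integral_zero)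
next
 case (Suc n)
 let ?S = "grid_sum ta xi n" and ?d = "%w. W (ta (Suc n)) w - W (ta n) w"
 have S: "?S : borel_measurable (\<F> (ta n))" and S2: "has_bochner_integral M (%w. (norm (?S w))^2)
   (\<Sum>i<n. (ta (Suc i) - ta i) * expectation (%w. (norm (xi i w))^2))"
  using Suc.IH Suc.prems by auto
 note t = Suc.prems(1)[of n] Suc.prems(1)[of "Suc n"] Suc.prems(2)[of n]
 note [measurable] = S Suc.prems(3)[of n, simplified]
 have SM [measurable]: "?S : borel_measurable M" "xi n : borel_measurable M" using F_M[OF S] F_M[OF Suc.prems(3)[of n]] t by auto
 have eq: "grid_sum ta xi (Suc n) w = ?S w + ?d w *R xi n w" for w by (simp add: grid_sum_def)
 have "grid_sum ta xi (Suc n) : borel_measurable (\<F> (ta (Suc n)))"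
  unfolding eq using t F_mono[OF S, of "ta (Suc n)"] F_mono[OF Suc.prems(3)[of n], of "ta (Suc n)"]
   W_measurable[of "ta n" "ta (Suc n)"] W_adapted[of "ta (Suc n)"] by simp
 moreover have "has_bochner_integral M (%w. (norm (grid_sum ta xi (Suc n) w))^2)
   (\<Sum>i<Suc n. (ta (Suc i) - ta i) * expectation (%w. (norm (xi i w))^2))"
 proof -
  have C: "norm (xi n w) <= C n" if "w : space M" for w using Suc.prems(4)[of n w] that by simp
  have 1: "(%w. 2 * (?S w \<bullet> xi n w)) : borel_measurable (\<F> (ta n))" by measurable
  have 2: "integrable M (%w. 2 * (?S w \<bullet> xi n w))"
  proof (rule Bochner_Integration.integrable_bound)
   show "integrable M (%w. (norm (?S w))^2 + (C n)^2)" using S2 by (auto intro!: Bochner_Integration.integrable_add simp: has_bochner_integral_iff)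
   show "AE w in M. norm (2 * (?S w \<bullet> xi n w)) <= norm ((norm (?S w))^2 + (C n)^2)"
   proof (rule AE_I2)
    fix w assume "w : space M"
    then have "norm (xi n w) ^ 2 <= (C n) ^ 2" using C by (intro power_mono) auto
    moreover have "\<bar>?S w \<bullet> xi n w\<bar> <= norm (?S w) * norm (xi n w)" by (rule Cauchy_Schwarz_ineq2)
    moreover have "2 * (norm (?S w) * norm (xi n w)) <= norm (?S w) ^ 2 + norm (xi n w) ^ 2"
     using sum_squares_bound[of "norm (?S w)" "norm (xi n w)"] by (simp add: mult.assoc)
    ultimately show "norm (2 * (?S w \<bullet> xi n w)) <= norm ((norm (?S w))^2 + (C n)^2)" by (simp add: abs_mult)
   qed
  qed measurable
  have 3: "(%w. (norm (xi n w))^2) : borel_measurable (\<F> (ta n))" by measurable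
  have 4: "integrable M (%w. (norm (xi n w))^2)" using C by (intro integrable_const_bound[of _ "(C n)^2"] AE_I2) (auto intro: power_mono)
  have "has_bochner_integral M (%w. (norm (?S w))^2 + (2 * (?S w \<bullet> xi n w)) * ?d w + (norm (xi n w))^2 * (?d w)^2)
    ((\<Sum>i<n. (ta (Suc i) - ta i) * expectation (%w. (norm (xi i w))^2)) + 0 + (ta (Suc n) - ta n) * expectation (%w. (norm (xi n w))^2))"
   using t by (intro has_bochner_integral_add S2 W_moment1 W_moment2 1 2 3 4) auto
  moreover have "(norm (grid_sum ta xi (Suc n) w))^2 = (norm (?S w))^2 + (2 * (?S w \<bullet> xi n w)) * ?d w + (norm (xi n w))^2 * (?d w)^2" for w
   unfolding eq power2_norm_eq_inner by (simp add: inner_add_left inner_add_right inner_commute power2_eq_square algebra_simps)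
  ultimately show ?thesis by simp
 qed
 ultimately show ?case ..
qed

lemma nn_grid_sum_isometry: fixes xi :: "nat => 'a => 'b::sep_inner"
 assumes ta: "!!i. i <= n ==> 0 <= ta i" "!!i. i < n ==> ta i <= ta (Suc i)" and xi: "!!i. i < n ==> xi i : borel_measurable (\<F> (ta i))"
  and bnd: "!!i w. i < n ==> w : space M ==> norm (xi i w) <= C i"
 shows "(EE w. nsq (grid_sum ta xi n w))
  = (\<Sum>i<n. ennreal (ta (Suc i) - ta i) * (EE w. nsq (xi i w)))"
proof -
 have "(EE w. nsq (grid_sum ta xi n w))
  = ennreal (\<Sum>i<n. (ta (Suc i) - ta i) * expectation (%w. (norm (xi i w))^2))"
 proof (subst nn_integral_eq_integral)
  have *: "has_bochner_integral M (%w. (norm (grid_sum ta xi n w))^2) (\<Sum>i<n. (ta (Suc i) - ta i) * expectation (%w. (norm (xi i w))^2))"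
   by (rule grid_sum_isometry[where C=C, THEN conjunct2]) (fact assms)+
  show "integrable M (%w. (norm (grid_sum ta xi n w))^2)" using * by (rule integrable.intros)
  show "ennreal (expectation (%w. (norm (grid_sum ta xi n w))^2)) = ennreal (\<Sum>i<n. (ta (Suc i) - ta i) * expectation (%w. (norm (xi i w))^2))"
   using has_bochner_integral_integral_eq[OF *] by simp
 qed simp
 also have "... = (\<Sum>i<n. ennreal ((ta (Suc i) - ta i) * expectation (%w. (norm (xi i w))^2)))"
  by (intro sum_ennreal[symmetric]) (auto intro!: sum_nonneg mult_nonneg_nonneg ta integral_nonneg_AE)
 also have "... = (\<Sum>i<n. ennreal (ta (Suc i) - ta i) * (EE w. nsq (xi i w)))"
 proof (intro sum.cong refl)
  fix i assume i: "i : {..<n}"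
  then have [measurable]: "xi i : borel_measurable M" using F_M[OF xi[of i]] ta(1)[of i] by auto
  have "integrable M (%w. (norm (xi i w))^2)" using bnd i by (intro integrable_const_bound[of _ "(C i)^2"] AE_I2) (auto intro: power_mono)
  then have "(EE w. nsq (xi i w)) = ennreal (expectation (%w. (norm (xi i w))^2))"
   by (rule nn_integral_eq_integral) auto
  then show "ennreal ((ta (Suc i) - ta i) * expectation (%w. (norm (xi i w))^2))
   = ennreal (ta (Suc i) - ta i) * (EE w. nsq (xi i w))" using i ta(2)[of i] by (simp add: ennreal_mult)
 qed
 finally show ?thesis .
qed

text \<open>Kolmogorov's stopping argument: \<open>et\<close> switches the integrand off once the
  sum has exceeded \<open>e\<close>, so the sum of \<open>et\<close> stays frozen above
  \<open>e\<close> until the end. Chebyshev's inequality and the isometry for \<open>et\<close> then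
  bound the event.\<close>

lemma grid_sum_maximal: fixes xi :: "nat => 'a => 'b::sep_inner"
 assumes ta: "!!i. i <= n ==> 0 <= ta i" "!!i. i < n ==> ta i <= ta (Suc i)" and xi: "!!i. i < n ==> xi i : borel_measurable (\<F> (ta i))"
  and bnd: "!!i w. i < n ==> w : space M ==> norm (xi i w) <= C i" and "0 < e"
 shows "{w:space M. EX j<=n. norm (grid_sum ta xi j w) > e} : sets M"
  and "ennreal (e^2) * emeasure M {w:space M. EX j<=n. norm (grid_sum ta xi j w) > e}
   <= (\<Sum>i<n. ennreal (ta (Suc i) - ta i) * (EE w. nsq (xi i w)))"
proof -
 let ?A = "{w:space M. EX j<=n. norm (grid_sum ta xi j w) > e}"
 define et where "et i w = (if ALL l<=i. norm (grid_sum ta xi l w) <= e then xi i w else 0)" for i w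
 have mono: "ta l <= ta i" if "l <= i" "i <= n" for l i using that
 proof (induction rule: dec_induct)
  case (step m)
  then show ?case using ta(2)[of m] by simp
 qed simp
 have S: "grid_sum ta xi l : borel_measurable (\<F> (ta i))" if "l <= i" "i <= n" for l i
 proof -
  have "grid_sum ta xi l : borel_measurable (\<F> (ta l))" using that by (intro grid_sum_isometry[where C=C, THEN conjunct1] ta xi bnd) auto
  then show ?thesis by (rule F_mono) (use that mono ta in auto)
 qed
 have etm: "et i : borel_measurable (\<F> (ta i))" if "i < n" for i
 proof -
  note [measurable] = xi[OF that]
  have [measurable]: "grid_sum ta xi l : borel_measurable (\<F> (ta i))" if "l : {..i}" for l using S[of l i] that \<open>i < n\<close> by auto
  have "(%w. if ALL l:{..i}. norm (grid_sum ta xi l w) <= e then xi i w else 0) : borel_measurable (\<F> (ta i))" by measurable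
  then show ?thesis by (simp add: et_def[abs_def])
 qed
 have etb: "norm (et i w) <= norm (xi i w)" for i w by (simp add: et_def)
 \<comment> \<open>Strict \<open>l < j\<close> suffices: the last summand, with index
   \<open>j - 1\<close>, tests the sums only up to that index.\<close>
 have stop: "grid_sum ta et j w = grid_sum ta xi j w" if "ALL l<j. norm (grid_sum ta xi l w) <= e" for j w
  unfolding grid_sum_def using that by (intro sum.cong) (auto simp: et_def grid_sum_def)
 have stopped: "grid_sum ta et m w = grid_sum ta et j w" if "norm (grid_sum ta xi j w) > e" "j <= m" for j m w using that(2)
 proof (induction rule: dec_induct)
  case (step m)
  have "et m w = 0" using that(1) step(1) by (auto simp: et_def not_le)
  then have "grid_sum ta et (Suc m) w = grid_sum ta et m w" by (simp add: grid_sum_def)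
  with step show ?case by simp
 qed simp
 have "e < norm (grid_sum ta et n w)" if "j <= n" "norm (grid_sum ta xi j w) > e" for j w
 proof -
  define k where "k = (LEAST j. norm (grid_sum ta xi j w) > e)"
  have "norm (grid_sum ta xi k w) > e" "k <= j" unfolding k_def using that by (auto intro: LeastI Least_le)
  moreover have "grid_sum ta et k w = grid_sum ta xi k w" by (intro stop) (auto simp: k_def dest: not_less_Least)
  ultimately show ?thesis using stopped[of k w n] that by simp
 qed
 note big = this
 have sub: "?A \<subseteq> {w:space M. ennreal (e^2) <= nsq (grid_sum ta et n w)}"
 proof safe
  fix w j assume "j <= n" "e < norm (grid_sum ta xi j w)"
  from big[OF this] show "ennreal (e^2) <= nsq (grid_sum ta et n w)" using \<open>0 < e\<close> by (intro ennreal_leI power_mono) auto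
 qed
 have "grid_sum ta et n : borel_measurable (\<F> (ta n))"
  using bnd by (intro grid_sum_isometry[where C=C, THEN conjunct1] ta etm order_trans[OF etb]) auto
 then have [measurable]: "grid_sum ta et n : borel_measurable M" by (rule F_M) (use ta in auto)
 have [measurable]: "grid_sum ta xi j : borel_measurable M" if "j : {..n}" for j using that by (intro F_M[OF S[of j j]] ta) auto
 have "{w:space M. EX j:{..n}. norm (grid_sum ta xi j w) > e} : sets M" by measurable
 then show "?A : sets M" by (simp add: Bex_def)
 have "ennreal (e^2) * emeasure M ?A <= ennreal (e^2) * emeasure M {w:space M. ennreal (e^2) <= nsq (grid_sum ta et n w)}"
  by (intro mult_left_mono emeasure_mono sub) auto
 also have "... = (EE w. ennreal (e^2) * indicator {w:space M. ennreal (e^2) <= nsq (grid_sum ta et n w)} w)"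
  by (subst nn_integral_cmult_indicator) auto
 also have "... <= (EE w. nsq (grid_sum ta et n w))" by (intro nn_integral_mono) (auto simp: indicator_def)
 also have "... = (\<Sum>i<n. ennreal (ta (Suc i) - ta i) * (EE w. nsq (et i w)))"
  by (rule nn_grid_sum_isometry[where C=C]) (auto intro: ta etm order_trans[OF etb bnd])
 also have "... <= (\<Sum>i<n. ennreal (ta (Suc i) - ta i) * (EE w. nsq (xi i w)))"
  using etb by (intro sum_mono mult_left_mono nn_integral_mono ennreal_leI power_mono) auto
 finally show "ennreal (e^2) * emeasure M ?A
   <= (\<Sum>i<n. ennreal (ta (Suc i) - ta i) * (EE w. nsq (xi i w)))" .
qed

end

lemma continuous_on_halfline: fixes f :: "real => 'b::topological_space" assumes "!!n::nat. continuous_on {0..real n} f" shows "continuous_on {0..} f"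
 unfolding continuous_on_eq_continuous_within
proof
 fix x :: real assume "x : {0..}"
 obtain n :: nat where n: "x < real n" using reals_Archimedean2 by blast
 have "at x within {0..} = at x within {0..real n}" using n by (intro at_within_nhd[of x "{..<real n}"]) auto
 moreover have "continuous (at x within {0..real n}) f"
  using assms[of n] n \<open>x : {0..}\<close> by (auto simp: continuous_on_eq_continuous_within)
 ultimately show "continuous (at x within {0..}) f" by simp
qed

lemma kap_tendsto: fixes f :: "real => 'b::topological_space" assumes "continuous_on {0..} f" "0 <= t"
 shows "(%p. f (kap p t)) ----> f t" by (rule continuous_on_tendsto_compose[OF assms(1) kap_lim]) (auto simp: assms kap_nonneg)

text \<open>Fatou's lemma along \<open>{0..r n}\<close>, which can miss only the null point
  \<open>t\<close>. Nothing is assumed about the integral up to \<open>t\<close> itself.\<close>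

lemma nn_integral_left_limit: fixes f :: "real => ennreal" assumes [measurable]: "(%u. f u * indicator {0..t} u) : borel_measurable borel"
  and "r ----> t" "!!n. r n <= t" "!!n. NI (r n) f <= d"
 shows "NI t f <= d"
proof -
 let ?g = "%u. f u * indicator {0..t} u"
 have eq: "f u * indicator {0..r n} u = ?g u * indicator {0..r n} u" for n u using assms(3)[of n] by (auto simp: indicator_def)
 have "NI t f <= (NL u. liminf (%n. ?g u * indicator {0..r n} u))"
 proof (rule nn_integral_mono_AE, use AE_lborel_singleton[of t] in eventually_elim)
  fix u assume "u ~= t"
  show "?g u <= liminf (%n. ?g u * indicator {0..r n} u)"
  proof (cases "u : {0..t}")
   case True
   then have "u < t" using \<open>u ~= t\<close> by simp
   then have "eventually (%n. u < r n) sequentially" using assms(2) by (simp add: order_tendsto_iff)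
   then have "eventually (%n. ?g u <= ?g u * indicator {0..r n} u) sequentially" by eventually_elim (use True in auto)
   then show ?thesis by (rule Liminf_bounded)
  qed simp
 qed
 also have "... <= liminf (%n. (NL u. ?g u * indicator {0..r n} u))"
  by (intro nn_integral_liminf) (use assms(1) in measurable)
 also have "... <= liminf (%n. d)" using assms(4) by (intro Liminf_mono always_eventually) (simp add: eq)
 finally show ?thesis by (simp add: Liminf_const)
qed

lemma norm_diff_power2_le: fixes a b :: "'b::real_normed_vector" shows "(norm (a - b))^2 <= 2 * (norm a)^2 + 2 * (norm b)^2"
proof -
 have "(norm (a - b))^2 <= (norm a + norm b)^2" by (intro power_mono norm_triangle_ineq4) auto
 also have "... <= 2 * (norm a)^2 + 2 * (norm b)^2" using sum_squares_bound[of "norm a" "norm b"] by (simp add: power2_sum)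
 finally show ?thesis .
qed

section \<open>Riemann sums of the stochastic integral\<close>

context wiener begin

definition dint :: "nat => (real => 'a => 'b::real_normed_vector) => real => 'a => 'b" where "dint p Y t w = (\<Sum>i<nat \<lceil>t * 2 ^ p\<rceil>.
  (W (min t (real (Suc i) / 2 ^ p)) w - W (min t (real i / 2 ^ p)) w) *R Y (real i / 2 ^ p) w)"

lemma dint_eq_sum: assumes "0 <= t" "t <= real N / 2 ^ p" shows "dint p Y t w = (\<Sum>i<N.
  (W (min t (real (Suc i) / 2 ^ p)) w - W (min t (real i / 2 ^ p)) w) *R Y (real i / 2 ^ p) w)"
 unfolding dint_def
proof (rule sum.mono_neutral_left)
 show "{..<nat \<lceil>t * 2 ^ p\<rceil>} \<subseteq> {..<N}" using nat_ceiling_le_iff[OF assms(1), of p N] assms(2) by auto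
 show "ALL i:{..<N} - {..<nat \<lceil>t * 2 ^ p\<rceil>}.
  (W (min t (real (Suc i) / 2 ^ p)) w - W (min t (real i / 2 ^ p)) w) *R Y (real i / 2 ^ p) w = 0"
 proof
  fix i assume "i : {..<N} - {..<nat \<lceil>t * 2 ^ p\<rceil>}"
  then have "nat \<lceil>t * 2 ^ p\<rceil> <= i" by (metis DiffD2 lessThan_iff not_le)
  then have "t <= real i / 2 ^ p" unfolding nat_ceiling_le_iff[OF assms(1)] .
  moreover have "real i / 2 ^ p <= real (Suc i) / 2 ^ p" by (simp add: divide_right_mono)
  ultimately have "min t (real (Suc i) / 2 ^ p) = t" "min t (real i / 2 ^ p) = t" by linarith+
  then show "(W (min t (real (Suc i) / 2 ^ p)) w - W (min t (real i / 2 ^ p)) w) *R Y (real i / 2 ^ p) w = 0" by simp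
 qed
qed simp

lemma dint_grid: "dint p Y (real j / 2 ^ p) w = grid_sum (%i. real i / 2 ^ p) (%i. Y (real i / 2 ^ p)) j w"
proof -
 have "min (real j / 2 ^ p) (real i / 2 ^ p) = real i / 2 ^ p" if "i <= j" for i using that by (intro min_absorb2 divide_right_mono) auto
 then show ?thesis by (subst dint_eq_sum[where N=j]) (auto simp: grid_sum_def intro!: sum.cong simp del: of_nat_Suc)
qed

text \<open>An integrand constant on the coarse cells lets the fine increments telescope inside each
  of them, so refinement changes nothing. Every comparison of two meshes rests on this.\<close>

lemma dint_kap: assumes "q <= p" "0 <= t" shows "dint p (%r. Y (kap q r)) t z = dint q Y t z"
proof -
 define N where "N = nat \<lceil>t * 2 ^ q\<rceil>"
 define k where "k = (2::nat) ^ (p - q)"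
 have "0 < k" by (simp add: k_def)
 have pq: "(2::real) ^ p = real k * 2 ^ q" using assms(1) by (simp add: k_def flip: power_add)
 have tN: "t <= real N / 2 ^ q" using nat_ceiling_le_iff[OF assms(2), of q N] by (simp add: N_def)
 also have "... = real (N * k) / 2 ^ p" using \<open>0 < k\<close> by (simp add: pq)
 finally have tNk: "t <= real (N * k) / 2 ^ p" .
 let ?w = "%i. W (min t (real i / 2 ^ p)) z"
 have "dint p (%r. Y (kap q r)) t z = (\<Sum>i<N * k. (?w (Suc i) - ?w i) *R Y (kap q (real i / 2 ^ p)) z)"
  by (rule dint_eq_sum[OF assms(2) tNk])
 also have "... = (\<Sum>m<N. \<Sum>i\<in>{m * k..<m * k + k}. (?w (Suc i) - ?w i) *R Y (kap q (real i / 2 ^ p)) z)"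
  by (rule sum.nat_group[symmetric])
 also have "... = (\<Sum>m<N. (W (min t (real (Suc m) / 2 ^ q)) z - W (min t (real m / 2 ^ q)) z) *R Y (real m / 2 ^ q) z)"
 proof (intro sum.cong refl)
  fix m
  have "(\<Sum>i\<in>{m * k..<m * k + k}. (?w (Suc i) - ?w i) *R Y (kap q (real i / 2 ^ p)) z)
   = (\<Sum>i\<in>{m * k..<m * k + k}. (?w (Suc i) - ?w i) *R Y (real m / 2 ^ q) z)"
  proof (intro sum.cong refl)
   fix i assume "i : {m * k..<m * k + k}"
   then have i: "m * k <= i" "i < Suc m * k" by auto
   have "real (m * k) <= real i" "real i < real (Suc m * k)" using i by (simp_all only: of_nat_le_iff of_nat_less_iff)
   then have "real m * real k <= real i" "real i < real (Suc m) * real k" by (simp_all only: of_nat_mult)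
   then have "kap q (real i / 2 ^ p) = real m / 2 ^ q" using \<open>0 < k\<close> unfolding pq by (intro kap_eqI) (auto simp: field_simps)
   then show "(?w (Suc i) - ?w i) *R Y (kap q (real i / 2 ^ p)) z = (?w (Suc i) - ?w i) *R Y (real m / 2 ^ q) z" by simp
  qed
  also have "... = (\<Sum>i\<in>{m * k..<m * k + k}. ?w (Suc i) - ?w i) *R Y (real m / 2 ^ q) z" by (rule scaleR_left.sum[symmetric])
  also have "(\<Sum>i\<in>{m * k..<m * k + k}. ?w (Suc i) - ?w i) = ?w (m * k + k) - ?w (m * k)" by (rule sum_Suc_diff') simp
  also have "real (m * k + k) / 2 ^ p = real (Suc m) / 2 ^ q" using \<open>0 < k\<close> by (simp add: pq field_simps)
  also have "real (m * k) / 2 ^ p = real m / 2 ^ q" using \<open>0 < k\<close> by (simp add: pq)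
  finally show "(\<Sum>i\<in>{m * k..<m * k + k}. (?w (Suc i) - ?w i) *R Y (kap q (real i / 2 ^ p)) z)
   = (W (min t (real (Suc m) / 2 ^ q)) z - W (min t (real m / 2 ^ q)) z) *R Y (real m / 2 ^ q) z" .
 qed
 also have "... = dint q Y t z" by (rule dint_eq_sum[symmetric]) (fact assms tN)+
 finally show ?thesis .
qed

lemma dint_diff: "dint p (%r w. Y r w - Z r w) t w = dint p Y t w - dint p Z t w" by (simp add: dint_def scaleR_diff_right sum_subtractf)

lemma dint_linear: "bounded_linear f ==> dint p (%r w. f (Y r w)) t w = f (dint p Y t w)"
 by (simp add: dint_def linear_sum[OF bounded_linear.linear] linear_scale[OF bounded_linear.linear])

lemma dint_continuous: assumes "w : space M" shows "continuous_on {0..} (%t. dint p Y t w)"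
proof (rule continuous_on_halfline)
 fix n :: nat
 let ?N = "n * 2 ^ p"
 have "continuous_on {0..real n} (%t. \<Sum>i<?N. (W (min t (real (Suc i) / 2 ^ p)) w - W (min t (real i / 2 ^ p)) w) *R Y (real i / 2 ^ p) w)"
  by (intro continuous_intros continuous_on_compose2[OF W_cont[OF assms]]) auto
 also have "continuous_on {0..real n} (%t. \<Sum>i<?N.
  (W (min t (real (Suc i) / 2 ^ p)) w - W (min t (real i / 2 ^ p)) w) *R Y (real i / 2 ^ p) w)
  \<longleftrightarrow> continuous_on {0..real n} (%t. dint p Y t w)" by (intro continuous_on_cong refl dint_eq_sum[symmetric]) auto
 finally show "continuous_on {0..real n} (%t. dint p Y t w)" .
qed

definition adapted :: "(real => 'a => 'b::topological_space) => bool"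
 where "adapted Y \<longleftrightarrow> (ALL t>=0. Y t : borel_measurable (\<F> t))"

definition bdd_process :: "(real => 'a => 'b::real_normed_vector) => bool"
 where "bdd_process Y \<longleftrightarrow> (EX C. ALL t>=0. ALL w:space M. norm (Y t w) <= C)"

lemma adaptedD: "adapted Y ==> 0 <= r ==> r <= t ==> Y r : borel_measurable (\<F> t)" unfolding adapted_def by (rule F_mono) auto

lemma adapted_M: "adapted Y ==> 0 <= r ==> Y r : borel_measurable M" unfolding adapted_def by (rule F_M) auto

lemma adapted_diff: fixes Y Z :: "real => 'a => 'b::sep_normed"
 shows "adapted Y ==> adapted Z ==> adapted (%t w. Y t w - Z t w)" unfolding adapted_def by (blast intro: borel_measurable_diff)

lemma adapted_scaleR: fixes Z :: "real => 'a => 'b::sep_normed"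
 shows "adapted Y ==> adapted Z ==> adapted (%t w. Y t w *R Z t w)" unfolding adapted_def by (blast intro: borel_measurable_scaleR)

lemma adapted_kap: "adapted Y ==> adapted (%t. Y (kap p t))" using adaptedD[OF _ kap_nonneg kap_le] unfolding adapted_def by blast

lemma bdd_process_diff: "bdd_process Y ==> bdd_process Z ==> bdd_process (%t w. Y t w - Z t w)" unfolding bdd_process_def
proof (elim exE)
 fix C D
 assume "ALL t>=0. ALL w:space M. norm (Y t w) <= C" "ALL t>=0. ALL w:space M. norm (Z t w) <= D"
 then show "EX C. ALL t>=0. ALL w:space M. norm (Y t w - Z t w) <= C"
  by (intro exI[of _ "C + D"]) (auto intro!: order_trans[OF norm_triangle_ineq4] add_mono)
qed

lemma bdd_process_kap: "bdd_process Y ==> bdd_process (%t. Y (kap p t))" unfolding bdd_process_def by (meson kap_nonneg)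

lemma dint_measurable: fixes Y :: "real => 'a => 'b::sep_normed" assumes "adapted Y" "0 <= t"
 shows "dint p Y t : borel_measurable (\<F> t)" unfolding dint_def
proof (intro borel_measurable_sum borel_measurable_scaleR borel_measurable_diff W_measurable adaptedD[OF assms(1)])
 fix i assume "i : {..<nat \<lceil>t * 2 ^ p\<rceil>}"
 then show "real i / 2 ^ p <= t" using less_nat_ceiling_iff[OF assms(2), of i p] by auto
qed (use assms in auto)

lemma dint_isometry: fixes Y :: "real => 'a => 'b::sep_inner" assumes "adapted Y" "bdd_process Y" "0 <= t"
 shows "(EE w. nsq (dint p Y t w))
  = (EE w. NI t (%u. nsq (Y (kap p u) w)))"
proof -
 obtain C where C: "!!t w. 0 <= t ==> w : space M ==> norm (Y t w) <= C" using assms(2) by (auto simp: bdd_process_def)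
 let ?N = "nat \<lceil>t * 2 ^ p\<rceil>" and ?ta = "%i. min t (real i / 2 ^ p)"
 have lt: "real i / 2 ^ p < t" if "i < ?N" for i using that less_nat_ceiling_iff[OF assms(3)] by blast
 have "(EE w. nsq (dint p Y t w))
  = (EE w. nsq (grid_sum ?ta (%i. Y (real i / 2 ^ p)) ?N w))" by (simp add: dint_def grid_sum_def)
 also have "... = (\<Sum>i<?N. ennreal (?ta (Suc i) - ?ta i) * (EE w. nsq (Y (real i / 2 ^ p) w)))"
 proof (rule nn_grid_sum_isometry[where C="%_. C"])
  fix i assume i: "i < ?N"
  have "real i / 2 ^ p <= real (Suc i) / 2 ^ p" by (simp add: divide_right_mono)
  then show "?ta i <= ?ta (Suc i)" by linarith
  show "Y (real i / 2 ^ p) : borel_measurable (\<F> (?ta i))"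
   using lt[OF i] adaptedD[OF assms(1), of "real i / 2 ^ p" "real i / 2 ^ p"] by (simp add: min_def)
 qed (use assms C in auto)
 also have "... = (\<Sum>i<?N. (EE w. ennreal (min t (real (Suc i) / 2 ^ p) - real i / 2 ^ p) * nsq (Y (real i / 2 ^ p) w)))"
 proof (intro sum.cong refl)
  fix i assume "i : {..<?N}"
  then have "?ta i = real i / 2 ^ p" using lt[of i] by (simp add: min_def)
  moreover have [measurable]: "Y (real i / 2 ^ p) : borel_measurable M" by (intro adapted_M assms) simp
  ultimately show "ennreal (?ta (Suc i) - ?ta i) * (EE w. nsq (Y (real i / 2 ^ p) w))
   = (EE w. ennreal (min t (real (Suc i) / 2 ^ p) - real i / 2 ^ p) * nsq (Y (real i / 2 ^ p) w))"
   by (simp add: nn_integral_cmult)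
 qed
 also have "... = (EE w. (\<Sum>i<?N. ennreal (min t (real (Suc i) / 2 ^ p) - real i / 2 ^ p) * nsq (Y (real i / 2 ^ p) w)))"
 proof (rule nn_integral_sum[symmetric])
  fix i
  have [measurable]: "Y (real i / 2 ^ p) : borel_measurable M" by (intro adapted_M assms) simp
  show "(%w. ennreal (min t (real (Suc i) / 2 ^ p) - real i / 2 ^ p) * nsq (Y (real i / 2 ^ p) w)) : borel_measurable M" by measurable
 qed
 also have "... = (EE w. NI t (%u. nsq (Y (kap p u) w)))"
  using nn_integral_step[OF assms(3), of "%r. nsq (Y r _)" p] by (simp only:)
 finally show ?thesis .
qed

text \<open>The discrete maximal inequality is applied on all grids finer than \<open>q\<close>. The
  sums do not change under refinement, so the exceptional sets increase and share one bound;
  continuity of the sums in \<open>t\<close> then passes from dyadic times to the whole of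
  \<open>[0, T]\<close>.\<close>

lemma dint_maximal: fixes Y :: "real => 'a => 'b::sep_inner"
 assumes "adapted Y" "bdd_process Y" "!!t. Y (kap q t) = Y t" "0 < e" obtains A where "A : sets M"
  "ennreal (e^2) * emeasure M A <= (EE w. NI (real T) (%r. nsq (Y r w)))"
  "!!w t. w : space M - A ==> 0 <= t ==> t <= real T ==> norm (dint q Y t w) <= e"
proof -
 obtain C where C: "!!t w. 0 <= t ==> w : space M ==> norm (Y t w) <= C" using assms(2) by (auto simp: bdd_process_def)
 define A where "A p = {w:space M. EX j<=T * 2 ^ p. norm (dint p Y (real j / 2 ^ p) w) > e}" for p :: nat
 have Yk: "(%r. Y (kap q r)) = Y" using assms(3) by auto
 have Ykp: "Y (kap p t) = Y t" if "q <= p" for p t by (metis assms(3) kap_kap that)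
 have dq: "dint p Y t w = dint q Y t w" if "q <= p" "0 <= t" for p t w using dint_kap[OF that, of Y w] by (simp add: Yk)
 have A: "A p : sets M & ennreal (e^2) * emeasure M (A p)
   <= (EE w. NI (real T) (%r. nsq (Y r w)))" if "q <= p" for p
 proof
  let ?n = "T * 2 ^ p" and ?ta = "%i::nat. real i / 2 ^ p" and ?xi = "%i::nat. Y (real i / 2 ^ p)"
  have prem: "!!i. i <= ?n ==> 0 <= ?ta i" "!!i. i < ?n ==> ?ta i <= ?ta (Suc i)" "!!i. i < ?n ==> ?xi i : borel_measurable (\<F> (?ta i))"
   "!!i w. i < ?n ==> w : space M ==> norm (?xi i w) <= C" using C assms(1) by (auto simp: divide_right_mono adapted_def)
  show "A p : sets M" unfolding A_def dint_grid by (rule grid_sum_maximal(1)[where C="%_. C"]) (fact prem assms)+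
  have "ennreal (e^2) * emeasure M (A p) <= (\<Sum>i<?n. ennreal (?ta (Suc i) - ?ta i) * (EE w. nsq (?xi i w)))"
   unfolding A_def dint_grid by (rule grid_sum_maximal(2)[where C="%_. C"]) (fact prem assms)+
  also have "... = (EE w. nsq (dint p Y (real ?n / 2 ^ p) w))"
   unfolding dint_grid by (rule nn_grid_sum_isometry[where C="%_. C", symmetric]) (fact prem)+
  also have "... = (EE w. NI (real T) (%r. nsq (Y (kap p r) w)))"
   by (subst dint_isometry) (use assms in auto)
  finally show "ennreal (e^2) * emeasure M (A p)
   <= (EE w. NI (real T) (%r. nsq (Y r w)))"
   by (simp add: Ykp[OF that])
 qed
 have inc: "incseq (%p. A (q + p))"
 proof (rule incseq_SucI, rule subsetI)
  fix p w assume "w : A (q + p)"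
  then obtain j where j: "w : space M" "j <= T * 2 ^ (q + p)" "norm (dint (q + p) Y (real j / 2 ^ (q + p)) w) > e" by (auto simp: A_def)
  have "real (2 * j) / 2 ^ (q + Suc p) = real j / 2 ^ (q + p)" by simp
  moreover have "dint (q + Suc p) Y (real j / 2 ^ (q + p)) w = dint (q + p) Y (real j / 2 ^ (q + p)) w" by (subst (1 2) dq) auto
  ultimately have "norm (dint (q + Suc p) Y (real (2 * j) / 2 ^ (q + Suc p)) w) > e" using j by metis
  then show "w : A (q + Suc p)" using j unfolding A_def by (auto intro!: exI[of _ "2 * j"])
 qed
 show ?thesis
 proof (rule that)
  show "(\<Union>p. A (q + p)) : sets M" using A by auto
  have "ennreal (e^2) * emeasure M (\<Union>p. A (q + p)) = ennreal (e^2) * (SUP p. emeasure M (A (q + p)))"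
   using A inc by (subst SUP_emeasure_incseq) auto
  also have "... = (SUP p. ennreal (e^2) * emeasure M (A (q + p)))" by (rule SUP_mult_left_ennreal)
  also have "... <= (EE w. NI (real T) (%r. nsq (Y r w)))"
   using A by (intro SUP_least) auto
  finally show "ennreal (e^2) * emeasure M (\<Union>p. A (q + p)) <= (EE w. NI (real T) (%r. nsq (Y r w)))" .
  fix w t assume w: "w : space M - (\<Union>p. A (q + p))" and t: "0 <= t" "t <= real T"
  have "norm (dint q Y (kap (q + p) t) w) <= e" for p
  proof -
   define j where "j = nat \<lfloor>t * 2 ^ (q + p)\<rfloor>"
   have kj: "kap (q + p) t = real j / 2 ^ (q + p)" using t by (simp add: kap_def j_def)
   have "t * 2 ^ (q + p) <= real T * 2 ^ (q + p)" using t by (intro mult_right_mono) auto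
   then have "\<lfloor>t * 2 ^ (q + p)\<rfloor> <= \<lfloor>real (T * 2 ^ (q + p))\<rfloor>" by (intro floor_mono) simp
   then have "j <= T * 2 ^ (q + p)" unfolding j_def by (simp only: floor_of_nat nat_le_iff)
   then have "norm (dint (q + p) Y (kap (q + p) t) w) <= e" using w by (auto simp: A_def kj not_less)
   then show ?thesis by (subst (asm) dq) (auto simp: kap_nonneg t)
  qed
  moreover have "(%p. norm (dint q Y (kap (q + p) t) w)) ----> norm (dint q Y t w)"
  proof -
   have "(%p. dint q Y (kap p t) w) ----> dint q Y t w" by (rule kap_tendsto) (use w t dint_continuous in auto)
   then have "(%p. dint q Y (kap (p + q) t) w) ----> dint q Y t w" by (rule LIMSEQ_ignore_initial_segment)
   then show ?thesis by (intro tendsto_norm) (simp add: add.commute)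
  qed
  ultimately show "norm (dint q Y t w) <= e" by (intro LIMSEQ_le_const2) auto
 qed
qed

end

lemma sigma_finite_restrict_lborel: "sigma_finite_measure (restrict_space lborel {0..t::real})"
proof -
 interpret finite_measure "restrict_space lborel {0..t}"
  by (rule finite_measureI) (cases "0 <= t"; simp add: emeasure_restrict_space space_restrict_space)
 show ?thesis by unfold_locales
qed

section \<open>Progressive processes, energies and cutoffs\<close>

context wiener begin

abbreviation "prog == progressively_measurable \<F>"

definition energy :: "(real => 'a => 'b::real_normed_vector) => real => 'a => ennreal"
 where "energy Y t w = NI t (%r. nsq (Y r w))"

text \<open>Left continuity is asked only along the dyadic approximations from below. This is enough
  for progressive measurability and for convergence of sampled energies, and step processes on a
  grid have it trivially.\<close>

definition lcad :: "(real => 'a => 'b::topological_space) => bool"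
 where "lcad Z \<longleftrightarrow> adapted Z & (ALL w:space M. ALL t>=0. (%p. Z (kap p t) w) ----> Z t w)"

text \<open>The indicator of a stochastic interval \<open>[0, \<tau>]\<close>, encoded as a
  decreasing 0-1 process, so that the stopping time \<tau> never has to be named. Left continuity is
  what makes it predictable.\<close>

definition cutoff :: "(real => 'a => real) => bool" where "cutoff h \<longleftrightarrow> lcad h & (ALL w:space M. ALL t>=0. h t w = 0 | h t w = 1) &
  (ALL w:space M. ALL r t. 0 <= r --> r <= t --> h t w <= h r w)"

text \<open>Here Riemann sums converge for every outcome. Step processes on dyadic grids and
  elementary processes with arbitrary nodes are both of this kind.\<close>

definition simple :: "real => (real => 'a => 'b::sep_inner) => ('a => 'b) => bool"
 where "simple t Z K \<longleftrightarrow> lcad Z & bdd_process Z & K : borel_measurable M &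
  (ALL w:space M. (%p. dint p Z t w) ----> K w)"

text \<open>A variant of \<open>has_ito_integral\<close> in which the approximating processes have pathwise convergent
  Riemann sums, so that their integrals are functions and not classes modulo null sets.\<close>

definition ito :: "real => (real => 'a => 'b::sep_inner) => ('a => 'b) => bool"
 where "ito t Y I \<longleftrightarrow> 0 <= t & prog Y & I : borel_measurable M & (ALL e>0. EX Z K A. simple t Z K & A : sets M & measure M A <= e &
   (ALL w:space M - A. energy (%r w. Z r w - Y r w) t w <= ennreal e & norm (K w - I w) <= e))"

lemma prog_section: assumes "prog Y" "w : space M" "0 <= t" shows "(%r. Y r w) : borel_measurable (restrict_space borel {0..t})"
proof -
 have "case_prod Y : borel_measurable (restrict_space borel {0..t} \<Otimes>\<^sub>M \<F> t)" using assms by (simp add: progressively_measurable_def)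
 then have "(%r. case_prod Y (r, w)) : borel_measurable (restrict_space borel {0..t})"
  by (rule measurable_compose[rotated]) (use assms space_F in auto)
 then show ?thesis by simp
qed

lemma prog_compose: "prog Y ==> f : borel_measurable borel ==> prog (%r w. f (Y r w))" unfolding progressively_measurable_def
proof safe
 fix t :: real assume "ALL t>=0. case_prod Y : borel_measurable (restrict_space borel {0..t} \<Otimes>\<^sub>M \<F> t)" "0 <= t"
 then have [measurable]: "case_prod Y : borel_measurable (restrict_space borel {0..t} \<Otimes>\<^sub>M \<F> t)" by simp
 assume [measurable]: "f : borel_measurable borel"
 have "(%x. f (case_prod Y x)) : borel_measurable (restrict_space borel {0..t} \<Otimes>\<^sub>M \<F> t)" by measurable
 then show "(%(r, w). f (Y r w)) : borel_measurable (restrict_space borel {0..t} \<Otimes>\<^sub>M \<F> t)" by (simp add: split_beta')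
qed

lemma prog_compose2: fixes f :: "'b::second_countable_topology => 'c::second_countable_topology => 'e::topological_space"
 assumes "prog Y" "prog Z" "case_prod f : borel_measurable (borel \<Otimes>\<^sub>M borel)" shows "prog (%r w. f (Y r w) (Z r w))"
 unfolding progressively_measurable_def
proof safe
 fix t :: real assume "0 <= t"
 then have [measurable]: "case_prod Y : borel_measurable (restrict_space borel {0..t} \<Otimes>\<^sub>M \<F> t)"
  "case_prod Z : borel_measurable (restrict_space borel {0..t} \<Otimes>\<^sub>M \<F> t)" using assms by (simp_all add: progressively_measurable_def)
 note [measurable] = assms(3)
 have "(%x. case_prod f (case_prod Y x, case_prod Z x)) : borel_measurable (restrict_space borel {0..t} \<Otimes>\<^sub>M \<F> t)" by measurable
 then show "(%(r, w). f (Y r w) (Z r w)) : borel_measurable (restrict_space borel {0..t} \<Otimes>\<^sub>M \<F> t)" by (simp add: split_beta')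
qed

lemma prog_deterministic: "c : borel_measurable borel ==> prog (%r w. c r)" unfolding progressively_measurable_def
proof safe
 fix t :: real
 assume [measurable]: "c : borel_measurable borel"
 have "(%x. c (fst x)) : borel_measurable (restrict_space borel {0..t} \<Otimes>\<^sub>M \<F> t)"
  by (rule measurable_compose[OF measurable_fst measurable_restrict_space1]) measurable
 then show "(%(r, w). c r) : borel_measurable (restrict_space borel {0..t} \<Otimes>\<^sub>M \<F> t)" by (simp add: split_beta')
qed

lemma prog_diff: fixes Y Z :: "real => 'a => 'b::sep_normed"
 shows "prog Y ==> prog Z ==> prog (%r w. Y r w - Z r w)" by (rule prog_compose2) (auto simp: split_beta')

lemma prog_scaleR: fixes Z :: "real => 'a => 'b::sep_normed"
 shows "prog Y ==> prog Z ==> prog (%r w. Y r w *R Z r w)" by (rule prog_compose2) (auto simp: split_beta')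

lemma path_nn_integral_measurable: fixes f :: "real => 'a => ennreal" assumes "prog f" "0 <= t"
 shows "(%w. NI t (%r. f r w)) : borel_measurable (\<F> t)"
proof -
 interpret L: sigma_finite_measure "restrict_space lborel {0..t}" by (rule sigma_finite_restrict_lborel)
 have "case_prod f : borel_measurable (restrict_space borel {0..t} \<Otimes>\<^sub>M \<F> t)" using assms by (simp add: progressively_measurable_def)
 then have "(%(x, y). case_prod f (y, x)) : borel_measurable (\<F> t \<Otimes>\<^sub>M restrict_space borel {0..t})" by (rule measurable_pair_swap)
 also have "(borel_measurable (\<F> t \<Otimes>\<^sub>M restrict_space borel {0..t}) :: (_ => ennreal) set)
  = borel_measurable (\<F> t \<Otimes>\<^sub>M restrict_space lborel {0..t})"
  by (intro measurable_cong_sets sets_pair_measure_cong) (simp_all add: sets_restrict_space)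
 finally have "(%w. \<integral>\<^sup>+r. f r w \<partial>restrict_space lborel {0..t}) : borel_measurable (\<F> t)"
  by (intro L.borel_measurable_nn_integral) simp
 then show ?thesis by (simp add: nn_integral_restrict_space)
qed

lemma energy_measurable: fixes Y :: "real => 'a => 'b::sep_normed" assumes "prog Y" "0 <= t"
 shows "energy Y t : borel_measurable (\<F> t)"
 using path_nn_integral_measurable[OF prog_compose[OF assms(1), of "%x. nsq x"] assms(2)] by (simp add: energy_def[abs_def])

lemma energy_measurable_M: fixes Y :: "real => 'a => 'b::sep_normed"
 shows "prog Y ==> 0 <= t ==> energy Y t : borel_measurable M" by (rule F_M[OF energy_measurable])

lemma path_measurable: fixes f :: "real => 'a => ennreal" assumes "prog f" "w : space M"
 shows "(%r. f r w * indicator {0..t} r) : borel_measurable borel"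
proof (cases "0 <= t")
 case True
 then show ?thesis using prog_section[OF assms True] by (subst (asm) borel_measurable_restrict_space_iff_ennreal) auto
qed simp

lemma norm2_measurable: fixes Y :: "real => 'a => 'b::sep_normed" assumes "prog Y" "w : space M"
 shows "(%r. nsq (Y r w) * indicator {0..t} r) : borel_measurable borel"
 by (rule path_measurable[OF prog_compose[OF assms(1), of "%x. nsq x"] assms(2)]) measurable

lemma energy_diff_le: fixes Y Z :: "real => 'a => 'b::sep_normed" assumes "prog Y" "prog Z" "w : space M"
 shows "energy (%r w. Y r w - Z r w) t w <= 2 * energy Y t w + 2 * energy Z t w"
proof -
 note [measurable] = norm2_measurable[OF assms(1,3), of t] norm2_measurable[OF assms(2,3), of t]
 have "energy (%r w. Y r w - Z r w) t w
  <= (NL r. 2 * (nsq (Y r w) * indicator {0..t} r) + 2 * (nsq (Z r w) * indicator {0..t} r))"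
  unfolding energy_def
 proof (intro nn_integral_mono)
  fix r
  have "nsq (Y r w - Z r w) <= ennreal (2 * (norm (Y r w))^2 + 2 * (norm (Z r w))^2)" by (intro ennreal_leI norm_diff_power2_le)
  also have "... = 2 * nsq (Y r w) + 2 * nsq (Z r w)" by (simp add: ennreal_plus ennreal_mult)
  finally show "nsq (Y r w - Z r w) * indicator {0..t} r <=
   2 * (nsq (Y r w) * indicator {0..t} r) + 2 * (nsq (Z r w) * indicator {0..t} r)" by (auto simp: indicator_def)
 qed
 also have "... = 2 * energy Y t w + 2 * energy Z t w" by (subst nn_integral_add) (auto simp: energy_def nn_integral_cmult)
 finally show ?thesis .
qed

lemma energy_minus_commute: "energy (%r w. Y r w - Z r w) t w = energy (%r w. Z r w - Y r w) t w" by (simp add: energy_def norm_minus_commute)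

lemma energy_cong: "(!!r. 0 <= r ==> r <= t ==> norm (Y r w) = norm (Z r w)) ==> energy Y t w = energy Z t w"
 unfolding energy_def by (intro nn_integral_cong) (auto simp: indicator_def)

lemma energy_mono: "(!!r. 0 <= r ==> r <= t ==> norm (Y r w) <= norm (Z r w)) ==> energy Y t w <= energy Z t w"
 unfolding energy_def by (intro nn_integral_mono) (auto simp: indicator_def intro!: ennreal_leI power_mono)

lemma energy_mono_time: "r <= t ==> energy Y r w <= energy Y t w" unfolding energy_def by (intro nn_integral_mono) (auto simp: indicator_def)

lemma energy_bounded: assumes "!!r. 0 <= r ==> r <= t ==> norm (Y r w) <= C" "0 <= t" shows "energy Y t w <= ennreal (C^2 * t)"
proof -
 have "energy Y t w <= (NL r. ennreal (C^2) * indicator {0..t} r)"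
  unfolding energy_def using assms by (intro nn_integral_mono) (auto simp: indicator_def intro!: ennreal_leI power_mono)
 also have "... = ennreal (C^2 * t)" using assms(2) by (simp add: nn_integral_cmult_indicator ennreal_mult)
 finally show ?thesis .
qed

lemma lcad_adapted: "lcad Z ==> adapted Z" by (simp add: lcad_def)

lemma lcadD: "lcad Z ==> w : space M ==> 0 <= t ==> (%p. Z (kap p t) w) ----> Z t w" by (simp add: lcad_def)

lemma lcad_diff: fixes Y Z :: "real => 'a => 'b::sep_normed"
 shows "lcad Y ==> lcad Z ==> lcad (%t w. Y t w - Z t w)" unfolding lcad_def using adapted_diff[of Y Z] by (auto intro!: tendsto_diff)

lemma lcad_scaleR: fixes Z :: "real => 'a => 'b::sep_normed"
 shows "lcad Y ==> lcad Z ==> lcad (%t w. Y t w *R Z t w)" unfolding lcad_def using adapted_scaleR[of Y Z] by (auto intro!: tendsto_scaleR)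

lemma lcad_continuous: assumes "adapted Y" "!!w. w : space M ==> continuous_on {0..} (%t. Y t w)" shows "lcad Y"
 unfolding lcad_def using assms kap_tendsto by blast

lemma lcad_kap: "adapted Y ==> lcad (%t. Y (kap m t))" unfolding lcad_def
proof (intro conjI adapted_kap ballI allI impI)
 fix w t
 have "eventually (%p. Y (kap m (kap p t)) w = Y (kap m t) w) sequentially" using eventually_ge_at_top[of m] by eventually_elim (simp add: kap_kap)
 then show "(%p. Y (kap m (kap p t)) w) ----> Y (kap m t) w" by (rule tendsto_eventually)
qed

text \<open>A sampled process takes its time argument from a countable set, hence is jointly
  measurable, and left continuity recovers the process as a limit. The \<open>min t\<close> keeps
  all sampling times within reach of \<open>\<F> t\<close>.\<close>

lemma lcad_prog: fixes Z :: "real => 'a => 'b::metric_space" assumes "lcad Z" shows "prog Z" unfolding progressively_measurable_def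
proof (intro allI impI)
 fix t :: real assume t: "0 <= t"
 let ?N = "restrict_space borel {0..t} \<Otimes>\<^sub>M \<F> t"
 have sp: "space ?N = {0..t} \<times> space M" using t by (simp add: space_pair_measure space_restrict_space space_F)
 show "case_prod Z : borel_measurable ?N"
 proof (rule borel_measurable_LIMSEQ_metric)
  fix p :: nat
  have "(%x. (%i::nat. %x. Z (min t (real i / 2 ^ p)) (snd x)) (nat \<lfloor>fst x * 2 ^ p\<rfloor>) x) : borel_measurable ?N"
  proof (rule measurable_compose_countable'[where I=UNIV and f="%i x. Z (min t (real i / 2 ^ p)) (snd x)"])
   show "(%x. Z (min t (real i / 2 ^ p)) (snd x)) : borel_measurable ?N" for i
    using adaptedD[OF lcad_adapted[OF assms], of "min t (real i / 2 ^ p)" t] t by (auto intro: measurable_compose[OF measurable_snd])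
   have "(%x. nat \<lfloor>fst x * 2 ^ p\<rfloor>) : measurable ?N (count_space UNIV)"
   proof (rule measurable_compose[OF measurable_fst])
    have "(%r::real. nat \<lfloor>r * 2 ^ p\<rfloor>) : measurable borel (count_space UNIV)" by measurable
    then show "(%r. nat \<lfloor>r * 2 ^ p\<rfloor>) : measurable (restrict_space borel {0..t}) (count_space UNIV)"
     by (rule measurable_restrict_space1)
   qed
   then show "(%x. nat \<lfloor>fst x * 2 ^ p\<rfloor>) : measurable ?N (count_space UNIV)" .
  qed auto
  also have "?this \<longleftrightarrow> (%x. Z (kap p (fst x)) (snd x)) : borel_measurable ?N"
  proof (rule measurable_cong)
   fix x assume "x : space ?N"
   then have x: "0 <= fst x" "fst x <= t" by (auto simp: sp)
   have "kap p (fst x) <= t" using kap_le[of p "fst x"] x by linarith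
   then show "(%i::nat. %x. Z (min t (real i / 2 ^ p)) (snd x)) (nat \<lfloor>fst x * 2 ^ p\<rfloor>) x = Z (kap p (fst x)) (snd x)"
    using x by (simp add: kap_def min_def)
  qed
  finally show "(%x. Z (kap p (fst x)) (snd x)) : borel_measurable ?N" .
 next
  fix x assume "x : space ?N"
  then show "(%p. Z (kap p (fst x)) (snd x)) ----> case_prod Z x" using lcadD[OF assms] by (auto simp: sp)
 qed
qed

lemma energy_dominated: fixes Y :: "real => 'a => 'b::sep_normed"
 assumes Yp: "!!p. prog (Y' p)" and Y: "prog Y" and t: "0 <= t" and C: "!!p r z. 0 <= r ==> z : space M ==> norm (Y' p r z) <= C"
  and lim: "!!r z. 0 <= r ==> z : space M ==> (%p. Y' p r z) ----> Y r z"
 shows "(%p. (EE z. energy (Y' p) t z)) ----> (EE z. energy Y t z)"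
proof (rule nn_integral_dominated_convergence[where w="%_. ennreal (C^2 * t)"])
 show "energy (Y' p) t : borel_measurable M" for p by (intro energy_measurable_M Yp t)
 show "energy Y t : borel_measurable M" by (intro energy_measurable_M Y t)
 show "AE z in M. energy (Y' p) t z <= ennreal (C^2 * t)" for p by (intro AE_I2 energy_bounded C t)
 show "(EE z. ennreal (C^2 * t)) < \<infinity>" by (simp add: emeasure_space_1)
 show "AE z in M. (%p. energy (Y' p) t z) ----> energy Y t z"
 proof (rule AE_I2)
  fix z assume z: "z : space M"
  show "(%p. energy (Y' p) t z) ----> energy Y t z" unfolding energy_def
  proof (rule nn_integral_dominated_convergence[where w="%r. ennreal (C^2) * indicator {0..t} r"])
   have *: "(%r. nsq (Z r z) * indicator {0..t} r) : borel_measurable lborel" if "prog Z" for Z :: "real => 'a => 'b"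
    using norm2_measurable[OF that z, of t] by simp
   show "(%r. nsq (Y' p r z) * indicator {0..t} r) : borel_measurable lborel" for p by (rule *[OF Yp])
   show "(%r. nsq (Y r z) * indicator {0..t} r) : borel_measurable lborel" by (rule *[OF Y])
   show "AE r in lborel. nsq (Y' p r z) * indicator {0..t} r <= ennreal (C^2) * indicator {0..t} r" for p
    using C[OF _ z] by (intro AE_I2) (auto simp: indicator_def intro!: ennreal_leI power_mono)
   show "(NL r. ennreal (C^2) * indicator {0..t} r) < \<infinity>"
    using t by (simp add: nn_integral_cmult_indicator ennreal_mult_less_top)
   show "AE r in lborel. (%p. nsq (Y' p r z) * indicator {0..t} r) ----> nsq (Y r z) * indicator {0..t} r"
   proof (rule AE_I2)
    fix r :: real
    show "(%p. nsq (Y' p r z) * indicator {0..t} r) ----> nsq (Y r z) * indicator {0..t} r"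
    proof (cases "r : {0..t}")
     case True
     then show ?thesis using lim[OF _ z, of r] by (auto intro!: tendsto_ennrealI tendsto_power tendsto_norm)
    qed simp
   qed
  qed simp
 qed
qed auto

lemma energy_kap_lim: fixes Z :: "real => 'a => 'b::sep_normed" assumes "lcad Z" "bdd_process Z" "0 <= t"
 shows "(%p. (EE w. energy (%r. Z (kap p r)) t w)) ----> (EE w. energy Z t w)"
proof -
 obtain C where C: "!!t w. 0 <= t ==> w : space M ==> norm (Z t w) <= C" using assms(2) by (auto simp: bdd_process_def)
 show ?thesis by (rule energy_dominated[where C=C]) (use assms in \<open>auto intro: lcad_prog lcad_kap lcad_adapted lcadD C kap_nonneg\<close>)
qed

lemma cutoff_values: "cutoff h ==> w : space M ==> 0 <= t ==> h t w = 0 | h t w = 1" by (simp add: cutoff_def)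

lemma cutoff_antimono: "cutoff h ==> w : space M ==> 0 <= r ==> r <= t ==> h t w <= h r w" by (simp add: cutoff_def)

lemma cutoff_lcad: "cutoff h ==> lcad h" by (simp add: cutoff_def)

lemma cutoff_const: "cutoff (%_ _. 1)" by (auto simp: cutoff_def lcad_def adapted_def)

lemma cutoffI: assumes "adapted h" "!!w t. w : space M ==> 0 <= t ==> h t w = 0 | h t w = 1"
  "!!w r t. w : space M ==> 0 <= r ==> r <= t ==> h t w <= h r w" and left: "!!w t. w : space M ==> 0 <= t ==> (!!p. h (kap p t) w = 1) ==> h t w = 1"
 shows "cutoff h" unfolding cutoff_def lcad_def
proof (intro conjI ballI allI impI)
 fix w and t :: real assume w: "w : space M" "0 <= t"
 show "(%p. h (kap p t) w) ----> h t w"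
 proof (cases "h t w = 1")
  case True
  have "h (kap p t) w = 1" for p using assms(3)[OF w(1) kap_nonneg[OF w(2)] kap_le, of p] assms(2)[OF w(1) kap_nonneg[OF w(2)], of p] True by auto
  then show ?thesis using True by simp
 next
  case False
  then obtain p where p: "h (kap p t) w ~= 1" using left[OF w] by blast
  \<comment> \<open>Finer grids round to later times, so monotonicity carries the zero from grid
    \<open>p\<close> to all of them.\<close>
  have "h (kap q t) w = 0" if "p <= q" for q
  proof -
   have "kap p t <= kap q t" by (metis kap_kap kap_le that)
   then show ?thesis using assms(3)[OF w(1) kap_nonneg[OF w(2)], of p "kap q t"] p assms(2)[OF w(1) kap_nonneg[OF w(2)]]
    by (metis zero_neq_one not_one_le_zero)
  qed
  then have "eventually (%q. h (kap q t) w = 0) sequentially" by (auto simp: eventually_sequentially)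
  moreover have "h t w = 0" using False assms(2)[OF w] by auto
  ultimately show ?thesis using tendsto_eventually by force
 qed
qed (use assms in auto)

text \<open>On \<open>{h t = 1}\<close> the process \<open>h\<close> equals 1 on all of
  \<open>[0, t]\<close>, so the sums of the cut integrand are those of \<open>Z\<close>. Their
  second moments are sampled energies, which converge, and Fatou's lemma gives the bound in the
  limit.\<close>

lemma simple_bound: assumes "simple t Z K" "cutoff h" "0 <= t"
 shows "(EE w. ennreal (h t w * (norm (K w))^2)) <= (EE w. energy (%u w. h u w *R Z u w) t w)"
proof -
 let ?Z = "%u w. h u w *R Z u w"
 have Z: "lcad Z" "bdd_process Z" "K : borel_measurable M" and lim: "!!w. w : space M ==> (%p. dint p Z t w) ----> K w"
  using assms(1) by (auto simp: simple_def)
 have h01: "h r w = 0 | h r w = 1" if "w : space M" "0 <= r" for r w using cutoff_values[OF assms(2) that] .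
 have lc: "lcad ?Z" by (intro lcad_scaleR cutoff_lcad assms Z)
 have bd: "bdd_process ?Z"
 proof -
  obtain C where C: "!!t w. 0 <= t ==> w : space M ==> norm (Z t w) <= C" using Z(2) by (auto simp: bdd_process_def)
  have "norm (?Z t w) <= max C 0" if "0 <= t" "w : space M" for t w using h01[of w t] C[OF that] that by auto
  then show ?thesis unfolding bdd_process_def by blast
 qed
 have le: "ennreal (h t w * (norm (dint p Z t w))^2) <= nsq (dint p ?Z t w)" if "w : space M" for p w
 proof (cases "h t w = 1")
  case True
  have "h r w = 1" if "0 <= r" "r <= t" for r
   using cutoff_antimono[OF assms(2) \<open>w : space M\<close> that] h01[OF \<open>w : space M\<close> that(1)] True by auto
  then have "dint p ?Z t w = dint p Z t w"
   unfolding dint_def using less_nat_ceiling_iff[OF assms(3), of _ p] by (intro sum.cong) (auto simp: less_imp_le)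
  then show ?thesis using True by simp
 next
  case False
  then have "h t w = 0" using h01[OF that assms(3)] by auto
  then show ?thesis by simp
 qed
 have [measurable]: "h t : borel_measurable M" "!!p. dint p Z t : borel_measurable M"
  using adapted_M[OF lcad_adapted[OF cutoff_lcad[OF assms(2)]] assms(3)] F_M[OF dint_measurable[OF lcad_adapted[OF Z(1)] assms(3)] assms(3)] by auto
 have "(EE w. ennreal (h t w * (norm (K w))^2))
  <= (EE w. liminf (%p. ennreal (h t w * (norm (dint p Z t w))^2)))"
 proof (rule nn_integral_mono)
  fix w assume "w : space M"
  then have "(%p. ennreal (h t w * (norm (dint p Z t w))^2)) ----> ennreal (h t w * (norm (K w))^2)"
   by (intro tendsto_intros tendsto_ennrealI lim)
  then have "liminf (%p. ennreal (h t w * (norm (dint p Z t w))^2)) = ennreal (h t w * (norm (K w))^2)" by (intro lim_imp_Liminf) auto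
  then show "ennreal (h t w * (norm (K w))^2) <= liminf (%p. ennreal (h t w * (norm (dint p Z t w))^2))" by simp
 qed
 also have "... <= liminf (%p. (EE w. ennreal (h t w * (norm (dint p Z t w))^2)))" by (rule nn_integral_liminf) measurable
 also have "... <= liminf (%p. (EE w. energy (%u. ?Z (kap p u)) t w))"
 proof (intro Liminf_mono always_eventually allI)
  fix p
  have "(EE w. ennreal (h t w * (norm (dint p Z t w))^2)) <= (EE w. nsq (dint p ?Z t w))"
   by (intro nn_integral_mono le)
  also have "... = (EE w. energy (%u. ?Z (kap p u)) t w)"
   using dint_isometry[OF lcad_adapted[OF lc] bd assms(3), of p] by (simp add: energy_def)
  finally show "(EE w. ennreal (h t w * (norm (dint p Z t w))^2)) <= (EE w. energy (%u. ?Z (kap p u)) t w)" .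
 qed
 also have "... = (EE w. energy ?Z t w)" by (intro lim_imp_Liminf energy_kap_lim lc bd assms) auto
 finally show ?thesis .
qed

lemma measure_tendsto_0: fixes f :: "nat => 'a => ennreal" assumes [measurable]: "!!j. f j : borel_measurable M"
  and lim: "AE z in M. (%j. f j z) ----> 0" and "0 < e"
 shows "(%j. measure M {z:space M. f j z > e}) ----> 0"
proof -
 have "(%j. (EE z. indicator {z:space M. f j z > e} z)) ----> (EE z. 0)"
 proof (rule nn_integral_dominated_convergence[where w="%_. 1"])
  show "AE z in M. (%j. indicator {z:space M. f j z > e} z :: ennreal) ----> 0" using lim
  proof eventually_elim
   case (elim z)
   then have "eventually (%j. f j z < e) sequentially" using \<open>0 < e\<close> by (simp add: order_tendsto_iff)
   then have "eventually (%j. indicator {z:space M. f j z > e} z = (0::ennreal)) sequentially" by eventually_elim (auto simp: indicator_def)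
   then show ?case by (rule tendsto_eventually)
  qed
 qed (auto simp: emeasure_space_1 indicator_def)
 then have "(%j. emeasure M {z:space M. f j z > e}) ----> 0" by simp
 then show ?thesis by (simp add: emeasure_eq_measure ennreal_tendsto_0_iff)
qed

lemma energy_left: fixes Y :: "real => 'a => 'b::sep_normed"
 assumes "prog Y" "w : space M" "r ----> t" "!!n. r n <= t" "!!n. energy Y (r n) w <= d" shows "energy Y t w <= d"
 unfolding energy_def by (rule nn_integral_left_limit[OF norm2_measurable[OF assms(1,2)] assms(3,4)])
  (use assms(5) in \<open>simp add: energy_def\<close>)

lemma energy_at_0: "energy Y 0 w = 0"
proof -
 have "energy Y 0 w = (\<integral>\<^sup>+r. 0 \<partial>(lborel :: real measure))" unfolding energy_def
 proof (rule nn_integral_cong_AE)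
  show "AE r in lborel. nsq (Y r w) * indicator {0..0} r = 0"
   using AE_lborel_singleton[of 0] by eventually_elim (simp add: indicator_def)
 qed
 then show ?thesis by simp
qed

definition stop :: "(real => 'a => 'b::real_normed_vector) => real => real => 'a => real"
 where "stop Y d t w = (if energy Y t w <= ennreal d then 1 else 0)"

lemma cutoff_stop: fixes Y :: "real => 'a => 'b::sep_normed" assumes "prog Y" shows "cutoff (stop Y d)"
proof (rule cutoffI)
 show "adapted (stop Y d)" unfolding adapted_def stop_def
 proof (intro allI impI)
  fix t :: real assume "0 <= t"
  note [measurable] = energy_measurable[OF assms this]
  show "(%w. if energy Y t w <= ennreal d then 1 else 0 :: real) : borel_measurable (\<F> t)" by measurable
 qed
 show "stop Y d t w <= stop Y d r w" if "r <= t" for r t w using energy_mono_time[OF that, of Y w] by (auto simp: stop_def)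
 show "stop Y d t w = 1" if "w : space M" "!!p. stop Y d (kap p t) w = 1" for t w
 proof -
  have "energy Y (kap p t) w <= ennreal d" for p using that(2)[of p] by (auto simp: stop_def split: if_splits)
  from energy_left[OF assms that(1) kap_lim kap_le this] show ?thesis by (simp add: stop_def)
 qed
qed (auto simp: stop_def)

text \<open>The energy is increasing and left-continuous in time, so the level \<open>d\<close>
  still holds at the supremum \<open>ta\<close> of the times that satisfy it, and the stopped
  process vanishes after \<open>ta\<close>. This covers energies that become infinite immediately
  after \<open>ta\<close>.\<close>

lemma energy_stop: fixes Y :: "real => 'a => 'b::sep_normed" assumes "prog Y" "w : space M" "0 <= t" "0 <= d"
 shows "energy (%r w. stop Y d r w *R Y r w) t w <= ennreal d"
proof -
 define S where "S = {r. 0 <= r & r <= t & energy Y r w <= ennreal d}"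
 define ta where "ta = Sup S"
 have S0: "0 : S" using assms by (simp add: S_def energy_at_0)
 have bdd: "bdd_above S" by (rule bdd_aboveI[of _ t]) (auto simp: S_def)
 have ta: "0 <= ta" unfolding ta_def by (rule cSup_upper[OF S0 bdd])
 have upper: "r <= ta" if "r : S" for r unfolding ta_def by (rule cSup_upper[OF that bdd])
 have eta: "energy Y ta w <= ennreal d"
 proof (rule energy_left[OF assms(1,2)])
  \<comment> \<open>These times stay in \<open>[0, ta]\<close> and, for \<open>ta > 0\<close>,
    strictly below \<open>ta\<close>, so that each of them is exceeded by a member of
    \<open>S\<close>.\<close>
  show "(%n. ta - ta / real (Suc n)) ----> ta"
   using tendsto_diff[OF tendsto_const tendsto_mult[OF tendsto_const LIMSEQ_inverse_real_of_nat], of ta ta] by (simp add: divide_inverse)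
  fix n
  show "ta - ta / real (Suc n) <= ta" using ta by simp
  show "energy Y (ta - ta / real (Suc n)) w <= ennreal d"
  proof (cases "ta = 0")
   case True
   then show ?thesis by (simp add: energy_at_0)
  next
   case False
   then have "ta - ta / real (Suc n) < Sup S" using ta by (simp add: ta_def[symmetric])
   then obtain s where "s : S" "ta - ta / real (Suc n) < s" using less_cSup_iff[of S] S0 bdd by blast
   then show ?thesis using energy_mono_time[of "ta - ta / real (Suc n)" s Y w] by (auto simp: S_def)
  qed
 qed
 have "energy (%r w. stop Y d r w *R Y r w) t w <= energy Y ta w" unfolding energy_def
 proof (rule nn_integral_mono)
  fix r
  show "nsq (stop Y d r w *R Y r w) * indicator {0..t} r <= nsq (Y r w) * indicator {0..ta} r"
   using upper[of r] by (auto simp: stop_def S_def indicator_def)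
 qed
 also note eta
 finally show ?thesis .
qed

lemma cutoff_mult: assumes "cutoff h" "cutoff et" shows "cutoff (%t w. h t w * et t w)"
proof (unfold cutoff_def, intro conjI ballI allI impI)
 show "lcad (%t w. h t w * et t w)" using lcad_scaleR[OF assms[THEN cutoff_lcad]] by simp
 fix w assume w: "w : space M"
 show "h t w * et t w = 0 | h t w * et t w = 1" if "0 <= t" for t using assms[THEN cutoff_values, OF w that] by auto
 show "h t w * et t w <= h r w * et r w" if "0 <= r" "r <= t" for r t
 proof (rule mult_mono)
  show "0 <= h r w" "0 <= et t w" using assms(1)[THEN cutoff_values, OF w, of r] assms(2)[THEN cutoff_values, OF w, of t] that by auto
 qed (use assms[THEN cutoff_antimono, OF w that] in auto)
qed

section \<open>The Ito integral: localised isometry and closure properties\<close>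

lemma ito_nonneg: "ito t Y I ==> 0 <= t" by (simp add: ito_def)
lemma ito_prog: "ito t Y I ==> prog Y" by (simp add: ito_def)
lemma ito_measurable: "ito t Y I ==> I : borel_measurable M" by (simp add: ito_def)

lemma itoE: assumes "ito t Y I" "0 < e" obtains Z K A where "simple t Z K" "A : sets M" "measure M A <= e"
  "!!w. w : space M - A ==> energy (%r w. Z r w - Y r w) t w <= ennreal e" "!!w. w : space M - A ==> norm (K w - I w) <= e"
proof -
 have "EX Z K A. simple t Z K & A : sets M & measure M A <= e &
   (ALL w:space M - A. energy (%r w. Z r w - Y r w) t w <= ennreal e & norm (K w - I w) <= e)"
  using assms unfolding ito_def by blast
 then show ?thesis using that by blast
qed

lemma itoI: assumes "0 <= t" "prog Y" "I : borel_measurable M" "!!e. 0 < e ==> EX Z K A. simple t Z K & A : sets M & measure M A <= e &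
   (ALL w:space M - A. energy (%r w. Z r w - Y r w) t w <= ennreal e & norm (K w - I w) <= e)"
 shows "ito t Y I" unfolding ito_def using assms by blast

lemma simple_lcad: "simple t Z K ==> lcad Z" by (simp add: simple_def)

lemma simple_prog: fixes Z :: "real => 'a => 'b::sep_inner"
 shows "simple t Z K ==> prog Z" by (intro lcad_prog simple_lcad)

lemma simple_measurable: "simple t Z K ==> K : borel_measurable M" by (simp add: simple_def)

lemma ito_simple: "simple t Z K ==> 0 <= t ==> ito t Z K"
proof (rule itoI)
 assume *: "simple t Z K"
 then show "prog Z" "K : borel_measurable M" by (auto intro: simple_prog simple_measurable)
 fix e :: real assume "0 < e"
 then show "EX Z' K' A. simple t Z' K' & A : sets M & measure M A <= e &
   (ALL w:space M - A. energy (%r w. Z' r w - Z r w) t w <= ennreal e & norm (K' w - K w) <= e)"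
  using * by (intro exI[of _ Z] exI[of _ K] exI[of _ "{}"]) (auto simp: energy_def)
qed

lemma summable_measure_halves: assumes "!!j. measure M (A j) <= (1 / 2) ^ j" shows "summable (%j. measure M (A j))"
 by (rule summable_comparison_test[OF _ summable_geometric[of "1 / 2 :: real"]]) (use assms in auto)

text \<open>Multiplying by the predictable cutoff leaves the Riemann sums unchanged on \<open>{h = 1}\<close>, so the
  isometry localises.\<close>

lemma ito_bound: fixes Y :: "real => 'a => 'b::sep_inner" assumes I: "ito t Y I" and h: "cutoff h"
 shows "(EE w. ennreal (h t w * (norm (I w))^2))
  <= 2 * (EE w. energy (%u w. h u w *R Y u w) t w)"
proof -
 note t = ito_nonneg[OF I] and Y = ito_prog[OF I]
 \<comment> \<open>Errors \<open>(1 / 2) ^ j\<close> are summable, so by Borel-Cantelli almost every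
   outcome eventually lies outside \<open>A j\<close>.\<close>
 define P where "P j Z K A \<longleftrightarrow> simple t Z K & A : sets M & measure M A <= (1 / 2) ^ j &
   (ALL w:space M - A. energy (%u w. Z u w - Y u w) t w <= ennreal ((1 / 2) ^ j) & norm (K w - I w) <= (1 / 2) ^ j)"
  for j :: nat and Z K A
 have "ALL j. EX x. P j (fst x) (fst (snd x)) (snd (snd x))"
 proof
  fix j
  have "EX Z K A. P j Z K A" using I unfolding P_def ito_def by simp
  then show "EX x. P j (fst x) (fst (snd x)) (snd (snd x))" by auto
 qed
 from choice[OF this] obtain x where x: "!!j. P j (fst (x j)) (fst (snd (x j))) (snd (snd (x j)))" by blast
 define Z K A where "Z j = fst (x j)" and "K j = fst (snd (x j))" and "A j = snd (snd (x j))" for j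
 have ZKA: "!!j. simple t (Z j) (K j)" "!!j. A j : sets M" "!!j. measure M (A j) <= (1 / 2) ^ j"
  "!!j w. w : space M - A j ==> energy (%u w. Z j u w - Y u w) t w <= ennreal ((1 / 2) ^ j)"
  "!!j w. w : space M - A j ==> norm (K j w - I w) <= (1 / 2) ^ j" using x unfolding P_def Z_def K_def A_def by blast+
 define D where "D j u w = Z j u w - Y u w" for j u w
 have D: "prog (D j)" for j unfolding D_def[abs_def] by (intro prog_diff Y simple_prog[OF ZKA(1)])
 \<comment> \<open>The cutoff is tightened to the times at which the approximation error is within
   its budget. This makes the error term bounded in mean, and almost surely the additional stop is
   inactive for large \<open>j\<close>. Separating the error from \<open>Y\<close> causes the factor
   2 of the conclusion.\<close>
 define et where "et j r w = h r w * stop (D j) ((1 / 2) ^ j) r w" for j r w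
 have et: "cutoff (et j)" for j unfolding et_def by (intro cutoff_mult h cutoff_stop D)
 have ph: "prog h" "!!j. prog (et j)" "!!j. prog (stop (D j) ((1 / 2) ^ j))" by (intro lcad_prog cutoff_lcad h et cutoff_stop D)+
 have ae: "AE w in M. eventually (%j. w : space M - A j) sequentially"
  by (rule borel_cantelli_AE1) (use ZKA(2) summable_measure_halves[OF ZKA(3)] in \<open>simp_all add: emeasure_eq_measure\<close>)
 have etm: "(%w. ennreal (et j t w * (norm (K j w))^2)) : borel_measurable M" for j
 proof -
  have [measurable]: "et j t : borel_measurable M" "K j : borel_measurable M"
   using adapted_M[OF lcad_adapted[OF cutoff_lcad[OF et]] t] simple_measurable[OF ZKA(1)] by auto
  show ?thesis by measurable
 qed
 let ?D = "(EE w. energy (%u w. h u w *R Y u w) t w)"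
 have bnd: "(EE w. ennreal (et j t w * (norm (K j w))^2)) <= 2 * ?D + 2 * ennreal ((1 / 2) ^ j)" for j
 proof -
  have "(EE w. ennreal (et j t w * (norm (K j w))^2)) <= (EE w. energy (%u w. et j u w *R Z j u w) t w)"
   by (rule simple_bound[OF ZKA(1) et t])
  also have "... <= (EE w. 2 * energy (%u w. h u w *R Y u w) t w + 2 * ennreal ((1 / 2) ^ j))"
  proof (rule nn_integral_mono)
   fix w assume w: "w : space M"
   have "energy (%u w. et j u w *R Z j u w) t w = energy (%u w. et j u w *R Y u w - (- et j u w) *R D j u w) t w"
    by (intro energy_cong) (simp add: D_def algebra_simps)
   also have "... <= 2 * energy (%u w. et j u w *R Y u w) t w + 2 * energy (%u w. (- et j u w) *R D j u w) t w"
    using prog_compose[OF ph(2)[of j], of uminus] by (intro energy_diff_le prog_scaleR ph Y D w) auto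
   also have "energy (%u w. et j u w *R Y u w) t w <= energy (%u w. h u w *R Y u w) t w"
    by (intro energy_mono) (auto simp: et_def stop_def)
   also have "energy (%u w. (- et j u w) *R D j u w) t w <= energy (%u w. stop (D j) ((1 / 2) ^ j) u w *R D j u w) t w"
   proof (intro energy_mono)
    fix u :: real assume "0 <= u" "u <= t"
    then show "norm ((- et j u w) *R D j u w) <= norm (stop (D j) ((1 / 2) ^ j) u w *R D j u w)"
     using cutoff_values[OF h w, of u] by (auto simp: et_def stop_def)
   qed
   also have "... <= ennreal ((1 / 2) ^ j)" by (rule energy_stop[OF D w t]) simp
   finally show "energy (%u w. et j u w *R Z j u w) t w <= 2 * energy (%u w. h u w *R Y u w) t w + 2 * ennreal ((1 / 2) ^ j)"
    by (simp add: mult_left_mono add_mono)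
  qed
  also have "... = 2 * ?D + 2 * ennreal ((1 / 2) ^ j)"
  proof -
   have [measurable]: "energy (%u w. h u w *R Y u w) t : borel_measurable M" by (intro energy_measurable_M prog_scaleR ph Y t)
   show ?thesis by (simp add: nn_integral_add nn_integral_cmult emeasure_space_1)
  qed
  finally show ?thesis .
 qed
 have "(EE w. ennreal (h t w * (norm (I w))^2))
  <= (EE w. liminf (%j. ennreal (et j t w * (norm (K j w))^2)))"
 proof (rule nn_integral_mono_AE, use ae in eventually_elim)
  fix w assume ev: "eventually (%j. w : space M - A j) sequentially"
  have "(%j. K j w) ----> I w"
  proof (rule Lim_transform_eventually)
   show "(%j. (K j w - I w) + I w) ----> I w"
   proof -
    have "(%j. K j w - I w) ----> 0"
    proof (rule tendsto_0_le[OF _ _, where K=1])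
     show "(%j. (1 / 2 :: real) ^ j) ----> 0" by (rule LIMSEQ_power_zero) simp
     show "eventually (%j. norm (K j w - I w) <= norm ((1 / 2 :: real) ^ j) * 1) sequentially" using ev by eventually_elim (use ZKA(5) in simp)
    qed
    from tendsto_add[OF this tendsto_const, of "I w"] show ?thesis by simp
   qed
  qed simp
  then have "(%j. ennreal (h t w * (norm (K j w))^2)) ----> ennreal (h t w * (norm (I w))^2)"
   by (intro tendsto_intros tendsto_ennrealI)
  moreover have "eventually (%j. ennreal (h t w * (norm (K j w))^2) = ennreal (et j t w * (norm (K j w))^2)) sequentially"
  proof (use ev in eventually_elim)
   fix j assume "w : space M - A j"
   then have "energy (D j) t w <= ennreal ((1 / 2) ^ j)" using ZKA(4) by (simp add: D_def[abs_def])
   then show "ennreal (h t w * (norm (K j w))^2) = ennreal (et j t w * (norm (K j w))^2)" by (simp add: et_def stop_def)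
  qed
  ultimately have "(%j. ennreal (et j t w * (norm (K j w))^2)) ----> ennreal (h t w * (norm (I w))^2)"
   by (rule Lim_transform_eventually)
  then have "liminf (%j. ennreal (et j t w * (norm (K j w))^2)) = ennreal (h t w * (norm (I w))^2)" by (intro lim_imp_Liminf) auto
  then show "ennreal (h t w * (norm (I w))^2) <= liminf (%j. ennreal (et j t w * (norm (K j w))^2))" by simp
 qed
 also have "... <= liminf (%j. (EE w. ennreal (et j t w * (norm (K j w))^2)))" by (rule nn_integral_liminf) (fact etm)
 also have "... <= liminf (%j. 2 * ?D + 2 * ennreal ((1 / 2) ^ j))" by (intro Liminf_mono always_eventually allI bnd)
 also have "... = 2 * ?D"
 proof -
  have "(%j. 2 * ?D + 2 * ennreal ((1 / 2) ^ j)) ----> 2 * ?D + 2 * ennreal 0"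
   by (intro tendsto_add tendsto_const ennreal_tendsto_cmult tendsto_ennrealI LIMSEQ_power_zero) auto
  then show ?thesis by (intro lim_imp_Liminf) auto
 qed
 finally show ?thesis .
qed

text \<open>While the energy is at most \<open>d\<close> the stop at that level is inactive, and
  Chebyshev's inequality applies to the localised isometry. It converts small energy in probability
  into a small integral in probability, without any moment assumption.\<close>

lemma ito_prob: fixes Y :: "real => 'a => 'b::sep_inner" assumes I: "ito t Y I" and "0 < e" "0 < d"
 shows "measure M {w:space M. norm (I w) > e} <= 2 * d / e^2 + measure M {w:space M. energy Y t w > ennreal d}"
proof -
 note t = ito_nonneg[OF I] and Y = ito_prog[OF I]
 have [measurable]: "I : borel_measurable M" "energy Y t : borel_measurable M" using ito_measurable[OF I] energy_measurable_M[OF Y t] by auto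
 let ?B = "{w:space M. norm (I w) > e & energy Y t w <= ennreal d}"
 have "ennreal (e^2) * emeasure M ?B = (EE w. ennreal (e^2) * indicator ?B w)" by (subst nn_integral_cmult_indicator) auto
 also have "... <= (EE w. ennreal (stop Y d t w * (norm (I w))^2))"
  using \<open>0 < e\<close> by (intro nn_integral_mono) (auto simp: indicator_def stop_def intro!: ennreal_leI power_mono)
 also have "... <= 2 * (EE w. energy (%r w. stop Y d r w *R Y r w) t w)"
  by (rule ito_bound[OF I cutoff_stop[OF Y]])
 also have "... <= 2 * (EE w. ennreal d)"
  using \<open>0 < d\<close> by (intro mult_left_mono nn_integral_mono energy_stop Y t) auto
 also have "... = ennreal (2 * d)" using \<open>0 < d\<close> by (simp add: emeasure_space_1 ennreal_mult)
 finally have "ennreal (e^2 * measure M ?B) <= ennreal (2 * d)" by (simp add: emeasure_eq_measure ennreal_mult)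
 then have "e^2 * measure M ?B <= 2 * d" using \<open>0 < d\<close> by (simp add: ennreal_le_iff)
 then have B: "measure M ?B <= 2 * d / e^2" using \<open>0 < e\<close> by (simp add: field_simps)
 have "measure M {w:space M. norm (I w) > e} <= measure M (?B \<union> {w:space M. energy Y t w > ennreal d})" by (intro finite_measure_mono) auto
 also have "... <= measure M ?B + measure M {w:space M. energy Y t w > ennreal d}" by (intro measure_Un_le) auto
 finally show ?thesis using B by simp
qed

lemma simple_diff: assumes "simple t Z K" "simple t Z' K'" shows "simple t (%r w. Z r w - Z' r w) (%w. K w - K' w)" using assms unfolding simple_def
 by (auto intro!: lcad_diff bdd_process_diff tendsto_diff simp: dint_diff)

lemma ito_diff: fixes Y Y' :: "real => 'a => 'b::sep_inner" assumes I: "ito t Y I" and I': "ito t Y' I'"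
 shows "ito t (%r w. Y r w - Y' r w) (%w. I w - I' w)"
proof (rule itoI)
 show "0 <= t" by (rule ito_nonneg[OF I])
 show "prog (%r w. Y r w - Y' r w)" by (intro prog_diff ito_prog[OF I] ito_prog[OF I'])
 show "(%w. I w - I' w) : borel_measurable M" by (intro borel_measurable_diff ito_measurable[OF I] ito_measurable[OF I'])
 fix e :: real assume "0 < e"
 \<comment> \<open>Two errors, each weighted by 2 in \<open>energy_diff_le\<close>, have to fit into
   \<open>e\<close>.\<close>
 then have "0 < e / 4" by simp
 obtain Z K A where Z: "simple t Z K" "A : sets M" "measure M A <= e / 4"
  "!!w. w : space M - A ==> energy (%r w. Z r w - Y r w) t w <= ennreal (e / 4)" "!!w. w : space M - A ==> norm (K w - I w) <= e / 4"
  using itoE[OF I \<open>0 < e / 4\<close>] by blast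
 obtain Z' K' A' where Z': "simple t Z' K'" "A' : sets M" "measure M A' <= e / 4"
  "!!w. w : space M - A' ==> energy (%r w. Z' r w - Y' r w) t w <= ennreal (e / 4)" "!!w. w : space M - A' ==> norm (K' w - I' w) <= e / 4"
  using itoE[OF I' \<open>0 < e / 4\<close>] by blast
 show "EX Z'' K'' A''. simple t Z'' K'' & A'' : sets M & measure M A'' <= e &
   (ALL w:space M - A''. energy (%r w. Z'' r w - (Y r w - Y' r w)) t w <= ennreal e & norm (K'' w - (I w - I' w)) <= e)"
 proof (intro exI conjI ballI)
  show "simple t (%r w. Z r w - Z' r w) (%w. K w - K' w)" by (rule simple_diff[OF Z(1) Z'(1)])
  show "A \<union> A' : sets M" using Z Z' by auto
  show "measure M (A \<union> A') <= e" using measure_Un_le[OF Z(2) Z'(2)] Z(3) Z'(3) \<open>0 < e\<close> by linarith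
  fix w assume "w : space M - (A \<union> A')"
  then have w: "w : space M" "w : space M - A" "w : space M - A'" by auto
  have "energy (%r w. Z r w - Z' r w - (Y r w - Y' r w)) t w = energy (%r w. (Z r w - Y r w) - (Z' r w - Y' r w)) t w"
   by (intro energy_cong) (simp add: algebra_simps)
  also have "... <= 2 * energy (%r w. Z r w - Y r w) t w + 2 * energy (%r w. Z' r w - Y' r w) t w"
   by (intro energy_diff_le prog_diff simple_prog[OF Z(1)] simple_prog[OF Z'(1)] ito_prog[OF I] ito_prog[OF I'] w)
  also have "... <= 2 * ennreal (e / 4) + 2 * ennreal (e / 4)" by (intro add_mono mult_left_mono Z(4) Z'(4) w) auto
  also have "... = ennreal e"
  proof -
   have "2 * ennreal (e / 4) = ennreal (e / 2)" using ennreal_mult'[of 2 "e / 4"] by simp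
   then show ?thesis using \<open>0 < e\<close> by (simp flip: ennreal_plus)
  qed
  finally show "energy (%r w. Z r w - Z' r w - (Y r w - Y' r w)) t w <= ennreal e" .
  have "norm (K w - K' w - (I w - I' w)) <= norm (K w - I w) + norm (K' w - I' w)"
   using norm_triangle_ineq4[of "K w - I w" "K' w - I' w"] by (simp add: algebra_simps)
  then show "norm (K w - K' w - (I w - I' w)) <= e" using Z(5)[OF w(2)] Z'(5)[OF w(3)] \<open>0 < e\<close> by linarith
 qed
qed

lemma ito_zero: "0 <= t ==> ito t (%_ _. 0) (%_. 0)" by (rule ito_simple)
  (auto simp: simple_def lcad_def adapted_def bdd_process_def dint_def intro!: exI[of _ 0])

lemma ito_add: fixes Y Y' :: "real => 'a => 'b::sep_inner" assumes I: "ito t Y I" and I': "ito t Y' I'"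
 shows "ito t (%r w. Y r w + Y' r w) (%w. I w + I' w)" using ito_diff[OF I ito_diff[OF ito_zero[OF ito_nonneg[OF I]] I']] by simp

lemma ito_sum: fixes Y :: "'i => real => 'a => 'b::sep_inner"
 assumes "finite S" "0 <= t" "!!i. i : S ==> ito t (Y i) (I i)" shows "ito t (%r w. \<Sum>i\<in>S. Y i r w) (%w. \<Sum>i\<in>S. I i w)"
 using assms(1,3)
proof (induction S rule: finite_induct)
 case (insert i S)
 then have "ito t (%r w. Y i r w + (\<Sum>i\<in>S. Y i r w)) (%w. I i w + (\<Sum>i\<in>S. I i w))" by (intro ito_add) auto
 with insert show ?case by simp
qed (simp add: ito_zero assms)

text \<open>A diagonal argument: the relation \<open>ito\<close> is closed, so later approximations
  may use integrals already constructed in place of simple ones.\<close>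

lemma ito_closed: fixes Y :: "real => 'a => 'b::sep_inner" assumes "0 <= t" "prog Y" "I : borel_measurable M"
  "!!e. 0 < e ==> EX Z K A. ito t Z K & A : sets M & measure M A <= e &
   (ALL w:space M - A. energy (%r w. Z r w - Y r w) t w <= ennreal e & norm (K w - I w) <= e)"
 shows "ito t Y I"
proof (rule itoI)
 fix e :: real assume "0 < e"
 then have "0 < e / 4" by simp
 then obtain Y' I' A' where Y': "ito t Y' I'" "A' : sets M" "measure M A' <= e / 4"
  "!!w. w : space M - A' ==> energy (%r w. Y' r w - Y r w) t w <= ennreal (e / 4)" "!!w. w : space M - A' ==> norm (I' w - I w) <= e / 4"
  using assms(4)[OF \<open>0 < e / 4\<close>] by blast
 obtain Z K A where Z: "simple t Z K" "A : sets M" "measure M A <= e / 4"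
  "!!w. w : space M - A ==> energy (%r w. Z r w - Y' r w) t w <= ennreal (e / 4)" "!!w. w : space M - A ==> norm (K w - I' w) <= e / 4"
  using itoE[OF Y'(1) \<open>0 < e / 4\<close>] by blast
 show "EX Z K A. simple t Z K & A : sets M & measure M A <= e &
   (ALL w:space M - A. energy (%r w. Z r w - Y r w) t w <= ennreal e & norm (K w - I w) <= e)"
 proof (intro exI conjI ballI)
  show "simple t Z K" by fact
  show "A \<union> A' : sets M" using Z Y' by auto
  show "measure M (A \<union> A') <= e" using measure_Un_le[OF Z(2) Y'(2)] Z(3) Y'(3) \<open>0 < e\<close> by linarith
  fix w assume "w : space M - (A \<union> A')"
  then have w: "w : space M" "w : space M - A" "w : space M - A'" by auto
  have "energy (%r w. Z r w - Y r w) t w = energy (%r w. (Z r w - Y' r w) - (Y r w - Y' r w)) t w" by (intro energy_cong) (simp add: algebra_simps)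
  also have "... <= 2 * energy (%r w. Z r w - Y' r w) t w + 2 * energy (%r w. Y r w - Y' r w) t w"
   by (intro energy_diff_le prog_diff simple_prog[OF Z(1)] ito_prog[OF Y'(1)] assms w)
  also have "energy (%r w. Y r w - Y' r w) t w = energy (%r w. Y' r w - Y r w) t w" by (rule energy_minus_commute)
  also have "2 * energy (%r w. Z r w - Y' r w) t w + 2 * energy (%r w. Y' r w - Y r w) t w <= 2 * ennreal (e / 4) + 2 * ennreal (e / 4)"
   by (intro add_mono mult_left_mono Z(4) Y'(4) w) auto
  also have "... = ennreal e"
  proof -
   have "2 * ennreal (e / 4) = ennreal (e / 2)" using ennreal_mult'[of 2 "e / 4"] by simp
   then show ?thesis using \<open>0 < e\<close> by (simp flip: ennreal_plus)
  qed
  finally show "energy (%r w. Z r w - Y r w) t w <= ennreal e" .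
  have "norm (K w - I w) <= norm (K w - I' w) + norm (I' w - I w)" using norm_triangle_ineq[of "K w - I' w" "I' w - I w"] by simp
  then show "norm (K w - I w) <= e" using Z(5)[OF w(2)] Y'(5)[OF w(3)] \<open>0 < e\<close> by linarith
 qed
qed (fact assms)+

lemma ito_limit: fixes Y :: "real => 'a => 'b::sep_inner"
 assumes Z: "!!n. ito t (Z n) (K n)" and Y: "prog Y" and [measurable]: "I : borel_measurable M"
  and lim1: "AE w in M. (%n. energy (%r w. Z n r w - Y r w) t w) ----> 0"
  and lim2: "AE w in M. (%n. K n w) ----> I w"
 shows "ito t Y I"
proof -
 note t = ito_nonneg[OF Z]
 have m1: "energy (%r w. Z n r w - Y r w) t : borel_measurable M" for n by (intro energy_measurable_M prog_diff Y ito_prog[OF Z] t)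
 have [measurable]: "K n : borel_measurable M" for n by (rule ito_measurable[OF Z])
 have m2: "(%w. ennreal (norm (K n w - I w))) : borel_measurable M" for n by measurable
 have lim3: "AE w in M. (%n. ennreal (norm (K n w - I w))) ----> 0" using lim2
 proof eventually_elim
  case (elim w)
  then have "(%n. ennreal (norm (K n w - I w))) ----> ennreal (norm (I w - I w))"
   by (intro tendsto_ennrealI tendsto_norm tendsto_diff tendsto_const)
  then show ?case by simp
 qed
 show ?thesis
 proof (rule ito_closed[OF t Y \<open>I : borel_measurable M\<close>])
  fix e :: real assume e: "0 < e"
  let ?A = "%n. {w:space M. energy (%r w. Z n r w - Y r w) t w > ennreal e}"
  let ?B = "%n. {w:space M. ennreal (norm (K n w - I w)) > ennreal e}"
  have "eventually (%n. measure M (?A n) < e / 2) sequentially" "eventually (%n. measure M (?B n) < e / 2) sequentially"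
   using order_tendstoD(2)[OF measure_tendsto_0[OF m1 lim1, of "ennreal e"], of "e / 2"]
    order_tendstoD(2)[OF measure_tendsto_0[OF m2 lim3, of "ennreal e"], of "e / 2"] e by simp_all
  then obtain n where n: "measure M (?A n) < e / 2" "measure M (?B n) < e / 2" using eventually_happens[OF eventually_conj] by force
  have AB: "?A n : sets M" "?B n : sets M" using m1 m2 by measurable
  show "EX Z' K A. ito t Z' K & A : sets M & measure M A <= e &
   (ALL w:space M - A. energy (%r w. Z' r w - Y r w) t w <= ennreal e & norm (K w - I w) <= e)"
  proof (intro exI conjI ballI)
   show "ito t (Z n) (K n)" by (rule Z)
   show "?A n \<union> ?B n : sets M" using AB by auto
   show "measure M (?A n \<union> ?B n) <= e" using measure_Un_le[OF AB] n by linarith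
   fix w assume "w : space M - (?A n \<union> ?B n)"
   then show "energy (%r w. Z n r w - Y r w) t w <= ennreal e" "norm (K n w - I w) <= e" using e by (auto simp: not_less ennreal_le_iff)
  qed
 qed
qed

lemma ito_cong_AE: fixes Y :: "real => 'a => 'b::sep_inner"
 assumes I: "ito t Y I" and "prog Y'" "I' : borel_measurable M" and ae: "AE w in M. (ALL r. 0 < r --> r <= t --> Y r w = Y' r w) & I w = I' w"
 shows "ito t Y' I'"
proof (rule ito_closed)
 obtain N where N: "N : null_sets M" "{w:space M. \<not> ((ALL r. 0 < r --> r <= t --> Y r w = Y' r w) & I w = I' w)} \<subseteq> N"
  using ae unfolding eventually_ae_filter by blast
 fix e :: real assume "0 < e"
 show "EX Z K A. ito t Z K & A : sets M & measure M A <= e &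
   (ALL w:space M - A. energy (%r w. Z r w - Y' r w) t w <= ennreal e & norm (K w - I' w) <= e)"
 proof (intro exI conjI ballI)
  show "ito t Y I" by fact
  show "N : sets M" "measure M N <= e" using N \<open>0 < e\<close> by (auto simp: null_sets_def measure_def)
  fix w assume "w : space M - N"
  then have eq: "!!r. 0 < r ==> r <= t ==> Y r w = Y' r w" "I w = I' w" using N(2) by auto
  have "energy (%r w. Y r w - Y' r w) t w = (\<integral>\<^sup>+r. 0 \<partial>(lborel :: real measure))" unfolding energy_def
  proof (rule nn_integral_cong_AE)
   show "AE r in lborel. nsq (Y r w - Y' r w) * indicator {0..t} r = 0"
    using AE_lborel_singleton[of 0] by eventually_elim (auto simp: indicator_def eq)
  qed
  then show "energy (%r w. Y r w - Y' r w) t w <= ennreal e" by simp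
  show "norm (I w - I' w) <= e" using eq \<open>0 < e\<close> by simp
 qed
qed (use assms ito_nonneg in auto)

lemma ito_linear: fixes Y :: "real => 'a => 'b::sep_inner" and f :: "'b => 'c::sep_inner"
 assumes I: "ito t Y I" and f: "bounded_linear f" shows "ito t (%r w. f (Y r w)) (%w. f (I w))"
proof (rule itoI)
 have [measurable]: "f : borel_measurable borel" using bounded_linear.continuous_on[OF f continuous_on_id] by (rule borel_measurable_continuous_onI)
 show "0 <= t" by (rule ito_nonneg[OF I])
 show "prog (%r w. f (Y r w))" by (intro prog_compose[OF ito_prog[OF I]]) measurable
 show "(%w. f (I w)) : borel_measurable M" using ito_measurable[OF I] by measurable
 obtain C where C: "0 < C" "!!x. norm (f x) <= norm x * C" using bounded_linear.pos_bounded[OF f] by auto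
 have fd: "f x - f y = f (x - y)" for x y by (simp add: linear_diff[OF bounded_linear.linear[OF f]])
 fix e :: real assume "0 < e"
 \<comment> \<open>The operator scales values by \<open>C\<close> but energies by
   \<open>C^2\<close>; both have to stay below \<open>e\<close>.\<close>
 define d where "d = min e (min (e / C) (e / C^2))"
 have d: "0 < d" "d <= e" "C * d <= e" "C^2 * d <= e" using \<open>0 < e\<close> C(1) by (auto simp: d_def field_simps min_def)
 obtain Z K A where Z: "simple t Z K" "A : sets M" "measure M A <= d" "!!w. w : space M - A ==> energy (%r w. Z r w - Y r w) t w <= ennreal d"
  "!!w. w : space M - A ==> norm (K w - I w) <= d" using itoE[OF I d(1)] by blast
 show "EX Z K A. simple t Z K & A : sets M & measure M A <= e &
   (ALL w:space M - A. energy (%r w. Z r w - f (Y r w)) t w <= ennreal e & norm (K w - f (I w)) <= e)"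
 proof (intro exI conjI ballI)
  show "simple t (%r w. f (Z r w)) (%w. f (K w))" unfolding simple_def
  proof (intro conjI ballI)
   have lc: "lcad Z" and bd: "bdd_process Z" and [measurable]: "K : borel_measurable M" using Z(1) by (auto simp: simple_def)
   show "lcad (%r w. f (Z r w))" using lc unfolding lcad_def adapted_def by (auto intro: bounded_linear.tendsto[OF f])
   obtain D where D: "!!t w. 0 <= t ==> w : space M ==> norm (Z t w) <= D" using bd by (auto simp: bdd_process_def)
   show "bdd_process (%r w. f (Z r w))" unfolding bdd_process_def
   proof (intro exI allI impI ballI)
    fix t :: real and w assume "0 <= t" "w : space M"
    then show "norm (f (Z t w)) <= D * C" using C(2)[of "Z t w"] D[of t w] C(1) by (meson mult_right_mono order_trans less_imp_le)
   qed
   show "(%w. f (K w)) : borel_measurable M" by measurable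
   show "(%p. dint p (%r w. f (Z r w)) t w) ----> f (K w)" if "w : space M" for w
    using Z(1) that by (auto simp: simple_def dint_linear[OF f] intro: bounded_linear.tendsto[OF f])
  qed
  show "A : sets M" "measure M A <= e" using Z d by auto
  fix w assume w: "w : space M - A"
  have "energy (%r w. f (Z r w) - f (Y r w)) t w <= (NL r. ennreal (C^2) * (nsq (Z r w - Y r w) * indicator {0..t} r))"
   unfolding energy_def
  proof (intro nn_integral_mono)
   fix r
   have "nsq (f (Z r w) - f (Y r w)) <= ennreal ((norm (Z r w - Y r w) * C)^2)" unfolding fd by (intro ennreal_leI power_mono C) auto
   also have "... = ennreal (C^2) * nsq (Z r w - Y r w)" by (simp add: power_mult_distrib ennreal_mult mult.commute)
   finally show "nsq (f (Z r w) - f (Y r w)) * indicator {0..t} r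
    <= ennreal (C^2) * (nsq (Z r w - Y r w) * indicator {0..t} r)" by (auto simp: indicator_def)
  qed
  also have "... = ennreal (C^2) * energy (%r w. Z r w - Y r w) t w" unfolding energy_def
   using norm2_measurable[OF prog_diff[OF simple_prog[OF Z(1)] ito_prog[OF I]], of w t] w by (intro nn_integral_cmult) auto
  also have "... <= ennreal (C^2) * ennreal d" by (intro mult_left_mono Z(4) w) auto
  also have "... <= ennreal e" using d by (simp flip: ennreal_mult add: ennreal_leI)
  finally show "energy (%r w. f (Z r w) - f (Y r w)) t w <= ennreal e" .
  have "norm (f (K w) - f (I w)) <= norm (K w - I w) * C" unfolding fd by (rule C)
  also have "... <= d * C" using Z(5)[OF w] C(1) by simp
  finally show "norm (f (K w) - f (I w)) <= e" using d(3) by (simp add: mult.commute)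
 qed
qed

end

section \<open>Agreement with the integral defined by elementary processes\<close>

lemma indicator_atMost_kap: "(%p. indicator {..a} (kap p t) :: real) ----> indicator {..a} t"
proof (rule tendsto_eventually)
 show "eventually (%p. indicator {..a} (kap p t) = (indicator {..a} t :: real)) sequentially"
 proof (cases "t <= a")
  case True
  then show ?thesis using kap_le[of _ t] by (intro always_eventually allI) (auto simp: indicator_def intro: order_trans)
 next
  case False
  then have "eventually (%p. a < kap p t) sequentially" using kap_lim[of t] by (simp add: order_tendsto_iff)
  then show ?thesis by eventually_elim (use False in \<open>auto simp: indicator_def\<close>)
 qed
qed

lemma indicator_Ioc_eq: "a <= b ==> indicator {a<..b} t = indicator {..b} t - (indicator {..a} t :: real)" for a b t :: real
 by (auto simp: indicator_def)

lemma indicator_Ioc_kap: assumes "a <= b" shows "(%p. indicator {a<..b} (kap p t) :: real) ----> indicator {a<..b} t"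
 unfolding indicator_Ioc_eq[OF assms] by (intro tendsto_diff indicator_atMost_kap)

context wiener begin

lemma simple_dyadic: fixes X :: "real => 'a => 'b::sep_inner" assumes "adapted X" "bdd_process X" "0 <= t"
 shows "simple t (%r. X (kap m r)) (dint m X t)" unfolding simple_def
proof (intro conjI ballI lcad_kap bdd_process_kap assms)
 show "dint m X t : borel_measurable M" by (rule F_M[OF dint_measurable]) (use assms in auto)
 fix w
 have "eventually (%p. dint p (%r. X (kap m r)) t w = dint m X t w) sequentially"
  using eventually_ge_at_top[of m] by eventually_elim (rule dint_kap[OF _ assms(3)])
 then show "(%p. dint p (%r. X (kap m r)) t w) ----> dint m X t w" by (rule tendsto_eventually)
qed

text \<open>The cells with left endpoint at most \<open>a\<close> reach to the grid point following
  \<open>kap p a\<close>, one mesh past the rounded time. Continuity of \<open>W\<close> removes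
  this overshoot in the limit.\<close>

lemma sum_increments_le: assumes "0 <= a" "0 <= t" "t <= real N / 2 ^ p"
 shows "(\<Sum>l<N. (W (min t (real (Suc l) / 2 ^ p)) z - W (min t (real l / 2 ^ p)) z) * indicator {..a} (real l / 2 ^ p))
  = W (min t (kap p a + 1 / 2 ^ p)) z - W 0 z"
proof -
 define k where "k = nat \<lfloor>a * 2 ^ p\<rfloor>"
 define w where "w l = W (min t (real l / 2 ^ p)) z" for l
 have ka: "kap p a + 1 / 2 ^ p = real (Suc k) / 2 ^ p" using assms(1) by (simp add: kap_def k_def add_divide_distrib)
 have le: "real l / 2 ^ p <= a \<longleftrightarrow> l < Suc k" for l
 proof -
  have "real l / 2 ^ p <= a \<longleftrightarrow> real l <= a * 2 ^ p" by (simp add: field_simps)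
  also have "... \<longleftrightarrow> int l <= \<lfloor>a * 2 ^ p\<rfloor>" by (simp add: le_floor_iff)
  also have "... \<longleftrightarrow> l < Suc k" unfolding k_def less_Suc_eq_le using assms(1) by (subst nat_le_eq_zle[symmetric]) auto
  finally show ?thesis .
 qed
 have "(\<Sum>l<N. (w (Suc l) - w l) * indicator {..a} (real l / 2 ^ p)) = (\<Sum>l<N. if l < Suc k then w (Suc l) - w l else 0)"
  by (intro sum.cong) (auto simp: indicator_def le)
 also have "... = (\<Sum>l\<in>{..<N} \<inter> {l. l < Suc k}. w (Suc l) - w l)" by (subst sum.inter_restrict) auto
 also have "{..<N} \<inter> {l. l < Suc k} = {..<min N (Suc k)}" by auto
 also have "(\<Sum>l<min N (Suc k). w (Suc l) - w l) = w (min N (Suc k)) - w 0" by (rule sum_lessThan_telescope)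
 also have "w (min N (Suc k)) = w (Suc k)"
 proof (cases "N <= Suc k")
  case True
  then have "real N / 2 ^ p <= real (Suc k) / 2 ^ p" by (intro divide_right_mono) auto
  then have "min t (real (Suc k) / 2 ^ p) = t" "min t (real N / 2 ^ p) = t" using assms(3) by linarith+
  then show ?thesis using True by (simp add: w_def min_def del: of_nat_Suc)
 qed (simp add: min_def)
 finally show ?thesis using assms(2) by (simp add: w_def ka)
qed

lemma W_tendsto: assumes "w : space M" "0 <= t" "0 <= a" shows "(%p. W (min t (kap p a + 1 / 2 ^ p)) w) ----> W (min t a) w"
proof (rule continuous_on_tendsto_compose[OF W_cont[OF assms(1)]])
 have "(%p. kap p a + 1 / 2 ^ p) ----> a + 0"
  using LIMSEQ_inverse_realpow_zero[of 2] by (intro tendsto_add kap_lim) (simp add: inverse_eq_divide)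
 then show "(%p. min t (kap p a + 1 / 2 ^ p)) ----> min t a" by (intro tendsto_min tendsto_const) simp
qed (use assms kap_nonneg in \<open>auto intro!: always_eventually\<close>)

lemma elementary_sorted: assumes "elementary M \<F> n ta xi" "i <= n" shows "0 <= ta i" using assms(2)
proof (induction i)
 case 0
 then show ?case using assms(1) by (simp add: elementary_def)
next
 case (Suc i)
 then have "ta i <= ta (Suc i)" using assms(1) by (simp add: elementary_def)
 with Suc show ?case by linarith
qed

text \<open>The nodes \<open>ta\<close> need not be dyadic, so the Riemann sums differ from the
  elementary integral. At each node the discrepancy is an increment of \<open>W\<close> over at most
  one mesh, and it vanishes pathwise.\<close>

lemma simple_elementary: fixes xi :: "nat => 'a => 'b::sep_inner"
 assumes el: "elementary M \<F> n ta xi" and t: "0 <= t" shows "simple t (elementary_process n ta xi) (elementary_integral W n ta xi t)"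
proof -
 have ta: "0 <= ta i" "ta i <= ta (Suc i)" "0 <= ta (Suc i)" if "i < n" for i
  using elementary_sorted[OF el, of i] elementary_sorted[OF el, of "Suc i"] el that by (auto simp: elementary_def)
 have xi: "xi i : borel_measurable (\<F> (ta i))" if "i < n" for i using el that by (simp add: elementary_def)
 have xiM: "xi i : borel_measurable M" if "i < n" for i by (rule F_M[OF xi[OF that] ta(1)[OF that]])
 show ?thesis unfolding simple_def
 proof (intro conjI ballI)
  show "lcad (elementary_process n ta xi)" unfolding lcad_def adapted_def
  proof (intro conjI ballI allI impI)
   fix r :: real assume "0 <= r"
   have "(%z. \<Sum>i<n. indicator {ta i<..ta (Suc i)} r *R xi i z) : borel_measurable (\<F> r)"
   proof (rule borel_measurable_sum)
    fix i assume "i : {..<n}"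
    then have i: "i < n" by simp
    show "(%z. indicator {ta i<..ta (Suc i)} r *R xi i z) : borel_measurable (\<F> r)"
    proof (cases "ta i < r")
     case True
     then have [measurable]: "xi i : borel_measurable (\<F> r)" by (intro F_mono[OF xi[OF i]] ta i) auto
     show ?thesis by measurable
    qed simp
   qed
   then show "elementary_process n ta xi r : borel_measurable (\<F> r)" by (simp add: elementary_process_def[abs_def])
  next
   fix z and r :: real
   show "(%p. elementary_process n ta xi (kap p r) z) ----> elementary_process n ta xi r z"
    unfolding elementary_process_def using ta by (intro tendsto_sum tendsto_scaleR tendsto_const indicator_Ioc_kap) auto
  qed
  show "bdd_process (elementary_process n ta xi)"
  proof -
   have "ALL i. EX B. i < n --> (ALL z:space M. norm (xi i z) <= B)"
   proof
    fix i
    show "EX B. i < n --> (ALL z:space M. norm (xi i z) <= B)"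
    proof (cases "i < n")
     case True
     then have "bounded (xi i ` space M)" using el by (simp add: elementary_def)
     then show ?thesis by (auto simp: bounded_iff)
    qed simp
   qed
   from choice[OF this] obtain B where B: "!!i z. i < n ==> z : space M ==> norm (xi i z) <= B i" by blast
   have "norm (elementary_process n ta xi r z) <= (\<Sum>i<n. B i)" if "z : space M" for r z unfolding elementary_process_def
   proof (rule sum_norm_le)
    fix i assume "i : {..<n}"
    then have "norm (xi i z) <= B i" using B[of i z] that by simp
    moreover have "0 <= B i" using order_trans[OF norm_ge_zero calculation] .
    ultimately show "norm (indicator {ta i<..ta (Suc i)} r *R xi i z) <= B i" by (auto simp: indicator_def)
   qed
   then show ?thesis unfolding bdd_process_def by blast
  qed
  show "elementary_integral W n ta xi t : borel_measurable M" unfolding elementary_integral_def[abs_def]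
   by (intro borel_measurable_sum borel_measurable_scaleR borel_measurable_diff W_measurable_M xiM) (use t ta in auto)
  fix z assume z: "z : space M"
  have dint: "dint p (elementary_process n ta xi) t z =
   (\<Sum>i<n. (W (min t (kap p (ta (Suc i)) + 1 / 2 ^ p)) z - W (min t (kap p (ta i) + 1 / 2 ^ p)) z) *R xi i z)" for p
  proof -
   let ?N = "nat \<lceil>t * 2 ^ p\<rceil>"
   let ?w = "%l. W (min t (real (Suc l) / 2 ^ p)) z - W (min t (real l / 2 ^ p)) z"
   have tN: "t <= real ?N / 2 ^ p" using nat_ceiling_le_iff[OF t, of p ?N] by simp
   have "dint p (elementary_process n ta xi) t z = (\<Sum>l<?N. \<Sum>i<n. (?w l * indicator {ta i<..ta (Suc i)} (real l / 2 ^ p)) *R xi i z)"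
    by (simp only: dint_def elementary_process_def scaleR_sum_right scaleR_scaleR)
   also have "... = (\<Sum>i<n. \<Sum>l<?N. (?w l * indicator {ta i<..ta (Suc i)} (real l / 2 ^ p)) *R xi i z)" by (rule sum.swap)
   also have "... = (\<Sum>i<n. (W (min t (kap p (ta (Suc i)) + 1 / 2 ^ p)) z - W (min t (kap p (ta i) + 1 / 2 ^ p)) z) *R xi i z)"
   proof (intro sum.cong refl)
    fix i assume "i : {..<n}"
    then have i: "i < n" by simp
    have "(\<Sum>l<?N. (?w l * indicator {ta i<..ta (Suc i)} (real l / 2 ^ p)) *R xi i z)
     = (\<Sum>l<?N. ?w l * indicator {ta i<..ta (Suc i)} (real l / 2 ^ p)) *R xi i z" by (simp only: scaleR_left.sum)
    also have "(\<Sum>l<?N. ?w l * indicator {ta i<..ta (Suc i)} (real l / 2 ^ p))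
     = (\<Sum>l<?N. ?w l * indicator {..ta (Suc i)} (real l / 2 ^ p)) - (\<Sum>l<?N. ?w l * indicator {..ta i} (real l / 2 ^ p))"
     by (simp only: indicator_Ioc_eq[OF ta(2)[OF i]] right_diff_distrib sum_subtractf)
    also have "... = W (min t (kap p (ta (Suc i)) + 1 / 2 ^ p)) z - W (min t (kap p (ta i) + 1 / 2 ^ p)) z"
     by (simp only: sum_increments_le[OF ta(1)[OF i] t tN] sum_increments_le[OF ta(3)[OF i] t tN])
    finally show "(\<Sum>l<?N. (?w l * indicator {ta i<..ta (Suc i)} (real l / 2 ^ p)) *R xi i z) =
     (W (min t (kap p (ta (Suc i)) + 1 / 2 ^ p)) z - W (min t (kap p (ta i) + 1 / 2 ^ p)) z) *R xi i z" .
   qed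
   finally show ?thesis .
  qed
  show "(%p. dint p (elementary_process n ta xi) t z) ----> elementary_integral W n ta xi t z"
   unfolding dint elementary_integral_def using ta by (intro tendsto_sum tendsto_scaleR tendsto_diff tendsto_const W_tendsto z t) auto
 qed
qed

lemma has_ito_imp_ito: fixes X :: "real => 'a => 'b::{sep_inner, banach}"
 assumes "has_ito_integral M \<F> W t X I" "0 <= t" obtains Y where "ito t Y I" "AE w in M. ALL r:{0..t}. X r w = Y r w"
proof -
 obtain Y n ta xi where I: "I : borel_measurable M" and Y: "prog Y" and ae: "AE w in M. ALL r:{0..t}. X r w = Y r w"
  and el: "!!j. elementary M \<F> (n j) (ta j) (xi j)" and lim1: "!!e. 0 < e ==> (%j. measure M {w : space M.
     (NI t (%r. nsq (elementary_process (n j) (ta j) (xi j) r w - Y r w)))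
      > ennreal e}) ----> 0"
  and lim2: "!!e. 0 < e ==> (%j. measure M {w : space M. norm (elementary_integral W (n j) (ta j) (xi j) t w - I w) > e}) ----> 0"
  using assms(1) unfolding has_ito_integral_def by blast
 have "ito t Y I"
 proof (rule itoI)
  fix e :: real assume e: "0 < e"
  let ?Z = "%j. elementary_process (n j) (ta j) (xi j)" and ?K = "%j. elementary_integral W (n j) (ta j) (xi j) t"
  have Z: "simple t (?Z j) (?K j)" for j by (rule simple_elementary[OF el assms(2)])
  let ?A = "%j. {w:space M. energy (%r w. ?Z j r w - Y r w) t w > ennreal e}"
  let ?B = "%j. {w:space M. norm (?K j w - I w) > e}"
  have [measurable]: "!!j. energy (%r w. ?Z j r w - Y r w) t : borel_measurable M" "!!j. ?K j : borel_measurable M"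
   using energy_measurable_M[OF prog_diff[OF simple_prog[OF Z] Y] assms(2)] simple_measurable[OF Z] by auto
  have "eventually (%j. measure M (?A j) < e / 2) sequentially" "eventually (%j. measure M (?B j) < e / 2) sequentially"
   unfolding energy_def using order_tendstoD(2)[OF lim1[OF e], of "e / 2"] order_tendstoD(2)[OF lim2[OF e], of "e / 2"] e by simp_all
  then obtain j where j: "measure M (?A j) < e / 2" "measure M (?B j) < e / 2" using eventually_happens[OF eventually_conj] by force
  show "EX Z K A. simple t Z K & A : sets M & measure M A <= e &
   (ALL w:space M - A. energy (%r w. Z r w - Y r w) t w <= ennreal e & norm (K w - I w) <= e)"
  proof (intro exI conjI ballI)
   show "simple t (?Z j) (?K j)" by (rule Z)
   have AB: "?A j : sets M" "?B j : sets M" using I by measurable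
   then show "?A j \<union> ?B j : sets M" by auto
   show "measure M (?A j \<union> ?B j) <= e" using measure_Un_le[OF AB] j by linarith
   fix w assume "w : space M - (?A j \<union> ?B j)"
   then show "energy (%r w. ?Z j r w - Y r w) t w <= ennreal e" "norm (?K j w - I w) <= e" by (auto simp: not_less)
  qed
 qed (fact assms Y I)+
 then show thesis using ae that by blast
qed

text \<open>The definition demands bounded elementary integrands, so \<open>Y\<close> is sampled at
  left endpoints and values of norm beyond \<open>j\<close> are replaced by 0. On a continuous path
  the replacement is inactive for large \<open>j\<close>, hence the error energies vanish, and
  \<open>ito_prob\<close> carries this over to the integrals.\<close>

lemma ito_imp_has_ito: fixes Y :: "real => 'a => 'b::{sep_inner, banach}"
 assumes I: "ito t Y I" and Y: "adapted Y" and cont: "!!z. z : space M ==> continuous_on {0..} (%u. Y u z)" shows "has_ito_integral M \<F> W t Y I"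
proof -
 note t = ito_nonneg[OF I] and Yp = ito_prog[OF I]
 define c where "c j y = (if norm y <= real j then y else 0)" for j :: nat and y :: 'b
 have [measurable]: "c j : borel_measurable borel" for j unfolding c_def by measurable
 define n where "n j = nat \<lceil>t * 2 ^ j\<rceil>" for j
 define ta where "ta j i = real i / 2 ^ j" for j i :: nat
 define xi where "xi j i z = c j (Y (ta j i) z)" for j i z
 have ta: "0 <= ta j i" "ta j i <= ta j (Suc i)" "ta j (Suc i) = ta j i + 1 / 2 ^ j" for i j
  by (auto simp: ta_def divide_right_mono add_divide_distrib)
 have el: "elementary M \<F> (n j) (ta j) (xi j)" for j
 proof -
  have "xi j i : borel_measurable (\<F> (ta j i))" for i
  proof -
   have [measurable]: "Y (ta j i) : borel_measurable (\<F> (ta j i))" using Y ta(1) by (simp add: adapted_def)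
   show ?thesis unfolding xi_def[abs_def] by measurable
  qed
  moreover have "bounded (xi j i ` space M)" for i unfolding bounded_iff by (rule exI[of _ "real j"]) (auto simp: xi_def c_def)
  ultimately show ?thesis using ta by (auto simp: elementary_def)
 qed
 let ?Z = "%j. elementary_process (n j) (ta j) (xi j)" and ?K = "%j. elementary_integral W (n j) (ta j) (xi j) t"
 have Z: "simple t (?Z j) (?K j)" for j by (rule simple_elementary[OF el t])
 have diff: "ito t (%u z. ?Z j u z - Y u z) (%z. ?K j z - I z)" for j by (rule ito_diff[OF ito_simple[OF Z t] I])
 have em: "energy (%u z. ?Z j u z - Y u z) t : borel_measurable M" for j by (rule energy_measurable_M[OF ito_prog[OF diff] t])
 \<comment> \<open>Elementary cells are open on the left, so at a grid point \<open>u\<close> the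
   value belongs to the cell ending there; hence a ceiling minus one where \<open>kap\<close> would
   use the floor.\<close>
 have Zval: "EX r. ?Z j u z = c j (Y r z) & 0 <= r & r < u & u <= r + 1 / 2 ^ j" if "0 < u" "u <= t" for j u z
 proof -
  define i where "i = nat \<lceil>u * 2 ^ j\<rceil> - 1"
  have pos: "0 < \<lceil>u * 2 ^ j\<rceil>" using that by simp
  then have Si: "int (Suc i) = \<lceil>u * 2 ^ j\<rceil>" by (simp add: i_def)
  have "\<lceil>u * 2 ^ j\<rceil> <= \<lceil>t * 2 ^ j\<rceil>" using that by (intro ceiling_mono mult_right_mono) auto
  then have "i < n j" using Si by (simp add: n_def)
  have r: "real i < u * 2 ^ j" "u * 2 ^ j <= real (Suc i)" using Si ceiling_correct[of "u * 2 ^ j"] by auto linarith+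
  then have i: "ta j i < u" "u <= ta j (Suc i)" by (auto simp: ta_def field_simps)
  have uniq: "indicator {ta j l<..ta j (Suc l)} u = (if l = i then 1 else 0 :: real)" for l
  proof (cases "l = i")
   case False
   have "\<not> (ta j l < u & u <= ta j (Suc l))"
   proof
    assume "ta j l < u & u <= ta j (Suc l)"
    then have "real l < u * 2 ^ j" "u * 2 ^ j <= real (Suc l)" by (auto simp: ta_def field_simps)
    with r False show False by linarith
   qed
   then show ?thesis using False by (auto simp: indicator_def)
  qed (use i in auto)
  have "?Z j u z = (\<Sum>l<n j. if l = i then xi j i z else 0)" unfolding elementary_process_def uniq by (intro sum.cong) auto
  then have "?Z j u z = c j (Y (ta j i) z)" using \<open>i < n j\<close> by (simp add: xi_def)
  then show ?thesis using i ta(1,3)[of j i] by (intro exI[of _ "ta j i"]) auto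
 qed
 have elim: "(%j. energy (%u z. ?Z j u z - Y u z) t z) ----> 0" if z: "z : space M" for z
 proof -
  have ct: "continuous_on {0..t} (%u. Y u z)" by (rule continuous_on_subset[OF cont[OF z]]) auto
  then have "bounded ((%u. Y u z) ` {0..t})" by (intro compact_imp_bounded compact_continuous_image) auto
  then obtain S where S: "!!u. 0 <= u ==> u <= t ==> norm (Y u z) <= S" unfolding bounded_iff by fastforce
  have "(%j. energy (%u z. ?Z j u z - Y u z) t z) ----> (\<integral>\<^sup>+u. 0 \<partial>(lborel :: real measure))"
   unfolding energy_def
  proof (rule nn_integral_dominated_convergence[where w="%u. ennreal ((2 * S)^2) * indicator {0..t} u"])
   show "(%u. nsq (?Z j u z - Y u z) * indicator {0..t} u) : borel_measurable lborel" for j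
    using norm2_measurable[OF ito_prog[OF diff] z] by simp
   show "(NL u. ennreal ((2 * S)^2) * indicator {0..t} u) < \<infinity>"
    using t by (simp add: nn_integral_cmult_indicator ennreal_mult_less_top)
   show "AE u in lborel. nsq (?Z j u z - Y u z) * indicator {0..t} u <= ennreal ((2 * S)^2) * indicator {0..t} u" for j
    using AE_lborel_singleton[of 0]
   proof eventually_elim
    fix u :: real assume "u ~= 0"
    show "nsq (?Z j u z - Y u z) * indicator {0..t} u <= ennreal ((2 * S)^2) * indicator {0..t} u"
    proof (cases "u : {0..t}")
     case True
     then obtain r where r: "?Z j u z = c j (Y r z)" "0 <= r" "r < u" using Zval[of u j z] \<open>u ~= 0\<close> by auto
     have "norm (c j (Y r z)) <= norm (Y r z)" by (simp add: c_def)
     also have "... <= S" using S[of r] r True by auto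
     finally have "norm (?Z j u z - Y u z) <= 2 * S" using S[of u] True norm_triangle_ineq4[of "?Z j u z" "Y u z"] r by auto
     then have "nsq (?Z j u z - Y u z) <= ennreal ((2 * S)^2)" by (intro ennreal_leI power_mono) auto
     then show ?thesis using True by simp
    qed simp
   qed
   show "AE u in lborel. (%j. nsq (?Z j u z - Y u z) * indicator {0..t} u) ----> 0" using AE_lborel_singleton[of 0]
   proof eventually_elim
    fix u :: real assume "u ~= 0"
    show "(%j. nsq (?Z j u z - Y u z) * indicator {0..t} u) ----> 0"
    proof (cases "u : {0..t}")
     case True
     then have "ALL j. EX r. ?Z j u z = c j (Y r z) & 0 <= r & r < u & u <= r + 1 / 2 ^ j" using Zval[of u _ z] \<open>u ~= 0\<close> by auto
     from choice[OF this] obtain r where r: "!!j. ?Z j u z = c j (Y (r j) z)" "!!j. 0 <= r j" "!!j. r j < u" "!!j. u <= r j + 1 / 2 ^ j" by blast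
     have "r ----> u"
     proof (rule tendsto_sandwich)
      show "(%j. u - 1 / 2 ^ j) ----> u" using tendsto_diff[OF tendsto_const LIMSEQ_inverse_realpow_zero[of 2], of u]
       by (simp add: inverse_eq_divide)
      show "eventually (%j. u - 1 / 2 ^ j <= r j) sequentially" using r(4) by (intro always_eventually allI) (simp add: algebra_simps)
     qed (use r(3) in \<open>auto intro!: always_eventually less_imp_le\<close>)
     then have "(%j. Y (r j) z) ----> Y u z" by (rule continuous_on_tendsto_compose[OF cont[OF z]]) (use True r in auto)
     moreover have "eventually (%j. Y (r j) z = ?Z j u z) sequentially" using eventually_ge_at_top[of "nat \<lceil>S\<rceil>"]
     proof eventually_elim
      case (elim j)
      then have "S <= real j" by linarith
      moreover have "norm (Y (r j) z) <= S" using S[of "r j"] r(2,3)[of j] True by auto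
      ultimately show ?case by (simp add: r(1) c_def)
     qed
     ultimately have "(%j. ?Z j u z) ----> Y u z" by (rule Lim_transform_eventually)
     then have "(%j. ?Z j u z - Y u z) ----> 0" by (simp add: LIM_zero)
     then have "(%j. nsq (?Z j u z - Y u z)) ----> nsq (0::'b)"
      by (intro tendsto_ennrealI tendsto_power tendsto_norm)
     then show ?thesis using True by simp
    qed simp
   qed
  qed auto
  then show ?thesis by simp
 qed
 have lim1: "(%j. measure M {z:space M. energy (%u z. ?Z j u z - Y u z) t z > ennreal ep}) ----> 0" if "0 < ep" for ep
  by (rule measure_tendsto_0[OF em]) (use that elim in \<open>auto intro!: AE_I2\<close>)
 have lim2: "(%j. measure M {z:space M. norm (?K j z - I z) > ep}) ----> 0" if ep: "0 < ep" for ep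
 proof (rule LIMSEQ_I)
  fix e :: real assume e: "0 < e"
  define d where "d = e * ep^2 / 4"
  have d: "0 < d" "2 * d / ep^2 = e / 2" using e ep by (auto simp: d_def)
  have "eventually (%j. measure M {z:space M. energy (%u z. ?Z j u z - Y u z) t z > ennreal d} < e / 2) sequentially"
   using order_tendstoD(2)[OF lim1[OF d(1)], of "e / 2"] e by simp
  then obtain J where J: "!!j. J <= j ==> measure M {z:space M. energy (%u z. ?Z j u z - Y u z) t z > ennreal d} < e / 2"
   by (auto simp: eventually_sequentially)
  have "measure M {z:space M. norm (?K j z - I z) > ep} < e" if "J <= j" for j using ito_prob[OF diff ep d(1), of j] J[OF that] d(2) by linarith
  then show "EX J. ALL j>=J. norm (measure M {z:space M. norm (?K j z - I z) > ep} - 0) < e" by (intro exI[of _ J]) auto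
 qed
 show ?thesis unfolding has_ito_integral_def
  using ito_measurable[OF I] Yp el lim1 lim2 by (intro conjI exI[of _ Y] exI[of _ n] exI[of _ ta] exI[of _ xi]) (auto simp: energy_def)
qed

end

section \<open>Integrals over subintervals and under time-dependent operators\<close>

lemma grid_cell: assumes "0 < u" "u <= t" obtains i where "i < nat \<lceil>t * 2 ^ p\<rceil>" "real i / 2 ^ p < u" "u <= real (Suc i) / 2 ^ p"
  "!!l. real l / 2 ^ p < u & u <= real (Suc l) / 2 ^ p \<longleftrightarrow> l = i"
proof -
 define i where "i = nat \<lceil>u * 2 ^ p\<rceil> - 1"
 have pos: "0 < \<lceil>u * 2 ^ p\<rceil>" using assms by simp
 then have Si: "int (Suc i) = \<lceil>u * 2 ^ p\<rceil>" by (simp add: i_def)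
 have "\<lceil>u * 2 ^ p\<rceil> <= \<lceil>t * 2 ^ p\<rceil>" using assms by (intro ceiling_mono mult_right_mono) auto
 then have "i < nat \<lceil>t * 2 ^ p\<rceil>" using Si by simp
 have cell: "real l / 2 ^ p < u & u <= real (Suc l) / 2 ^ p \<longleftrightarrow> real l < u * 2 ^ p & u * 2 ^ p <= real (Suc l)" for l
  by (simp add: field_simps)
 have r: "real i < u * 2 ^ p" "u * 2 ^ p <= real (Suc i)" using Si ceiling_correct[of "u * 2 ^ p"] by auto linarith+
 have "l = i" if "real l < u * 2 ^ p & u * 2 ^ p <= real (Suc l)" for l using that r by linarith
 with r have uniq: "real l / 2 ^ p < u & u <= real (Suc l) / 2 ^ p \<longleftrightarrow> l = i" for l unfolding cell by blast
 show thesis by (rule that[OF \<open>i < nat \<lceil>t * 2 ^ p\<rceil>\<close> _ _ uniq]) (use uniq[of i] in auto)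
qed

context wiener begin

text \<open>The cell containing \<open>a\<close> is not cut at \<open>a\<close> in the sums up to
  \<open>t\<close>, so the extended sum exceeds the old one by one increment of \<open>W\<close>
  across the rest of that cell, and this increment tends to 0.\<close>

lemma simple_extend: fixes Z :: "real => 'a => 'b::sep_inner" assumes "simple a Z K" "0 <= a" "a <= t"
 shows "simple t (%u om. indicator {..a} u *R Z u om) K"
proof -
 have Z: "lcad Z" "bdd_process Z" "K : borel_measurable M" and lim: "!!om. om : space M ==> (%p. dint p Z a om) ----> K om"
  using assms(1) by (auto simp: simple_def)
 obtain C where C: "!!t om. 0 <= t ==> om : space M ==> norm (Z t om) <= C" using Z(2) by (auto simp: bdd_process_def)
 have lc: "lcad (%u om. indicator {..a} u :: real)" unfolding lcad_def adapted_def using indicator_atMost_kap by auto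
 show ?thesis unfolding simple_def
 proof (intro conjI ballI)
  show "lcad (%u om. indicator {..a} u *R Z u om)" by (rule lcad_scaleR[OF lc Z(1)])
  show "bdd_process (%u om. indicator {..a} u *R Z u om)" unfolding bdd_process_def
  proof (intro exI allI impI ballI)
   fix r :: real and om assume "0 <= r" "om : space M"
   then have "norm (Z r om) <= C" by (rule C)
   then show "norm (indicator {..a} r *R Z r om) <= max C 0" by (auto simp: indicator_def)
  qed
  show "K : borel_measurable M" by fact
  fix om assume om: "om : space M"
  have eq: "dint p (%u om. indicator {..a} u *R Z u om) t om
   = dint p Z a om + (W (min t (kap p a + 1 / 2 ^ p)) om - W a om) *R Z (kap p a) om" for p
  proof -
   define k where "k = nat \<lfloor>a * 2 ^ p\<rfloor>"
   \<comment> \<open>At least \<open>Suc k\<close> cells, so that the one starting at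
     \<open>kap p a\<close> is among them even if \<open>t = a\<close> is a grid point.\<close>
   define N where "N = max (nat \<lceil>t * 2 ^ p\<rceil>) (Suc k)"
   define w where "w l = W (min t (real l / 2 ^ p)) om" for l
   define v where "v l = W (min a (real l / 2 ^ p)) om" for l
   define z where "z l = Z (real l / 2 ^ p) om" for l :: nat
   have t: "0 <= t" using assms by simp
   have tN: "t <= real N / 2 ^ p" using nat_ceiling_le_iff[OF t, of p N] by (simp add: N_def)
   then have aN: "a <= real N / 2 ^ p" using assms by simp
   have ka: "kap p a = real k / 2 ^ p" "kap p a + 1 / 2 ^ p = real (Suc k) / 2 ^ p" using assms(2) by (simp_all add: kap_def k_def add_divide_distrib)
   have k: "real k / 2 ^ p <= a" "a < real (Suc k) / 2 ^ p" using kap_le[of p a] kap_gt[of a p] ka by auto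
   have le: "real i / 2 ^ p <= a \<longleftrightarrow> i <= k" for i
   proof
    assume "real i / 2 ^ p <= a"
    then have "real i / 2 ^ p < real (Suc k) / 2 ^ p" using k by linarith
    then show "i <= k" by (simp add: divide_less_cancel)
   next
    assume "i <= k"
    then have "real i / 2 ^ p <= real k / 2 ^ p" by (intro divide_right_mono) auto
    then show "real i / 2 ^ p <= a" using k by linarith
   qed
   have vw: "v i = w i" if "i <= k" for i
   proof -
    have "real i / 2 ^ p <= a" using le that by simp
    then show ?thesis using assms(3) by (simp add: v_def w_def min_absorb2)
   qed
   have v: "v i = W a om" if "k < i" for i using le[of i] that by (auto simp: v_def min_def)
   have "dint p (%u om. indicator {..a} u *R Z u om) t om = (\<Sum>i<N. if i <= k then (w (Suc i) - w i) *R z i else 0)"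
    unfolding dint_eq_sum[OF t tN] w_def z_def by (intro sum.cong) (auto simp: indicator_def le)
   also have "... = (\<Sum>i<N. (v (Suc i) - v i) *R z i + (if i = k then (w (Suc k) - W a om) *R z k else 0))"
   proof (intro sum.cong refl)
    fix i consider "i < k" | "i = k" | "k < i" by linarith
    then show "(if i <= k then (w (Suc i) - w i) *R z i else 0)
     = (v (Suc i) - v i) *R z i + (if i = k then (w (Suc k) - W a om) *R z k else 0)"
    proof cases
     case 2
     then show ?thesis using vw[of k] v[of "Suc k"] by (simp add: scaleR_left_diff_distrib)
    qed (auto simp: vw v)
   qed
   also have "... = dint p Z a om + (w (Suc k) - W a om) *R z k"
   proof -
    have "k < N" by (simp add: N_def)
    then show ?thesis unfolding dint_eq_sum[OF assms(2) aN] by (simp add: sum.distrib v_def z_def del: of_nat_Suc)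
   qed
   finally show ?thesis unfolding ka(2) unfolding ka(1) w_def z_def .
  qed
  have "(%p. (W (min t (kap p a + 1 / 2 ^ p)) om - W a om) *R Z (kap p a) om) ----> (W (min t a) om - W a om) *R Z a om"
   using assms by (intro tendsto_intros W_tendsto lcadD[OF Z(1)] om) auto
  then have "(%p. (W (min t (kap p a + 1 / 2 ^ p)) om - W a om) *R Z (kap p a) om) ----> 0"
   using assms(3) by (simp add: min_def split: if_splits)
  from tendsto_add[OF lim[OF om] this]
  show "(%p. dint p (%u om. indicator {..a} u *R Z u om) t om) ----> K om" by (simp add: eq)
 qed
qed

lemma ito_extend: fixes Y :: "real => 'a => 'b::sep_inner" assumes I: "ito a Y I" and "a <= t"
 shows "ito t (%r w. indicator {..a} r *R Y r w) I"
proof (rule itoI)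
 note a = ito_nonneg[OF I]
 show "0 <= t" using a assms by simp
 show "prog (%r w. indicator {..a} r *R Y r w)" by (intro prog_scaleR prog_deterministic ito_prog[OF I]) auto
 show "I : borel_measurable M" by (rule ito_measurable[OF I])
 fix e :: real assume "0 < e"
 then obtain Z K A where Z: "simple a Z K" "A : sets M" "measure M A <= e" "!!w. w : space M - A ==> energy (%r w. Z r w - Y r w) a w <= ennreal e"
  "!!w. w : space M - A ==> norm (K w - I w) <= e" using itoE[OF I] by blast
 have "energy (%r w. indicator {..a} r *R Z r w - indicator {..a} r *R Y r w) t w <= energy (%r w. Z r w - Y r w) a w" for w
  unfolding energy_def by (intro nn_integral_mono) (auto simp: indicator_def)
 then show "EX Z K A. simple t Z K & A : sets M & measure M A <= e &
   (ALL w:space M - A. energy (%r w. Z r w - indicator {..a} r *R Y r w) t w <= ennreal e & norm (K w - I w) <= e)"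
  using Z simple_extend[OF Z(1) a assms(2)]
  by (intro exI[of _ "%r w. indicator {..a} r *R Z r w"] exI[of _ K] exI[of _ A]) (auto intro: order_trans)
qed

lemma ito_interval: fixes Y :: "real => 'a => 'b::sep_inner" assumes "ito a Y Ia" "ito b Y Ib" "a <= b" "b <= t"
 shows "ito t (%r w. indicator {a<..b} r *R Y r w) (%w. Ib w - Ia w)"
proof -
 have "ito t (%r w. indicator {..b} r *R Y r w - indicator {..a} r *R Y r w) (%w. Ib w - Ia w)"
  using assms by (intro ito_diff ito_extend) auto
 then show ?thesis by (simp only: indicator_Ioc_eq[OF assms(3)] scaleR_left_diff_distrib)
qed

text \<open>Finite energy is not part of \<open>ito\<close>. It is inherited from the bounded
  approximants outside sets of arbitrarily small measure.\<close>

lemma ito_energy_finite: fixes Y :: "real => 'a => 'b::sep_inner" assumes I: "ito t Y I"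
 shows "AE w in M. energy Y t w < \<infinity>"
proof -
 have [measurable]: "energy Y t : borel_measurable M" by (intro energy_measurable_M ito_prog[OF I] ito_nonneg[OF I])
 have "measure M {w:space M. energy Y t w = \<infinity>} <= e" if e: "0 < e" for e
 proof -
  obtain Z K A where Z: "simple t Z K" "A : sets M" "measure M A <= e" "!!w. w : space M - A ==> energy (%r w. Z r w - Y r w) t w <= ennreal e"
   "!!w. w : space M - A ==> norm (K w - I w) <= e" using itoE[OF I e] by blast
  have "bdd_process Z" using Z(1) by (simp add: simple_def)
  then obtain C where C: "!!t w. 0 <= t ==> w : space M ==> norm (Z t w) <= C" by (auto simp: bdd_process_def)
  have "energy Y t w < \<infinity>" if w: "w : space M - A" for w
  proof -
   have "energy Y t w = energy (%r w. Z r w - (Z r w - Y r w)) t w" by simp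
   also have "... <= 2 * energy Z t w + 2 * energy (%r w. Z r w - Y r w) t w"
    using w by (intro energy_diff_le prog_diff simple_prog[OF Z(1)] ito_prog[OF I]) auto
   also have "... <= 2 * ennreal (C^2 * t) + 2 * ennreal e" using w by (intro add_mono mult_left_mono Z(4) energy_bounded C ito_nonneg[OF I]) auto
   also have "... < \<infinity>" by (simp add: ennreal_mult_less_top)
   finally show ?thesis .
  qed
  then have "{w:space M. energy Y t w = \<infinity>} \<subseteq> A" by fastforce
  from finite_measure_mono[OF this Z(2)] show ?thesis using Z(3) by linarith
 qed
 then have "measure M {w:space M. energy Y t w = \<infinity>} <= 0" by (rule field_le_epsilon) simp
 then have "emeasure M {w:space M. energy Y t w = \<infinity>} = 0" by (simp add: emeasure_eq_measure measure_le_0_iff)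
 then have "AE w in M. \<not> energy Y t w = \<infinity>" by (intro AE_I[where N="{w:space M. energy Y t w = \<infinity>}"]) auto
 then show ?thesis by (auto simp: less_top)
qed

text \<open>The left-endpoint sums over the increments of \<open>I\<close> are themselves Ito integrals, of
  \<open>C(t\<^sub>i) Y\<close>, hence converge to the integral of \<open>C Y\<close>.\<close>

lemma ito_transform: fixes Y :: "real => 'a => 'b::sep_inner"
  and C :: "real => 'b => 'c::sep_inner"
 assumes I: "!!r. 0 <= r ==> r <= t ==> ito r Y (I r)" and t: "0 <= t"
  and C: "!!r. bounded_linear (C r)" "!!r q x. norm (C r x - C q x) <= L * \<bar>r - q\<bar> * norm x" and [measurable]: "J : borel_measurable M"
  and lim: "AE w in M. (%p. \<Sum>i<nat \<lceil>t * 2 ^ p\<rceil>.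
   C (real i / 2 ^ p) (I (min t (real (Suc i) / 2 ^ p)) w - I (real i / 2 ^ p) w)) ----> J w"
 shows "ito t (%u w. C u (Y u w)) J"
proof -
 note I' = I[OF t order_refl]
 note Y = ito_prog[OF I']
 define n where "n p = nat \<lceil>t * 2 ^ p\<rceil>" for p
 define S where "S p w = (\<Sum>i<n p. C (real i / 2 ^ p) (I (min t (real (Suc i) / 2 ^ p)) w - I (real i / 2 ^ p) w))" for p w
 define Z where "Z p u w = (\<Sum>i<n p. C (real i / 2 ^ p) (indicator {real i / 2 ^ p<..min t (real (Suc i) / 2 ^ p)} u *R Y u w))" for p u w
 have Z: "ito t (Z p) (S p)" for p unfolding Z_def[abs_def] S_def[abs_def]
 proof (rule ito_sum)
  fix i assume "i : {..<n p}"
  then have "real i / 2 ^ p < t" using less_nat_ceiling_iff[OF t, of i p] by (simp add: n_def)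
  moreover have "real i / 2 ^ p <= real (Suc i) / 2 ^ p" by (simp add: divide_right_mono)
  ultimately have "real i / 2 ^ p <= t" "real i / 2 ^ p <= min t (real (Suc i) / 2 ^ p)" by auto
  then show "ito t (%u w. C (real i / 2 ^ p) (indicator {real i / 2 ^ p<..min t (real (Suc i) / 2 ^ p)} u *R Y u w))
   (%w. C (real i / 2 ^ p) (I (min t (real (Suc i) / 2 ^ p)) w - I (real i / 2 ^ p) w))" by (intro ito_linear[OF ito_interval C(1)] I) (use t in auto)
 qed (use t in auto)
 have prod_eq: "(%x. C (fst x) (snd x)) = case_prod C" by auto
 have contC: "continuous_on UNIV (case_prod C)" unfolding continuous_on_def
 proof
  fix z :: "real \<times> 'b"
  obtain r0 x0 where z: "z = (r0, x0)" by (cases z)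
  have "((%z. C (fst z) (snd z)) \<longlongrightarrow> C r0 x0) (at (r0, x0))"
  proof (rule Lim_transform)
   show "((%z. C r0 (snd z)) \<longlongrightarrow> C r0 x0) (at (r0, x0))"
    using tendsto_snd[OF tendsto_ident_at, of "(r0, x0)" UNIV] by (intro bounded_linear.tendsto[OF C(1)]) simp
   have "((%z. L * \<bar>fst z - r0\<bar> * norm (snd z)) \<longlongrightarrow> L * \<bar>r0 - r0\<bar> * norm x0) (at (r0, x0))"
    using tendsto_fst[OF tendsto_ident_at, of "(r0, x0)" UNIV] tendsto_snd[OF tendsto_ident_at, of "(r0, x0)" UNIV] by (intro tendsto_intros) simp_all
   then have "((%z. L * \<bar>fst z - r0\<bar> * norm (snd z)) \<longlongrightarrow> 0) (at (r0, x0))" by simp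
   then show "((%z. C (fst z) (snd z) - C r0 (snd z)) \<longlongrightarrow> 0) (at (r0, x0))"
    by (rule Lim_null_comparison[rotated]) (intro always_eventually allI C(2))
  qed
  then show "(case_prod C \<longlongrightarrow> case_prod C z) (at z within UNIV)" by (simp add: prod_eq z)
 qed
 then have "case_prod C : borel_measurable borel" by (rule borel_measurable_continuous_onI)
 then have CY: "prog (%u w. C u (Y u w))" by (intro prog_compose2[OF prog_deterministic[of "%x. x"] Y]) (auto simp: borel_prod)
 \<comment> \<open>Only the operator is sampled and \<open>Y\<close> is not, so the error is the
   oscillation of \<open>C\<close> over one mesh times the energy of \<open>Y\<close>; no regularity
   of \<open>Y\<close> in time is used.\<close>
 have en: "energy (%u w. Z p u w - C u (Y u w)) t w <= ennreal ((L / 2 ^ p)^2) * energy Y t w" if "w : space M" for p w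
 proof -
  have "energy (%u w. Z p u w - C u (Y u w)) t w
   <= (NL u. ennreal ((L / 2 ^ p)^2) * (nsq (Y u w) * indicator {0..t} u))" unfolding energy_def
  proof (rule nn_integral_mono_AE, use AE_lborel_singleton[of 0] in eventually_elim)
   fix u :: real assume "u ~= 0"
   show "nsq (Z p u w - C u (Y u w)) * indicator {0..t} u
    <= ennreal ((L / 2 ^ p)^2) * (nsq (Y u w) * indicator {0..t} u)"
   proof (cases "u : {0..t}")
    case True
    then obtain i where i: "i < n p" "real i / 2 ^ p < u" "u <= real (Suc i) / 2 ^ p"
     "!!l. real l / 2 ^ p < u & u <= real (Suc l) / 2 ^ p \<longleftrightarrow> l = i"
     using \<open>u ~= 0\<close> grid_cell[of u t p] unfolding n_def by (metis atLeastAtMost_iff less_eq_real_def)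
    have ind: "indicator {real l / 2 ^ p<..min t (real (Suc l) / 2 ^ p)} u = (if l = i then 1 else 0 :: real)" for l
     using True i(4)[of l] by (simp add: indicator_def del: of_nat_Suc)
    have "Z p u w = (\<Sum>l<n p. if l = i then C (real i / 2 ^ p) (Y u w) else 0)" unfolding Z_def ind
     by (intro sum.cong refl) (auto simp: linear_0[OF bounded_linear.linear[OF C(1)]])
    then have "norm (Z p u w - C u (Y u w)) <= L * \<bar>real i / 2 ^ p - u\<bar> * norm (Y u w)"
     using i(1) C(2)[of "real i / 2 ^ p" "Y u w" u] by simp
    also have "... <= \<bar>L\<bar> * (1 / 2 ^ p) * norm (Y u w)"
    proof -
     have "\<bar>real i / 2 ^ p - u\<bar> <= 1 / 2 ^ p" using i(2,3) by (simp add: add_divide_distrib)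
     then have "L * \<bar>real i / 2 ^ p - u\<bar> <= \<bar>L\<bar> * (1 / 2 ^ p)"
      by (intro order_trans[OF mult_right_mono[of L "\<bar>L\<bar>"] mult_left_mono]) auto
     then show ?thesis by (rule mult_right_mono) simp
    qed
    finally have "(norm (Z p u w - C u (Y u w)))^2 <= (\<bar>L\<bar> * (1 / 2 ^ p) * norm (Y u w))^2" by (rule power_mono) simp
    also have "... = (L / 2 ^ p)^2 * (norm (Y u w))^2" by (simp add: power_mult_distrib power_divide)
    finally have "nsq (Z p u w - C u (Y u w)) <= ennreal ((L / 2 ^ p)^2 * (norm (Y u w))^2)" by (rule ennreal_leI)
    then show ?thesis using True by (simp add: ennreal_mult)
   qed simp
  qed
  also have "... = ennreal ((L / 2 ^ p)^2) * energy Y t w"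
   unfolding energy_def using norm2_measurable[OF Y that, of t] by (intro nn_integral_cmult) simp
  finally show ?thesis .
 qed
 have lim1: "AE w in M. (%p. energy (%u w. Z p u w - C u (Y u w)) t w) ----> 0" using ito_energy_finite[OF I'] AE_space
 proof eventually_elim
  case (elim w)
  note fin = elim(1) and w = elim(2)
  have "(%p. ennreal ((L / 2 ^ p)^2) * energy Y t w) ----> ennreal ((L * 0)^2) * energy Y t w"
  proof (rule tendsto_mult_ennreal)
   have "(%p. L / 2 ^ p) ----> L * 0"
    using tendsto_mult[OF tendsto_const LIMSEQ_inverse_realpow_zero[of 2], of L] by (simp add: divide_inverse)
   then show "(%p. ennreal ((L / 2 ^ p)^2)) ----> ennreal ((L * 0)^2)" by (intro tendsto_ennrealI tendsto_power)
  qed (use fin in auto)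
  then have "(%p. ennreal ((L / 2 ^ p)^2) * energy Y t w) ----> 0" by simp
  then show ?case
   by (rule tendsto_sandwich[OF _ _ tendsto_const, rotated 2]) (auto intro!: always_eventually en w)
 qed
 show ?thesis by (rule ito_limit[OF Z CY \<open>J : borel_measurable M\<close> lim1]) (use lim in \<open>simp add: S_def n_def\<close>)
qed

end

section \<open>Gronwall's inequality and path integrals\<close>

lemma nn_integral_exp_le: assumes "0 <= D" "0 < be" "0 <= t" and a: "!!r. 0 <= r ==> r <= t ==> a r <= ennreal (D * exp (be * r))"
 shows "NI t a <= ennreal (D / be * (exp (be * t) - 1))"
proof -
 have "NI t a <= (NL r. ennreal (D * exp (be * r)) * indicator {0..t} r)"
  using a by (intro nn_integral_mono) (auto simp: indicator_def)
 also have "... = ennreal (D / be * exp (be * t) - D / be * exp (be * 0))"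
 proof (rule nn_integral_FTC_Icc)
  fix r :: real
  have "((%r. D / be * exp (be * r)) has_real_derivative D / be * (exp (be * r) * be)) (at r)" by (auto intro!: derivative_eq_intros)
  then show "((%r. D / be * exp (be * r)) has_real_derivative D * exp (be * r)) (at r)" using assms(2) by simp
 qed (use assms in auto)
 finally show ?thesis by (simp add: right_diff_distrib)
qed

text \<open>The function is extended-valued and not assumed measurable, so a majorant is iterated.
  Against the weight \<open>exp (2 * c * t)\<close> one passage through the inequality halves the
  excess \<open>B'\<close>; the doubled rate supplies that half and costs the factor 2 in front of
  \<open>e\<close>.\<close>

lemma gronwall: assumes "0 <= e" "0 < c" and bnd: "!!t. 0 <= t ==> t <= T ==> a t <= ennreal B"
  and ineq: "!!t. 0 <= t ==> t <= T ==> a t <= ennreal e + ennreal c * NI t a"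
  and t: "0 <= t" "t <= T"
 shows "a t <= ennreal (2 * e * exp (2 * c * t))"
proof -
 define B' where "B' = max B 0"
 have step: "a t <= ennreal ((2 * e + B' / 2 ^ n) * exp (2 * c * t))" if "0 <= t" "t <= T" for n t using that
 proof (induction n arbitrary: t)
  case 0
  have "a t <= ennreal B'" using bnd[OF 0] by (auto simp: B'_def max_def ennreal_neg split: if_splits intro: order_trans)
  also have "... <= ennreal ((2 * e + B' / 2 ^ 0) * exp (2 * c * t))"
  proof (rule ennreal_leI)
   have "B' * 1 <= (2 * e + B') * exp (2 * c * t)" using assms(1,2) 0 by (intro mult_mono) (auto simp: B'_def)
   then show "B' <= (2 * e + B' / 2 ^ 0) * exp (2 * c * t)" by simp
  qed
  finally show ?case .
 next
  case (Suc n)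
  let ?D = "2 * e + B' / 2 ^ n"
  have D: "0 <= ?D" using assms(1) by (simp add: B'_def)
  have "a t <= ennreal e + ennreal c * NI t a" by (rule ineq[OF Suc.prems])
  also have "... <= ennreal e + ennreal c * ennreal (?D / (2 * c) * (exp (2 * c * t) - 1))"
   using Suc assms(2) D by (intro add_left_mono mult_left_mono nn_integral_exp_le) auto
  also have "... = ennreal (e + ?D / 2 * (exp (2 * c * t) - 1))" using assms(1,2) Suc.prems D by (simp flip: ennreal_mult' ennreal_plus)
  also have "... <= ennreal ((2 * e + B' / 2 ^ Suc n) * exp (2 * c * t))"
  proof (rule ennreal_leI)
   have "e * 1 <= e * exp (2 * c * t)" using assms(1,2) Suc.prems by (intro mult_left_mono) auto
   moreover have "?D / 2 * (exp (2 * c * t) - 1) <= ?D / 2 * exp (2 * c * t)" using D by (intro mult_left_mono) auto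
   moreover have "(2 * e + B' / 2 ^ Suc n) * exp (2 * c * t) = e * exp (2 * c * t) + ?D / 2 * exp (2 * c * t)" by (simp add: field_simps)
   ultimately show "e + ?D / 2 * (exp (2 * c * t) - 1) <= (2 * e + B' / 2 ^ Suc n) * exp (2 * c * t)" unfolding right_diff_distrib by linarith
  qed
  finally show ?case .
 qed
 have half: "B' / 2 ^ n = B' * (1 / 2) ^ n" for n by (simp add: power_divide)
 have "(%n. (2 * e + B' * (1 / 2) ^ n) * exp (2 * c * t)) ----> (2 * e + B' * 0) * exp (2 * c * t)"
  by (intro tendsto_intros LIMSEQ_power_zero) auto
 then have "(%n. ennreal ((2 * e + B' / 2 ^ n) * exp (2 * c * t))) ----> ennreal (2 * e * exp (2 * c * t))"
  unfolding half by (intro tendsto_ennrealI) simp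
 then show ?thesis using step[OF t] by (intro LIMSEQ_le_const) auto
qed

lemma set_integral_norm2_le: fixes f :: "real => 'b::{banach, second_countable_topology}" assumes "set_integrable lborel {0..t} f" "0 <= t"
 shows "nsq (LINT r:{0..t}|lborel. f r) <= ennreal t * NI t (%r. nsq (f r))"
proof -
 let ?g = "%r. indicator {0..t} r *R f r"
 have [measurable]: "?g : borel_measurable borel" and int: "integrable lborel ?g" using assms(1) by (auto simp: set_integrable_def)
 have "ennreal (norm (integral\<^sup>L lborel ?g)) <= (NL r. ennreal (norm (?g r)))"
  by (rule integral_norm_bound_ennreal[OF int])
 also have "... = (NL r. indicator {0..t} r * ennreal (norm (?g r)))"
  by (intro nn_integral_cong) (auto simp: indicator_def)
 finally have "ennreal (norm (integral\<^sup>L lborel ?g)) ^ 2 <= (NL r. indicator {0..t} r * ennreal (norm (?g r)))^2"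
  by (intro power_mono) auto
 also have "... <= (NL r. (indicator {0..t} r)^2) * (NL r. (ennreal (norm (?g r)))^2)"
  by (rule Cauchy_Schwarz_nn_integral) measurable
 also have "(NL r. (indicator {0..t} r)^2) = ennreal t"
 proof -
  have "(NL r. (indicator {0..t} r)^2) = (NL r. indicator {0..t} r)"
   by (intro nn_integral_cong) (auto simp: indicator_def)
  then show ?thesis using assms(2) by simp
 qed
 also have "(NL r. (ennreal (norm (?g r)))^2) = NI t (%r. nsq (f r))"
  by (intro nn_integral_cong) (auto simp: indicator_def ennreal_power)
 finally show ?thesis by (simp add: set_lebesgue_integral_def ennreal_power)
qed

lemma set_integral_continuous: fixes f :: "real => 'b::{banach, second_countable_topology}" assumes "set_integrable lborel {0..T} f"
 shows "continuous_on {0..T} (%t. LINT r:{0..t}|lborel. f r)"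
proof (rule continuous_on_sequentiallyI)
 fix u a assume u: "ALL n. u n : {0..T}" and a: "a : {0..T}" and lim: "u ----> (a::real)"
 let ?g = "%r. indicator {0..T} r *R f r"
 have int: "integrable lborel ?g" using assms by (simp add: set_integrable_def)
 then have [measurable]: "?g : borel_measurable borel" by auto
 have eq: "(LINT r:{0..t}|lborel. f r) = (\<integral>r. indicator {0..t} r *R ?g r \<partial>lborel)" if "t : {0..T}" for t
  unfolding set_lebesgue_integral_def using that by (intro Bochner_Integration.integral_cong) (auto simp: indicator_def)
 have "(%n. \<integral>r. indicator {0..u n} r *R ?g r \<partial>lborel) ----> (\<integral>r. indicator {0..a} r *R ?g r \<partial>lborel)"
 proof (rule integral_dominated_convergence[where w="%r. norm (?g r)"])
  show "AE r in lborel. (%n. indicator {0..u n} r *R ?g r) ----> indicator {0..a} r *R ?g r"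
   using AE_lborel_singleton[of a]
  proof eventually_elim
   case (elim r)
   have "eventually (%n. indicator {0..u n} r = (indicator {0..a} r :: real)) sequentially"
   proof (cases "r < a")
    case True
    then have "eventually (%n. r < u n) sequentially" using lim by (simp add: order_tendsto_iff)
    then show ?thesis by eventually_elim (use True in \<open>auto simp: indicator_def\<close>)
   next
    case False
    then have "eventually (%n. u n < r) sequentially" using lim \<open>r ~= a\<close> by (simp add: order_tendsto_iff)
    then show ?thesis by eventually_elim (use False \<open>r ~= a\<close> in \<open>auto simp: indicator_def\<close>)
   qed
   then have "eventually (%n. indicator {0..a} r *R ?g r = indicator {0..u n} r *R ?g r) sequentially" by eventually_elim simp
   then show ?case
    by (rule Lim_transform_eventually[OF tendsto_const])
  qed
  show "integrable lborel (%r. norm (?g r))" using integrable_norm[OF int] .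
  show "AE r in lborel. norm (indicator {0..u n} r *R ?g r) <= norm (?g r)" for n by (intro AE_I2) (auto simp: indicator_def)
 qed measurable
 then show "(%n. LINT r:{0..u n}|lborel. f r) ----> (LINT r:{0..a}|lborel. f r)" using eq u a by simp
qed

lemma set_integrable_continuous_halfline: fixes f :: "real => 'b::{banach, second_countable_topology}" assumes "continuous_on {0..} f"
 shows "set_integrable lborel {0..t} f" by (rule borel_integrable_atLeastAtMost') (rule continuous_on_subset[OF assms], auto)

lemma set_integral_continuous_halfline: fixes f :: "real => 'b::{banach, second_countable_topology}" assumes "continuous_on {0..} f"
 shows "continuous_on {0..} (%t. LINT r:{0..t}|lborel. f r)"
 by (intro continuous_on_halfline set_integral_continuous set_integrable_continuous_halfline assms)

context wiener begin

lemma path_integral_measurable: fixes f :: "real => 'a => 'b::{banach, second_countable_topology}" assumes "prog f" "0 <= t"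
 shows "(%w. LINT r:{0..t}|lborel. f r w) : borel_measurable (\<F> t)"
proof -
 interpret L: sigma_finite_measure "restrict_space lborel {0..t}" by (rule sigma_finite_restrict_lborel)
 have "case_prod f : borel_measurable (restrict_space borel {0..t} \<Otimes>\<^sub>M \<F> t)" using assms by (simp add: progressively_measurable_def)
 then have "(%(x, y). case_prod f (y, x)) : borel_measurable (\<F> t \<Otimes>\<^sub>M restrict_space borel {0..t})" by (rule measurable_pair_swap)
 also have "(borel_measurable (\<F> t \<Otimes>\<^sub>M restrict_space borel {0..t}) :: (_ => 'b) set)
  = borel_measurable (\<F> t \<Otimes>\<^sub>M restrict_space lborel {0..t})"
  by (intro measurable_cong_sets sets_pair_measure_cong) (simp_all add: sets_restrict_space)
 finally have "(%w. \<integral>r. f r w \<partial>restrict_space lborel {0..t}) : borel_measurable (\<F> t)"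
  by (intro L.borel_measurable_lebesgue_integral) simp
 then show ?thesis by (simp add: integral_restrict_space set_lebesgue_integral_def)
qed

lemma energy_Fubini: fixes Y :: "real => 'a => 'b::sep_normed" assumes Y: "prog Y" and t: "0 <= t"
 shows "(EE w. energy Y t w) = NI t (%r. (EE w. nsq (Y r w)))"
proof -
 let ?R = "restrict_space lborel {0..t}"
 interpret L: sigma_finite_measure ?R by (rule sigma_finite_restrict_lborel)
 interpret P: pair_sigma_finite ?R M by unfold_locales
 have "case_prod Y : borel_measurable (restrict_space borel {0..t} \<Otimes>\<^sub>M \<F> t)" using assms by (simp add: progressively_measurable_def)
 moreover have "(%x. x) : measurable (?R \<Otimes>\<^sub>M M) (restrict_space borel {0..t} \<Otimes>\<^sub>M \<F> t)"
 proof (rule measurable_pair)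
  show "snd \<circ> (%x. x) : measurable (?R \<Otimes>\<^sub>M M) (\<F> t)"
  proof (rule measurableI)
   fix A assume "A : sets (\<F> t)"
   then have "A : sets M" using sets_F_M[OF t] by blast
   from measurable_sets[OF measurable_snd this]
   show "(snd \<circ> (%x. x)) -` A \<inter> space (?R \<Otimes>\<^sub>M M) : sets (?R \<Otimes>\<^sub>M M)" by (simp add: comp_def)
  qed (auto simp: space_pair_measure space_F[OF t])
  have "fst : measurable (?R \<Otimes>\<^sub>M M) ?R" by simp
  also have "measurable (?R \<Otimes>\<^sub>M M) ?R = measurable (?R \<Otimes>\<^sub>M M) (restrict_space borel {0..t})"
   by (intro measurable_cong_sets) (simp_all add: sets_restrict_space)
  finally show "fst \<circ> (%x. x) : measurable (?R \<Otimes>\<^sub>M M) (restrict_space borel {0..t})" by (simp add: comp_def)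
 qed
 ultimately have [measurable]: "case_prod Y : borel_measurable (?R \<Otimes>\<^sub>M M)" by (rule measurable_compose[rotated])
 have "(EE w. energy Y t w) = (EE w. (\<integral>\<^sup>+r. nsq (case_prod Y (r, w)) \<partial>?R))"
  by (simp add: energy_def nn_integral_restrict_space)
 also have "... = (\<integral>\<^sup>+r. (EE w. nsq (case_prod Y (r, w))) \<partial>?R)"
  using P.Fubini[of "%x. nsq (case_prod Y x)"] by simp
 finally show ?thesis by (simp add: nn_integral_restrict_space)
qed

text \<open>The series of the \<open>f n\<close> has finite mean from \<open>n0\<close> on, so it
  converges almost surely and its terms tend to 0.\<close>

lemma AE_tendsto_0_summable: fixes f :: "nat => 'a => ennreal" assumes [measurable]: "!!n. f n : borel_measurable M"
  and bnd: "!!n. n0 <= n ==> (EE w. f n w) <= ennreal (D * q ^ n)" and q: "0 <= q" "q < 1" and "0 <= D"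
 shows "AE w in M. (%n. f n w) ----> 0"
proof -
 have "(EE w. (\<Sum>n. f (n + n0) w)) = (\<Sum>n. (EE w. f (n + n0) w))" by (rule nn_integral_suminf) simp
 also have "... <= (\<Sum>n. ennreal (D * q ^ (n + n0)))" by (intro suminf_le bnd) auto
 also have "... < \<infinity>"
 proof -
  have "summable (%n. D * q ^ (n + n0))" using q by (intro summable_mult summable_ignore_initial_segment summable_geometric) auto
  then show ?thesis using q \<open>0 <= D\<close> by (subst suminf_ennreal2) auto
 qed
 finally have "AE w in M. (\<Sum>n. f (n + n0) w) ~= \<infinity>" by (intro nn_integral_noteq_infinite) auto
 then show ?thesis
 proof eventually_elim
  case (elim w)
  note fin = elim
  then have f: "f (n + n0) w ~= \<infinity>" for n by (metis ennreal_suminf_lessD infinity_ennreal_def less_top)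
  have "(%n. f (n + n0) w) ----> 0"
  proof -
   have eq: "ennreal (enn2real (f (n + n0) w)) = f (n + n0) w" for n using f[of n] by (simp add: less_top)
   have "summable (%n. enn2real (f (n + n0) w))" using fin by (intro summable_suminf_not_top) (auto simp: eq)
   then have "(%n. enn2real (f (n + n0) w)) ----> 0" by (rule summable_LIMSEQ_zero)
   then have "(%n. ennreal (enn2real (f (n + n0) w))) ----> ennreal 0" by (rule tendsto_ennrealI)
   then show ?thesis by (simp add: eq)
  qed
  then show ?case by (rule LIMSEQ_offset)
 qed
qed

lemma Markov: fixes f :: "'a => ennreal" assumes [measurable]: "f : borel_measurable M"
 shows "c * emeasure M {w:space M. c < f w} <= (EE w. f w)"
proof -
 have "c * emeasure M {w:space M. c < f w} = (EE w. c * indicator {w:space M. c < f w} w)"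
  by (subst nn_integral_cmult_indicator) auto
 also have "... <= (EE w. f w)" by (intro nn_integral_mono) (auto simp: indicator_def)
 finally show ?thesis .
qed

definition regular :: "(real => 'a => 'b::topological_space) => bool"
 where "regular w \<longleftrightarrow> adapted w & (ALL z:space M. continuous_on {0..} (%t. w t z))"

lemma regular_adapted: "regular w ==> adapted w" by (simp add: regular_def)
lemma regular_continuous: "regular w ==> z : space M ==> continuous_on {0..} (%t. w t z)" by (simp add: regular_def)
lemma regular_lcad: "regular w ==> lcad w" by (simp add: regular_def lcad_continuous)

lemma regular_prog: fixes w :: "real => 'a => 'b::metric_space" shows "regular w ==> prog w" by (intro lcad_prog regular_lcad)

lemma regular_compose: fixes w :: "real => 'a => 'b::topological_space" and f :: "real => 'b => 'c::topological_space"
 assumes "regular w" "continuous_on UNIV (case_prod f)" shows "regular (%r z. f r (w r z))" unfolding regular_def adapted_def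
proof (intro conjI allI impI ballI)
 fix t :: real assume "0 <= t"
 then have [measurable]: "w t : borel_measurable (\<F> t)" using assms(1) by (simp add: regular_def adapted_def)
 have "continuous_on UNIV (%x. case_prod f (t, x))" by (rule continuous_on_compose2[OF assms(2)]) (auto intro!: continuous_intros)
 then have [measurable]: "f t : borel_measurable borel" by (simp add: borel_measurable_continuous_onI)
 show "(%z. f t (w t z)) : borel_measurable (\<F> t)" by measurable
next
 fix z assume "z : space M"
 then have "continuous_on {0..} (%t. case_prod f (t, w t z))"
  by (intro continuous_on_compose2[OF assms(2)] continuous_on_Pair continuous_on_id regular_continuous[OF assms(1)]) auto
 then show "continuous_on {0..} (%t. f t (w t z))" by simp
qed

lemma energy_lipschitz: fixes Z :: "real => 'a => 'b::sep_normed"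
 assumes "prog Z" "w : space M" and le: "!!r. 0 <= r ==> r <= t ==> norm (Y r w) <= L * norm (Z r w)"
 shows "energy Y t w <= ennreal (L^2) * energy Z t w"
proof -
 have "energy Y t w <= (NL r. ennreal (L^2) * (nsq (Z r w) * indicator {0..t} r))"
  unfolding energy_def
 proof (intro nn_integral_mono)
  fix r
  show "nsq (Y r w) * indicator {0..t} r <= ennreal (L^2) * (nsq (Z r w) * indicator {0..t} r)"
  proof (cases "r : {0..t}")
   case True
   then have "(norm (Y r w))^2 <= (L * norm (Z r w))^2" using le by (intro power_mono) auto
   then have "nsq (Y r w) <= ennreal (L^2 * (norm (Z r w))^2)" by (intro ennreal_leI) (simp add: power_mult_distrib)
   then show ?thesis using True by (simp add: ennreal_mult)
  qed simp
 qed
 also have "... = ennreal (L^2) * energy Z t w" unfolding energy_def using norm2_measurable[OF assms(1,2), of t] by (intro nn_integral_cmult) simp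
 finally show ?thesis .
qed

text \<open>On the finer of the two meshes both sums belong to step processes, so their difference
  does too and the isometry is exact.\<close>

lemma dint_sampled: fixes X X' :: "real => 'a => 'b::sep_inner"
 assumes "adapted X" "adapted X'" "bdd_process X" "bdd_process X'" "0 <= t"
 shows "(EE w. nsq (dint m X t w - dint n X' t w))
  = (EE w. energy (%r w. X (kap m r) w - X' (kap n r) w) t w)"
proof -
 let ?D = "%r w. X (kap m r) w - X' (kap n r) w" and ?p = "max m n"
 have "dint m X t w - dint n X' t w = dint ?p ?D t w" for w using dint_kap[of m ?p t X w] dint_kap[of n ?p t X' w] assms(5) by (simp add: dint_diff)
 moreover have "(EE w. nsq (dint ?p ?D t w)) = (EE w. energy (%r. ?D (kap ?p r)) t w)"
  unfolding energy_def by (rule dint_isometry) (intro adapted_diff adapted_kap bdd_process_diff bdd_process_kap assms)+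
 ultimately show ?thesis by (simp add: kap_kap)
qed

lemma dint_sampled_maximal: fixes X X' :: "real => 'a => 'b::sep_inner"
 assumes "adapted X" "adapted X'" "bdd_process X" "bdd_process X'" "0 < e" obtains A where "A : sets M"
  "ennreal (e^2) * emeasure M A <= (EE w. energy (%r w. X (kap m r) w - X' (kap n r) w) (real T) w)"
  "!!w t. w : space M - A ==> 0 <= t ==> t <= real T ==> norm (dint m X t w - dint n X' t w) <= e"
proof -
 let ?D = "%r w. X (kap m r) w - X' (kap n r) w" and ?p = "max m n"
 have ad: "adapted ?D" "bdd_process ?D" by (intro adapted_diff adapted_kap bdd_process_diff bdd_process_kap assms)+
 obtain A where A: "A : sets M"
  "ennreal (e^2) * emeasure M A <= (EE w. NI (real T) (%r. nsq (?D r w)))"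
  "!!w t. w : space M - A ==> 0 <= t ==> t <= real T ==> norm (dint ?p ?D t w) <= e"
  by (rule dint_maximal[OF ad _ assms(5), of ?p T]) (auto simp: kap_kap)
 have "dint m X t w - dint n X' t w = dint ?p ?D t w" if "0 <= t" for t w
  using dint_kap[of m ?p t X w] dint_kap[of n ?p t X' w] that by (simp add: dint_diff)
 with A show ?thesis by (intro that[of A]) (simp_all add: energy_def)
qed

end

section \<open>Picard iteration for bounded Lipschitz coefficients\<close>

locale lipschitz_sde = wiener M \<F> W for M :: "'a measure" and \<F> :: "real => 'a measure" and W :: "real => 'a => real" +
 fixes b g :: "real => 'b::{sep_inner, banach} => 'b" and x0 :: 'b and L C :: real
 assumes b_cont: "continuous_on UNIV (case_prod b)" and g_cont: "continuous_on UNIV (case_prod g)"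
  and b_lip: "norm (b t x - b t y) <= L * norm (x - y)" and g_lip: "norm (g t x - g t y) <= L * norm (x - y)"
  and b_bound: "norm (b t x) <= C" and g_bound: "norm (g t x) <= C" and L_nonneg: "0 <= L"
begin

abbreviation G :: "(real => 'a => 'b) => real => 'a => 'b" where "G w == %r z. g r (w r z)"

definition drift :: "(real => 'a => 'b) => real => 'a => 'b" where "drift w t z = (LINT r:{0..t}|lborel. b r (w r z))"

definition picard_step :: "nat => (real => 'a => 'b) => real => 'a => 'b" where "picard_step m w t z = x0 + drift w t z + dint m (G w) t z"

lemma G_regular: "regular w ==> regular (G w)" by (rule regular_compose[OF _ g_cont])

lemma G_adapted: "regular w ==> adapted (G w)" by (intro regular_adapted G_regular)

lemma G_bdd: "bdd_process (G w)" unfolding bdd_process_def using g_bound by blast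

lemma b_regular: "regular w ==> regular (%r z. b r (w r z))" by (rule regular_compose[OF _ b_cont])

lemma b_integrable: "regular w ==> z : space M ==> set_integrable lborel {0..t} (%r. b r (w r z))"
 by (intro set_integrable_continuous_halfline regular_continuous[OF b_regular])

lemma drift_regular: assumes "regular w" shows "regular (drift w)" unfolding regular_def adapted_def drift_def
 using path_integral_measurable[OF regular_prog[OF b_regular[OF assms]]]
  set_integral_continuous_halfline[OF regular_continuous[OF b_regular[OF assms]]]
 by auto

lemma picard_step_regular: "regular w ==> regular (picard_step m w)"
 using drift_regular[of w] dint_measurable[OF G_adapted[of w], of _ m] dint_continuous[of _ m "G w"] unfolding regular_def adapted_def picard_step_def
 by (auto intro!: continuous_intros borel_measurable_add)

lemma mesh_limit: assumes "regular w" "0 <= T"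
 shows "(%m. (EE z. energy (%r z. G w (kap m r) z - G w r z) T z)) ----> 0"
proof -
 have lc: "lcad (G w)" by (intro regular_lcad G_regular assms)
 have "(%m. (EE z. energy (%r z. G w (kap m r) z - G w r z) T z)) ----> (EE z. energy (%_ _. 0 :: 'b) T z)"
 proof (rule energy_dominated[where C="2 * C"])
  show "prog (%r z. G w (kap m r) z - G w r z)" for m by (intro prog_diff lcad_prog lc lcad_kap lcad_adapted[OF lc])
  show "prog (%_ _. 0 :: 'b)" by (rule prog_deterministic) simp
  show "norm (G w (kap m r) z - G w r z) <= 2 * C" for m r z
   using norm_triangle_ineq4[of "G w (kap m r) z" "G w r z"] g_bound[of "kap m r" "w (kap m r) z"] g_bound[of r "w r z"] by simp
  show "(%m. G w (kap m r) z - G w r z) ----> 0" if "0 <= r" "z : space M" for r z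
   using lcadD[OF lc that(2,1)] by (simp add: LIM_zero)
 qed (fact assms)
 then show ?thesis by (simp add: energy_def)
qed

lemma energy_G_le: assumes "regular w" "regular v" "z : space M"
 shows "energy (%r z. G w r z - G v r z) t z <= ennreal (L^2) * energy (%r z. w r z - v r z) t z"
 using assms g_lip by (intro energy_lipschitz prog_diff regular_prog) auto

lemma drift_diff_le: assumes "regular w" "regular v" "z : space M" "0 <= t"
 shows "nsq (drift w t z - drift v t z) <= ennreal (t * L^2) * energy (%r z. w r z - v r z) t z"
proof -
 note int = b_integrable[OF assms(1,3), of t] b_integrable[OF assms(2,3), of t]
 have "drift w t z - drift v t z = (LINT r:{0..t}|lborel. b r (w r z) - b r (v r z))" unfolding drift_def using int by (simp add: set_integral_diff)
 also have "ennreal ((norm ...)^2) <= ennreal t * energy (%r z. b r (w r z) - b r (v r z)) t z"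
  unfolding energy_def using int by (intro set_integral_norm2_le assms set_integral_diff)
 also have "... <= ennreal t * (ennreal (L^2) * energy (%r z. w r z - v r z) t z)"
  using assms b_lip by (intro mult_left_mono energy_lipschitz prog_diff regular_prog) auto
 also have "... = ennreal (t * L^2) * energy (%r z. w r z - v r z) t z" using assms by (simp add: ennreal_mult mult.assoc)
 finally show ?thesis .
qed

lemma drift_bound: assumes "regular w" "z : space M" "0 <= t" shows "norm (drift w t z) <= C * t"
proof -
 have "norm (drift w t z) <= (LINT r:{0..t}|lborel. norm (b r (w r z)))"
  unfolding drift_def by (rule set_integral_norm_bound[OF b_integrable[OF assms(1,2)]])
 also have "... <= (LINT r:{0..t}|lborel. C)"
 proof (rule set_integral_mono)
  show "set_integrable lborel {0..t} (%r. norm (b r (w r z)))" by (rule set_integrable_norm[OF b_integrable[OF assms(1,2)]])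
  show "set_integrable lborel {0..t} (%r. C)" by (intro set_integrable_continuous_halfline continuous_intros)
 qed (use b_bound in auto)
 also have "... = C * t" using assms(3) by (simp add: set_lebesgue_integral_def)
 finally show ?thesis .
qed

text \<open>A Picard iteration whose stochastic integrals are replaced by Riemann sums on a mesh
  \<open>m n\<close> so fine that the discretisation error is at most \<open>8\<^sup>-\<^sup>n\<close>. All iterates are then explicit, and
  the limit equation holds by the definition of the integral.\<close>

lemma picard_sequence: obtains w :: "nat => real => 'a => 'b" and m :: "nat => nat"
 where "w 0 = (%_ _. x0)" "!!n. w (Suc n) = picard_step (m n) (w n)" "!!n. regular (w n)"
  "!!n. (EE z. energy (%r z. G (w n) (kap (m n) r) z - G (w n) r z) (real n) z) <= ennreal ((1 / 8) ^ n)"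
proof -
 define err where "err n w m = (EE z. energy (%r z. G w (kap m r) z - G w r z) (real n) z)" for n w m
 have ex: "EX m. err n w m <= ennreal ((1 / 8) ^ n)" if "regular w" for n w
 proof -
  have "eventually (%m. err n w m < ennreal ((1 / 8) ^ n)) sequentially" unfolding err_def by (intro order_tendstoD(2)[OF mesh_limit[OF that]]) auto
  then show ?thesis using eventually_happens[of _ sequentially] by (auto intro: less_imp_le)
 qed
 have reg0: "regular (%_ _. x0)" by (auto simp: regular_def adapted_def)
 \<comment> \<open>Dependent choice: the mesh \<open>m n\<close> can be picked only when the iterate
   \<open>w n\<close> is known, and the next iterate is built with this mesh.\<close>
 have "EX f. ALL n. (regular (fst (f n)) & err n (fst (f n)) (snd (f n)) <= ennreal ((1 / 8) ^ n) & (n = 0 --> fst (f n) = (%_ _. x0)))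
  & fst (f (Suc n)) = picard_step (snd (f n)) (fst (f n))"
 proof (rule dependent_nat_choice)
  show "EX x. regular (fst x) & err 0 (fst x) (snd x) <= ennreal ((1 / 8) ^ 0) & (0 = (0::nat) --> fst x = (%_ _. x0))"
   using ex[OF reg0, of 0] reg0 by (auto intro!: exI[of _ "%_ _. x0"])
  fix x :: "(real => 'a => 'b) \<times> nat" and n :: nat
  assume "regular (fst x) & err n (fst x) (snd x) <= ennreal ((1 / 8) ^ n) & (n = 0 --> fst x = (%_ _. x0))"
  then have "regular (picard_step (snd x) (fst x))" by (intro picard_step_regular) simp
  then show "EX y. (regular (fst y) & err (Suc n) (fst y) (snd y) <= ennreal ((1 / 8) ^ Suc n) & (Suc n = 0 --> fst y = (%_ _. x0)))
   & fst y = picard_step (snd x) (fst x)" using ex[of "picard_step (snd x) (fst x)" "Suc n"] by (auto intro!: exI[of _ "picard_step (snd x) (fst x)"])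
 qed
 then obtain f where f: "!!n. regular (fst (f n))" "!!n. err n (fst (f n)) (snd (f n)) <= ennreal ((1 / 8) ^ n)"
  "fst (f 0) = (%_ _. x0)" "!!n. fst (f (Suc n)) = picard_step (snd (f n)) (fst (f n))" by blast
 show ?thesis by (rule that[of "%n. fst (f n)" "%n. snd (f n)"]) (use f in \<open>auto simp: err_def\<close>)
qed

end

lemma numeral_mult_ennreal: "0 <= x ==> ennreal (numeral k * x) = numeral k * ennreal x" by (simp add: ennreal_mult)

lemma ennreal_norm_diff_le: fixes a b :: "'c::real_normed_vector"
 shows "nsq (a - b) <= 2 * nsq a + 2 * nsq b"
proof -
 have "nsq (a - b) <= ennreal (2 * (norm a)^2 + 2 * (norm b)^2)" by (intro ennreal_leI norm_diff_power2_le)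
 also have "... = 2 * nsq a + 2 * nsq b" by (simp add: ennreal_plus ennreal_mult)
 finally show ?thesis .
qed

lemma ennreal_norm_add_le: fixes a b :: "'c::real_normed_vector"
 shows "nsq (a + b) <= 2 * nsq a + 2 * nsq b" using ennreal_norm_diff_le[of a "- b"] by simp

context lipschitz_sde begin

lemma C_nonneg: "0 <= C" using order_trans[OF norm_ge_zero b_bound] .

lemma nn_integral_energy_bounded: assumes "0 <= t" "!!r w. 0 <= r ==> norm (Y r w) <= D"
 shows "(EE w. energy Y t w) <= ennreal (D^2 * t)"
proof -
 have "(EE w. energy Y t w) <= (EE w. ennreal (D^2 * t))"
  using assms by (intro nn_integral_mono energy_bounded) auto
 then show ?thesis by (simp add: emeasure_space_1)
qed

lemma regular_measurable_M: "regular w ==> 0 <= t ==> w t : borel_measurable M" by (intro adapted_M regular_adapted)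

lemma dint_measurable_M: assumes "regular w" "0 <= t" shows "dint m (G w) t : borel_measurable M"
 by (rule F_M[OF dint_measurable[OF G_adapted[OF assms(1)] assms(2)] assms(2)])

lemma dint_second_moment: assumes "regular w" "0 <= t"
 shows "(EE z. nsq (dint m (G w) t z)) <= ennreal (C^2 * t)"
proof -
 have "(EE z. nsq (dint m (G w) t z)) = (EE z. energy (%r. G w (kap m r)) t z)"
  unfolding energy_def by (rule dint_isometry[OF G_adapted[OF assms(1)] G_bdd assms(2)])
 also have "... <= ennreal (C^2 * t)" by (rule nn_integral_energy_bounded[OF assms(2) g_bound])
 finally show ?thesis .
qed

lemma picard_second_moment: assumes "regular w" "0 <= t"
 shows "(EE z. nsq (picard_step m w t z - x0)) <= ennreal (2 * (C * t)^2 + 2 * (C^2 * t))"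
proof -
 note [measurable] = dint_measurable_M[OF assms, of m]
 have "(EE z. nsq (picard_step m w t z - x0))
  <= (EE z. ennreal (2 * (C * t)^2) + 2 * nsq (dint m (G w) t z))"
 proof (rule nn_integral_mono)
  fix z assume z: "z : space M"
  have "nsq (picard_step m w t z - x0) <= 2 * nsq (drift w t z) + 2 * nsq (dint m (G w) t z)"
   using ennreal_norm_add_le[of "drift w t z" "dint m (G w) t z"] by (simp add: picard_step_def add.assoc)
  also have "nsq (drift w t z) <= ennreal ((C * t)^2)" by (intro ennreal_leI power_mono drift_bound assms z) simp
  finally show "nsq (picard_step m w t z - x0) <= ennreal (2 * (C * t)^2) + 2 * nsq (dint m (G w) t z)"
   by (simp add: ennreal_mult mult_left_mono add_mono)
 qed
 also have "... = ennreal (2 * (C * t)^2) + 2 * (EE z. nsq (dint m (G w) t z))"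
  by (simp add: nn_integral_add nn_integral_cmult emeasure_space_1)
 also have "... <= ennreal (2 * (C * t)^2) + 2 * ennreal (C^2 * t)" by (intro add_left_mono mult_left_mono dint_second_moment assms) auto
 also have "... = ennreal (2 * (C * t)^2 + 2 * (C^2 * t))" using assms(2) by (simp add: ennreal_plus ennreal_mult)
 finally show ?thesis .
qed

context fixes w :: "nat => real => 'a => 'b" and m :: "nat => nat"
 assumes w0: "w 0 = (%_ _. x0)" and wSuc: "!!n. w (Suc n) = picard_step (m n) (w n)" and reg: "!!n. regular (w n)"
  and err: "!!n. (EE z. energy (%u z. G (w n) (kap (m n) u) z - G (w n) u z) (real n) z) <= ennreal ((1 / 8) ^ n)"
begin

definition "dw n = (%u z. w (Suc n) u z - w n u z)"
definition "msd n t = (EE z. nsq (dw n t z))"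
definition "gd n = (%u z. G (w (Suc n)) (kap (m (Suc n)) u) z - G (w n) (kap (m n) u) z)"

lemma dw_prog: "prog (dw n)" unfolding dw_def by (intro prog_diff regular_prog reg)

lemma msd_integral: "0 <= t ==> (EE z. energy (dw n) t z) = NI t (%u. msd n u)"
 unfolding msd_def by (rule energy_Fubini[OF dw_prog])

lemma msd_bounded: assumes "0 <= t" "t <= T" shows "msd n t <= ennreal (8 * (C * T)^2 + 8 * (C^2 * T))"
proof -
 let ?B = "2 * (C * t)^2 + 2 * (C^2 * t)"
 have B: "0 <= ?B" using assms by simp
 have b: "(EE z. nsq (w n t z - x0)) <= ennreal ?B" for n
  using picard_second_moment[OF reg assms(1)] B by (cases n) (simp_all add: w0 wSuc)
 have [measurable]: "w n t : borel_measurable M" for n by (intro regular_measurable_M reg assms)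
 have "msd n t <= (EE z. 2 * nsq (w (Suc n) t z - x0) + 2 * nsq (w n t z - x0))"
  unfolding msd_def
 proof (rule nn_integral_mono)
  fix z
  show "nsq (dw n t z) <= 2 * nsq (w (Suc n) t z - x0) + 2 * nsq (w n t z - x0)"
   using ennreal_norm_diff_le[of "w (Suc n) t z - x0" "w n t z - x0"] by (simp add: dw_def)
 qed
 also have "... = 2 * (EE z. nsq (w (Suc n) t z - x0)) + 2 * (EE z. nsq (w n t z - x0))"
  by (simp add: nn_integral_add nn_integral_cmult)
 also have "... <= 2 * ennreal ?B + 2 * ennreal ?B" by (intro add_mono mult_left_mono b) auto
 also have "... = ennreal (2 * ?B + 2 * ?B)" using B by (simp only: ennreal_plus ennreal_mult mult_nonneg_nonneg zero_le_numeral ennreal_numeral)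
 also have "... <= ennreal (8 * (C * T)^2 + 8 * (C^2 * T))"
 proof (rule ennreal_leI)
  have "(C * t)^2 <= (C * T)^2" "C^2 * t <= C^2 * T" using assms C_nonneg by (auto intro!: power_mono mult_left_mono)
  moreover have "2 * (2 * a + 2 * b) + 2 * (2 * a + 2 * b) <= 8 * A + 8 * B" if "a <= A" "b <= B" for a b A B :: real using that by simp
  ultimately show "2 * ?B + 2 * ?B <= 8 * (C * T)^2 + 8 * (C^2 * T)" by blast
 qed
 finally show ?thesis .
qed

lemma gd_energy: assumes "0 <= t" "t <= real n"
 shows "(EE z. energy (gd n) t z) <= ennreal (5 * (1 / 8) ^ n) + ennreal (4 * L^2) * NI t (%u. msd n u)"
proof -
 let ?P = "%n u z. G (w n) (kap (m n) u) z - G (w n) u z"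
 let ?R = "%u z. G (w (Suc n)) u z - G (w n) u z"
 have lc: "lcad (G (w n))" for n by (intro regular_lcad G_regular reg)
 have P: "prog (?P n)" for n by (intro prog_diff lcad_prog lc lcad_kap lcad_adapted[OF lc])
 have R: "prog ?R" by (intro prog_diff lcad_prog lc)
 have [measurable]: "energy (?P k) t : borel_measurable M" "energy (dw n) t : borel_measurable M" for k
  by (intro energy_measurable_M P dw_prog assms)+
 have "(EE z. energy (gd n) t z)
  <= (EE z. 2 * energy (?P (Suc n)) t z + 2 * (2 * energy (?P n) t z + 2 * (ennreal (L^2) * energy (dw n) t z)))"
 proof (rule nn_integral_mono)
  fix z assume z: "z : space M"
  \<comment> \<open>The difference of two sampled integrands is the mesh error of the new iterate,
    minus that of the old one, plus the difference without sampling.\<close>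
  have "energy (gd n) t z = energy (%u z. ?P (Suc n) u z - (?P n u z - ?R u z)) t z" by (intro energy_cong) (simp add: gd_def)
  also have "... <= 2 * energy (?P (Suc n)) t z + 2 * energy (%u z. ?P n u z - ?R u z) t z" by (intro energy_diff_le P R prog_diff[OF P R] z)
  also have "energy (%u z. ?P n u z - ?R u z) t z <= 2 * energy (?P n) t z + 2 * energy ?R t z" by (intro energy_diff_le P R z)
  also have "energy ?R t z <= ennreal (L^2) * energy (dw n) t z" unfolding dw_def by (rule energy_G_le[OF reg reg z])
  finally show "energy (gd n) t z <= 2 * energy (?P (Suc n)) t z + 2 * (2 * energy (?P n) t z + 2 * (ennreal (L^2) * energy (dw n) t z))"
   by (simp add: add_mono mult_left_mono)
 qed
 also have "... = 2 * (EE z. energy (?P (Suc n)) t z)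
   + 2 * (2 * (EE z. energy (?P n) t z) + 2 * (ennreal (L^2) * (EE z. energy (dw n) t z)))"
  by (simp add: nn_integral_add nn_integral_cmult)
 also have "... <= 2 * ennreal ((1 / 8) ^ Suc n)
   + 2 * (2 * ennreal ((1 / 8) ^ n) + 2 * (ennreal (L^2) * NI t (%u. msd n u)))"
 proof -
  have P8: "(EE z. energy (?P k) t z) <= ennreal ((1 / 8) ^ k)" if "n <= k" for k
   using assms that by (intro order_trans[OF nn_integral_mono[OF energy_mono_time] err]) auto
  show ?thesis unfolding msd_integral[OF assms(1)] by (intro add_mono mult_left_mono P8 order_refl) auto
 qed
 also have "... = ennreal (2 * (1 / 8) ^ Suc n + 4 * (1 / 8) ^ n) + ennreal (4 * L^2) * NI t (%u. msd n u)"
 proof -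
  have "ennreal (2 * (1 / 8) ^ Suc n + 4 * (1 / 8) ^ n) = 2 * ennreal ((1 / 8) ^ Suc n) + 4 * ennreal ((1 / 8) ^ n)"
   by (simp only: ennreal_plus numeral_mult_ennreal zero_le_power zero_le_divide_1_iff zero_le_numeral mult_nonneg_nonneg)
  moreover have "ennreal (4 * L^2) = 4 * ennreal (L^2)" by (simp only: numeral_mult_ennreal zero_le_power2)
  moreover have "2 * p + 2 * (2 * q + 2 * (l * i)) = 2 * p + 4 * q + 4 * l * i" for p q l i :: ennreal
   by (simp add: distrib_left mult.assoc[symmetric] add.assoc)
  ultimately show ?thesis by (simp only:)
 qed
 \<comment> \<open>The two mesh errors contribute \<open>2 / 8 + 4\<close>, which is below
   5.\<close>
 also have "... <= ennreal (5 * (1 / 8) ^ n) + ennreal (4 * L^2) * NI t (%u. msd n u)"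
  by (intro add_right_mono ennreal_leI) simp
 finally show ?thesis .
qed

lemma msd_recursion: assumes "0 <= t" "t <= T" "T <= real n"
 shows "msd (Suc n) t <= ennreal (2 * T * L^2 + 8 * L^2 + 10) * NI t (%u. msd n u)
  + ennreal ((2 * T * L^2 + 8 * L^2 + 10) * (1 / 8) ^ n)"
proof -
 \<comment> \<open>One constant serves both terms: \<open>2 * T * L^2\<close> comes from the drift,
   \<open>8 * L^2\<close> from the stochastic part, and 10 is twice the 5 of
   \<open>gd_energy\<close>.\<close>
 let ?I = "NI t (%u. msd n u)" and ?c = "2 * T * L^2 + 8 * L^2 + 10"
 let ?E = "%z. dint (m (Suc n)) (G (w (Suc n))) t z - dint (m n) (G (w n)) t z"
 have [measurable]: "energy (dw n) t : borel_measurable M" "?E : borel_measurable M"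
  by (intro energy_measurable_M dw_prog assms borel_measurable_diff dint_measurable_M reg)+
 have "msd (Suc n) t <= (EE z. 2 * (ennreal (t * L^2) * energy (dw n) t z) + 2 * nsq (?E z))"
  unfolding msd_def
 proof (rule nn_integral_mono)
  fix z assume z: "z : space M"
  have "dw (Suc n) t z = (drift (w (Suc n)) t z - drift (w n) t z) + ?E z" unfolding dw_def wSuc by (simp add: picard_step_def)
  then have "nsq (dw (Suc n) t z) <= 2 * nsq (drift (w (Suc n)) t z - drift (w n) t z) + 2 * nsq (?E z)"
   by (simp only: ennreal_norm_add_le)
  also have "nsq (drift (w (Suc n)) t z - drift (w n) t z) <= ennreal (t * L^2) * energy (dw n) t z"
   unfolding dw_def by (rule drift_diff_le[OF reg reg z assms(1)])
  finally show "nsq (dw (Suc n) t z) <= 2 * (ennreal (t * L^2) * energy (dw n) t z) + 2 * nsq (?E z)"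
   by (simp add: add_mono mult_left_mono)
 qed
 also have "... = 2 * (ennreal (t * L^2) * (EE z. energy (dw n) t z)) + 2 * (EE z. nsq (?E z))"
  by (simp add: nn_integral_add nn_integral_cmult)
 also have "(EE z. nsq (?E z)) = (EE z. energy (gd n) t z)"
  unfolding gd_def by (intro dint_sampled G_adapted G_bdd reg assms)
 also have "(EE z. energy (dw n) t z) = ?I" by (rule msd_integral[OF assms(1)])
 also have "2 * (ennreal (t * L^2) * ?I) + 2 * (EE z. energy (gd n) t z)
  <= 2 * (ennreal (T * L^2) * ?I) + 2 * (ennreal (5 * (1 / 8) ^ n) + ennreal (4 * L^2) * ?I)"
  using assms by (intro add_mono mult_left_mono mult_right_mono gd_energy ennreal_leI) auto
 also have "... = ennreal (2 * (T * L^2) + 8 * L^2) * ?I + ennreal (10 * (1 / 8) ^ n)"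
 proof -
  have T: "0 <= T" using assms by simp
  have "ennreal (2 * (T * L^2) + 8 * L^2) = 2 * ennreal (T * L^2) + 2 * ennreal (4 * L^2)"
   using T by (simp add: ennreal_mult[symmetric] ennreal_plus[symmetric] flip: ennreal_numeral del: ennreal_plus)
  moreover have "ennreal (10 * (1 / 8) ^ n) = 2 * ennreal (5 * (1 / 8) ^ n)" by (simp flip: ennreal_numeral ennreal_mult)
  ultimately show ?thesis by (simp add: distrib_left distrib_right mult.assoc add.commute add.left_commute)
 qed
 also have "... <= ennreal ?c * ?I + ennreal (?c * (1 / 8) ^ n)"
 proof -
  have "0 <= T * L^2" "0 <= L^2" using assms by auto
  then have c: "2 * (T * L^2) + 8 * L^2 <= ?c" "10 <= ?c" by linarith+
  have "ennreal (10 * (1 / 8) ^ n) <= ennreal (?c * (1 / 8) ^ n)" by (rule ennreal_leI[OF mult_right_mono[OF c(2)]]) simp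
  then show ?thesis by (intro add_mono mult_right_mono ennreal_leI[OF c(1)]) auto
 qed
 finally show ?thesis .
qed

lemma msd_decay: fixes T :: nat obtains D where "0 <= D" "!!n t. T <= n ==> 0 <= t ==> t <= real T ==> msd n t <= ennreal (D * (1 / 8) ^ n)"
  "!!n t. T <= n ==> 0 <= t ==> t <= real T ==> NI t (%u. msd n u) <= ennreal (D * (1 / 8) ^ n)"
proof -
 define c where "c = 2 * real T * L^2 + 8 * L^2 + 10"
 define B where "B = 8 * (C * real T)^2 + 8 * (C^2 * real T)"
 \<comment> \<open>The recursion is available only for \<open>T <= n\<close>, so the induction
   starts at \<open>n = T\<close>, where \<open>B * 8 ^ T\<close> compensates
   \<open>(1 / 8) ^ T\<close>. The weight \<open>exp (16 * c * t)\<close> makes the integral term at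
   most half of what the step from \<open>n\<close> to \<open>Suc n\<close> allows, and
   \<open>16 * c <= D\<close> fits the mesh error into the other half.\<close>
 define D where "D = 16 * c + B * 8 ^ T"
 have c: "1 <= c" by (simp add: c_def add_nonneg_nonneg add_increasing)
 have B: "0 <= B" by (simp add: B_def)
 then have D: "0 <= D" "16 * c <= D" using c by (auto simp: D_def)
 have decay: "msd n t <= ennreal (D * (1 / 8) ^ n * exp (16 * c * t))" if "T <= n" "0 <= t" "t <= real T" for n t using that
 proof (induction n arbitrary: t rule: dec_induct)
  case base
  have "msd T t <= ennreal B" unfolding B_def by (rule msd_bounded) (use base in auto)
  also have "... <= ennreal (D * (1 / 8) ^ T * exp (16 * c * t))"
  proof (rule ennreal_leI)
   have "B = B * 8 ^ T * (1 / 8) ^ T" by (simp add: power_divide)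
   also have "... <= D * (1 / 8) ^ T" using c by (intro mult_right_mono) (auto simp: D_def)
   also have "... <= D * (1 / 8) ^ T * exp (16 * c * t)" using mult_left_mono[of 1 "exp (16 * c * t)" "D * (1 / 8) ^ T"] D c base by simp
   finally show "B <= D * (1 / 8) ^ T * exp (16 * c * t)" .
  qed
  finally show ?case .
 next
  case (step n)
  let ?q = "(1 / 8 :: real) ^ n" and ?e = "exp (16 * c * t)"
  have e: "1 <= ?e" using c step.prems by simp
  have I: "NI t (%u. msd n u) <= ennreal (D * ?q / (16 * c) * (?e - 1))"
   using D c step by (intro nn_integral_exp_le) auto
  have "msd (Suc n) t <= ennreal c * NI t (%u. msd n u) + ennreal (c * ?q)"
   unfolding c_def using step by (intro msd_recursion) auto
  also have "... <= ennreal c * ennreal (D * ?q / (16 * c) * (?e - 1)) + ennreal (c * ?q)" by (intro add_right_mono mult_left_mono I) auto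
  also have "... = ennreal (D * ?q / 16 * (?e - 1) + c * ?q)" using c D e by (simp flip: ennreal_mult' ennreal_plus)
  also have "... <= ennreal (D * (1 / 8) ^ Suc n * ?e)"
  proof (rule ennreal_leI)
   have "D * ?q / 16 * (?e - 1) <= D * ?q / 16 * ?e" using D by (intro mult_left_mono) auto
   moreover have "c * ?q <= D * ?q / 16 * ?e"
   proof -
    have "c * ?q * 1 <= (D / 16 * ?q) * ?e" using D c e by (intro mult_mono) auto
    then show ?thesis by simp
   qed
   moreover have "D * (1 / 8) ^ Suc n * ?e = D * ?q / 16 * ?e + D * ?q / 16 * ?e" by simp
   ultimately show "D * ?q / 16 * (?e - 1) + c * ?q <= D * (1 / 8) ^ Suc n * ?e" by linarith
  qed
  finally show ?case .
 qed
 define E where "E = D * exp (16 * c * real T)"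
 have ex: "exp (16 * c * t) <= exp (16 * c * real T)" if "t <= real T" for t using that c by simp
 show ?thesis
 proof (rule that[of E])
  show "0 <= E" using D by (simp add: E_def)
  fix n t assume *: "T <= n" "0 <= t" "t <= real T"
  have "D * (1 / 8) ^ n * exp (16 * c * t) <= D * (1 / 8) ^ n * exp (16 * c * real T)" using ex[OF *(3)] D by (intro mult_left_mono) auto
  also have "... = E * (1 / 8) ^ n" by (simp add: E_def)
  finally show "msd n t <= ennreal (E * (1 / 8) ^ n)" using decay[OF *] by (meson ennreal_leI order_trans)
  have "NI t (%u. msd n u) <= ennreal (D * (1 / 8) ^ n / (16 * c) * (exp (16 * c * t) - 1))"
   using D c * by (intro nn_integral_exp_le decay) auto
  also have "... <= ennreal (E * (1 / 8) ^ n)"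
  proof (rule ennreal_leI)
   have "D * (1 / 8) ^ n / (16 * c) * (exp (16 * c * t) - 1) <= D * (1 / 8) ^ n * exp (16 * c * real T)"
   proof (rule mult_mono)
    show "D * (1 / 8) ^ n / (16 * c) <= D * (1 / 8) ^ n" using D c by (simp add: divide_le_eq mult_left_mono)
    show "exp (16 * c * t) - 1 <= exp (16 * c * real T)" using ex[OF *(3)] by linarith
    show "0 <= exp (16 * c * t) - 1" using c * by simp
   qed (use D in auto)
   then show "D * (1 / 8) ^ n / (16 * c) * (exp (16 * c * t) - 1) <= E * (1 / 8) ^ n" by (simp add: E_def mult.commute mult.left_commute)
  qed
  finally show "NI t (%u. msd n u) <= ennreal (E * (1 / 8) ^ n)" .
 qed
qed

text \<open>This is where the rate \<open>1 / 8\<close> comes from: Chebyshev's inequality at level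
  \<open>(1 / 2) ^ n\<close> loses a factor \<open>4 ^ n\<close>, and \<open>(1 / 2) ^ n\<close>
  remains for Borel-Cantelli.\<close>

lemma ennreal_measure_bound: assumes "ennreal ((1 / 4) ^ n) * emeasure M A <= ennreal (K * (1 / 8) ^ n)" "0 <= K"
 shows "measure M A <= K * (1 / 2) ^ n"
proof -
 have "ennreal ((1 / 4) ^ n * measure M A) <= ennreal (K * (1 / 8) ^ n)" using assms(1) by (simp add: emeasure_eq_measure ennreal_mult)
 then have "(1 / 4) ^ n * measure M A <= K * (1 / 8) ^ n" using assms(2) by (simp add: ennreal_le_iff)
 also have "(1 / 8 :: real) ^ n = (1 / 4) ^ n * (1 / 2) ^ n" by (simp flip: power_mult_distrib)
 finally have "(1 / 4) ^ n * measure M A <= (1 / 4) ^ n * (K * (1 / 2) ^ n)" by (simp add: mult.left_commute)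
 then show ?thesis by simp
qed

text \<open>Drift increments are dominated, uniformly in time, by the energy up to \<open>T\<close>,
  to which Markov's inequality applies; the stochastic increments obey the maximal inequality on the
  finer mesh. Each part exceeds \<open>(1 / 2) ^ n\<close> with probability of order
  \<open>(1 / 2) ^ n\<close>.\<close>

lemma picard_increment: fixes T :: nat shows "AE z in M. eventually (%n. ALL t:{0..real T}. norm (dw (Suc n) t z) <= 2 * (1 / 2) ^ n) sequentially"
proof -
 obtain D where D: "0 <= D" "!!n t. T <= n ==> 0 <= t ==> t <= real T ==> msd n t <= ennreal (D * (1 / 8) ^ n)"
  "!!n t. T <= n ==> 0 <= t ==> t <= real T ==> NI t (%u. msd n u) <= ennreal (D * (1 / 8) ^ n)"
  using msd_decay[of T] by blast
 define K where "K = 5 + 4 * L^2 * D + real T * L^2 * D"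
 have K: "0 <= K" using D by (simp add: K_def)
 have "EX A:sets M. measure M A <= 2 * K * (1 / 2) ^ n &
  (ALL z:space M - A. ALL t:{0..real T}. norm (dw (Suc n) t z) <= 2 * (1 / 2) ^ n)" if n: "T <= n" for n
 proof -
  have msd: "NI (real T) (%u. msd n u) <= ennreal (D * (1 / 8) ^ n)" by (rule D(3)[OF n]) auto
  have half: "((1 / 2 :: real) ^ n)^2 = (1 / 4) ^ n" by (simp add: power2_eq_square flip: power_mult_distrib)
  obtain A where A: "A : sets M" "ennreal (((1 / 2) ^ n)^2) * emeasure M A <= (EE z. energy (gd n) (real T) z)"
   "!!z t. z : space M - A ==> 0 <= t ==> t <= real T ==> norm (dint (m (Suc n)) (G (w (Suc n))) t z - dint (m n) (G (w n)) t z) <= (1 / 2) ^ n"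
   unfolding gd_def by (rule dint_sampled_maximal[of "G (w (Suc n))" "G (w n)" "(1 / 2) ^ n" "m (Suc n)" "m n" T]) (auto intro: G_adapted G_bdd reg)
  have "ennreal ((1 / 4) ^ n) * emeasure M A <= ennreal (5 * (1 / 8) ^ n) + ennreal (4 * L^2) * ennreal (D * (1 / 8) ^ n)"
   using A(2) gd_energy[of "real T" n] n msd unfolding half by (meson add_left_mono mult_left_mono of_nat_0_le_iff of_nat_mono order_trans zero_le)
  also have "... = ennreal ((5 + 4 * L^2 * D) * (1 / 8) ^ n)" using D(1) by (simp flip: ennreal_mult ennreal_plus add: algebra_simps)
  also have "... <= ennreal (K * (1 / 8) ^ n)" using D(1) by (intro ennreal_leI mult_right_mono) (auto simp: K_def)
  finally have PA: "measure M A <= K * (1 / 2) ^ n" by (rule ennreal_measure_bound[OF _ K])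
  define f where "f z = ennreal (real T * L^2) * energy (dw n) (real T) z" for z
  have [measurable]: "energy (dw n) (real T) : borel_measurable M" by (intro energy_measurable_M dw_prog) simp
  have [measurable]: "f : borel_measurable M" unfolding f_def[abs_def] by measurable
  let ?B = "{z:space M. ennreal ((1 / 4) ^ n) < f z}"
  have B: "?B : sets M" by measurable
  have "ennreal ((1 / 4) ^ n) * emeasure M ?B <= (EE z. f z)" by (rule Markov) measurable
  also have "... = ennreal (real T * L^2) * NI (real T) (%u. msd n u)"
   unfolding f_def by (simp add: nn_integral_cmult msd_integral)
  also have "... <= ennreal (real T * L^2) * ennreal (D * (1 / 8) ^ n)" by (intro mult_left_mono msd) auto
  also have "... = ennreal (real T * L^2 * D * (1 / 8) ^ n)" using D(1) by (simp flip: ennreal_mult add: mult.assoc)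
  also have "... <= ennreal (K * (1 / 8) ^ n)" using D(1) by (intro ennreal_leI mult_right_mono) (auto simp: K_def)
  finally have PB: "measure M ?B <= K * (1 / 2) ^ n" by (rule ennreal_measure_bound[OF _ K])
  show ?thesis
  proof (intro bexI[of _ "A \<union> ?B"] conjI ballI)
   show "A \<union> ?B : sets M" using A(1) B by auto
   show "measure M (A \<union> ?B) <= 2 * K * (1 / 2) ^ n" using measure_Un_le[OF A(1) B] PA PB by linarith
   fix z t assume z: "z : space M - (A \<union> ?B)" and t: "t : {0..real T}"
   have "nsq (drift (w (Suc n)) t z - drift (w n) t z) <= ennreal (t * L^2) * energy (dw n) t z"
    unfolding dw_def using z t by (intro drift_diff_le reg) auto
   also have "... <= f z" unfolding f_def using t by (intro mult_mono ennreal_leI mult_right_mono energy_mono_time) auto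
   also have "... <= ennreal (((1 / 2) ^ n)^2)" using z by (auto simp: half not_less)
   finally have "(norm (drift (w (Suc n)) t z - drift (w n) t z))^2 <= ((1 / 2) ^ n)^2" by (simp add: ennreal_le_iff)
   then have "norm (drift (w (Suc n)) t z - drift (w n) t z) <= (1 / 2) ^ n" by (rule power2_le_imp_le) simp
   moreover have "norm (dint (m (Suc n)) (G (w (Suc n))) t z - dint (m n) (G (w n)) t z) <= (1 / 2) ^ n" using A(3)[of z t] z t by auto
   moreover have "dw (Suc n) t z = (drift (w (Suc n)) t z - drift (w n) t z) + (dint (m (Suc n)) (G (w (Suc n))) t z - dint (m n) (G (w n)) t z)"
    unfolding dw_def wSuc by (simp add: picard_step_def)
   ultimately show "norm (dw (Suc n) t z) <= 2 * (1 / 2) ^ n"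
    using norm_triangle_ineq[of "drift (w (Suc n)) t z - drift (w n) t z" "dint (m (Suc n)) (G (w (Suc n))) t z - dint (m n) (G (w n)) t z"] by simp
  qed
 qed
 note ex = this
 \<comment> \<open>The estimate is available from \<open>n = T\<close> on; before that the empty set
   is chosen and nothing is claimed.\<close>
 have "ALL n. EX A. A : sets M & measure M A <= 2 * K * (1 / 2) ^ n &
  (ALL z:space M - A. T <= n --> (ALL t:{0..real T}. norm (dw (Suc n) t z) <= 2 * (1 / 2) ^ n))"
 proof (intro allI)
  fix n
  show "EX A. A : sets M & measure M A <= 2 * K * (1 / 2) ^ n &
   (ALL z:space M - A. T <= n --> (ALL t:{0..real T}. norm (dw (Suc n) t z) <= 2 * (1 / 2) ^ n))"
  proof (cases "T <= n")
   case True
   then show ?thesis using ex[of n] by blast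
  next
   case False
   then show ?thesis using K by (intro exI[of _ "{}"]) simp
  qed
 qed
 from choice[OF this] obtain A where A: "!!n. A n : sets M" "!!n. measure M (A n) <= 2 * K * (1 / 2) ^ n"
  "!!n z t. z : space M - A n ==> T <= n ==> t : {0..real T} ==> norm (dw (Suc n) t z) <= 2 * (1 / 2) ^ n" by blast
 have "summable (%n. measure M (A n))" by (rule summable_comparison_test[OF _ summable_mult[OF summable_geometric[of "1 / 2 :: real"], of "2 * K"]])
   (use A(2) in auto)
 then have "AE z in M. eventually (%n. z : space M - A n) sequentially"
  by (intro borel_cantelli_AE1) (use A(1) in \<open>simp_all add: emeasure_eq_measure\<close>)
 then show ?thesis
 proof eventually_elim
  case (elim z)
  then show ?case
   using eventually_ge_at_top[of T] by eventually_elim (use A(3) in blast)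
 qed
qed

end

text \<open>The equation is read as a statement on its residual: what remains after the drift has to
  be an Ito integral of the noise coefficient. No version of the integral has to be
  selected.\<close>

definition solution :: "(real => 'a => 'b) => bool"
 where "solution v \<longleftrightarrow> regular v & (ALL t>=0. ito t (G v) (%w. v t w - x0 - drift v t w))"

lemma energy_uniform_limit: assumes "uniform_limit {0..t} (%n u. w n u z) (%u. v u z) sequentially" "0 <= t"
 shows "(%n. energy (%u z. w n u z - v u z) t z) ----> 0"
proof (rule tendsto_zero_ennreal)
 fix r :: real assume r: "0 < r"
 define e where "e = sqrt (r / (t + 1))"
 have e: "0 < e" "e^2 * t < r" using r assms(2) by (auto simp: e_def field_simps)
 have "eventually (%n. ALL u:{0..t}. dist (w n u z) (v u z) < e) sequentially" using uniform_limitD[OF assms(1) e(1)] .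
 then show "eventually (%n. energy (%u z. w n u z - v u z) t z < ennreal r) sequentially"
 proof eventually_elim
  fix n assume *: "ALL u:{0..t}. dist (w n u z) (v u z) < e"
  have "energy (%u z. w n u z - v u z) t z <= ennreal (e^2 * t)" using * assms(2) by (intro energy_bounded) (auto simp: dist_norm less_imp_le)
  also have "... < ennreal r" using e r by (intro ennreal_lessI) auto
  finally show "energy (%u z. w n u z - v u z) t z < ennreal r" .
 qed
qed

theorem solution_exists: "EX v. solution v"
proof -
 obtain w m where w0: "w 0 = (%_ _. x0)" and wSuc: "!!n. w (Suc n) = picard_step (m n) (w n)" and reg: "!!n. regular (w n)"
  and err: "!!n. (EE z. energy (%r z. G (w n) (kap (m n) r) z - G (w n) r z) (real n) z) <= ennreal ((1 / 8) ^ n)"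
  by (rule picard_sequence) blast
 have "AE z in M. ALL T::nat. eventually (%n. ALL t:{0..real T}. norm (w (Suc (Suc n)) t z - w (Suc n) t z) <= 2 * (1 / 2) ^ n) sequentially"
  using picard_increment[OF w0 wSuc reg err] unfolding dw_def[OF w0 wSuc reg err] AE_all_countable by blast
 then obtain N where N: "N : null_sets M" and incr: "!!z T. z : space M - N ==>
   eventually (%n. ALL t:{0..real T}. norm (w (Suc (Suc n)) t z - w (Suc n) t z) <= 2 * (1 / 2) ^ n) sequentially"
  unfolding eventually_ae_filter by blast
 \<comment> \<open>The value \<open>x0\<close> on the null set gives continuous paths for every
   outcome, and \<open>v\<close> stays adapted because null sets belong to the filtration from time
   0.\<close>
 define v where "v t z = (if z : N then x0 else lim (%n. w n t z))" for t z
 have unif: "uniform_limit {0..real T} (%n t. w n t z) (%t. v t z) sequentially" if z: "z : space M - N" for T z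
 proof -
  let ?d = "%n t. w (Suc n) t z - w n t z" and ?M = "%n. 4 * (1 / 2 :: real) ^ n"
  have "eventually (%n. ALL t:{0..real T}. norm (?d (Suc n) t) <= ?M (Suc n)) sequentially" using incr[OF z, of T] by eventually_elim simp
  then have "eventually (%n. ALL t:{0..real T}. norm (?d n t) <= ?M n) sequentially"
   by (rule iffD1[OF eventually_sequentially_Suc[of "%n. ALL t:{0..real T}. norm (?d n t) <= ?M n"]])
  moreover have "summable ?M" by (intro summable_mult summable_geometric) simp
  ultimately have "uniform_limit {0..real T} (%n t. \<Sum>i<n. ?d i t) (%t. \<Sum>i. ?d i t) sequentially" by (rule Weierstrass_m_test_ev)
  then have "uniform_limit {0..real T} (%n t. x0 + (\<Sum>i<n. ?d i t)) (%t. x0 + (\<Sum>i. ?d i t)) sequentially"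
   by (intro uniform_limit_add uniform_limit_const)
  also have "(%n t. x0 + (\<Sum>i<n. ?d i t)) = (%n t. w n t z)"
  proof (intro ext)
   fix n t
   show "x0 + (\<Sum>i<n. ?d i t) = w n t z" using sum_lessThan_telescope[of "%i. w i t z" n] by (simp add: w0)
  qed
  finally have ul: "uniform_limit {0..real T} (%n t. w n t z) (%t. x0 + (\<Sum>i. ?d i t)) sequentially" .
  have "x0 + (\<Sum>i. ?d i t) = v t z" if "t : {0..real T}" for t using limI[OF tendsto_uniform_limitI[OF ul that]] z by (simp add: v_def)
  then show ?thesis using ul by (subst uniform_limit_cong'[where g="%n t. w n t z" and i="%t. x0 + (\<Sum>i. ?d i t)"]) auto
 qed
 have unif': "uniform_limit {0..t} (%n t. w n t z) (%t. v t z) sequentially" if z: "z : space M - N" for t z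
 proof -
  obtain T :: nat where "t <= real T" using real_arch_simple by blast
  then show ?thesis by (intro uniform_limit_on_subset[OF unif[OF z, of T]]) auto
 qed
 have v: "regular v" unfolding regular_def adapted_def
 proof (intro conjI allI impI ballI)
  fix t :: real assume t: "0 <= t"
  have "N : sets (\<F> t)" by (rule null_sets_F[OF t N])
  then have [measurable]: "{z:space (\<F> t). z : N} : sets (\<F> t)" using sets.sets_into_space by (auto simp: Collect_conj_eq Int_absorb1)
  have [measurable]: "w n t : borel_measurable (\<F> t)" for n using reg t by (simp add: regular_def adapted_def)
  show "v t : borel_measurable (\<F> t)" unfolding v_def[abs_def] by measurable
 next
  fix z assume "z : space M"
  show "continuous_on {0..} (%t. v t z)"
  proof (cases "z : N")
   case False
   have "continuous_on {0..real T} (%t. v t z)" for T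
   proof (rule uniform_limit_theorem[OF _ unif])
    show "eventually (%n. continuous_on {0..real T} (%t. w n t z)) sequentially"
     by (intro always_eventually allI continuous_on_subset[OF regular_continuous[OF reg \<open>z : space M\<close>]]) auto
   qed (use False \<open>z : space M\<close> in auto)
   then show ?thesis by (rule continuous_on_halfline)
  qed (simp add: v_def)
 qed
 have AE_N: "AE z in M. z : space M - N" using AE_not_in[OF N] AE_space by eventually_elim auto
 have "ito t (G v) (%z. v t z - x0 - drift v t z)" if t: "0 <= t" for t
 proof (rule ito_limit)
  let ?Z = "%n r. G (w n) (kap (m n) r)" and ?K = "%n. dint (m n) (G (w n)) t"
  let ?P = "%n r z. ?Z n r z - G (w n) r z"
  show Z: "ito t (?Z n) (?K n)" for n by (intro ito_simple simple_dyadic G_adapted G_bdd reg t)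
  show "prog (G v)" by (intro regular_prog G_regular v)
  show "(%z. v t z - x0 - drift v t z) : borel_measurable M"
   by (intro borel_measurable_diff regular_measurable_M drift_regular v t borel_measurable_const)
  have e0: "(%n. energy (%r z. w n r z - v r z) t z) ----> 0" if "z : space M - N" for z
   by (rule energy_uniform_limit) (fact unif'[OF that] t)+
  have P: "prog (?P n)" for n by (intro prog_diff ito_prog[OF Z] regular_prog G_regular reg)
  \<comment> \<open>Once \<open>t <= n\<close> the expected mesh errors decay geometrically, so they
    vanish almost surely. The rest of the error, \<open>G v\<close> against \<open>G (w n)\<close>,
    is controlled by the uniform convergence of the paths.\<close>
  have "AE z in M. (%n. energy (?P n) t z) ----> 0"
  proof (rule AE_tendsto_0_summable[where D=1 and q="1 / 8" and ?n0.0="nat \<lceil>t\<rceil>"])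
   show "energy (?P n) t : borel_measurable M" for n by (intro energy_measurable_M P t)
   show "(EE z. energy (?P n) t z) <= ennreal (1 * (1 / 8) ^ n)" if "nat \<lceil>t\<rceil> <= n" for n
   proof -
    have "t <= real n" using that t by linarith
    then have "(EE z. energy (?P n) t z) <= (EE z. energy (?P n) (real n) z)"
     by (intro nn_integral_mono energy_mono_time)
    also note err
    finally show ?thesis by simp
   qed
  qed auto
  then show "AE z in M. (%n. energy (%r z. ?Z n r z - G v r z) t z) ----> 0" using AE_N
  proof eventually_elim
   case (elim z)
   note lim = elim(1) and z = elim(2)
   have le: "energy (%r z. ?Z n r z - G v r z) t z <= 2 * energy (?P n) t z + 2 * (ennreal (L^2) * energy (%r z. w n r z - v r z) t z)" for n
   proof -
    have "energy (%r z. ?Z n r z - G v r z) t z = energy (%r z. ?P n r z - (G v r z - G (w n) r z)) t z" by (intro energy_cong) simp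
    also have "... <= 2 * energy (?P n) t z + 2 * energy (%r z. G v r z - G (w n) r z) t z"
     using z by (intro energy_diff_le P prog_diff regular_prog G_regular reg v) auto
    also have "energy (%r z. G v r z - G (w n) r z) t z <= ennreal (L^2) * energy (%r z. w n r z - v r z) t z"
     unfolding energy_minus_commute[of "G v"] using z by (intro energy_G_le reg v) auto
    finally show ?thesis by (simp add: mult_left_mono add_left_mono)
   qed
   have "(%n. 2 * energy (?P n) t z + 2 * (ennreal (L^2) * energy (%r z. w n r z - v r z) t z)) ----> 2 * 0 + 2 * (ennreal (L^2) * 0)"
    by (intro tendsto_add ennreal_tendsto_cmult lim e0 z) auto
   then have "(%n. 2 * energy (?P n) t z + 2 * (ennreal (L^2) * energy (%r z. w n r z - v r z) t z)) ----> 0" by simp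
   then show ?case
    by (rule tendsto_sandwich[OF _ _ tendsto_const, rotated 2]) (auto intro!: always_eventually le)
  qed
  show "AE z in M. (%n. ?K n z) ----> v t z - x0 - drift v t z" using AE_N
  proof eventually_elim
   case (elim z)
   note z = elim
   have K: "?K n z = w (Suc n) t z - x0 - drift (w n) t z" for n by (simp add: wSuc picard_step_def)
   have "(%n. w n t z) ----> v t z" by (rule tendsto_uniform_limitI[OF unif'[OF z, of t]]) (use t in auto)
   then have 1: "(%n. w (Suc n) t z) ----> v t z" by (rule LIMSEQ_Suc)
   have "(%n. ennreal (t * L^2) * energy (%r z. w n r z - v r z) t z) ----> ennreal (t * L^2) * 0"
    by (intro ennreal_tendsto_cmult e0 z) simp
   then have "(%n. ennreal (t * L^2) * energy (%r z. w n r z - v r z) t z) ----> 0" by simp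
   note lim0 = this
   have le: "nsq (drift (w n) t z - drift v t z) <= ennreal (t * L^2) * energy (%r z. w n r z - v r z) t z" for n
    by (rule drift_diff_le) (use reg v z t in auto)
   from lim0 have "(%n. nsq (drift (w n) t z - drift v t z)) ----> 0"
    by (rule tendsto_sandwich[OF _ _ tendsto_const, rotated 2]) (auto intro!: always_eventually le)
   then have "(%n. (norm (drift (w n) t z - drift v t z))^2) ----> 0" by (simp add: ennreal_tendsto_0_iff)
   then have "(%n. sqrt ((norm (drift (w n) t z - drift v t z))^2)) ----> sqrt 0" by (rule tendsto_real_sqrt)
   then have "(%n. drift (w n) t z - drift v t z) ----> 0" by (simp add: tendsto_norm_zero_iff)
   then have "(%n. drift (w n) t z) ----> drift v t z" by (simp add: LIM_zero_iff)
   then show ?case unfolding K by (intro tendsto_diff 1 tendsto_const)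
  qed
 qed
 then show ?thesis using v unfolding solution_def by blast
qed

end

section \<open>A logarithmic Lyapunov function and its one-step expansion\<close>

text \<open>The difference of the two sides has derivative \<open>z ^ 3 / (1 + z)\<close>, so it
  decreases up to 0, vanishes there and increases afterwards.\<close>

lemma ln_le_cubic: fixes z :: real assumes "-1 < z" shows "ln (1 + z) <= z - z^2 / 2 + z ^ 3 / 3"
proof -
 define h where "h z = z - z^2 / 2 + z ^ 3 / 3 - ln (1 + z)" for z :: real
 have h': "(h has_real_derivative z ^ 3 / (1 + z)) (at z)" if "-1 < z" for z
 proof -
  have "(h has_real_derivative 1 - z + z^2 - 1 / (1 + z)) (at z)"
   unfolding h_def using that by (auto intro!: derivative_eq_intros simp: power2_eq_square power3_eq_cube field_simps)
  moreover have "1 - z + z^2 - 1 / (1 + z) = z ^ 3 / (1 + z)" using that by (simp add: field_simps power2_eq_square power3_eq_cube)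
  ultimately show ?thesis by simp
 qed
 have "h 0 <= h z"
 proof (cases "0 <= z")
  case True
  then show ?thesis
  proof (rule DERIV_nonneg_imp_nondecreasing)
   fix y :: real assume "0 <= y"
   then show "EX d. (h has_real_derivative d) (at y) & 0 <= d" using h'[of y] by (intro exI[of _ "y ^ 3 / (1 + y)"] conjI) auto
  qed
 next
  case False
  show ?thesis
  proof (rule DERIV_nonpos_imp_nonincreasing[of z 0 h])
   fix y assume "z <= y" "y <= 0"
   moreover have "y ^ 3 <= 0" using \<open>y <= 0\<close> by (simp add: power3_eq_cube mult_nonneg_nonpos mult_nonpos_nonpos)
   ultimately show "EX d. (h has_real_derivative d) (at y) & d <= 0"
    using h'[of y] assms by (intro exI[of _ "y ^ 3 / (1 + y)"] conjI) (auto intro: divide_nonpos_nonneg)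
  qed (use False in simp)
 qed
 then show ?thesis by (simp add: h_def)
qed

text \<open>Continuing \<open>ln\<close> linearly below \<open>1\<close> keeps it concave and \<open>C\<^sup>1\<close>, and makes the Lyapunov function
  \<open>llog (norm x)\<^sup>2\<close> smooth at \<open>0\<close>.\<close>

definition llog :: "real => real" where "llog y = (if y <= 1 then y - 1 else ln y)"

text \<open>The tangent line of a concave function lies above it; \<open>1 / max 1 y\<close> is the
  slope of \<open>llog\<close> at \<open>y\<close>.\<close>

lemma llog_concave: assumes "0 <= y" "0 <= y'" shows "llog y' <= llog y + (y' - y) / max 1 y"
proof (cases "1 <= y")
 case True
 then have "ln y' <= ln y + (y' - y) / y" if "0 < y'" using ln_le_minus_one[of "y' / y"] that by (simp add: ln_div diff_divide_distrib)
 moreover have "y' - 1 <= ln y + (y' - y) / y" if "y' <= 1"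
 proof -
  have "- ln y <= 1 / y - 1" using ln_le_minus_one[of "1 / y"] True by (simp add: ln_div)
  moreover have "(y' - 1) * (1 - 1 / y) <= 0" using that True by (intro mult_nonpos_nonneg) auto
  moreover have "(y' - y) / y = y' / y - 1" using True by (simp add: diff_divide_distrib)
  moreover have "(y' - 1) * (1 - 1 / y) = y' - y' / y - 1 + 1 / y" by (simp add: algebra_simps diff_divide_distrib)
  ultimately show ?thesis by linarith
 qed
 moreover have "llog y = ln y" using True by (auto simp: llog_def)
 ultimately show ?thesis using True by (auto simp: llog_def max_def)
next
 case False
 then show ?thesis using ln_le_minus_one[of y'] by (auto simp: llog_def max_def)
qed

text \<open>As long as \<open>y + q\<close> stays above 1 this is the expansion of
  \<open>ln\<close>. To fall onto the linear branch from \<open>y >= r^2\<close> the relative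
  increment must be at least \<open>1 - 1 / r^2\<close> in size, so its cube, suitably weighted,
  outweighs the 3/2 that \<open>z - z^2 / 2\<close> can be short of 0. This is where
  \<open>r > 1\<close> is needed.\<close>

lemma llog_cubic: assumes r: "1 < r" and y: "r^2 <= y" and "0 <= y + q"
 shows "llog (y + q) <= llog y + q / y - (q / y)^2 / 2 + (1 / 3 + 3 / (2 * (1 - 1 / r^2) ^ 3)) * \<bar>q / y\<bar> ^ 3"
proof -
 define z where "z = q / y"
 define z0 where "z0 = 1 - 1 / r^2"
 have r2: "1 < r^2" using r by (simp add: one_less_power)
 then have y1: "1 < y" using y by linarith
 have z0: "0 < z0" using r2 by (simp add: z0_def divide_less_eq)
 have q: "y + q = y * (1 + z)" using y1 by (simp add: z_def distrib_left)
 have ly: "llog y = ln y" "0 < ln y" using y1 by (auto simp: llog_def)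
 have c0: "0 <= 3 / (2 * z0 ^ 3)" using z0 by simp
 have "llog (y + q) <= ln y + z - z^2 / 2 + (1 / 3 + 3 / (2 * z0 ^ 3)) * \<bar>z\<bar> ^ 3"
 proof (cases "y + q <= 1")
  case False
  then have "0 < y * (1 + z)" using q by simp
  then have z: "-1 < z" using y1 by (simp add: zero_less_mult_iff)
  have "llog (y + q) = ln y + ln (1 + z)" using False q y1 z by (simp add: llog_def ln_mult)
  also have "... <= ln y + (z - z^2 / 2 + z ^ 3 / 3)" using ln_le_cubic[OF z] by simp
  also have "z ^ 3 <= \<bar>z\<bar> ^ 3" by (simp flip: power_abs)
  finally show ?thesis using mult_nonneg_nonneg[OF c0, of "\<bar>z\<bar> ^ 3"] by (simp add: distrib_right)
 next
  case True
  have "1 + z <= 1 / y" using True q y1 by (simp add: field_simps)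
  also have "1 / y <= 1 / r^2" using y r2 y1 by (intro divide_left_mono mult_pos_pos) auto
  finally have zz: "z0 <= - z" by (simp add: z0_def)
  have "0 <= y * (1 + z)" using assms(3) q by simp
  then have "- 1 <= z" using y1 by (simp add: zero_le_mult_iff)
  then have "\<bar>z\<bar> <= 1" using zz z0 by linarith
  then have "z^2 <= 1" by (simp add: abs_square_le_1)
  have "z0 ^ 3 <= \<bar>z\<bar> ^ 3" using zz z0 by (intro power_mono) auto
  then have "3 / 2 <= 3 / (2 * z0 ^ 3) * \<bar>z\<bar> ^ 3" using z0 by (simp add: field_simps)
  moreover have "0 <= \<bar>z\<bar> ^ 3" by simp
  ultimately have "3 / 2 <= (1 / 3 + 3 / (2 * z0 ^ 3)) * \<bar>z\<bar> ^ 3" unfolding distrib_right by linarith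
  moreover have "llog (y + q) <= 0" using True by (simp add: llog_def)
  ultimately show ?thesis using ly \<open>- 1 <= z\<close> \<open>z^2 <= 1\<close> by linarith
 qed
 then show ?thesis by (simp add: ly z_def z0_def)
qed

lemma power3_sum_le: fixes a b c :: real assumes "0 <= a" "0 <= b" "0 <= c" shows "(a + b + c) ^ 3 <= 27 * (a ^ 3 + b ^ 3 + c ^ 3)"
proof -
 define m where "m = max a (max b c)"
 have "(a + b + c) ^ 3 <= (3 * m) ^ 3" using assms by (intro power_mono) (auto simp: m_def)
 also have "... = 27 * m ^ 3" by (simp add: power_mult_distrib)
 also have "m ^ 3 <= a ^ 3 + b ^ 3 + c ^ 3" using assms by (auto simp: m_def max_def)
 finally show ?thesis by simp
qed

text \<open>The terms linear in \<open>d\<close> and in \<open>d\<^sup>2 - D\<close> have mean zero when \<open>d\<close> is a Brownian increment over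
  a time step \<open>D\<close>; the last line is of higher order.\<close>

lemma llog_step: fixes x b g :: "'b::real_inner" assumes r: "1 < r" and D: "0 <= D" "D <= 1" and C: "1 <= C" "norm b <= C" "norm g <= C"
  and small: "norm x < r ==> 2 * (x \<bullet> b) + (norm g)^2 <= K"
  and large: "r <= norm x ==> 2 * (x \<bullet> b) + (norm g)^2 - 2 * (x \<bullet> g)^2 / (norm x)^2 <= K * (norm x)^2"
  and K: "0 <= K" and m: "m = 1 / max 1 ((norm x)^2)" and Q: "Q = C^2 + 8 * C ^ 3 + (1 / 3 + 3 / (2 * (1 - 1 / r^2) ^ 3)) * (1728 * C ^ 6)"
 shows "llog ((norm (x + D *R b + d *R g))^2) <= llog ((norm x)^2) + K * D + 2 * m * (x \<bullet> g + D * (b \<bullet> g)) * d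
  + (m * (norm g)^2 - (if r <= norm x then 2 * m^2 * (x \<bullet> g)^2 else 0)) * (d^2 - D)
  + Q * (D^2 + \<bar>d\<bar> * D + \<bar>d\<bar> ^ 3 + D ^ 3 + d ^ 6)"
proof -
 define y where "y = (norm x)^2"
 define xb xg bg bb gg where "xb = x \<bullet> b" and "xg = x \<bullet> g" and "bg = b \<bullet> g" and "bb = (norm b)^2" and "gg = (norm g)^2"
 define q where "q = 2 * D * xb + 2 * d * xg + D^2 * bb + 2 * D * d * bg + d^2 * gg"
 have yq: "(norm (x + D *R b + d *R g))^2 = y + q" unfolding y_def q_def xb_def xg_def bg_def bb_def gg_def power2_norm_eq_inner
  by (simp add: inner_add_left inner_add_right inner_commute power2_eq_square algebra_simps)
 have y0: "0 <= y" "0 <= y + q" using yq[symmetric] by (auto simp: y_def)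
 have m01: "0 < m" "m <= 1" unfolding m by auto
 have bb: "0 <= bb" "bb <= C^2" and gg: "0 <= gg" "gg <= C^2" using C by (auto simp: bb_def gg_def intro!: power_mono)
 have bg: "\<bar>bg\<bar> <= C^2"
 proof -
  have "\<bar>bg\<bar> <= norm b * norm g" unfolding bg_def by (rule Cauchy_Schwarz_ineq2)
  also have "... <= C * C" using C by (intro mult_mono) auto
  finally show ?thesis by (simp add: power2_eq_square)
 qed
 have z0: "0 < 1 - 1 / r^2" using r by (simp add: one_less_power)
 define c where "c = 1 / 3 + 3 / (2 * (1 - 1 / r^2) ^ 3)"
 have c: "0 <= c" using z0 by (simp add: c_def)
 define err where "err = D^2 + \<bar>d\<bar> * D + \<bar>d\<bar> ^ 3 + D ^ 3 + d ^ 6"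
 have d6: "0 <= d ^ 6" by simp
 have err: "0 <= \<bar>d\<bar> * D" "0 <= \<bar>d\<bar> ^ 3" "0 <= D ^ 3" "0 <= D^2" using D by auto
 have mbb: "m * D^2 * bb <= C^2 * D^2"
 proof -
  have "m * bb <= 1 * C^2" using m01 bb by (intro mult_mono) auto
  then show ?thesis using mult_right_mono[of "m * bb" "C^2" "D^2"] by (simp add: mult.commute mult.left_commute)
 qed
 have Qc: "Q = C^2 + 8 * C ^ 3 + c * (1728 * C ^ 6)" by (simp add: Q c_def)
 show ?thesis
 proof (cases "r <= norm x")
  case False
  \<comment> \<open>Below \<open>r\<close> the first-order bound is enough, since hypothesis
    \<open>small\<close> does not rely on the negative second-order term.\<close>
  have "llog (y + q) <= llog y + q * m" using llog_concave[OF y0] by (simp add: m y_def)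
  also have "q * m = D * (m * (2 * xb + gg)) + 2 * m * (xg + D * bg) * d + m * gg * (d^2 - D) + m * D^2 * bb" by (simp add: q_def algebra_simps)
  also have "D * (m * (2 * xb + gg)) <= D * K"
  proof (rule mult_left_mono)
   have "2 * xb + gg <= K" using small False by (simp add: xb_def gg_def)
   then have "m * (2 * xb + gg) <= m * K" using m01 by (intro mult_left_mono) auto
   also have "... <= 1 * K" using m01 K by (intro mult_right_mono) auto
   finally show "m * (2 * xb + gg) <= K" by simp
  qed (rule D)
  also note mbb
  also have "C^2 * D^2 <= Q * err"
  proof (rule mult_mono)
   show "C^2 <= Q" using C c by (simp add: Qc)
   show "D^2 <= err" using err d6 by (simp add: err_def)
   show "0 <= Q" using C c by (simp add: Qc)
  qed simp
  finally show ?thesis using False unfolding yq err_def[symmetric] by (simp add: y_def[symmetric] xb_def xg_def bg_def gg_def bb_def mult.commute)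
 next
  case True
  have x1: "1 <= norm x" using True r by linarith
  have yr: "r^2 <= y" using True r by (auto simp: y_def intro!: power_mono)
  have y1: "1 <= y" unfolding y_def using x1 by (simp add: one_le_power)
  have my: "m = 1 / y" using y1 by (simp add: m y_def max_def)
  have nm: "norm x * m <= 1"
  proof -
   have "norm x * m = 1 / norm x" using x1 by (simp add: my y_def power2_eq_square)
   then show ?thesis using x1 by (simp add: divide_le_eq)
  qed
  have xm: "\<bar>x \<bullet> h\<bar> * m <= C" if "norm h <= C" for h
  proof -
   have "\<bar>x \<bullet> h\<bar> * m <= (norm x * norm h) * m" using m01 by (intro mult_right_mono Cauchy_Schwarz_ineq2) auto
   also have "... = (norm x * m) * norm h" by simp
   also have "... <= 1 * C" using nm that C m01 by (intro mult_mono) auto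
   finally show ?thesis by simp
  qed
  \<comment> \<open>The relative increment is split into \<open>\<alpha> * d\<close>, of the order
    of a Brownian increment, whose square yields the negative second-order term, and a rest
    \<open>e\<close> of order \<open>D + d^2\<close>.\<close>
  define z \<alpha> e where "z = q / y" and "\<alpha> = 2 * m * xg" and "e = m * (2 * D * xb + D^2 * bb + 2 * D * d * bg + d^2 * gg)"
  have "z = m * q" by (simp add: z_def my)
  then have z: "z = \<alpha> * d + e" by (simp add: q_def \<alpha>_def e_def algebra_simps)
  have \<alpha>: "\<bar>\<alpha>\<bar> <= 2 * C" using xm[OF C(3)] m01 by (simp add: \<alpha>_def abs_mult xg_def mult.commute)
  have C2: "C <= C^2" using C by (simp add: power2_eq_square)
  have e: "\<bar>e\<bar> <= 4 * C^2 * (D + d^2)"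
  proof -
   have 1: "\<bar>m * (2 * D * xb)\<bar> <= 2 * D * C^2"
   proof -
    have "\<bar>m * (2 * D * xb)\<bar> = 2 * D * (\<bar>xb\<bar> * m)" using D m01 by (simp add: abs_mult)
    also have "... <= 2 * D * C^2" using xm[OF C(2)] C2 D by (intro mult_left_mono) (auto simp: xb_def)
    finally show ?thesis .
   qed
   have 2: "\<bar>m * (D^2 * bb)\<bar> <= D * C^2"
   proof -
    have "D^2 <= D" using D by (simp add: power2_eq_square mult_left_le)
    then have "C^2 * D^2 <= C^2 * D" by (intro mult_left_mono) auto
    then show ?thesis using mbb m01 bb by (simp add: abs_mult mult.commute mult.left_commute)
   qed
   have 3: "\<bar>m * (2 * D * d * bg)\<bar> <= (D + d^2) * C^2"
   proof -
    have "2 * \<bar>d\<bar> * D <= d^2 + D^2" using sum_squares_bound[of "\<bar>d\<bar>" D] by simp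
    also have "D^2 <= D" using D by (simp add: power2_eq_square mult_left_le)
    finally have *: "2 * D * \<bar>d\<bar> <= D + d^2" by (simp add: mult.commute mult.left_commute)
    have "\<bar>m * (2 * D * d * bg)\<bar> = m * ((2 * D * \<bar>d\<bar>) * \<bar>bg\<bar>)" using D m01 by (simp add: abs_mult)
    also have "... <= 1 * ((D + d^2) * C^2)" using m01 * bg D by (intro mult_mono) auto
    finally show ?thesis by simp
   qed
   have 4: "\<bar>m * (d^2 * gg)\<bar> <= d^2 * C^2"
   proof -
    have "\<bar>m * (d^2 * gg)\<bar> = m * (d^2 * gg)" using m01 gg by simp
    also have "... <= 1 * (d^2 * C^2)" using m01 gg by (intro mult_mono) auto
    finally show ?thesis by simp
   qed
   have "e = m * (2 * D * xb) + m * (D^2 * bb) + m * (2 * D * d * bg) + m * (d^2 * gg)" by (simp add: e_def distrib_left)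
   then have "\<bar>e\<bar> <= 2 * D * C^2 + D * C^2 + (D + d^2) * C^2 + d^2 * C^2" using 1 2 3 4 by linarith
   also have "... = 4 * C^2 * D + 2 * C^2 * d^2" by (simp add: algebra_simps)
   also have "... <= 4 * C^2 * (D + d^2)" using mult_nonneg_nonneg[of "C^2" "d^2"] by (simp add: distrib_left)
   finally show ?thesis .
  qed
  have ade: "\<bar>\<alpha> * d * e\<bar> <= 8 * C ^ 3 * (\<bar>d\<bar> * D + \<bar>d\<bar> ^ 3)"
  proof -
   have "\<bar>\<alpha> * d * e\<bar> = (\<bar>\<alpha>\<bar> * \<bar>e\<bar>) * \<bar>d\<bar>" by (simp add: abs_mult)
   also have "... <= ((2 * C) * (4 * C^2 * (D + d^2))) * \<bar>d\<bar>" using \<alpha> e C by (intro mult_right_mono mult_mono) auto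
   also have "... = 8 * C ^ 3 * (\<bar>d\<bar> * D + \<bar>d\<bar> * d^2)" by (simp add: power2_eq_square power3_eq_cube algebra_simps)
   also have "\<bar>d\<bar> * d^2 = \<bar>d\<bar> ^ 3" by (metis power2_abs power2_eq_square power3_eq_cube mult.assoc)
   finally show ?thesis .
  qed
  \<comment> \<open>The constant is \<open>4 ^ 3 * 27\<close>, from \<open>4 * C^2\<close> in the
    bound on \<open>z\<close> and from \<open>power3_sum_le\<close>.\<close>
  have z3: "\<bar>z\<bar> ^ 3 <= 1728 * C ^ 6 * (\<bar>d\<bar> ^ 3 + D ^ 3 + d ^ 6)"
  proof -
   have "\<bar>z\<bar> <= \<bar>\<alpha>\<bar> * \<bar>d\<bar> + \<bar>e\<bar>" unfolding z by (metis abs_mult abs_triangle_ineq)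
   also have "... <= 2 * C * \<bar>d\<bar> + 4 * C^2 * (D + d^2)" using \<alpha> e by (intro add_mono mult_right_mono) auto
   also have "2 * C * \<bar>d\<bar> <= 4 * C^2 * \<bar>d\<bar>" using C2 C by (intro mult_right_mono) auto
   finally have "\<bar>z\<bar> <= 4 * C^2 * (\<bar>d\<bar> + D + d^2)" by (simp add: distrib_left)
   then have "\<bar>z\<bar> ^ 3 <= (4 * C^2 * (\<bar>d\<bar> + D + d^2)) ^ 3" by (intro power_mono) auto
   also have "... = 64 * C ^ 6 * (\<bar>d\<bar> + D + d^2) ^ 3" by (simp add: power_mult_distrib flip: power_mult)
   also have "... <= 64 * C ^ 6 * (27 * (\<bar>d\<bar> ^ 3 + D ^ 3 + (d^2) ^ 3))" using D C by (intro mult_left_mono power3_sum_le) auto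
   also have "... = 1728 * C ^ 6 * (\<bar>d\<bar> ^ 3 + D ^ 3 + (d^2) ^ 3)" by (simp add: mult.assoc[symmetric])
   also have "(d^2) ^ 3 = d ^ 6" by (simp flip: power_mult)
   finally show ?thesis .
  qed
  have sq: "- (z^2 / 2) <= - (\<alpha>^2 * d^2 / 2) + \<bar>\<alpha> * d * e\<bar>"
  proof -
   have "z^2 = \<alpha>^2 * d^2 + 2 * (\<alpha> * d * e) + e^2" by (simp add: z power2_sum power_mult_distrib)
   moreover have "- \<bar>\<alpha> * d * e\<bar> <= \<alpha> * d * e" by linarith
   moreover have "0 <= e^2" by simp
   ultimately show ?thesis by linarith
  qed
  \<comment> \<open>Writing \<open>d^2\<close> as \<open>D + (d^2 - D)\<close>, the terms with
    \<open>D\<close> form exactly the expression bounded by \<open>large\<close>, including the gain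
    from \<open>- z^2 / 2\<close>.\<close>
  have main: "z - \<alpha>^2 * d^2 / 2 <= K * D + 2 * m * (xg + D * bg) * d + (m * gg - 2 * m^2 * xg^2) * (d^2 - D) + C^2 * D^2"
  proof -
   have "2 * xb + gg - 2 * xg^2 / y <= K * y" using large[OF True] by (simp add: xb_def gg_def xg_def y_def)
   then have "m * (2 * xb + gg - 2 * xg^2 / y) <= m * (K * y)" using m01 by (intro mult_left_mono) auto
   then have "m * (2 * xb + gg) - 2 * m^2 * xg^2 <= K" using y1 by (simp add: my right_diff_distrib power2_eq_square)
   then have "D * (m * (2 * xb + gg) - 2 * m^2 * xg^2) <= D * K" using D by (intro mult_left_mono) auto
   moreover have "z - \<alpha>^2 * d^2 / 2 = D * (m * (2 * xb + gg) - 2 * m^2 * xg^2) + 2 * m * (xg + D * bg) * d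
    + (m * gg - 2 * m^2 * xg^2) * (d^2 - D) + m * D^2 * bb" unfolding z \<alpha>_def e_def by (simp add: algebra_simps power2_eq_square)
   ultimately show ?thesis using mbb by (simp add: mult.commute)
  qed
  have cz: "c * \<bar>z\<bar> ^ 3 <= c * (1728 * C ^ 6 * (\<bar>d\<bar> ^ 3 + D ^ 3 + d ^ 6))" by (intro mult_left_mono z3 c)
  have "llog (y + q) <= llog y + z - z^2 / 2 + c * \<bar>z\<bar> ^ 3" using llog_cubic[OF r yr y0(2)] by (simp add: z_def c_def)
  also have "... <= llog y + K * D + 2 * m * (xg + D * bg) * d + (m * gg - 2 * m^2 * xg^2) * (d^2 - D)
   + (C^2 * D^2 + 8 * C ^ 3 * (\<bar>d\<bar> * D + \<bar>d\<bar> ^ 3) + c * (1728 * C ^ 6 * (\<bar>d\<bar> ^ 3 + D ^ 3 + d ^ 6)))"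
   using sq main ade cz by linarith
  also have "C^2 * D^2 + 8 * C ^ 3 * (\<bar>d\<bar> * D + \<bar>d\<bar> ^ 3) + c * (1728 * C ^ 6 * (\<bar>d\<bar> ^ 3 + D ^ 3 + d ^ 6))
   <= C^2 * err + 8 * C ^ 3 * err + c * (1728 * C ^ 6) * err"
  proof -
   have "D^2 <= err" "\<bar>d\<bar> * D + \<bar>d\<bar> ^ 3 <= err" "\<bar>d\<bar> ^ 3 + D ^ 3 + d ^ 6 <= err"
    using err d6 unfolding err_def by linarith+
   moreover have "0 <= c * (1728 * C ^ 6)" using c C by simp
   ultimately show ?thesis using C unfolding mult.assoc[symmetric] by (intro add_mono mult_left_mono) auto
  qed
  also have "C^2 * err + 8 * C ^ 3 * err + c * (1728 * C ^ 6) * err = Q * err" by (simp add: Qc distrib_right)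
  finally show ?thesis using True unfolding yq err_def[symmetric] by (simp add: y_def[symmetric] xg_def bg_def gg_def)
 qed
qed

section \<open>Localised second-moment estimates\<close>

context wiener begin

text \<open>Closedness in time reduces the uncountable quantifier to dyadic times, which gives
  measurability, and it also yields the left continuity of the cutoff. Sampling at
  \<open>min t\<close> of a grid point never looks beyond \<open>t\<close> and includes
  \<open>t\<close> itself.\<close>

lemma cutoff_pred: assumes P: "!!q. 0 <= q ==> Measurable.pred (\<F> q) (P q)" and cl: "!!w. w : space M ==> closed {q. 0 <= q & P q w}"
 shows "cutoff (%t w. if ALL q:{0..t}. P q w then 1 else 0)"
proof (rule cutoffI)
 have lim: "P q w" if "w : space M" "0 <= q" "!!p. P (kap p q) w" for q w
  using closed_sequentially[OF cl[OF that(1)], of "%p. kap p q" q] that kap_nonneg[OF that(2)] kap_lim[of q] by simp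
 show "adapted (%t w. if ALL q:{0..t}. P q w then 1 else 0 :: real)" unfolding adapted_def
 proof (intro allI impI)
  fix t :: real assume t: "0 <= t"
  have [measurable]: "Measurable.pred (\<F> t) (P (min t (real i / 2 ^ p)))" for i p :: nat by (rule F_mono[OF P]) (use t in auto)
  have "(%w. if ALL i p::nat. P (min t (real i / 2 ^ p)) w then 1 else 0 :: real) : borel_measurable (\<F> t)" by measurable
  also have "?this \<longleftrightarrow> (%w. if ALL q:{0..t}. P q w then 1 else 0 :: real) : borel_measurable (\<F> t)"
  proof (rule measurable_cong)
   fix w assume "w : space (\<F> t)"
   then have w: "w : space M" using space_F[OF t] by simp
   have "(ALL i p::nat. P (min t (real i / 2 ^ p)) w) \<longleftrightarrow> (ALL q:{0..t}. P q w)"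
   proof
    assume *: "ALL i p::nat. P (min t (real i / 2 ^ p)) w"
    show "ALL q:{0..t}. P q w"
    proof
     fix q assume q: "q : {0..t}"
     have "P (kap p q) w" for p
     proof -
      have "kap p q = min t (real (nat \<lfloor>q * 2 ^ p\<rfloor>) / 2 ^ p)" using kap_le[of p q] q by (simp add: kap_def min_def)
      then show ?thesis using * by simp
     qed
     then show "P q w" using lim[OF w, of q] q by simp
    qed
   qed (use t in auto)
   then show "(if ALL i p::nat. P (min t (real i / 2 ^ p)) w then 1 else 0 :: real) = (if ALL q:{0..t}. P q w then 1 else 0)" by simp
  qed
  finally show "(%w. if ALL q:{0..t}. P q w then 1 else 0 :: real) : borel_measurable (\<F> t)" .
 qed
 show "(if ALL q:{0..t}. P q w then 1 else 0) = (1::real)"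
  if w: "w : space M" "0 <= t" and 1: "!!p. (if ALL q:{0..kap p t}. P q w then 1 else 0) = (1::real)" for w t
 proof -
  have *: "P q w" if "0 <= q" "q <= kap p t" for q p using 1[of p] that by (auto split: if_splits)
  have "P q w" if q: "0 <= q" "q <= t" for q
  proof (cases "q = t")
   case True
   have "P (kap p t) w" for p by (rule *[of _ p]) (use w kap_nonneg in auto)
   then show ?thesis using lim[OF w] True by simp
  next
   case False
   then have "eventually (%p. q < kap p t) sequentially" using q kap_lim[of t] by (simp add: order_tendsto_iff)
   then obtain p where "q < kap p t" using eventually_happens by force
   then show ?thesis using *[of q p] q by simp
  qed
  then show ?thesis by simp
 qed
qed auto

text \<open>Where the cutoff still equals 1 at \<open>t\<close> it can be inserted into the drift
  integral for free; Cauchy-Schwarz bounds that integral and \<open>ito_bound\<close> the stochastic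
  one. The 4 is 2 from splitting the square times 2 from \<open>ito_bound\<close>.\<close>

lemma local_estimate: fixes D :: "'a => 'b::{sep_inner, banach}"
 assumes th: "cutoff th" and J: "ito t h J" and f: "prog f"
  and D: "AE w in M. set_integrable lborel {0..t} (%r. f r w) & D w = (LINT r:{0..t}|lborel. f r w) + J w"
 shows "(EE w. ennreal (th t w * (norm (D w))^2))
  <= ennreal (2 * t) * (EE w. energy (%r w. th r w *R f r w) t w)
   + 4 * (EE w. energy (%r w. th r w *R h r w) t w)"
proof -
 note t = ito_nonneg[OF J]
 have [measurable]: "th t : borel_measurable M" "J : borel_measurable M"
  using adapted_M[OF lcad_adapted[OF cutoff_lcad[OF th]] t] ito_measurable[OF J] by auto
 have [measurable]: "energy (%r w. th r w *R f r w) t : borel_measurable M"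
  by (intro energy_measurable_M prog_scaleR lcad_prog cutoff_lcad th f t)
 have "(EE w. ennreal (th t w * (norm (D w))^2))
  <= (EE w. 2 * (ennreal t * energy (%r w. th r w *R f r w) t w) + 2 * ennreal (th t w * (norm (J w))^2))"
 proof (rule nn_integral_mono_AE, use D AE_space in eventually_elim)
  fix w assume *: "set_integrable lborel {0..t} (%r. f r w) & D w = (LINT r:{0..t}|lborel. f r w) + J w" and w: "w : space M"
  show "ennreal (th t w * (norm (D w))^2) <= 2 * (ennreal t * energy (%r w. th r w *R f r w) t w) + 2 * ennreal (th t w * (norm (J w))^2)"
  proof (cases "th t w = 1")
   case True
   have one: "th r w = 1" if "0 <= r" "r <= t" for r using cutoff_antimono[OF th w that] cutoff_values[OF th w that(1)] True by auto
   have "nsq (D w) <= 2 * nsq (LINT r:{0..t}|lborel. f r w) + 2 * nsq (J w)"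
    using * by (simp only: ennreal_norm_add_le)
   also have "nsq (LINT r:{0..t}|lborel. f r w) <= ennreal t * energy f t w"
    unfolding energy_def using * by (intro set_integral_norm2_le t) auto
   also have "energy f t w = energy (%r w. th r w *R f r w) t w" by (rule energy_cong) (simp add: one)
   finally show ?thesis using True by (simp add: mult_left_mono add_mono)
  next
   case False
   then have "th t w = 0" using cutoff_values[OF th w t] by auto
   then show ?thesis by simp
  qed
 qed
 also have "... = 2 * (ennreal t * (EE w. energy (%r w. th r w *R f r w) t w))
  + 2 * (EE w. ennreal (th t w * (norm (J w))^2))" by (simp add: nn_integral_add nn_integral_cmult)
 also have "... <= 2 * (ennreal t * (EE w. energy (%r w. th r w *R f r w) t w))
  + 2 * (2 * (EE w. energy (%r w. th r w *R h r w) t w))"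
  by (intro add_left_mono mult_left_mono ito_bound[OF J th]) auto
 also have "... = ennreal (2 * t) * (EE w. energy (%r w. th r w *R f r w) t w)
   + 4 * (EE w. energy (%r w. th r w *R h r w) t w)"
  using t by (simp add: numeral_mult_ennreal mult.assoc[symmetric])
 finally show ?thesis .
qed

end

section \<open>Exit probabilities by an Euler scheme\<close>

lemma llog_ge: "0 <= y ==> - 1 <= llog y" by (auto simp: llog_def intro: order_trans[OF _ ln_ge_zero])

lemma llog_le: "0 <= y ==> llog y <= y" using ln_le_minus_one[of y] by (auto simp: llog_def)

lemma llog_ge_ln: "1 <= c ==> c <= y ==> ln c <= llog y" by (cases "y = 1") (auto simp: llog_def)

lemma llog_measurable [measurable]: "llog : borel_measurable borel" unfolding llog_def[abs_def] by measurable

lemma step_integral: fixes h :: "real => 'b::{banach, second_countable_topology}"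
 shows "has_bochner_integral lborel (%r. indicator {0..real i / 2 ^ p} r *R h (kap p r)) (\<Sum>j<i. (1 / 2 ^ p) *R h (real j / 2 ^ p))"
proof -
 have "has_bochner_integral lborel (%r. \<Sum>j<i. indicator {real j / 2 ^ p..<real (Suc j) / 2 ^ p} r *R h (real j / 2 ^ p))
  (\<Sum>j<i. (1 / 2 ^ p) *R h (real j / 2 ^ p))"
 proof (rule has_bochner_integral_sum)
  fix j
  have "has_bochner_integral lborel (indicator {real j / 2 ^ p..<real (Suc j) / 2 ^ p} :: real => real) (1 / 2 ^ p)"
   using has_bochner_integral_real_indicator[of "{real j / 2 ^ p..<real (Suc j) / 2 ^ p}" lborel]
   by (simp add: divide_right_mono diff_divide_distrib[symmetric])
  then show "has_bochner_integral lborel (%r. indicator {real j / 2 ^ p..<real (Suc j) / 2 ^ p} r *R h (real j / 2 ^ p))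
   ((1 / 2 ^ p) *R h (real j / 2 ^ p))" by (rule has_bochner_integral_scaleR_left)
 qed
 also have "(%r. \<Sum>j<i. indicator {real j / 2 ^ p..<real (Suc j) / 2 ^ p} r *R h (real j / 2 ^ p))
  = (%r. indicator {0..<real i / 2 ^ p} r *R h (kap p r))"
 proof
  fix r
  show "(\<Sum>j<i. indicator {real j / 2 ^ p..<real (Suc j) / 2 ^ p} r *R h (real j / 2 ^ p))
   = indicator {0..<real i / 2 ^ p} r *R h (kap p r)"
  proof (induction i)
   case (Suc i)
   have eq: "indicator {0..<real (Suc i) / 2 ^ p} r = indicator {0..<real i / 2 ^ p} r + (indicator {real i / 2 ^ p..<real (Suc i) / 2 ^ p} r :: real)"
    using divide_right_mono[of "real i" "real (Suc i)" "2 ^ p"] by (auto simp: indicator_def intro: order_trans[of 0 "real i / 2 ^ p"])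
   have "indicator {real i / 2 ^ p..<real (Suc i) / 2 ^ p} r *R h (real i / 2 ^ p)
    = indicator {real i / 2 ^ p..<real (Suc i) / 2 ^ p} r *R h (kap p r)" by (auto simp: indicator_def kap_eqI)
   then show ?case by (simp only: sum.lessThan_Suc Suc.IH eq scaleR_left_distrib)
  qed simp
 qed
 finally have 1: "has_bochner_integral lborel (%r. indicator {0..<real i / 2 ^ p} r *R h (kap p r)) (\<Sum>j<i. (1 / 2 ^ p) *R h (real j / 2 ^ p))" .
 have "has_bochner_integral lborel (%r. indicator {real i / 2 ^ p} r *R h (real i / 2 ^ p)) (0 *R h (real i / 2 ^ p))"
  using has_bochner_integral_real_indicator[of "{real i / 2 ^ p}" lborel] by (intro has_bochner_integral_scaleR_left) simp
 from has_bochner_integral_add[OF 1 this]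
 have 2: "has_bochner_integral lborel (%r. indicator {0..<real i / 2 ^ p} r *R h (kap p r) + indicator {real i / 2 ^ p} r *R h (real i / 2 ^ p))
  (\<Sum>j<i. (1 / 2 ^ p) *R h (real j / 2 ^ p))" by simp
 have "indicator {0..<real i / 2 ^ p} r *R h (kap p r) + indicator {real i / 2 ^ p} r *R h (real i / 2 ^ p)
  = indicator {0..real i / 2 ^ p} r *R h (kap p r)" for r by (auto simp: indicator_def)
 with 2 show ?thesis by simp
qed

context lipschitz_sde begin

text \<open>The coefficients are evaluated along the solution \<open>v\<close> and not along the
  scheme, so the distance to \<open>v\<close> is a pure sampling error and no Gronwall argument is
  required.\<close>

definition euler :: "(real => 'a => 'b) => nat => nat => 'a => 'b"
 where "euler v p i w = x0 + (\<Sum>j<i. (1 / 2 ^ p) *R b (real j / 2 ^ p) (v (real j / 2 ^ p) w)) + dint p (G v) (real i / 2 ^ p) w"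

definition mesh_error :: "(real => 'a => 'b) => real => nat => ennreal"
 where "mesh_error v T p = ennreal (2 * T) * (EE w. energy (%r w. b (kap p r) (v (kap p r) w) - b r (v r w)) T w)
  + 4 * (EE w. energy (%r w. G v (kap p r) w - G v r w) T w)"

lemma euler_Suc: "euler v p (Suc i) w = euler v p i w + (1 / 2 ^ p) *R b (real i / 2 ^ p) (v (real i / 2 ^ p) w)
  + (W (real (Suc i) / 2 ^ p) w - W (real i / 2 ^ p) w) *R g (real i / 2 ^ p) (v (real i / 2 ^ p) w)"
 unfolding euler_def dint_grid grid_sum_def by (simp add: add_ac)

lemma euler_0: "euler v p 0 w = x0" unfolding euler_def dint_grid grid_sum_def by simp

lemma euler_measurable: assumes v: "regular v" shows "euler v p i : borel_measurable (\<F> (real i / 2 ^ p))"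
proof -
 have [measurable]: "dint p (G v) (real i / 2 ^ p) : borel_measurable (\<F> (real i / 2 ^ p))" by (intro dint_measurable G_adapted v) simp
 have "(%w. b (real j / 2 ^ p) (v (real j / 2 ^ p) w)) : borel_measurable (\<F> (real i / 2 ^ p))" if "j < i" for j
  by (rule adaptedD[OF regular_adapted[OF b_regular[OF v]]]) (use that in \<open>auto intro: divide_right_mono\<close>)
 then show ?thesis unfolding euler_def[abs_def] by (intro borel_measurable_add borel_measurable_sum borel_measurable_scaleR) (auto simp: lessThan_iff)
qed

lemma euler_error: assumes v: "solution v" and T: "real i / 2 ^ p <= T"
 shows "(EE w. nsq (euler v p i w - v (real i / 2 ^ p) w)) <= mesh_error v T p"
proof -
 let ?t = "real i / 2 ^ p"
 let ?f = "%u w. b (kap p u) (v (kap p u) w) - b u (v u w)"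
 have r: "regular v" using v by (simp add: solution_def)
 have J: "ito ?t (%u w. G v (kap p u) w - G v u w) (%w. dint p (G v) ?t w - (v ?t w - x0 - drift v ?t w))"
  using v by (intro ito_diff[OF ito_simple[OF simple_dyadic]] G_adapted G_bdd r) (auto simp: solution_def)
 have f: "prog ?f" by (intro prog_diff lcad_prog lcad_kap[where Y="%u w. b u (v u w)"] regular_lcad regular_adapted b_regular r)
 have D: "set_integrable lborel {0..?t} (%u. ?f u w) & euler v p i w - v ?t w
  = (LINT u:{0..?t}|lborel. ?f u w) + (dint p (G v) ?t w - (v ?t w - x0 - drift v ?t w))" if "w : space M" for w
 proof -
  note s = step_integral[of i p "%u. b u (v u w)"]
  have 1: "set_integrable lborel {0..?t} (%u. b (kap p u) (v (kap p u) w))"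
   unfolding set_integrable_def using s by (rule has_bochner_integral_iff[THEN iffD1, THEN conjunct1])
  note 2 = b_integrable[OF r that, of ?t]
  have "(LINT u:{0..?t}|lborel. b (kap p u) (v (kap p u) w)) = (\<Sum>j<i. (1 / 2 ^ p) *R b (real j / 2 ^ p) (v (real j / 2 ^ p) w))"
   unfolding set_lebesgue_integral_def by (rule has_bochner_integral_integral_eq[OF s])
  then have "(LINT u:{0..?t}|lborel. ?f u w) = (\<Sum>j<i. (1 / 2 ^ p) *R b (real j / 2 ^ p) (v (real j / 2 ^ p) w)) - drift v ?t w"
   using set_integral_diff(2)[OF 1 2] by (simp add: drift_def)
  then show ?thesis using set_integral_diff(1)[OF 1 2] by (simp add: euler_def)
 qed
 have "(EE w. ennreal (1 * (norm (euler v p i w - v ?t w))^2))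
  <= ennreal (2 * ?t) * (EE w. energy (%u w. 1 *R ?f u w) ?t w)
   + 4 * (EE w. energy (%u w. 1 *R (G v (kap p u) w - G v u w)) ?t w)"
  by (rule local_estimate[OF cutoff_const J f]) (use D in \<open>auto intro: AE_I2\<close>)
 also have "... <= mesh_error v T p" unfolding mesh_error_def scaleR_one using T
  by (intro add_mono mult_mono nn_integral_mono energy_mono_time ennreal_leI) auto
 finally show ?thesis by simp
qed

lemma mesh_error_lim: assumes v: "regular v" and T: "0 <= T" shows "mesh_error v T ----> 0"
proof -
 have "(%p. (EE w. energy (%u w. b (kap p u) (v (kap p u) w) - b u (v u w)) T w))
  ----> (EE w. energy (%u w. 0 :: 'b) T w)"
 proof (rule energy_dominated[where C="2 * C"])
  note r = b_regular[OF v]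
  show "prog (%u w. b (kap p u) (v (kap p u) w) - b u (v u w))" for p
   by (intro prog_diff lcad_prog lcad_kap[where Y="%u w. b u (v u w)"] regular_lcad regular_adapted r)
  show "prog (%u w. 0 :: 'b)" by (rule prog_deterministic) simp
  show "norm (b (kap p u) (v (kap p u) w) - b u (v u w)) <= 2 * C" for p u w using norm_triangle_ineq4[of "b (kap p u) (v (kap p u) w)" "b u (v u w)"]
    b_bound[of "kap p u" "v (kap p u) w"] b_bound[of u "v u w"] by simp
  show "(%p. b (kap p u) (v (kap p u) w) - b u (v u w)) ----> 0" if "0 <= u" "w : space M" for u w
   using lcadD[OF regular_lcad[OF r] that(2,1)] by (rule LIM_zero)
 qed (fact T)
 then have "(%p. (EE w. energy (%u w. b (kap p u) (v (kap p u) w) - b u (v u w)) T w)) ----> 0"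
  by (simp add: energy_def)
 then have "(%p. mesh_error v T p) ----> ennreal (2 * T) * 0 + 4 * 0"
  unfolding mesh_error_def by (intro tendsto_add ennreal_tendsto_cmult mesh_limit[OF v T]) auto
 then show ?thesis by simp
qed

text \<open>The scheme tests the inequality at \<open>x\<close> with coefficients taken at
  \<open>y\<close>. With \<open>e = L * norm (y - x)\<close> the exchange costs
  \<open>2 * norm x * e\<close> in the drift, \<open>2 * C * e\<close> in the squared noise and, for
  large \<open>x\<close>, \<open>4 * C * e\<close> in the quotient. Since there
  \<open>norm x <= (norm x)^2\<close>, the sum stays proportional to the squared norm.\<close>

lemma lyapunov_perturb: assumes r: "1 < r" and small: "norm x < r ==> 2 * (x \<bullet> b t x) + (norm (g t x))^2 <= K"
  and large: "r <= norm x ==> 2 * (x \<bullet> b t x) + (norm (g t x))^2 - 2 * (x \<bullet> g t x)^2 / (norm x)^2 <= K * (norm x)^2"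
  and K': "K' = K + (2 * r + 6 * C) * L * norm (y - x)"
 shows "norm x < r ==> 2 * (x \<bullet> b t y) + (norm (g t y))^2 <= K'"
  and "r <= norm x ==> 2 * (x \<bullet> b t y) + (norm (g t y))^2 - 2 * (x \<bullet> g t y)^2 / (norm x)^2 <= K' * (norm x)^2"
proof -
 define e where "e = L * norm (y - x)"
 have e: "norm (b t y - b t x) <= e" "norm (g t y - g t x) <= e" unfolding e_def by (rule b_lip g_lip)+
 have e0: "0 <= e" using L_nonneg by (simp add: e_def)
 note C0 = C_nonneg
 have 1: "x \<bullet> b t y <= x \<bullet> b t x + norm x * e"
 proof -
  have "x \<bullet> (b t y - b t x) <= norm x * norm (b t y - b t x)" by (rule norm_cauchy_schwarz)
  also have "... <= norm x * e" by (intro mult_left_mono e) auto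
  finally show ?thesis by (simp add: inner_diff_right)
 qed
 have gs: "norm (g t y + g t x) <= 2 * C" using norm_triangle_ineq[of "g t y" "g t x"] g_bound[of t y] g_bound[of t x] by simp
 have 2: "(norm (g t y))^2 <= (norm (g t x))^2 + 2 * C * e"
 proof -
  have "(norm (g t y))^2 - (norm (g t x))^2 = (g t y + g t x) \<bullet> (g t y - g t x)"
   by (simp add: power2_norm_eq_inner inner_add_left inner_diff_right inner_commute[of "g t x" "g t y"])
  also have "... <= norm (g t y + g t x) * norm (g t y - g t x)" by (rule norm_cauchy_schwarz)
  also have "... <= (2 * C) * e" using C0 by (intro mult_mono gs e) auto
  finally show ?thesis by simp
 qed
 { assume x: "norm x < r"
  have "norm x * e <= r * e" using x e0 by (intro mult_right_mono) auto
  then have "2 * (x \<bullet> b t y) + (norm (g t y))^2 <= K + (2 * r + 2 * C) * e" using 1 2 small[OF x] by (simp add: distrib_right)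
  also have "... <= K + (2 * r + 6 * C) * e" using C0 e0 by (intro add_left_mono mult_right_mono) auto
  finally show "2 * (x \<bullet> b t y) + (norm (g t y))^2 <= K'" by (simp add: K' e_def mult.assoc) }
 { assume x: "r <= norm x"
  then have x1: "1 < norm x" using r by linarith
  define n where "n = norm x"
  have n: "1 < n" "n <= n^2" "1 <= n^2" using x1 by (auto simp: n_def self_le_power one_le_power)
  have 3: "(x \<bullet> g t x)^2 - (x \<bullet> g t y)^2 <= n^2 * (2 * C * e)"
  proof -
   have "(x \<bullet> g t x)^2 - (x \<bullet> g t y)^2 = (x \<bullet> (g t y + g t x)) * (x \<bullet> (g t x - g t y))"
    by (simp add: inner_add_right inner_diff_right power2_eq_square algebra_simps)
   also have "... <= \<bar>x \<bullet> (g t y + g t x)\<bar> * \<bar>x \<bullet> (g t x - g t y)\<bar>" by (metis abs_ge_self abs_mult)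
   also have "... <= (n * norm (g t y + g t x)) * (n * norm (g t x - g t y))" unfolding n_def by (intro mult_mono Cauchy_Schwarz_ineq2) auto
   also have "... <= (n * (2 * C)) * (n * e)" using e(2) gs C0 n by (intro mult_mono) (auto simp: norm_minus_commute)
   finally show ?thesis by (simp add: power2_eq_square mult_ac)
  qed
  then have 4: "- (2 * (x \<bullet> g t y)^2 / n^2) <= - (2 * (x \<bullet> g t x)^2 / n^2) + 4 * C * e" using n by (simp add: field_simps)
  have "2 * (x \<bullet> b t y) + (norm (g t y))^2 - 2 * (x \<bullet> g t y)^2 / n^2 <= K * n^2 + 2 * (n * e) + 6 * (C * e)"
   using 1 2 4 large[OF x] unfolding n_def[symmetric] by linarith
  also have "... <= K * n^2 + 2 * (r * e * n^2) + 6 * (C * e * n^2)"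
  proof -
   have "n * e <= n^2 * e" using n e0 by (intro mult_right_mono) auto
   also have "... <= r * (n^2 * e)" using r e0 mult_right_mono[of 1 r "n^2 * e"] by simp
   finally have "n * e <= r * e * n^2" by (simp add: mult_ac)
   moreover have "C * e * 1 <= C * e * n^2" using n C0 e0 by (intro mult_left_mono) auto
   ultimately show ?thesis by simp
  qed
  also have "... = K' * n^2" by (simp add: K' e_def algebra_simps)
  finally show "2 * (x \<bullet> b t y) + (norm (g t y))^2 - 2 * (x \<bullet> g t y)^2 / (norm x)^2 <= K' * (norm x)^2" by (simp add: n_def) }
qed

text \<open>Up to a term linear in time, \<open>1 + llog\<close> of the squared norm is a
  non-negative supermartingale along the scheme, and on exit at level \<open>n\<close> it has
  reached \<open>1 + ln (n^2)\<close>; this gives the logarithmic tail. The term with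
  \<open>et\<close> is the price of \<open>lyapunov_perturb\<close>, the one with
  \<open>sqrt (1 / 2 ^ p)\<close> that of the higher-order remainder, and both vanish with the
  mesh.\<close>

lemma euler_tail: assumes v: "solution v" and r: "1 < r" and C1: "1 <= C" and K: "0 <= K"
  and small: "!!t x. 0 <= t ==> norm x < r ==> 2 * (x \<bullet> b t x) + (norm (g t x))^2 <= K" and large: "!!t x. 0 <= t ==> r <= norm x ==>
   2 * (x \<bullet> b t x) + (norm (g t x))^2 - 2 * (x \<bullet> g t x)^2 / (norm x)^2 <= K * (norm x)^2"
  and n: "1 <= n" and T: "real N / 2 ^ p <= T" and E: "mesh_error v T p <= ennreal (et^2)" "0 <= et"
  and Q: "Q = C^2 + 8 * C ^ 3 + (1 / 3 + 3 / (2 * (1 - 1 / r^2) ^ 3)) * (1728 * C ^ 6)"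
 shows "(1 + ln (n^2)) * measure M {w:space M. EX i<=N. n <= norm (euler v p i w)}
  <= 1 + llog ((norm x0)^2) + T * (K + (2 * r + 6 * C) * L * et + 20 * Q * sqrt (1 / 2 ^ p))"
proof -
 let ?t = "%i::nat. real i / 2 ^ p" and ?Y = "euler v p"
 define De s :: real where "De = 1 / 2 ^ p" and "s = sqrt (1 / 2 ^ p)"
 have s: "0 < s" "s <= 1" "De = s^2" by (simp_all add: s_def De_def)
 have De: "0 < De" "De <= 1" by (auto simp: De_def)
 have dt: "?t (Suc i) - ?t i = De" "?t i <= ?t (Suc i)" "0 <= ?t i" for i
  by (auto simp: De_def diff_divide_distrib[symmetric] intro: divide_right_mono)
 define D where "D = (2 * r + 6 * C) * L"
 have D: "0 <= D" using r C1 L_nonneg by (simp add: D_def)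
 have "0 < 1 - 1 / r^2" using r by (simp add: one_less_power)
 then have Q0: "0 <= Q" using C1 by (simp add: Q)
 \<comment> \<open>\<open>a i\<close> records that the scheme has stayed below \<open>n\<close> up
   to step \<open>i\<close>. The summand 1 in \<open>\<phi>\<close> below makes it non-negative, as
   \<open>llog\<close> is at least -1 on squared norms.\<close>
 define a where "a i w = (if ALL j<=i. norm (?Y j w) < n then 1 else 0 :: real)" for i w
 define \<phi> where "\<phi> i w = 1 + llog ((norm (?Y i w))^2)" for i w
 define be where "be = 1 + ln (n^2)"
 have rv: "regular v" using v by (simp add: solution_def)
 have YF: "?Y j : borel_measurable (\<F> (?t i))" if "j <= i" for i j
  by (rule F_mono[OF euler_measurable[OF rv]]) (use that in \<open>auto intro: divide_right_mono\<close>)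
 have aF: "a i : borel_measurable (\<F> (?t i))" for i
 proof -
  have [measurable]: "!!j. j : {..i} ==> ?Y j : borel_measurable (\<F> (?t i))" using YF by auto
  have "(%w. if ALL j:{..i}. norm (?Y j w) < n then 1 else 0 :: real) : borel_measurable (\<F> (?t i))" by measurable
  then show ?thesis by (simp add: a_def[abs_def] Ball_def)
 qed
 have [measurable]: "?Y i : borel_measurable M" "a i : borel_measurable M" for i using F_M[OF YF[OF order_refl]] F_M[OF aF] by auto
 have [measurable]: "\<phi> i : borel_measurable M" for i unfolding \<phi>_def[abs_def] by measurable
 have a01: "0 <= a i w" "a i w <= 1" and an: "norm (?Y i w) < n | a i w = 0" for i w by (auto simp: a_def)
 have \<phi>0: "0 <= \<phi> i w" for i w using llog_ge[of "(norm (?Y i w))^2"] by (simp add: \<phi>_def)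
 have be: "0 < be" using n by (simp add: be_def add_pos_nonneg)
 have \<phi>n: "be <= \<phi> i w" if "n <= norm (?Y i w)" for i w
  unfolding \<phi>_def be_def using that n by (intro add_left_mono llog_ge_ln power_mono) (auto simp: one_le_power)
 have bdd: "integrable M f" if "f : borel_measurable M" "!!w. w : space M ==> norm (f w) <= B" for f :: "'a => real" and B :: real
  using that by (intro integrable_const_bound[of f B]) (auto intro: AE_I2)
 have a\<phi>: "integrable M (%w. a i w * \<phi> i w)" for i
 proof (rule bdd)
  fix w
  have "a i w * \<phi> i w <= 1 + n^2"
  proof (cases "a i w = 0")
   case False
   then have "norm (?Y i w) < n" using an by blast
   then have "(norm (?Y i w))^2 <= n^2" by (intro power_mono) auto
   then have "\<phi> i w <= 1 + n^2" using llog_le[of "(norm (?Y i w))^2"] by (simp add: \<phi>_def)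
   then have "a i w * \<phi> i w <= 1 * (1 + n^2)" using a01[of i w] \<phi>0[of i w] by (intro mult_mono) auto
   then show ?thesis by simp
  qed simp
  then show "norm (a i w * \<phi> i w) <= 1 + n^2" using a01[of i w] \<phi>0[of i w] by simp
 qed measurable
 have a_int: "integrable M (a i)" for i by (rule bdd[of _ 1]) (use a01 in auto)
 \<comment> \<open>What is tracked is the mean of \<open>\<phi>\<close> before the exit plus
   \<open>be\<close> times the exit probability: after the exit, \<open>\<phi>\<close> is replaced
   by a value that it has at least reached.\<close>
 have step: "expectation (%w. a (Suc i) w * \<phi> (Suc i) w) + be * (expectation (a i) - expectation (a (Suc i)))
   <= expectation (%w. a i w * \<phi> i w) + De * (K + D * et + 20 * Q * s)" if i: "i < N" for i
 proof -
  define de where "de w = W (?t (Suc i)) w - W (?t i) w" for w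
  define x bb gg where "x w = ?Y i w" and "bb w = b (?t i) (v (?t i) w)" and "gg w = g (?t i) (v (?t i) w)" for w
  define e where "e w = norm (v (?t i) w - x w)" for w
  define m where "m w = 1 / max 1 ((norm (x w))^2)" for w
  define A where "A w = a i w * (2 * m w * (x w \<bullet> gg w + De * (bb w \<bullet> gg w)))" for w
let ?q = "%w. m w * (norm (gg w))^2 - (if r <= norm (x w) then 2 * (m w)^2 * (x w \<bullet> gg w)^2 else 0)" and ?er = "%w. De^2 + \<bar>de w\<bar> * De + \<bar>de w\<bar> ^ 3 + De ^ 3 + de w ^ 6"
  define B where "B w = a i w * ?q w" for w
  \<comment> \<open>The odd powers of the increment are replaced by even ones, whose moments are
    known, through Young's inequality balanced with \<open>s\<close>, the standard deviation of the
    increment.\<close>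
  define err where "err d = De^2 + s * (d^2 + De) / 2 + (s * d^2 + d ^ 4 / s) / 2 + De ^ 3 + d ^ 6" for d :: real
  have [measurable]: "x : borel_measurable (\<F> (?t i))" unfolding x_def[abs_def] by (rule YF) simp
  have [measurable]: "bb : borel_measurable (\<F> (?t i))" "gg : borel_measurable (\<F> (?t i))" "v (?t i) : borel_measurable (\<F> (?t i))" "a i : borel_measurable (\<F> (?t i))"
   unfolding bb_def[abs_def] gg_def[abs_def]
   using adaptedD[OF regular_adapted[OF b_regular[OF rv]]] adaptedD[OF G_adapted[OF rv]] adaptedD[OF regular_adapted[OF rv]] aF dt(3) by auto
  have AF: "A : borel_measurable (\<F> (?t i))" and BF: "B : borel_measurable (\<F> (?t i))" and eF: "e : borel_measurable (\<F> (?t i))"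
   unfolding A_def[abs_def] B_def[abs_def] e_def[abs_def] m_def by measurable
  note AM[measurable] = F_M[OF AF dt(3)] F_M[OF BF dt(3)] F_M[OF eF dt(3)]
  have xg: "m w * \<bar>x w \<bullet> gg w\<bar> <= C" and m1: "0 <= m w" "m w <= 1" for w
  proof -
   show m1: "0 <= m w" "m w <= 1" by (auto simp: m_def)
   have "m w * norm (x w) <= 1"
   proof (cases "norm (x w) <= 1")
    case True then show ?thesis using m1 by (intro mult_le_one) auto
   next
    case False
    then have "norm (x w) <= (norm (x w))^2" by (intro self_le_power) auto
    then show ?thesis using False by (simp add: m_def max_def divide_le_eq)
   qed
   then have "(m w * norm (x w)) * norm (gg w) <= 1 * C" using m1 g_bound by (intro mult_mono) (auto simp: gg_def)
   moreover have "m w * \<bar>x w \<bullet> gg w\<bar> <= m w * (norm (x w) * norm (gg w))" by (intro mult_left_mono Cauchy_Schwarz_ineq2 m1)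
   ultimately show "m w * \<bar>x w \<bullet> gg w\<bar> <= C" by (simp add: mult.assoc)
  qed
  have aux: "k * y <= z" if "0 <= k" "k <= 1" "0 <= y" "y <= z" for k y z :: real using mult_left_le_one_le[OF that(3,1,2)] that(4) by linarith
  have A: "integrable M A"
  proof (rule bdd)
   fix w
   have "\<bar>bb w \<bullet> gg w\<bar> <= norm (bb w) * norm (gg w)" by (rule Cauchy_Schwarz_ineq2)
   also have "... <= C * C" unfolding bb_def gg_def using C1 by (intro mult_mono b_bound g_bound) auto
   finally have 1: "De * \<bar>bb w \<bullet> gg w\<bar> <= 1 * (C * C)" using De by (intro mult_mono) auto
   then have "m w * (De * \<bar>bb w \<bullet> gg w\<bar>) <= 1 * (C * C)" using m1[of w] De 1 by (intro mult_mono[of "m w" 1 "De * \<bar>bb w \<bullet> gg w\<bar>" "C * C"]) auto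
   then have "2 * m w * \<bar>x w \<bullet> gg w + De * (bb w \<bullet> gg w)\<bar> <= 2 * (C + C * C)"
    using mult_left_mono[OF abs_triangle_ineq[of "x w \<bullet> gg w" "De * (bb w \<bullet> gg w)"] m1(1)[of w]] xg[of w] De
    by (simp add: abs_mult distrib_left)
   then have "a i w * (2 * m w * \<bar>x w \<bullet> gg w + De * (bb w \<bullet> gg w)\<bar>) <= 2 * (C + C * C)"
    using a01[of i w] m1[of w] by (rule_tac aux) auto
   then show "norm (A w) <= 2 * (C + C * C)" using a01[of i w] m1[of w] by (simp add: A_def abs_mult)
  qed measurable
  have B: "integrable M B"
  proof (rule bdd)
   fix w
   have "m w * (norm (gg w))^2 <= 1 * C^2" using m1[of w] g_bound by (intro mult_mono power_mono) (auto simp: gg_def)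
   moreover have "(m w)^2 * (x w \<bullet> gg w)^2 <= C^2" using power_mono[OF xg[of w], of 2] m1[of w] by (simp add: power_mult_distrib)
   ultimately have "\<bar>?q w\<bar> <= 3 * C^2"
   proof -
    assume 1: "m w * (norm (gg w))^2 <= 1 * C^2" and 2: "(m w)^2 * (x w \<bullet> gg w)^2 <= C^2"
    have "0 <= m w * (norm (gg w))^2" "0 <= (m w)^2 * (x w \<bullet> gg w)^2" using m1[of w] by auto
    then show ?thesis using 1 2 by (simp only: mult.assoc abs_le_iff split: if_split) linarith
   qed
   then have "a i w * \<bar>?q w\<bar> <= 3 * C^2"
    using a01[of i w] by (rule_tac aux) auto
   then show "norm (B w) <= 3 * C^2" using a01[of i w] by (simp add: B_def abs_mult)
  qed measurable
  have e: "integrable M e" "expectation e <= et"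
  proof -
   have "?t i <= ?t N" using i by (intro divide_right_mono) auto
   then have "?t i <= T" using T by linarith
   then have "(EE w. ennreal ((e w)^2)) <= mesh_error v T p"
    using euler_error[OF v, of i p T] by (simp add: e_def x_def norm_minus_commute)
   also note E(1)
   finally have nn: "(EE w. ennreal ((e w)^2)) <= ennreal (et^2)" .
   have e2: "integrable M (%w. (e w)^2)" by (rule integrableI_nonneg) (use le_less_trans[OF nn] in auto)
   have le: "expectation (%w. (e w)^2) <= et^2" using nn by (subst (asm) nn_integral_eq_integral[OF e2]) (auto simp: ennreal_le_iff)
   show e1: "integrable M e" by (rule square_integrable_imp_integrable[OF _ e2]) measurable
   have "(expectation e)^2 <= expectation (%w. (e w)^2)" using variance_eq[OF e1 e2] variance_positive[of e] by simp
   then have "(expectation e)^2 <= et^2" using le by linarith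
   then show "expectation e <= et" using E(2) by (rule power2_le_imp_le)
  qed
  have mom1: "has_bochner_integral M (%w. A w * de w) 0" unfolding de_def by (rule W_moment1[OF dt(3) dt(2) AF A])
  have mom2: "has_bochner_integral M (%w. B w * (de w)^2) (De * expectation B)"
   unfolding de_def dt(1)[of i, symmetric] by (rule W_moment2[OF dt(3) dt(2) BF B])
  have "has_bochner_integral M (%w. 1 * (de w)^2) (De * expectation (%_. 1))"
   unfolding de_def dt(1)[of i, symmetric] by (rule W_moment2[OF dt(3) dt(2)]) auto
  then have v2: "has_bochner_integral M (%w. (de w)^2) De" by (simp add: prob_space)
  have v4: "has_bochner_integral M (%w. de w ^ 4) (3 * De^2)" unfolding de_def dt(1)[of i, symmetric] by (rule W_moment4[OF dt(3) dt(2)])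
  have v6: "has_bochner_integral M (%w. de w ^ 6) (15 * De ^ 3)" unfolding de_def dt(1)[of i, symmetric] by (rule W_moment6[OF dt(3) dt(2)])
  have c: "has_bochner_integral M (%_. k) k" for k :: real by (simp add: has_bochner_integral_iff prob_space)
  have "has_bochner_integral M (%w. err (de w)) (De^2 + s * (De + De) / 2 + (s * De + 3 * De^2 / s) / 2 + De ^ 3 + 15 * De ^ 3)" unfolding err_def
   by (intro has_bochner_integral_add has_bochner_integral_divide_zero has_bochner_integral_mult_right c v2 v4 v6)
  then have errI: "integrable M (%w. err (de w))" "expectation (%w. err (de w)) <= 20 * (s * De)"
  proof -
   assume *: "has_bochner_integral M (%w. err (de w)) (De^2 + s * (De + De) / 2 + (s * De + 3 * De^2 / s) / 2 + De ^ 3 + 15 * De ^ 3)"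
   \<comment> \<open>In terms of \<open>s\<close> every term has order at least
     \<open>s ^ 3\<close>, and the coefficients 1, 1, 2 and 16 add up to 20. One step thus loses
     \<open>s * De\<close>, which after summation over a bounded time is of order
     \<open>s\<close>.\<close>
   have "De^2 + s * (De + De) / 2 + (s * De + 3 * De^2 / s) / 2 + De ^ 3 + 15 * De ^ 3 = s ^ 4 + s ^ 3 + (s ^ 3 + 3 * s ^ 3) / 2 + 16 * s ^ 6"
   proof -
    have "3 * De^2 / s = 3 * s ^ 3" using s by (simp add: power2_eq_square power3_eq_cube)
    moreover have "De^2 = s ^ 4" "De ^ 3 = s ^ 6" "s * De = s ^ 3" by (simp_all add: s(3) eval_nat_numeral mult_ac)
    ultimately show ?thesis by (simp add: distrib_left)
   qed
   also have "... <= 20 * s ^ 3" using power_decreasing[of 3 4 s] power_decreasing[of 3 6 s] s by simp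
   also have "s ^ 3 = s * De" by (simp add: s(3) power2_eq_square power3_eq_cube)
   finally show "expectation (%w. err (de w)) <= 20 * (s * De)" using has_bochner_integral_integral_eq[OF *] by simp
   show "integrable M (%w. err (de w))" using * by (rule has_bochner_integral_iff[THEN iffD1, THEN conjunct1])
  qed
  have pw: "a (Suc i) w * \<phi> (Suc i) w + be * (a i w - a (Suc i) w)
    <= a i w * \<phi> i w + De * (K + D * e w) + A w * de w + (B w * (de w)^2 - De * B w) + Q * err (de w)" for w
  proof -
   have errd: "?er w <= err (de w)"
   proof -
    define d where "d = \<bar>de w\<bar>"
    have d: "0 <= d" "(de w)^2 = d^2" "de w ^ 4 = d ^ 4" by (simp_all add: d_def)
    have sq: "2 * (d * s) <= d^2 + De" using sum_squares_bound[of d s] by (simp add: s(3))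
    have 1: "d * De <= s * (d^2 + De) / 2" using mult_left_mono[OF sq, of s] s by (simp add: power2_eq_square mult_ac)
    have 2: "d ^ 3 <= (s * d^2 + d ^ 4 / s) / 2"
    proof -
     have "d^2 * (2 * (d * s)) <= d^2 * (d^2 + s^2)" using sq s by (intro mult_left_mono) auto
     then have "2 * d ^ 3 * s <= (s * d^2 + d ^ 4 / s) * s" using s by (simp add: power2_eq_square power3_eq_cube power4_eq_xxxx algebra_simps)
     then show ?thesis using s by simp
    qed
    show ?thesis using 1 2 unfolding err_def d d_def[symmetric] by linarith
   qed
   \<comment> \<open>If the exit happens at this very step, \<open>\<phi> (Suc i)\<close> is at
     least \<open>be\<close> and pays for the jump of \<open>a\<close>.\<close>
   have "a (Suc i) w * \<phi> (Suc i) w + be * (a i w - a (Suc i) w) <= a i w * \<phi> (Suc i) w"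
   proof (cases "norm (?Y (Suc i) w) < n")
    case True
    then have "a (Suc i) w = a i w" by (auto simp: a_def le_Suc_eq)
    then show ?thesis by simp
   next
    case False
    then have "a (Suc i) w = 0" by (auto simp: a_def)
    then show ?thesis using mult_left_mono[OF \<phi>n[of "Suc i" w] a01(1)[of i w]] False by (simp add: mult.commute)
   qed
   also have "... <= a i w * (\<phi> i w + (K + D * e w) * De + 2 * m w * (x w \<bullet> gg w + De * (bb w \<bullet> gg w)) * de w
    + ?q w * ((de w)^2 - De)
    + Q * ?er w)"
   proof (rule mult_left_mono)
    note pert = lyapunov_perturb[where t="?t i" and x="x w" and y="v (?t i) w" and K=K and K'="K + D * e w", OF r small[OF dt(3)] large[OF dt(3)], folded bb_def gg_def]
    have "llog ((norm (x w + De *R bb w + de w *R gg w))^2) <= llog ((norm (x w))^2) + (K + D * e w) * De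
     + 2 * m w * (x w \<bullet> gg w + De * (bb w \<bullet> gg w)) * de w
     + ?q w * ((de w)^2 - De)
     + Q * ?er w"
    proof (rule llog_step[OF r _ De(2) C1 _ _ _ _ _ m_def Q])
     show "norm (bb w) <= C" "norm (gg w) <= C" unfolding bb_def gg_def by (rule b_bound g_bound)+
     show "0 <= K + D * e w" using K D by (simp add: e_def)
     show "norm (x w) < r ==> 2 * (x w \<bullet> bb w) + (norm (gg w))^2 <= K + D * e w" by (rule pert(1)) (auto simp: D_def e_def)
     show "r <= norm (x w) ==> 2 * (x w \<bullet> bb w) + (norm (gg w))^2 - 2 * (x w \<bullet> gg w)^2 / (norm (x w))^2 <= (K + D * e w) * (norm (x w))^2"
      by (rule pert(2)) (auto simp: D_def e_def)
    qed (use De in auto)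
    moreover have "?Y (Suc i) w = x w + De *R bb w + de w *R gg w" unfolding euler_Suc by (simp add: x_def bb_def gg_def de_def De_def)
    ultimately show "\<phi> (Suc i) w <= \<phi> i w + (K + D * e w) * De + 2 * m w * (x w \<bullet> gg w + De * (bb w \<bullet> gg w)) * de w
    + ?q w * ((de w)^2 - De)
    + Q * ?er w" by (simp add: \<phi>_def x_def)
   qed (rule a01)
   also have "... = a i w * \<phi> i w + a i w * (De * (K + D * e w)) + A w * de w + (B w * (de w)^2 - De * B w)
    + a i w * (Q * ?er w)"
   proof -
    have "k * (p + l * d + P * f + R * (h - d) + z) = k * p + k * (d * l) + (k * P) * f + ((k * R) * h - d * (k * R)) + k * z"
     for k p l d P f R h z :: real by (simp add: algebra_simps)
    then show ?thesis unfolding A_def B_def .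
   qed
   also have "... <= a i w * \<phi> i w + De * (K + D * e w) + A w * de w + (B w * (de w)^2 - De * B w) + Q * err (de w)"
   proof (intro add_mono order_refl)
    have "0 <= De * (K + D * e w)" using De K D by (simp add: e_def)
    then show "a i w * (De * (K + D * e w)) <= De * (K + D * e w)" by (rule aux[OF a01 _ order_refl])
    have "0 <= ?er w" using De by (intro add_nonneg_nonneg) auto
    then show "a i w * (Q * ?er w) <= Q * err (de w)"
     by (rule aux[OF a01 mult_nonneg_nonneg[OF Q0] mult_left_mono[OF errd Q0]])
   qed
   finally show ?thesis .
  qed
  note mom = mom1[THEN has_bochner_integral_iff[THEN iffD1]] mom2[THEN has_bochner_integral_iff[THEN iffD1]]
  have "expectation (%w. a (Suc i) w * \<phi> (Suc i) w + be * (a i w - a (Suc i) w))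
   <= expectation (%w. a i w * \<phi> i w + De * (K + D * e w) + A w * de w + (B w * (de w)^2 - De * B w) + Q * err (de w))"
   using mom e(1) A B errI(1) a\<phi> a_int by (intro integral_mono pw integrable_add integrable_diff integrable_mult_right integrable_const) auto
  also have "... = expectation (%w. a i w * \<phi> i w) + De * (K + D * expectation e) + Q * expectation (%w. err (de w))"
   using mom e(1) A B errI(1) a\<phi> a_int by (simp add: prob_space)
  also have "... <= expectation (%w. a i w * \<phi> i w) + De * (K + D * et) + Q * (20 * (s * De))"
   using e errI Q0 D De by (intro add_mono mult_left_mono order_refl) auto
  also have "... = expectation (%w. a i w * \<phi> i w) + De * (K + D * et + 20 * Q * s)" by (simp add: algebra_simps)
  finally show ?thesis using a\<phi> a_int by simp
 qed
 let ?k = "K + D * et + 20 * Q * s"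
 have "expectation (%w. a i w * \<phi> i w) + be * (1 - expectation (a i)) <= 1 + llog ((norm x0)^2) + ?t i * ?k" if "i <= N" for i using that
 proof (induction i)
  case 0
  have eq: "a 0 = (%_. if norm x0 < n then 1 else 0)" "\<phi> 0 = (%_. 1 + llog ((norm x0)^2))" by (auto simp: a_def \<phi>_def euler_0)
  show ?case
  proof (cases "norm x0 < n")
   case True
   then show ?thesis unfolding eq by (simp add: prob_space)
  next
   case False
   \<comment> \<open>The scheme starts at the constant \<open>x0\<close>, so \<open>\<phi> 0\<close>
     may be evaluated at an arbitrary outcome.\<close>
   then show ?thesis using \<phi>n[of 0 undefined] unfolding eq by (simp add: \<phi>_def euler_0 prob_space)
  qed
 next
  case (Suc i)
  have "?t (Suc i) * ?k = ?t i * ?k + De * ?k" using dt(1)[of i] by (metis add.commute diff_add_cancel distrib_right)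
  then show ?case using step[of i] Suc by (simp add: right_diff_distrib)
 qed
 from this[of N] have "expectation (%w. a N w * \<phi> N w) + be * (1 - expectation (a N)) <= 1 + llog ((norm x0)^2) + ?t N * ?k" by simp
 moreover have "0 <= expectation (%w. a N w * \<phi> N w)" by (intro integral_nonneg_AE AE_I2 mult_nonneg_nonneg a01 \<phi>0)
 moreover have "?t N * ?k <= T * ?k" using T K D E(2) Q0 s by (intro mult_right_mono) auto
 moreover have "1 - expectation (a N) = measure M {w:space M. EX i<=N. n <= norm (euler v p i w)}"
 proof -
  let ?S = "{w:space M. EX i<=N. n <= norm (euler v p i w)}"
  have S: "?S : sets M" by measurable
  have "a N w = 1 - indicator ?S w" if "w : space M" for w using that by (auto simp: a_def indicator_def not_less)
  then have "expectation (a N) = expectation (%w. 1 - indicator ?S w)" by (intro Bochner_Integration.integral_cong refl)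
  also have "... = 1 - prob ?S" using S by (subst Bochner_Integration.integral_diff) (auto simp: prob_space less_top[symmetric])
  finally show ?thesis by simp
 qed
 ultimately show ?thesis by (simp add: be_def D_def s_def)
qed

text \<open>If \<open>v\<close> exceeds \<open>n\<close> at a time of grid \<open>q\<close>, then
  the scheme on a finer grid exceeds \<open>n - 1\<close> or is more than 1 away from
  \<open>v\<close> at one of finitely many points. The second possibility disappears as the scheme
  is refined, and path continuity extends the bound from the grids to all times.\<close>

lemma solution_tail: assumes v: "solution v" and r: "1 < r" and C1: "1 <= C" and K: "0 <= K"
  and small: "!!t x. 0 <= t ==> norm x < r ==> 2 * (x \<bullet> b t x) + (norm (g t x))^2 <= K" and large: "!!t x. 0 <= t ==> r <= norm x ==>
   2 * (x \<bullet> b t x) + (norm (g t x))^2 - 2 * (x \<bullet> g t x)^2 / (norm x)^2 <= K * (norm x)^2"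
  and n: "2 <= n"
 shows "{w:space M. EX t:{0..real T}. n < norm (v t w)} : sets M" (is "?S : _")
  and "(1 + ln ((n - 1)^2)) * measure M {w:space M. EX t:{0..real T}. n < norm (v t w)} <= 1 + llog ((norm x0)^2) + real T * K"
proof -
 have rv: "regular v" using v by (simp add: solution_def)
 have [measurable]: "v t : borel_measurable M" if "0 <= t" for t by (rule regular_measurable_M[OF rv that])
 have em[measurable]: "euler v p i : borel_measurable M" for p i by (rule F_M[OF euler_measurable[OF rv]]) simp
 define A where "A q = {w:space M. EX j<=T * 2 ^ q. n < norm (v (real j / 2 ^ q) w)}" for q
 have [measurable]: "A q : sets M" for q unfolding A_def by measurable
 have inc: "incseq A"
 proof (rule incseq_SucI)
  fix q
  show "A q <= A (Suc q)" unfolding A_def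
  proof safe
   fix w j assume "j <= T * 2 ^ q" "n < norm (v (real j / 2 ^ q) w)"
   then show "EX j<=T * 2 ^ Suc q. n < norm (v (real j / 2 ^ Suc q) w)" by (intro exI[of _ "2 * j"]) auto
  qed
 qed
 have UA: "(\<Union>q. A q) = ?S"
 proof safe
  fix w t assume w: "w : space M" and t: "t : {0..real T}" and *: "n < norm (v t w)"
  have "(%q. norm (v (kap q t) w)) ----> norm (v t w)"
   using t by (intro tendsto_norm kap_tendsto regular_continuous[OF rv w]) auto
  then have "eventually (%q. n < norm (v (kap q t) w)) sequentially" using * by (rule order_tendstoD)
  then obtain q where q: "n < norm (v (kap q t) w)" using eventually_happens by force
  have "kap q t = real (nat \<lfloor>t * 2 ^ q\<rfloor>) / 2 ^ q" using t by (simp add: kap_def)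
  moreover have "nat \<lfloor>t * 2 ^ q\<rfloor> <= T * 2 ^ q"
  proof -
   have "t * 2 ^ q <= real (T * 2 ^ q)" using t by (simp add: mult_right_mono)
   then show ?thesis by linarith
  qed
  ultimately have "w : A q" using w q by (auto simp: A_def)
  then show "w : (\<Union>q. A q)" by blast
 next
  fix q w assume "w : A q"
  then obtain j where j: "w : space M" "j <= T * 2 ^ q" "n < norm (v (real j / 2 ^ q) w)" by (auto simp: A_def)
  have "real j <= real (T * 2 ^ q)" using j(2) by (rule of_nat_mono)
  then have "real j / 2 ^ q <= real T" by (simp add: divide_le_eq)
  then show "EX t:{0..real T}. n < norm (v t w)" using j(3) by (intro bexI[of _ "real j / 2 ^ q"]) auto
 qed (auto simp: A_def)
 show S: "?S : sets M" unfolding UA[symmetric] by measurable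
 define be where "be = 1 + ln ((n - 1)^2)"
 have be: "0 <= be" using n by (simp add: be_def one_le_power)
 define Q where "Q = C^2 + 8 * C ^ 3 + (1 / 3 + 3 / (2 * (1 - 1 / r^2) ^ 3)) * (1728 * C ^ 6)"
 define et where "et p = enn2real (mesh_error v T p)" for p
 have lim0: "mesh_error v T ----> 0" by (rule mesh_error_lim[OF rv]) simp
 then have et0: "et ----> 0" unfolding et_def using tendsto_enn2real[of "mesh_error v T" 0] by simp
 have fin: "eventually (%p. mesh_error v T p = ennreal (et p)) sequentially"
  using order_tendstoD(2)[OF lim0 zero_less_one] by eventually_elim (metis et_def ennreal_enn2real less_trans ennreal_one_less_top)
 \<comment> \<open>Here \<open>q\<close> is fixed while the mesh of the scheme tends to 0, so the
   number of points at which Markov's inequality is applied does not grow.\<close>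
 have Aq: "be * measure M (A q) <= 1 + llog ((norm x0)^2) + real T * K" for q
 proof (rule LIMSEQ_le_const)
  let ?J = "T * 2 ^ q"
  let ?b = "%p. 1 + llog ((norm x0)^2) + real T * (K + (2 * r + 6 * C) * L * sqrt (et p) + 20 * Q * sqrt (1 / 2 ^ p)) + be * (real (Suc ?J) * et p)"
  have "?b ----> 1 + llog ((norm x0)^2) + real T * (K + (2 * r + 6 * C) * L * sqrt 0 + 20 * Q * sqrt 0) + be * (real (Suc ?J) * 0)"
   by (intro tendsto_intros et0 LIMSEQ_divide_realpow_zero) auto
  then show "?b ----> 1 + llog ((norm x0)^2) + real T * K" by simp
  from fin have "eventually (%p. be * measure M (A q) <= ?b p) sequentially" using eventually_ge_at_top[of q]
  proof eventually_elim
   case (elim p)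
   note me = elim(1) and qp = elim(2)
   define B where "B j = {w:space M. 1 < nsq (euler v p (j * 2 ^ (p - q)) w - v (real j / 2 ^ q) w)}" for j
   define D where "D = {w:space M. EX i<=T * 2 ^ p. n - 1 <= norm (euler v p i w)}"
   have [measurable]: "B j : sets M" "D : sets M" for j unfolding B_def D_def by measurable
   have e: "2 ^ p = 2 ^ (p - q) * (2::real) ^ q" "2 ^ p = 2 ^ (p - q) * (2::nat) ^ q" using qp by (auto simp flip: power_add)
   have Bm: "measure M (B j) <= et p" if "j <= ?J" for j
   proof -
    have ti: "real (j * 2 ^ (p - q)) / 2 ^ p = real j / 2 ^ q" by (simp add: e)
    have "real j <= real ?J" using that by (rule of_nat_mono)
    then have "real j / 2 ^ q <= real T" by (simp add: divide_le_eq)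
    from euler_error[OF v, of "j * 2 ^ (p - q)" p T] this
    have "(EE w. nsq (euler v p (j * 2 ^ (p - q)) w - v (real j / 2 ^ q) w)) <= ennreal (et p)"
     unfolding ti me by blast
    with Markov[of "%w. nsq (euler v p (j * 2 ^ (p - q)) w - v (real j / 2 ^ q) w)" 1]
    have "emeasure M (B j) <= ennreal (et p)" unfolding B_def by (simp add: order_trans)
    then show ?thesis by (simp add: emeasure_eq_measure et_def)
   qed
   have sub: "A q \<subseteq> D \<union> (\<Union>j\<le>?J. B j)"
   proof
    fix w assume "w : A q"
    then obtain j where j: "w : space M" "j <= ?J" "n < norm (v (real j / 2 ^ q) w)" by (auto simp: A_def)
    show "w : D \<union> (\<Union>j\<le>?J. B j)"
    proof (rule ccontr)
     assume *: "w ~: D \<union> (\<Union>j\<le>?J. B j)"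
     have "j * 2 ^ (p - q) <= T * 2 ^ p" using j(2) unfolding e by (simp add: mult.commute mult.left_commute)
     then have 1: "norm (euler v p (j * 2 ^ (p - q)) w) < n - 1" using * j by (force simp: D_def not_le)
     have "(norm (euler v p (j * 2 ^ (p - q)) w - v (real j / 2 ^ q) w))^2 <= 1" using * j by (auto simp: B_def not_less)
     then have 2: "norm (euler v p (j * 2 ^ (p - q)) w - v (real j / 2 ^ q) w) <= 1" by (simp add: abs_square_le_1)
     show False using 1 2 j(3) norm_triangle_ineq2[of "v (real j / 2 ^ q) w" "euler v p (j * 2 ^ (p - q)) w"] by (simp add: norm_minus_commute)
    qed
   qed
   have "measure M (A q) <= measure M (D \<union> (\<Union>j\<le>?J. B j))" by (intro finite_measure_mono sub) measurable
   also have "... <= measure M D + measure M (\<Union>j\<le>?J. B j)" by (rule measure_Un_le) measurable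
   also have "measure M (\<Union>j\<le>?J. B j) <= (\<Sum>j\<le>?J. measure M (B j))" by (rule finite_measure_subadditive_finite) auto
   also have "... <= (\<Sum>j\<le>?J. et p)" by (intro sum_mono Bm) simp
   also have "... = real (Suc ?J) * et p" by simp
   finally have "be * measure M (A q) <= be * (measure M D + real (Suc ?J) * et p)" using be by (simp add: mult_left_mono)
   moreover have "be * measure M D <= 1 + llog ((norm x0)^2) + real T * (K + (2 * r + 6 * C) * L * sqrt (et p) + 20 * Q * sqrt (1 / 2 ^ p))"
    unfolding be_def D_def by (rule euler_tail[OF v r C1 K small large _ _ _ _ Q_def]) (use n me in \<open>auto simp: et_def\<close>)
   ultimately show ?case by (simp add: distrib_left)
  qed
  then show "EX N. ALL p>=N. be * measure M (A q) <= ?b p" by (simp add: eventually_sequentially)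
 qed
 have "(%q. measure M (A q)) ----> measure M (\<Union>q. A q)" by (rule finite_Lim_measure_incseq[OF _ inc]) auto
 then have "(%q. be * measure M (A q)) ----> be * measure M ?S" unfolding UA by (intro tendsto_intros)
 then show "(1 + ln ((n - 1)^2)) * measure M ?S <= 1 + llog ((norm x0)^2) + real T * K"
  unfolding be_def[symmetric] by (rule LIMSEQ_le_const2) (use Aq in auto)
qed

end

section \<open>Gronwall's argument under a cutoff\<close>

context wiener begin

text \<open>Fatou's lemma passes to the limit in \<open>N\<close> before Gronwall's inequality is
  applied, so Lipschitz bounds uniform in \<open>N\<close> suffice. The approximants enter only
  through norms: they may live in another space, and only their norms have to converge to that of
  \<open>D\<close>. The cutoff provides both the Lipschitz bounds and the finite second moment that
  starts the iteration.\<close>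

lemma local_gronwall: fixes D :: "real => 'a => 'b::{sep_inner, banach}"
  and f h :: "nat => real => 'a => 'c::{sep_inner, banach}"
 assumes th: "cutoff th" and D: "prog D" and f: "!!N. prog (f N)" and J: "!!N t. 0 <= t ==> t <= T ==> ito t (h N) (J N t)"
  and f_int: "!!N. AE w in M. set_integrable lborel {0..T} (%r. f N r w)" and lim: "!!t. 0 <= t ==> t <= T ==>
   AE w in M. (%N. norm ((LINT r:{0..t}|lborel. f N r w) + J N t w)) ----> norm (D t w)"
  and Lf: "!!N. AE w in M. ALL r:{0..T}. norm (th r w *R f N r w) <= L * norm (th r w *R D r w)"
  and Lh: "!!N. AE w in M. ALL r:{0..T}. norm (th r w *R h N r w) <= L * norm (th r w *R D r w)"
  and bnd: "!!t. 0 <= t ==> t <= T ==> (EE w. nsq (th t w *R D t w)) <= ennreal B"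
  and t: "0 <= t" "t <= T"
 shows "AE w in M. th t w *R D t w = 0"
proof -
 define e where "e t = (EE w. nsq (th t w *R D t w))" for t
 \<comment> \<open>\<open>2 * T\<close> and 4 are the weights of \<open>local_estimate\<close>; the
   summand 1 keeps \<open>c\<close> positive when \<open>L\<close> is 0.\<close>
 define c where "c = (2 * T + 4) * L^2 + 1"
 have c: "0 < c" using t by (simp add: c_def add_nonneg_pos)
 have thp: "prog th" by (intro lcad_prog cutoff_lcad th)
 have thD: "prog (%r w. th r w *R D r w)" by (intro prog_scaleR thp D)
 have ineq: "e t <= ennreal 0 + ennreal c * NI t e" if t: "0 <= t" "t <= T" for t
 proof -
  let ?X = "%N w. (LINT r:{0..t}|lborel. f N r w) + J N t w"
  have [measurable]: "th t : borel_measurable M" "J N t : borel_measurable M" for N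
   using adapted_M[OF lcad_adapted[OF cutoff_lcad[OF th]] t(1)] ito_measurable[OF J[OF t]] by auto
  have [measurable]: "(%w. LINT r:{0..t}|lborel. f N r w) : borel_measurable M" for N by (intro F_M[OF path_integral_measurable[OF f t(1)]] t)
  have [measurable]: "energy (%r w. th r w *R D r w) t : borel_measurable M" by (rule energy_measurable_M[OF thD t(1)])
  have E: "(EE w. energy (%r w. th r w *R Y r w) t w) <= ennreal (L^2) * NI t e"
   if "AE w in M. ALL r:{0..T}. norm (th r w *R Y r w) <= L * norm (th r w *R D r w)" for Y :: "real => 'a => 'c"
  proof -
   have "(EE w. energy (%r w. th r w *R Y r w) t w) <= (EE w. ennreal (L^2) * energy (%r w. th r w *R D r w) t w)"
    using that AE_space by (intro nn_integral_mono_AE, eventually_elim) (use t in \<open>intro energy_lipschitz thD, auto\<close>)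
   then show ?thesis using energy_Fubini[OF thD t(1)] by (simp add: nn_integral_cmult e_def)
  qed
  have EX: "(EE w. ennreal (th t w * (norm (?X N w))^2)) <= ennreal c * NI t e" for N
  proof -
   let ?I = "NI t e"
   have "(EE w. ennreal (th t w * (norm (?X N w))^2))
    <= ennreal (2 * t) * (EE w. energy (%r w. th r w *R f N r w) t w)
    + 4 * (EE w. energy (%r w. th r w *R h N r w) t w)"
   proof (rule local_estimate[OF th J[OF t] f])
    show "AE w in M. set_integrable lborel {0..t} (%r. f N r w) & ?X N w = ?X N w"
     using f_int[of N] by eventually_elim (use t in \<open>auto elim!: set_integrable_subset\<close>)
   qed
   also have "... <= ennreal (2 * T) * (ennreal (L^2) * ?I) + 4 * (ennreal (L^2) * ?I)" using t by (intro add_mono mult_mono E Lf Lh ennreal_leI) auto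
   also have "... = ennreal ((2 * T + 4) * L^2) * ?I" using t by (simp add: ennreal_mult ennreal_plus distrib_right mult.assoc)
   also have "... <= ennreal c * ?I" by (intro mult_right_mono ennreal_leI) (auto simp: c_def)
   finally show ?thesis .
  qed
  have "e t = (EE w. liminf (%N. ennreal (th t w * (norm (?X N w))^2)))" unfolding e_def
  proof (rule nn_integral_cong_AE, use lim[OF t] AE_space in eventually_elim)
   fix w assume l: "(%N. norm (?X N w)) ----> norm (D t w)" and w: "w : space M"
   have "(%N. ennreal (th t w * (norm (?X N w))^2)) ----> ennreal (th t w * (norm (D t w))^2)"
    by (intro tendsto_ennrealI tendsto_mult tendsto_power tendsto_const l)
   then have "liminf (%N. ennreal (th t w * (norm (?X N w))^2)) = ennreal (th t w * (norm (D t w))^2)" by (rule lim_imp_Liminf[rotated]) simp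
   then show "nsq (th t w *R D t w) = liminf (%N. ennreal (th t w * (norm (?X N w))^2))"
    using cutoff_values[OF th w t(1)] by auto
  qed
  also have "... <= liminf (%N. (EE w. ennreal (th t w * (norm (?X N w))^2)))" by (rule nn_integral_liminf) measurable
  also have "... <= liminf (%N. ennreal c * NI t e)" by (intro Liminf_mono always_eventually allI EX)
  also have "... = ennreal c * NI t e" by (rule Liminf_const) simp
  finally show ?thesis by simp
 qed
 have "e t <= ennreal (2 * 0 * exp (2 * c * t))" by (rule gronwall[OF order_refl c _ ineq t]) (use bnd in \<open>auto simp: e_def\<close>)
 then have 0: "(EE w. nsq (th t w *R D t w)) = 0" by (simp add: e_def)
 have Dm: "(%w. th t w *R D t w) : borel_measurable M"
 proof -
  have "(%w. (t, w)) : measurable (\<F> t) (restrict_space borel {0..t} \<Otimes>\<^sub>M \<F> t)"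
   using t by (intro measurable_Pair1' ) (simp add: space_restrict_space)
  from measurable_compose[OF this thD[unfolded progressively_measurable_def, rule_format, OF t(1)]]
  show ?thesis using t by (intro F_M[of _ t]) auto
 qed
 have "AE w in M. nsq (th t w *R D t w) = 0" using 0 Dm by (subst (asm) nn_integral_0_iff_AE) (auto simp del: norm_scaleR)
 then show ?thesis by eventually_elim (simp del: norm_scaleR scaleR_eq_0_iff)
qed

text \<open>The dyadic times are countable, so one null set serves them all; continuity of paths
  then gives the remaining times.\<close>

lemma AE_kap: assumes "!!t. 0 <= t ==> AE w in M. P t w" shows "AE w in M. ALL t>=0. ALL p. P (kap p t) w"
proof -
 have "AE w in M. ALL i p. P (real i / 2 ^ p) w" by (simp add: AE_all_countable assms)
 then show ?thesis
 proof eventually_elim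
  fix w assume *: "ALL i p. P (real i / 2 ^ p) w"
  have "kap p t = real (nat \<lfloor>t * 2 ^ p\<rfloor>) / 2 ^ p" if "0 <= t" for p t using that by (simp add: kap_def)
  then show "ALL t>=0. ALL p. P (kap p t) w" using * by metis
 qed
qed

end

section \<open>Truncated equations and the global solution\<close>

definition trunc :: "real => 'b::real_normed_vector => real" where "trunc R x = max 0 (min 1 (R + 1 - norm x))"

lemma trunc_range: "0 <= trunc R x" "trunc R x <= 1" by (auto simp: trunc_def)

lemma trunc_inside: "norm x <= R ==> trunc R x = 1" by (simp add: trunc_def)

lemma trunc_outside: "R + 1 <= norm x ==> trunc R x = 0" by (simp add: trunc_def)

lemma trunc_lipschitz: "\<bar>trunc R x - trunc R y\<bar> <= norm (x - y)"
 using norm_triangle_ineq2[of x y] norm_triangle_ineq2[of y x] by (auto simp: trunc_def norm_minus_commute)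

lemma trunc_scale_bound: assumes "!!x. norm x <= R + 1 ==> norm (h x) <= D" "0 <= D" shows "norm (trunc R x *R h x) <= D"
proof (cases "norm x <= R + 1")
 case True
 have "trunc R x * norm (h x) <= 1 * D" using assms True trunc_range by (intro mult_mono) auto
 then show ?thesis by (simp add: abs_of_nonneg trunc_range)
qed (use trunc_outside[of R x] assms in simp)

text \<open>The difference is written as the weight times \<open>h x - h y\<close> plus the
  difference of weights times \<open>h y\<close>, with \<open>y\<close> in the ball of radius
  \<open>R + 1\<close>. If only \<open>x\<close> lies in it the roles are exchanged, and if neither
  does both terms vanish.\<close>

lemma trunc_scale_lipschitz: fixes h :: "'b::real_normed_vector => 'c::real_normed_vector"
 assumes lip: "!!x y. norm x <= R + 1 ==> norm y <= R + 1 ==> norm (h x - h y) <= L * norm (x - y)"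
  and bnd: "!!x. norm x <= R + 1 ==> norm (h x) <= D" and "0 <= L" "0 <= D"
 shows "norm (trunc R x *R h x - trunc R y *R h y) <= (L + D) * norm (x - y)"
proof -
 have *: "norm (trunc R x *R h x - trunc R y *R h y) <= (L + D) * norm (x - y)" if y: "norm y <= R + 1" for x y
 proof -
  have "norm (trunc R x *R (h x - h y)) <= L * norm (x - y)"
  proof (cases "norm x <= R + 1")
   case True
   have "trunc R x * norm (h x - h y) <= 1 * (L * norm (x - y))" using lip[OF True y] trunc_range by (intro mult_mono) auto
   then show ?thesis by (simp add: abs_of_nonneg trunc_range)
  qed (use trunc_outside[of R x] assms in simp)
  moreover have "norm ((trunc R x - trunc R y) *R h y) <= norm (x - y) * D" using trunc_lipschitz[of R x y] bnd[OF y] by (simp add: mult_mono)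
  moreover have "trunc R x *R h x - trunc R y *R h y = trunc R x *R (h x - h y) + (trunc R x - trunc R y) *R h y"
   by (simp add: algebra_simps)
  ultimately show ?thesis using norm_triangle_ineq[of "trunc R x *R (h x - h y)" "(trunc R x - trunc R y) *R h y"]
   by (simp only: distrib_right mult.commute[of D])
 qed
 show ?thesis
 proof (cases "norm y <= R + 1")
  case False
  show ?thesis
  proof (cases "norm x <= R + 1")
   case True
   then show ?thesis using *[of x y] by (simp add: norm_minus_commute)
  qed (use False assms trunc_outside[of R x] trunc_outside[of R y] in simp)
 qed (rule *)
qed

locale lyapunov_sde = wiener M \<F> W for M :: "'a measure" and \<F> :: "real => 'a measure" and W :: "real => 'a => real" +
 fixes b g :: "real => 'b::{sep_inner, banach} => 'b" and x0 :: 'b and Lip Bd :: "real => real" and r B :: real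
 assumes b_cont: "continuous_on UNIV (case_prod b)" and g_cont: "continuous_on UNIV (case_prod g)"
  and b_lip: "norm x <= R ==> norm y <= R ==> norm (b t x - b t y) <= Lip R * norm (x - y)"
  and g_lip: "norm x <= R ==> norm y <= R ==> norm (g t x - g t y) <= Lip R * norm (x - y)"
  and b_bound: "norm x <= R ==> norm (b t x) <= Bd R" and g_bound: "norm x <= R ==> norm (g t x) <= Bd R"
  and Lip_nonneg: "0 <= Lip R" and Bd_nonneg: "0 <= Bd R" and r: "1 < r" and lyapunov: "r <= norm x ==>
   2 * (x \<bullet> b t x) + (norm (g t x))^2 - 2 * (x \<bullet> g t x)^2 / (norm x)^2 <= B * (norm x)^2"
begin

text \<open>Truncating \<open>b\<close> quadratically and \<open>g\<close> linearly scales the Lyapunov expression by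
  \<open>(trunc R x)\<^sup>2\<close>, so its bound survives the truncation.\<close>

definition "tb R t x = trunc R x *R trunc R x *R b t x"
definition "tg R t x = trunc R x *R g t x"
text \<open>The truncation is supported in the ball of radius \<open>R + 1\<close>; the summand 1
  secures the hypothesis \<open>1 <= C\<close> of the tail estimate.\<close>

definition "tC R = 1 + Bd (R + 1)"
definition "tL R = Lip (R + 1) + tC R + tC R"
text \<open>Independent of \<open>R\<close>: inside radius \<open>r\<close> the untruncated bounds
  are used, outside the Lyapunov condition. The tail bound is therefore the same for all
  truncations, and this is what excludes explosion.\<close>

definition "tK = 2 * r * Bd r + (Bd r)^2 + \<bar>B\<bar>"

lemma truncated: "lipschitz_sde M \<F> W (tb R) (tg R) (tL R) (tC R)"
proof (unfold_locales)
 have C: "0 <= tC R" "Bd (R + 1) <= tC R" using Bd_nonneg[of "R + 1"] by (auto simp: tC_def)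
 have bnd: "norm (trunc R x *R h t x) <= tC R" if "!!x. norm x <= R + 1 ==> norm (h t x) <= Bd (R + 1)" for h :: "real => 'b => 'b" and t x
  by (rule trunc_scale_bound) (use that C in \<open>auto intro: order_trans\<close>)
 have lip: "norm (trunc R x *R h t x - trunc R y *R h t y) <= (Lip (R + 1) + tC R) * norm (x - y)"
  if "!!x y. norm x <= R + 1 ==> norm y <= R + 1 ==> norm (h t x - h t y) <= Lip (R + 1) * norm (x - y)"
   "!!x. norm x <= R + 1 ==> norm (h t x) <= Bd (R + 1)" for h :: "real => 'b => 'b" and t x y
  by (rule trunc_scale_lipschitz) (use that C Lip_nonneg in \<open>auto intro: order_trans\<close>)
 have tcont: "continuous_on UNIV (%(t::real, x::'b). trunc R x)" unfolding trunc_def case_prod_beta by (intro continuous_intros)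
 show "continuous_on UNIV (case_prod (tb R))" "continuous_on UNIV (case_prod (tg R))"
  using continuous_on_scaleR[OF tcont continuous_on_scaleR[OF tcont b_cont]] continuous_on_scaleR[OF tcont g_cont]
  by (simp_all add: tb_def tg_def case_prod_beta)
 fix t x y
 show "norm (tb R t x) <= tC R" unfolding tb_def by (rule trunc_scale_bound) (use bnd[of b] b_bound C in auto)
 show "norm (tg R t x) <= tC R" unfolding tg_def by (rule bnd) (rule g_bound)
 show "norm (tb R t x - tb R t y) <= tL R * norm (x - y)" unfolding tb_def tL_def
  by (rule trunc_scale_lipschitz) (use bnd[of b] b_bound b_lip lip[of b] C Lip_nonneg in auto)
 have "norm (tg R t x - tg R t y) <= (Lip (R + 1) + tC R) * norm (x - y)" unfolding tg_def by (rule lip[OF g_lip g_bound])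
 also have "... <= tL R * norm (x - y)" using C by (intro mult_right_mono) (auto simp: tL_def)
 finally show "norm (tg R t x - tg R t y) <= tL R * norm (x - y)" .
 show "0 <= tL R" using C Lip_nonneg by (simp add: tL_def)
qed

lemma tK_nonneg: "0 <= tK" using r Bd_nonneg by (simp add: tK_def)

lemma truncated_small: assumes "norm x < r" shows "2 * (x \<bullet> tb R t x) + (norm (tg R t x))^2 <= tK"
proof -
 have "x \<bullet> b t x <= norm x * norm (b t x)" by (rule norm_cauchy_schwarz)
 also have "... <= r * Bd r" using assms r by (intro mult_mono b_bound) auto
 finally have 1: "x \<bullet> b t x <= r * Bd r" .
 have 2: "(norm (g t x))^2 <= (Bd r)^2" using assms by (intro power_mono g_bound) auto
 have "2 * (x \<bullet> tb R t x) + (norm (tg R t x))^2 = (trunc R x)^2 * (2 * (x \<bullet> b t x) + (norm (g t x))^2)"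
  by (simp add: tb_def tg_def power2_eq_square algebra_simps)
 also have "... <= (trunc R x)^2 * tK" using 1 2 by (intro mult_left_mono) (auto simp: tK_def)
 also have "... <= 1 * tK" using tK_nonneg trunc_range[of R x] by (intro mult_right_mono) (auto simp: power_le_one)
 finally show ?thesis by simp
qed

lemma truncated_large: assumes "r <= norm x"
 shows "2 * (x \<bullet> tb R t x) + (norm (tg R t x))^2 - 2 * (x \<bullet> tg R t x)^2 / (norm x)^2 <= tK * (norm x)^2"
proof -
 have "2 * (x \<bullet> tb R t x) + (norm (tg R t x))^2 - 2 * (x \<bullet> tg R t x)^2 / (norm x)^2
  = (trunc R x)^2 * (2 * (x \<bullet> b t x) + (norm (g t x))^2 - 2 * (x \<bullet> g t x)^2 / (norm x)^2)"
  by (simp add: tb_def tg_def power2_eq_square algebra_simps)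
 also have "... <= (trunc R x)^2 * (tK * (norm x)^2)"
 proof (rule mult_left_mono)
  have "B <= tK" using r Bd_nonneg[of r] by (simp add: tK_def add_increasing)
  then have "B * (norm x)^2 <= tK * (norm x)^2" by (intro mult_right_mono) auto
  then show "2 * (x \<bullet> b t x) + (norm (g t x))^2 - 2 * (x \<bullet> g t x)^2 / (norm x)^2 <= tK * (norm x)^2"
   using lyapunov[OF assms, of t] by linarith
 qed simp
 also have "... <= 1 * (tK * (norm x)^2)" using tK_nonneg trunc_range[of R x] by (intro mult_right_mono) (auto simp: power_le_one)
 finally show ?thesis by simp
qed

end

context wiener begin

lemma cutoff_norm_sup: fixes w :: "real => 'a => 'b::real_normed_vector" assumes w: "regular w"
 shows "cutoff (%t z. if ALL q:{0..t}. norm (w q z) <= c then 1 else 0)"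
proof (rule cutoff_pred)
 fix q :: real assume q: "0 <= q"
 have [measurable]: "w q : borel_measurable (\<F> q)" by (rule adaptedD[OF regular_adapted[OF w] q order_refl])
 show "Measurable.pred (\<F> q) (%z. norm (w q z) <= c)" by measurable
next
 fix z assume "z : space M"
 then have "closed ({0..} \<inter> (%q. norm (w q z)) -` {..c})" by (intro continuous_closed_preimage continuous_on_norm regular_continuous w) auto
 also have "{0..} \<inter> (%q. norm (w q z)) -` {..c} = {q. 0 <= q & norm (w q z) <= c}" by auto
 finally show "closed {q. 0 <= q & norm (w q z) <= c}" .
qed

end

context lyapunov_sde begin

lemma tb_regular: "regular v ==> regular (%u w. tb R u (v u w))" and tg_regular: "regular v ==> regular (%u w. tg R u (v u w))"
proof -
 interpret S: lipschitz_sde M \<F> W "tb R" "tg R" x0 "tL R" "tC R" by (rule truncated)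
 show "regular v ==> regular (%u w. tb R u (v u w))" "regular v ==> regular (%u w. tg R u (v u w))" by (rule S.b_regular S.G_regular; assumption)+
qed

definition truncated_solution :: "real => (real => 'a => 'b) => bool"
 where "truncated_solution R v \<longleftrightarrow> regular v & (ALL t>=0. ito t (%u w. tg R u (v u w))
  (%w. v t w - x0 - (LINT u:{0..t}|lborel. tb R u (v u w))))"

lemma truncated_solution_exists: "EX v. truncated_solution R v"
proof -
 interpret S: lipschitz_sde M \<F> W "tb R" "tg R" x0 "tL R" "tC R" by (rule truncated)
 show ?thesis using S.solution_exists unfolding truncated_solution_def S.solution_def S.drift_def by blast
qed

lemma truncated_solution_tail: assumes v: "truncated_solution R v" and n: "2 <= n" shows "{w:space M. EX t:{0..real T}. n < norm (v t w)} : sets M"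
  and "(1 + ln ((n - 1)^2)) * measure M {w:space M. EX t:{0..real T}. n < norm (v t w)} <= 1 + llog ((norm x0)^2) + real T * tK"
proof -
 interpret S: lipschitz_sde M \<F> W "tb R" "tg R" x0 "tL R" "tC R" by (rule truncated)
 have "S.solution v" using v unfolding truncated_solution_def S.solution_def S.drift_def by blast
 note S.solution_tail[OF this r _ tK_nonneg truncated_small truncated_large n, of T]
 moreover have "1 <= tC R" using Bd_nonneg by (simp add: tC_def)
 ultimately show "{w:space M. EX t:{0..real T}. n < norm (v t w)} : sets M"
  "(1 + ln ((n - 1)^2)) * measure M {w:space M. EX t:{0..real T}. n < norm (v t w)} <= 1 + llog ((norm x0)^2) + real T * tK" by blast+
qed

text \<open>While \<open>v\<close> stays within radius \<open>R\<close>, both truncations are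
  inactive along it, so there it also solves the equation truncated at \<open>R'\<close>. The
  uniqueness argument is run with the cutoff at the exit of \<open>v\<close> and with constant
  sequences of approximants.\<close>

lemma truncated_consistent: assumes v: "truncated_solution R v" and v': "truncated_solution R' v'" and R: "R <= R'"
 shows "AE w in M. ALL t>=0. (ALL q:{0..t}. norm (v q w) <= R) --> v t w = v' t w"
proof -
 interpret S: lipschitz_sde M \<F> W "tb R" "tg R" x0 "tL R" "tC R" by (rule truncated)
 interpret S': lipschitz_sde M \<F> W "tb R'" "tg R'" x0 "tL R'" "tC R'" by (rule truncated)
 have rv: "regular v" "regular v'" using v v' by (auto simp: truncated_solution_def)
 define th where "th = (%t w. if ALL q:{0..t}. norm (v q w) <= R then 1 else 0 :: real)"
 have th: "cutoff th" unfolding th_def by (rule cutoff_norm_sup[OF rv(1)])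
 let ?D = "%u w. v u w - v' u w"
 let ?f = "%u w. tb R u (v u w) - tb R' u (v' u w)" and ?h = "%u w. tg R u (v u w) - tg R' u (v' u w)"
 let ?J = "%t w. (v t w - x0 - S.drift v t w) - (v' t w - x0 - S'.drift v' t w)"
 have f: "prog ?f" and Dp: "prog ?D" by (intro prog_diff regular_prog tb_regular rv)+
 have J: "ito t ?h (?J t)" if "0 <= t" for t using v v' that unfolding truncated_solution_def S.drift_def S'.drift_def by (intro ito_diff) blast+
 have fi: "set_integrable lborel {0..t} (%u. ?f u w)" and LI: "(LINT u:{0..t}|lborel. ?f u w) + ?J t w = ?D t w" if "w : space M" for t w
 proof -
  note i = S.b_integrable[OF rv(1) that, of t] S'.b_integrable[OF rv(2) that, of t]
  show "set_integrable lborel {0..t} (%u. ?f u w)" using i by (rule set_integral_diff)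
  show "(LINT u:{0..t}|lborel. ?f u w) + ?J t w = ?D t w" using set_integral_diff(2)[OF i] by (simp add: S.drift_def S'.drift_def)
 qed
 have inside: "tb R u (v u w) = tb R' u (v u w)" "tg R u (v u w) = tg R' u (v u w)" if "0 <= u" "th u w ~= 0" for u w
 proof -
  have "norm (v u w) <= R" using that by (auto simp: th_def split: if_splits)
  then show "tb R u (v u w) = tb R' u (v u w)" "tg R u (v u w) = tg R' u (v u w)" using R by (simp_all add: tb_def tg_def trunc_inside)
 qed
 have fL: "norm (th u w *R ?f u w) <= tL R' * norm (th u w *R ?D u w)"
  "norm (th u w *R ?h u w) <= tL R' * norm (th u w *R ?D u w)" if u: "0 <= u" for u w
 proof -
  have "th u w = 0 | th u w = 1" by (simp add: th_def)
  then show "norm (th u w *R ?f u w) <= tL R' * norm (th u w *R ?D u w)"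
   "norm (th u w *R ?h u w) <= tL R' * norm (th u w *R ?D u w)" using inside[OF u, of w] S'.b_lip S'.g_lip by auto
 qed
 define C where "C = tC R + tC R'"
 have fC: "norm (?f u w) <= C" "norm (?h u w) <= C" for u w unfolding C_def
  by (rule order_trans[OF norm_triangle_ineq4 add_mono[OF S.b_bound S'.b_bound]]
   order_trans[OF norm_triangle_ineq4 add_mono[OF S.g_bound S'.g_bound]])+
 have D0: "AE w in M. th t w *R ?D t w = 0" if t: "0 <= t" for t
 proof (rule local_gronwall[where f="%_. ?f" and h="%_. ?h" and J="%_. ?J" and T=t and L="tL R'", OF th Dp f J])
  show "AE w in M. set_integrable lborel {0..t} (%u. ?f u w)" using fi by (intro AE_I2)
  show "AE w in M. (%N. norm ((LINT u:{0..r}|lborel. ?f u w) + ?J r w)) ----> norm (?D r w)" for r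
   by (intro AE_I2) (simp only: LI tendsto_const)
  show "AE w in M. ALL u:{0..t}. norm (th u w *R ?f u w) <= tL R' * norm (th u w *R ?D u w)" by (intro AE_I2 ballI fL) simp
  show "AE w in M. ALL u:{0..t}. norm (th u w *R ?h u w) <= tL R' * norm (th u w *R ?D u w)" by (intro AE_I2 ballI fL) simp
  \<comment> \<open>Gronwall's inequality requires a finite bound beforehand; the truncated
    coefficients are bounded, so it follows with the trivial cutoff.\<close>
  show "(EE w. nsq (th r w *R ?D r w)) <= ennreal (2 * t * (C^2 * t) + 4 * (C^2 * t))" if r: "0 <= r" "r <= t" for r
  proof -
   have "(EE w. nsq (th r w *R ?D r w)) <= (EE w. ennreal (1 * (norm (?D r w))^2))"
    by (intro nn_integral_mono ennreal_leI) (auto simp: th_def)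
   also have "... <= ennreal (2 * r) * (EE w. energy (%u w. 1 *R ?f u w) r w)
    + 4 * (EE w. energy (%u w. 1 *R ?h u w) r w)"
    by (rule local_estimate[OF cutoff_const J[OF r(1)] f]) (use fi LI in \<open>auto intro!: AE_I2\<close>)
   also have "... <= ennreal (2 * r) * ennreal (C^2 * r) + 4 * ennreal (C^2 * r)"
    unfolding scaleR_one using r by (intro add_mono mult_left_mono S.nn_integral_energy_bounded fC) auto
   also have "... = ennreal (2 * r * (C^2 * r) + 4 * (C^2 * r))" using r by (simp add: numeral_mult_ennreal ennreal_mult ennreal_plus)
   also have "... <= ennreal (2 * t * (C^2 * t) + 4 * (C^2 * t))" using r by (intro ennreal_leI add_mono mult_mono) auto
   finally show ?thesis .
  qed
 qed (use t in auto)
 have "AE w in M. ALL t>=0. ALL p. th (kap p t) w *R ?D (kap p t) w = 0" by (rule AE_kap) (rule D0)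
 then show ?thesis using AE_space
 proof eventually_elim
  fix w assume *: "ALL t>=0. ALL p. th (kap p t) w *R ?D (kap p t) w = 0" and w: "w : space M"
  show "ALL t>=0. (ALL q:{0..t}. norm (v q w) <= R) --> v t w = v' t w"
  proof (intro allI impI)
   fix t :: real assume t: "0 <= t" and le: "ALL q:{0..t}. norm (v q w) <= R"
   have "th (kap p t) w = 1" for p using le kap_le[of p t] by (auto simp: th_def)
   then have "?D (kap p t) w = 0" for p using * t by (metis scaleR_one)
   moreover have "(%p. ?D (kap p t) w) ----> ?D t w"
    using w rv by (intro kap_tendsto continuous_on_diff regular_continuous t) auto
   ultimately have "?D t w = 0" by (simp add: LIMSEQ_const_iff)
   then show "v t w = v' t w" by simp
  qed
 qed
qed

theorem global_solution: obtains w where "regular w"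
  "!!t. 0 <= t ==> ito t (%u z. g u (w u z)) (%z. w t z - x0 - (LINT u:{0..t}|lborel. b u (w u z)))"
proof -
 obtain v where v: "!!n::nat. truncated_solution (real n) (v n)"
  using choice[of "%n v. truncated_solution (real n) v"] truncated_solution_exists by blast
 have rv: "regular (v n)" for n using v by (simp add: truncated_solution_def)
 have bounded: "AE z in M. ALL T::nat. EX n::nat. ALL t:{0..real T}. norm (v n t z) <= real n" unfolding AE_all_countable
 proof
  fix T :: nat
  define S where "S n = {z:space M. EX t:{0..real T}. real n < norm (v n t z)}" for n
  define c where "c = 1 + llog ((norm x0)^2) + real T * tK"
  \<comment> \<open>The shift by 2 meets the condition \<open>2 <= n\<close> of the tail bound; the
    right side \<open>c\<close> does not depend on the level.\<close>
  have S[measurable]: "S (n + 2) : sets M" and m: "(1 + ln ((real n + 1)^2)) * measure M (S (n + 2)) <= c" for n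
   using truncated_solution_tail[OF v[of "n + 2"], of "real (n + 2)" T] by (auto simp: S_def c_def algebra_simps)
  have le: "measure M (S (n + 2)) <= c / (1 + ln ((real n + 1)^2))" for n
  proof -
   have "0 < 1 + ln ((real n + 1)^2)" by (intro add_pos_nonneg ln_ge_zero) (auto simp: one_le_power)
   then show ?thesis using m[of n] by (simp add: pos_le_divide_eq mult.commute)
  qed
  have "(%n. c / (1 + ln ((real n + 1)^2))) ----> 0" by real_asymp
  moreover have "measure M (\<Inter>n. S (n + 2)) <= c / (1 + ln ((real n + 1)^2))" for n
   using finite_measure_mono[OF _ S, of "\<Inter>n. S (n + 2)" n] le[of n] by (meson INT_lower UNIV_I order_trans)
  ultimately have "measure M (\<Inter>n. S (n + 2)) <= 0" by (intro LIMSEQ_le_const) blast+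
  moreover have "(\<Inter>n. S (n + 2)) : sets M" by measurable
  ultimately have "(\<Inter>n. S (n + 2)) : null_sets M"
   by (simp only: null_sets_def emeasure_eq_measure measure_le_0_iff mem_Collect_eq ennreal_0 simp_thms)
  then have "AE z in M. z ~: (\<Inter>n. S (n + 2))" by (rule AE_not_in)
  then show "AE z in M. EX n::nat. ALL t:{0..real T}. norm (v n t z) <= real n" using AE_space
  proof eventually_elim
   case (elim z)
   then obtain n where "z ~: S (n + 2)" by blast
   then show ?case
    using \<open>z : space M\<close> by (intro exI[of _ "n + 2"]) (auto simp: S_def not_less)
  qed
 qed
 have "AE z in M. ALL n n'. n <= n' --> (ALL t>=0. (ALL q:{0..t}. norm (v n q z) <= real n) --> v n t z = v n' t z)"
  unfolding AE_all_countable using truncated_consistent[OF v v] by (intro allI AE_impI) simp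
 with bounded have "AE z in M. ALL T::nat. EX n::nat. ALL n'>=n. ALL t:{0..real T}. norm (v n t z) <= real n & v n' t z = v n t z"
 proof eventually_elim
  case (elim z)
  note b = elim(1) and c = elim(2)
  show ?case
  proof
   fix T
   obtain n where n: "ALL t:{0..real T}. norm (v n t z) <= real n" using b by blast
   have "v n' t z = v n t z" if "n <= n'" "t : {0..real T}" for n' t using c[rule_format, of n n' t] n that by auto
   then show "EX n::nat. ALL n'>=n. ALL t:{0..real T}. norm (v n t z) <= real n & v n' t z = v n t z" using n by blast
  qed
 qed
 then obtain N where N: "N : null_sets M" and good: "!!z T::nat. z : space M - N ==>
   EX n::nat. ALL n'>=n. ALL t:{0..real T}. norm (v n t z) <= real n & v n' t z = v n t z"
  by (rule AE_E3) blast
 \<comment> \<open>On each \<open>[0, T]\<close> almost every path is eventually constant in the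
   truncation level, so the limit is attained. The value \<open>x0\<close> on the null set keeps
   every path continuous.\<close>
 define w where "w t z = (if z : N then x0 else lim (%n. v n t z))" for t z
 have loc: "EX n::nat. ALL n'>=n. ALL t:{0..real T}. norm (v n' t z) <= real n' & v n' t z = w t z" if z: "z : space M - N" for T :: nat and z
 proof -
  obtain n where n: "ALL n'>=n. ALL t:{0..real T}. norm (v n t z) <= real n & v n' t z = v n t z" using good[OF z] by blast
  have "w t z = v n t z" if t: "t : {0..real T}" for t
  proof -
   have "eventually (%n'. v n' t z = v n t z) sequentially" using eventually_ge_at_top[of n] by eventually_elim (use n t in blast)
   then have "(%n'. v n' t z) ----> v n t z" by (rule tendsto_eventually)
   then show ?thesis using z by (simp add: w_def limI)
  qed
  then have "norm (v n' t z) <= real n' & v n' t z = w t z" if "n <= n'" "t : {0..real T}" for n' t using n that by (metis of_nat_le_iff order_trans)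
  then show ?thesis by blast
 qed
 have rw: "regular w" unfolding regular_def adapted_def
 proof (intro conjI allI impI ballI)
  fix t :: real assume t: "0 <= t"
  have "N : sets (\<F> t)" by (rule null_sets_F[OF t N])
  then have [measurable]: "{z:space (\<F> t). z : N} : sets (\<F> t)" using sets.sets_into_space by (auto simp: Collect_conj_eq Int_absorb1)
  have [measurable]: "v n t : borel_measurable (\<F> t)" for n using rv t by (simp add: regular_def adapted_def)
  show "w t : borel_measurable (\<F> t)" unfolding w_def[abs_def] by measurable
 next
  fix z assume z: "z : space M"
  show "continuous_on {0..} (%t. w t z)"
  proof (cases "z : N")
   case False
   have "continuous_on {0..real T} (%t. w t z)" for T
   proof -
    obtain n where n: "ALL t:{0..real T}. v n t z = w t z" using loc[of z T] False z by blast
    have "continuous_on {0..real T} (%t. v n t z)" by (rule continuous_on_subset[OF regular_continuous[OF rv z]]) auto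
    then show ?thesis by (rule continuous_on_eq) (use n in blast)
   qed
   then show ?thesis by (rule continuous_on_halfline)
  qed (simp add: w_def)
 qed
 have AE_N: "AE z in M. z : space M - N" using AE_not_in[OF N] AE_space by eventually_elim auto
 have "ito t (%u z. g u (w u z)) (%z. w t z - x0 - (LINT u:{0..t}|lborel. b u (w u z)))" if t: "0 <= t" for t
 proof (rule ito_limit)
  let ?K = "%n z. v n t z - x0 - (LINT u:{0..t}|lborel. tb (real n) u (v n u z))"
  show "ito t (%u z. tg (real n) u (v n u z)) (?K n)" for n using v t by (simp add: truncated_solution_def)
  show "prog (%u z. g u (w u z))" by (rule regular_prog[OF regular_compose[OF rw g_cont]])
  have "(%z. w t z - x0 - (LINT u:{0..t}|lborel. b u (w u z))) : borel_measurable (\<F> t)"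
   using adaptedD[OF regular_adapted[OF rw] t order_refl] path_integral_measurable[OF regular_prog[OF regular_compose[OF rw b_cont]] t] by measurable
  then show "(%z. w t z - x0 - (LINT u:{0..t}|lborel. b u (w u z))) : borel_measurable M" by (rule F_M[OF _ t])
  have ev: "eventually (%n. ALL u:{0..t}. norm (w u z) <= real n & v n u z = w u z) sequentially" if z: "z : space M - N" for z
  proof -
   obtain T :: nat where T: "t <= real T" using real_arch_simple by blast
   obtain n where "ALL n'>=n. ALL t:{0..real T}. norm (v n' t z) <= real n' & v n' t z = w t z" using loc[OF z, of T] by blast
   then have *: "norm (w u z) <= real n'" "v n' u z = w u z" if "n <= n'" "u : {0..t}" for n' u using that T by (metis atLeastAtMost_iff order_trans)+
   show ?thesis using eventually_ge_at_top[of n] by eventually_elim (use * in blast)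
  qed
  show "AE z in M. (%n. energy (%u z. tg (real n) u (v n u z) - g u (w u z)) t z) ----> 0" using AE_N
  proof eventually_elim
   case (elim z)
   from ev[OF this] have "eventually (%n. energy (%u z. tg (real n) u (v n u z) - g u (w u z)) t z = 0) sequentially"
   proof eventually_elim
    fix n assume n: "ALL u:{0..t}. norm (w u z) <= real n & v n u z = w u z"
    have "energy (%u z. tg (real n) u (v n u z) - g u (w u z)) t z = energy (%u z. 0 :: 'b) t z"
     by (rule energy_cong) (use n in \<open>simp add: tg_def trunc_inside\<close>)
    then show "energy (%u z. tg (real n) u (v n u z) - g u (w u z)) t z = 0" by (simp add: energy_def)
   qed
   then show ?case by (rule tendsto_eventually)
  qed
  show "AE z in M. (%n. ?K n z) ----> w t z - x0 - (LINT u:{0..t}|lborel. b u (w u z))" using AE_N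
  proof eventually_elim
   case (elim z)
   from ev[OF this] have "eventually (%n. ?K n z = w t z - x0 - (LINT u:{0..t}|lborel. b u (w u z))) sequentially"
   proof eventually_elim
    fix n assume n: "ALL u:{0..t}. norm (w u z) <= real n & v n u z = w u z"
    have "(LINT u:{0..t}|lborel. tb (real n) u (v n u z)) = (LINT u:{0..t}|lborel. b u (w u z))"
     by (rule set_lebesgue_integral_cong) (use n in \<open>auto simp: tb_def trunc_inside\<close>)
    then show "?K n z = w t z - x0 - (LINT u:{0..t}|lborel. b u (w u z))" using n t by simp
   qed
   then show ?case by (rule tendsto_eventually)
  qed
 qed
 then show thesis using rw that by blast
qed

end

section \<open>Fourier multipliers and rotations of square-summable families\<close>

lemma ell2_eqI: "(!!k. ell2_nth x k = ell2_nth y k) ==> x = y" by (intro ell2_nth_inject[THEN iffD1] ext)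

lemma ell2_norm_leI: assumes "!!S. finite S ==> (\<Sum>k\<in>S. (cmod (ell2_nth x k))^2) <= B^2" "0 <= B" shows "norm x <= B"
proof (rule power2_le_imp_le)
 show "(norm x)^2 <= B^2" unfolding norm_ell2_sq by (rule infsum_le_finite_sums[OF ell2_sq_summable assms(1)])
qed (fact assms)

lemma ell2_norm_mono: assumes "!!k. cmod (ell2_nth x k) <= C * cmod (ell2_nth y k)" "0 <= C" shows "norm x <= C * norm y"
proof (rule ell2_norm_leI)
 fix S :: "'a set" assume S: "finite S"
 have "(\<Sum>k\<in>S. (cmod (ell2_nth x k))^2) <= (\<Sum>k\<in>S. C^2 * (cmod (ell2_nth y k))^2)"
  unfolding power_mult_distrib[symmetric] by (intro sum_mono power_mono assms) auto
 also have "... <= C^2 * (norm y)^2" unfolding sum_distrib_left[symmetric] by (intro mult_left_mono sum_le_norm_ell2_sq S) auto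
 finally show "(\<Sum>k\<in>S. (cmod (ell2_nth x k))^2) <= (C * norm y)^2" by (simp add: power_mult_distrib)
qed (use assms in simp)

lemma ell2_nth_linear: "bounded_linear (%x. ell2_nth x k)"
 by (rule bounded_linear_intro[where K=1]) (auto simp: plus_ell2.rep_eq scaleR_ell2.rep_eq cmod_ell2_nth_le)

text \<open>If the product is not square-summable, \<open>Abs_ell2\<close> returns an unspecified
  value, so statements about multipliers carry a bound \<open>bdd_by\<close> on the symbol.\<close>

definition ell2_mult :: "('i => complex) => 'i ell2 => 'i ell2" where "ell2_mult m x = Abs_ell2 (%k. m k * ell2_nth x k)"

definition bdd_by :: "real => ('i => complex) => bool" where "bdd_by C m \<longleftrightarrow> 0 <= C & (ALL k. cmod (m k) <= C)"

lemma ell2_mult_nth: assumes "bdd_by C m" shows "ell2_nth (ell2_mult m x) k = m k * ell2_nth x k"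
proof -
 have "(%k. (cmod (m k * ell2_nth x k))^2) summable_on UNIV"
 proof (rule summable_on_comparison_test)
  show "(%k. C^2 * (cmod (ell2_nth x k))^2) summable_on UNIV" by (intro summable_on_cmult_right ell2_sq_summable)
  show "(cmod (m k * ell2_nth x k))^2 <= C^2 * (cmod (ell2_nth x k))^2" for k
   using assms unfolding norm_mult power_mult_distrib bdd_by_def by (intro mult_right_mono power_mono) auto
 qed auto
 then show ?thesis by (simp add: ell2_mult_def Abs_ell2_inverse)
qed

lemma ell2_mult_norm: "bdd_by C m ==> norm (ell2_mult m x) <= C * norm x"
 by (rule ell2_norm_mono) (auto simp: ell2_mult_nth norm_mult bdd_by_def intro: mult_right_mono)

lemma ell2_mult_linear: assumes "bdd_by C m" shows "bounded_linear (ell2_mult m)"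
proof (rule bounded_linear_intro[where K=C])
 show "ell2_mult m (x + y) = ell2_mult m x + ell2_mult m y" "ell2_mult m (c *R x) = c *R ell2_mult m x" for x y c
  by (rule ell2_eqI; simp add: ell2_mult_nth[OF assms] plus_ell2.rep_eq scaleR_ell2.rep_eq algebra_simps)+
 show "norm (ell2_mult m x) <= norm x * C" for x using ell2_mult_norm[OF assms, of x] by (simp add: mult.commute)
qed

lemma ell2_mult_diff_mult:
 "bdd_by C m ==> bdd_by C' m' ==> bdd_by C'' (%k. m k - m' k) ==> ell2_mult m x - ell2_mult m' x = ell2_mult (%k. m k - m' k) x"
 by (rule ell2_eqI) (simp add: ell2_mult_nth minus_ell2.rep_eq left_diff_distrib)

lemma ell2_approx: assumes "0 < e" obtains S where "finite S" "norm (x - ell2_mult (indicator S) x) <= e"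
proof -
 obtain S where S: "finite S" "dist (\<Sum>k\<in>S. (cmod (ell2_nth x k))^2) (\<Sum>\<^sub>\<infinity>k. (cmod (ell2_nth x k))^2) <= e^2"
  using infsum_finite_approximation[OF ell2_sq_summable, of "e^2" x] assms by auto
 have b: "bdd_by 1 (indicator S :: 'a => complex)" by (auto simp: bdd_by_def indicator_def)
 have "norm (x - ell2_mult (indicator S) x) <= e"
 proof (rule ell2_norm_leI)
  fix T :: "'a set" assume T: "finite T"
  have "(\<Sum>k\<in>T. (cmod (ell2_nth (x - ell2_mult (indicator S) x) k))^2) = (\<Sum>k\<in>T - S. (cmod (ell2_nth x k))^2)"
   by (rule sum.mono_neutral_cong_right) (auto simp: minus_ell2.rep_eq ell2_mult_nth[OF b] T)
  also have "... = (\<Sum>k\<in>S \<union> T. (cmod (ell2_nth x k))^2) - (\<Sum>k\<in>S. (cmod (ell2_nth x k))^2)"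
   using sum.union_disjoint[of S "T - S" "%k. (cmod (ell2_nth x k))^2"] S T by auto
  also have "... <= (norm x)^2 - (\<Sum>k\<in>S. (cmod (ell2_nth x k))^2)" using sum_le_norm_ell2_sq[of "S \<union> T" x] S T by simp
  also have "... <= e^2" using S(2) unfolding norm_ell2_sq dist_real_def by linarith
  finally show "(\<Sum>k\<in>T. (cmod (ell2_nth (x - ell2_mult (indicator S) x) k))^2) <= e^2" .
 qed (use assms in simp)
 then show thesis using S that by blast
qed

text \<open>Bounded pointwise convergence of symbols gives strong convergence: finitely many
  coordinates carry all of \<open>x\<close> up to a small rest, the symbols converge uniformly on
  them, and the rest is multiplied by at most \<open>2 * C\<close>. The summands 1 in the
  denominators cover \<open>C = 0\<close> and \<open>x = 0\<close>.\<close>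

lemma ell2_mult_tendsto: fixes m :: "'n => 'a => complex"
 assumes m: "!!n. bdd_by C (m n)" and m': "bdd_by C m'" and lim: "!!k. ((%n. m n k) \<longlongrightarrow> m' k) F"
 shows "((%n. ell2_mult (m n) x) \<longlongrightarrow> ell2_mult m' x) F"
proof (rule tendstoI)
 fix e :: real assume e: "0 < e"
 have C: "0 <= C" using m' by (simp add: bdd_by_def)
 obtain S where S: "finite S" "norm (x - ell2_mult (indicator S) x) <= e / (4 * C + 1)" using ell2_approx[of "e / (4 * C + 1)" x] e C by auto
 define de where "de = e / (4 * norm x + 1)"
 have de: "0 < de" using e by (simp add: de_def add_nonneg_pos)
 have "eventually (%n. ALL k:S. dist (m n k) (m' k) < de) F" by (intro eventually_ball_finite S ballI tendstoD[OF lim de])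
 then show "eventually (%n. dist (ell2_mult (m n) x) (ell2_mult m' x) < e) F"
 proof eventually_elim
  case (elim n)
  note n = elim
  define d where "d = (%k. m n k - m' k)"
  define dS where "dS = (%k. d k * indicator S k)"
  let ?r = "x - ell2_mult (indicator S) x"
  have "cmod (d k) <= 2 * C" for k unfolding d_def using norm_triangle_ineq4[of "m n k" "m' k"] m[of n] m' unfolding bdd_by_def by (smt (verit))
  then have d: "bdd_by (2 * C) d" using C by (simp add: bdd_by_def)
  have dS: "bdd_by de dS" using n de by (auto simp: dS_def d_def bdd_by_def indicator_def dist_norm less_imp_le)
  have i: "bdd_by 1 (indicator S :: 'a => complex)" by (auto simp: bdd_by_def indicator_def)
  have "ell2_mult (m n) x - ell2_mult m' x = ell2_mult dS x + ell2_mult d ?r"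
   by (rule ell2_eqI, simp only: ell2_mult_nth[OF m] ell2_mult_nth[OF m'] ell2_mult_nth[OF d] ell2_mult_nth[OF dS] ell2_mult_nth[OF i]
     plus_ell2.rep_eq minus_ell2.rep_eq) (simp add: dS_def d_def algebra_simps)
  then have "dist (ell2_mult (m n) x) (ell2_mult m' x) <= de * norm x + 2 * C * norm ?r"
   unfolding dist_norm using norm_triangle_le[OF add_mono[OF ell2_mult_norm[OF dS] ell2_mult_norm[OF d]]] by metis
  also have "... <= e / 4 + e / 2"
  proof (rule add_mono)
   have "de * norm x * 4 <= de * (4 * norm x + 1)" using de by (simp add: algebra_simps)
   also have "... = e" unfolding de_def by (simp add: add_nonneg_pos less_imp_neq[symmetric])
   finally show "de * norm x <= e / 4" by simp
   have "2 * C * norm ?r <= 2 * C * (e / (4 * C + 1))" using S C by (intro mult_left_mono) auto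
   also have "... <= e / 2" using C e by (simp add: field_simps)
   finally show "2 * C * norm ?r <= e / 2" .
  qed
  also have "... < e" using e by simp
  finally show ?case .
 qed
qed

text \<open>For \<open>m = 1\<close> this is the unitary group with frequencies \<open>c\<close>. A
  further symbol \<open>m\<close> with bounded \<open>c k * m k\<close> makes the rotation Lipschitz
  and differentiable in time on the whole space.\<close>

definition rot :: "('i => complex) => ('i => real) => real => 'i ell2 => 'i ell2" where "rot m c t = ell2_mult (%k. m k * cis (c k * t))"

lemma bdd_by_cis: "bdd_by C m ==> bdd_by C (%k. m k * cis (c k * t))" by (simp add: bdd_by_def norm_mult)

lemmas rot_nth = ell2_mult_nth[OF bdd_by_cis, folded rot_def] and rot_norm = ell2_mult_norm[OF bdd_by_cis, folded rot_def]
 and rot_linear = ell2_mult_linear[OF bdd_by_cis, folded rot_def]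

lemma rot_continuous: assumes m: "bdd_by C m" and y: "continuous_on S y" and q: "continuous_on S q" shows "continuous_on S (%z. rot m c (q z) (y z))"
 unfolding continuous_on_def
proof
 fix t assume t: "t : S"
 let ?F = "at t within S"
 have "((%z. rot m c (q z) (y z - y t)) \<longlongrightarrow> 0) ?F"
 proof (rule Lim_null_comparison)
  show "eventually (%z. norm (rot m c (q z) (y z - y t)) <= C * norm (y z - y t)) ?F" by (intro always_eventually allI rot_norm m)
  have "((%z. y z - y t) \<longlongrightarrow> y t - y t) ?F" using y t by (intro tendsto_diff tendsto_const) (auto simp: continuous_on_def)
  then show "((%z. C * norm (y z - y t)) \<longlongrightarrow> 0) ?F" by (intro tendsto_mult_right_zero) (simp add: tendsto_norm_zero)
 qed
 moreover have "(q \<longlongrightarrow> q t) ?F" using q t by (auto simp: continuous_on_def)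
 then have "((%z. rot m c (q z) (y t)) \<longlongrightarrow> rot m c (q t) (y t)) ?F"
  unfolding rot_def by (intro ell2_mult_tendsto[OF bdd_by_cis[OF m] bdd_by_cis[OF m]] tendsto_intros tendsto_cis)
 ultimately have "((%z. rot m c (q z) (y z - y t) + rot m c (q z) (y t)) \<longlongrightarrow> 0 + rot m c (q t) (y t)) ?F" by (rule tendsto_add)
 then show "((%z. rot m c (q z) (y z)) \<longlongrightarrow> rot m c (q t) (y t)) ?F" by (simp add: linear_simps[OF rot_linear[OF m]])
qed

lemma rot_lipschitz: assumes m: "bdd_by C m" and c: "bdd_by C (%k. \<i> * of_real (c k) * m k)"
 shows "norm (rot m c a x - rot m c b x) <= C * \<bar>a - b\<bar> * norm x"
proof -
 have d: "cmod (m k * cis (c k * a) - m k * cis (c k * b)) <= C * \<bar>a - b\<bar>" for k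
 proof -
  have "cmod (m k * cis (c k * a) - m k * cis (c k * b)) = cmod (m k) * cmod (cis (c k * a) - cis (c k * b))"
   by (simp add: norm_mult flip: right_diff_distrib)
  also have "... <= cmod (m k) * \<bar>c k * a - c k * b\<bar>"
  proof (rule mult_left_mono)
   have "cmod (cis (c k * a) - cis (c k * b)) = cmod (cis (c k * b)) * cmod (cis (c k * a - c k * b) - 1)"
    unfolding norm_mult[symmetric] right_diff_distrib cis_mult by simp
   also have "... <= \<bar>c k * a - c k * b\<bar>" using iexp_approx1[of "c k * a - c k * b" 0] by (simp add: cis_conv_exp)
   finally show "cmod (cis (c k * a) - cis (c k * b)) <= \<bar>c k * a - c k * b\<bar>" .
  qed simp
  also have "... = cmod (\<i> * of_real (c k) * m k) * \<bar>a - b\<bar>" by (simp add: norm_mult abs_mult flip: right_diff_distrib)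
  also have "... <= C * \<bar>a - b\<bar>" using c by (intro mult_right_mono) (auto simp: bdd_by_def)
  finally show ?thesis .
 qed
 then have b: "bdd_by (C * \<bar>a - b\<bar>) (%k. m k * cis (c k * a) - m k * cis (c k * b))" using m by (simp add: bdd_by_def)
 show ?thesis unfolding rot_def ell2_mult_diff_mult[OF bdd_by_cis[OF m] bdd_by_cis[OF m] b] by (rule ell2_mult_norm[OF b])
qed

text \<open>Coordinates are continuous linear functionals, so the vector-valued integral can be
  checked coordinate by coordinate, where it is the fundamental theorem for an exponential.\<close>

lemma rot_deriv: fixes x :: "'i::countable ell2" assumes m: "bdd_by C m" and c: "bdd_by C (%k. \<i> * of_real (c k) * m k)" and "a <= b"
 shows "rot m c b x - rot m c a x = (LINT t:{a..b}|lborel. rot (%k. \<i> * of_real (c k) * m k) c t x)"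
proof (rule ell2_eqI)
 fix k
 let ?r = "rot (%k. \<i> * of_real (c k) * m k) c"
 have "set_integrable lborel {a..b} (%t. ?r t x)"
  unfolding set_integrable_def by (intro borel_integrable_compact rot_continuous[OF c] continuous_on_const continuous_on_id) auto
 then have "ell2_nth (LINT t:{a..b}|lborel. ?r t x) k = (LINT t:{a..b}|lborel. ell2_nth (?r t x) k)"
  unfolding set_lebesgue_integral_def set_integrable_def
  by (subst integral_bounded_linear[OF ell2_nth_linear, symmetric]) (auto simp: scaleR_ell2.rep_eq)
 also have "... = m k * cis (c k * b) * ell2_nth x k - m k * cis (c k * a) * ell2_nth x k" unfolding set_lebesgue_integral_def
 proof (rule has_bochner_integral_integral_eq[OF has_bochner_integral_FTC_Icc[OF \<open>a <= b\<close>]])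
  show "((%t. m k * cis (c k * t) * ell2_nth x k) has_vector_derivative ell2_nth (?r t x) k) (at t within {a..b})" for t
   unfolding rot_nth[OF c] cis_conv_exp of_real_mult
   by (rule has_vector_derivative_real_field) (auto intro!: derivative_eq_intros simp: algebra_simps)
  show "continuous_on {a..b} (%t. ell2_nth (?r t x) k)" unfolding rot_nth[OF c] by (intro continuous_intros)
 qed
 finally show "ell2_nth (rot m c b x - rot m c a x) k = ell2_nth (LINT t:{a..b}|lborel. ?r t x) k" by (simp add: minus_ell2.rep_eq rot_nth[OF m])
qed

lemma set_integral_Icc_diff: fixes k :: "real => 'b::{banach, second_countable_topology}"
 assumes k: "set_integrable lborel {0..T} k" and ab: "0 <= a" "a <= b" "b <= T"
 shows "(LINT r:{a..b}|lborel. k r) = (LINT r:{0..b}|lborel. k r) - (LINT r:{0..a}|lborel. k r)"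
proof -
 have i: "set_integrable lborel {0..a} k" "set_integrable lborel {a<..b} k" using ab by (auto intro!: set_integrable_subset[OF k])
 have "{0..b} = {0..a} \<union> {a<..b}" using ab by auto
 then have "(LINT r:{0..b}|lborel. k r) = (LINT r:{0..a}|lborel. k r) + (LINT r:{a<..b}|lborel. k r)"
  using set_integral_Un[OF _ i] by (metis Int_emptyI atLeastAtMost_iff greaterThanAtMost_iff not_less)
 moreover have "(LINT r:{a<..b}|lborel. k r) = (LINT r:{a..b}|lborel. k r)"
  unfolding set_lebesgue_integral_def by (rule integral_discrete_difference[of "{a}"]) (auto simp: indicator_def)
 ultimately show ?thesis by simp
qed

lemma set_integral_norm_le: fixes k :: "real => 'b::{banach, second_countable_topology}"
 assumes "set_integrable lborel S k" "set_integrable lborel S h" "!!r. r : S ==> norm (k r) <= h r"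
 shows "norm (LINT r:S|lborel. k r) <= (LINT r:S|lborel. h r)"
proof -
 have "norm (LINT r:S|lborel. k r) <= (LINT r:S|lborel. norm (k r))" by (rule set_integral_norm_bound[OF assms(1)])
 also have "... <= (LINT r:S|lborel. h r)" using assms by (intro set_integral_mono set_integrable_norm) auto
 finally show ?thesis .
qed

lemma rot_integrable: fixes f :: "real => 'i::countable ell2" assumes m: "bdd_by C m" and f: "set_integrable lborel S f"
 shows "set_integrable lborel S (%r. rot m c r (f r))"
proof -
 have "continuous_on UNIV (%z::real \<times> 'i ell2. rot m c (fst z) (snd z))" by (intro rot_continuous[OF m] continuous_intros)
 then have [measurable]: "(%z. rot m c (fst z) (snd z)) : borel_measurable borel" by (rule borel_measurable_continuous_onI)
 have f': "integrable lborel (%r. indicator S r *R f r)" using f by (simp add: set_integrable_def)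
 have [measurable]: "(%r. indicator S r *R f r) : borel_measurable borel" using borel_measurable_integrable[OF f'] by simp
 have "(%r. (r, indicator S r *R f r)) : borel \<rightarrow>\<^sub>M borel" unfolding borel_prod[symmetric] by measurable
 then have "(%r. rot m c (fst (r, indicator S r *R f r)) (snd (r, indicator S r *R f r))) : borel_measurable borel"
  by (rule measurable_compose) measurable
 then have "integrable lborel (%r. rot m c r (indicator S r *R f r))"
 proof (rule_tac Bochner_Integration.integrable_bound[OF integrable_mult_right[OF integrable_norm[OF f'], of C]])
  show "AE r in lborel. norm (rot m c r (indicator S r *R f r)) <= norm (C * norm (indicator S r *R f r))"
   by (intro AE_I2 order_trans[OF rot_norm[OF m]]) (simp add: abs_mult mult_right_mono)
 qed simp
 then show ?thesis by (simp add: set_integrable_def linear_simps[OF rot_linear[OF m]])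
qed

text \<open>Summation by parts.\<close>

lemma rot_summation: fixes f y :: "real => 'i::countable ell2" assumes m: "bdd_by C m" and c: "bdd_by C (%k. \<i> * of_real (c k) * m k)"
  and y: "continuous_on {0..} y" and f: "set_integrable lborel {0..t} f" and t: "0 <= t"
  and z: "!!r. 0 <= r ==> r <= t ==> z r = y r - y 0 - (LINT u:{0..r}|lborel. f u)"
 shows "(%p. \<Sum>i<nat \<lceil>t * 2 ^ p\<rceil>. rot m c (real i / 2 ^ p) (z (min t (real (Suc i) / 2 ^ p)) - z (real i / 2 ^ p)))
  ----> rot m c t (y t) - rot m c 0 (y 0)
   - (LINT u:{0..t}|lborel. rot (%k. \<i> * of_real (c k) * m k) c u (y u)) - (LINT u:{0..t}|lborel. rot m c u (f u))"
  (is "?S ----> ?G")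
proof -
 let ?r = "rot m c" and ?r' = "rot (%k. \<i> * of_real (c k) * m k) c"
 have C: "0 <= C" using m by (simp add: bdd_by_def)
 let ?I = "%a b k. LINT u:{a..b}|lborel. k u"
 have tel: "(\<Sum>i<N. ?I (s i) (s (Suc i)) k) = ?I 0 t k"
  if k: "set_integrable lborel {0..t} k" and s: "s 0 = 0" "s N = t" "!!i. s i <= s (Suc i)" "!!i. 0 <= s i" "!!i. s i <= t"
  for s :: "nat => real" and N and k :: "real => 'e::{banach, second_countable_topology}"
 proof -
  have "(\<Sum>i<N. ?I (s i) (s (Suc i)) k) = (\<Sum>i<N. ?I 0 (s (Suc i)) k - ?I 0 (s i) k)"
   using s by (intro sum.cong refl set_integral_Icc_diff[OF k])
  also have "... = ?I 0 t k - ?I 0 0 k" using sum_lessThan_telescope[of "%i. ?I 0 (s i) k" N] s by simp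
  also have "?I 0 0 k = 0" unfolding set_lebesgue_integral_def
   by (rule integral_eq_zero_AE) (use AE_lborel_singleton[of 0] in eventually_elim, auto simp: indicator_def)
  finally show ?thesis by simp
 qed
 have cont': "continuous_on {0..} (%u. ?r' u (y u))" by (intro rot_continuous[OF c] y continuous_on_id)
 have i1: "set_integrable lborel {0..t} (%u. ?r' u (y u))" by (rule set_integrable_continuous_halfline[OF cont'])
 have i2: "set_integrable lborel {0..t} (%u. ?r u (f u))" by (rule rot_integrable[OF m f])
 have i3: "set_integrable lborel {0..t} (%u. norm (f u))" by (rule set_integrable_norm[OF f])
 have i4: "set_integrable lborel {0..t} (%u. a)" for a :: "'e::{banach, second_countable_topology}"
  by (rule set_integrable_continuous_halfline) (rule continuous_on_const)
 have uc: "uniformly_continuous_on {0..t} y" by (intro compact_uniformly_continuous continuous_on_subset[OF y]) auto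
 let ?M = "?I 0 t (%u. norm (f u))"
 have est: "norm (?S p - ?G) <= C * ep * t + C * (1 / 2 ^ p) * ?M"
  if mod: "!!a b. a : {0..t} ==> b : {0..t} ==> \<bar>a - b\<bar> <= 1 / 2 ^ p ==> norm (y a - y b) <= ep" for p ep
 proof -
  define N where "N = nat \<lceil>t * 2 ^ p\<rceil>"
  define s where "s i = min t (real i / 2 ^ p)" for i
  have s: "s 0 = 0" "s N = t" "s i <= s (Suc i)" "0 <= s i" "s i <= t" "s (Suc i) - s i <= 1 / 2 ^ p" for i
  proof -
   show "s N = t" using nat_ceiling_le_iff[OF t, of p N] by (simp add: s_def N_def)
   have "real (Suc i) / 2 ^ p = real i / 2 ^ p + 1 / 2 ^ p" by (simp add: add_divide_distrib)
   moreover have "0 < (1::real) / 2 ^ p" by simp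
   ultimately show "s (Suc i) - s i <= 1 / 2 ^ p" unfolding s_def by linarith
   show "s i <= s (Suc i)" unfolding s_def by (intro min.mono order_refl divide_right_mono) auto
  qed (use t in \<open>auto simp: s_def\<close>)
  have si: "s i = real i / 2 ^ p" if "i < N" for i using less_nat_ceiling_iff[OF t, of i p] that by (simp add: s_def N_def)
  let ?A = "%i u. ?r' u (y (s (Suc i)) - y u)" and ?B = "%i u. ?r (s i) (f u) - ?r u (f u)"
  have sub: "{s i..s (Suc i)} \<subseteq> {0..t}" for i using s by auto
  have iA: "set_integrable lborel {s i..s (Suc i)} (?A i)" "set_integrable lborel {s i..s (Suc i)} (%u. ?r' u (y u))"
   "set_integrable lborel {s i..s (Suc i)} (%u. ?r' u (y (s (Suc i))))" for i
  proof -
   show 1: "set_integrable lborel {s i..s (Suc i)} (%u. ?r' u (y u))" by (rule set_integrable_subset[OF i1 _ sub]) simp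
   show 2: "set_integrable lborel {s i..s (Suc i)} (%u. ?r' u (y (s (Suc i))))" by (rule set_integrable_subset[OF rot_integrable[OF c i4] _ sub]) simp
   show "set_integrable lborel {s i..s (Suc i)} (?A i)" using set_integral_diff(1)[OF 2 1] by (simp add: linear_simps[OF rot_linear[OF c]])
  qed
  have iB: "set_integrable lborel {s i..s (Suc i)} (?B i)" "set_integrable lborel {s i..s (Suc i)} (%u. ?r u (f u))"
   "set_integrable lborel {s i..s (Suc i)} f" for i
  proof -
   show f': "set_integrable lborel {s i..s (Suc i)} f" by (rule set_integrable_subset[OF f _ sub]) simp
   show 1: "set_integrable lborel {s i..s (Suc i)} (%u. ?r u (f u))" by (rule set_integrable_subset[OF i2 _ sub]) simp
   show "set_integrable lborel {s i..s (Suc i)} (?B i)"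
    using integrable_bounded_linear[OF rot_linear[OF m, of c "s i"] f'[unfolded set_integrable_def]]
    by (intro set_integral_diff(1)[OF _ 1]) (simp add: set_integrable_def linear_simps[OF rot_linear[OF m]])
  qed
  \<comment> \<open>Abel summation on one cell. \<open>?A\<close> is the error of freezing
    \<open>y\<close> at the right endpoint under the differentiated rotation, \<open>?B\<close> that
    of freezing the rotation at the left endpoint in front of \<open>f\<close>; both vanish with the
    mesh.\<close>
  have trm: "?r (s i) (z (s (Suc i)) - z (s i)) = (?r (s (Suc i)) (y (s (Suc i))) - ?r (s i) (y (s i)))
   - (?I (s i) (s (Suc i)) (?A i) + ?I (s i) (s (Suc i)) (%u. ?r' u (y u)))
   - (?I (s i) (s (Suc i)) (?B i) + ?I (s i) (s (Suc i)) (%u. ?r u (f u)))" for i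
  proof -
   have A: "?I (s i) (s (Suc i)) (?A i) + ?I (s i) (s (Suc i)) (%u. ?r' u (y u)) = ?r (s (Suc i)) (y (s (Suc i))) - ?r (s i) (y (s (Suc i)))"
    unfolding rot_deriv[OF m c s(3)] set_integral_add(2)[OF iA(1,2), symmetric] by (simp add: linear_simps[OF rot_linear[OF c]])
   have B: "?I (s i) (s (Suc i)) (?B i) + ?I (s i) (s (Suc i)) (%u. ?r u (f u)) = ?r (s i) (?I (s i) (s (Suc i)) f)"
   proof -
    have "?I (s i) (s (Suc i)) (?B i) + ?I (s i) (s (Suc i)) (%u. ?r u (f u)) = ?I (s i) (s (Suc i)) (%u. ?r (s i) (f u))"
     unfolding set_integral_add(2)[OF iB(1,2), symmetric] by simp
    also have "... = ?r (s i) (?I (s i) (s (Suc i)) f)" using integral_bounded_linear[OF rot_linear[OF m] iB(3)[of i, unfolded set_integrable_def]]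
     by (simp add: set_lebesgue_integral_def linear_simps[OF rot_linear[OF m]])
    finally show ?thesis .
   qed
   have "z (s (Suc i)) - z (s i) = y (s (Suc i)) - y (s i) - ?I (s i) (s (Suc i)) f"
    using set_integral_Icc_diff[OF f s(4) s(3) s(5)] by (simp add: z s)
   then show ?thesis unfolding A B by (simp add: linear_simps[OF rot_linear[OF m]])
  qed
  have "?S p = (\<Sum>i<N. ?r (s i) (z (s (Suc i)) - z (s i)))" unfolding N_def[symmetric] by (rule sum.cong) (auto simp: si s_def[of "Suc i" for i])
  also have "... = ?G - (\<Sum>i<N. ?I (s i) (s (Suc i)) (?A i) + ?I (s i) (s (Suc i)) (?B i))"
   unfolding trm sum_subtractf sum.distrib tel[OF i1 s(1,2) s(3,4,5)] tel[OF i2 s(1,2) s(3,4,5)]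
   using sum_lessThan_telescope[of "%i. ?r (s i) (y (s i))" N] s by (simp add: sum_subtractf)
  finally have "norm (?S p - ?G) = norm (\<Sum>i<N. ?I (s i) (s (Suc i)) (?A i) + ?I (s i) (s (Suc i)) (?B i))" by simp
  also have "... <= (\<Sum>i<N. ?I (s i) (s (Suc i)) (%_. C * ep) + ?I (s i) (s (Suc i)) (%u. C * (1 / 2 ^ p) * norm (f u)))"
  proof (intro order_trans[OF norm_sum] sum_mono order_trans[OF norm_triangle_ineq] add_mono set_integral_norm_le iA iB)
   fix i u assume u: "u : {s i..s (Suc i)}"
   have "\<bar>s (Suc i) - u\<bar> <= 1 / 2 ^ p" "\<bar>s i - u\<bar> <= 1 / 2 ^ p" using u s(6)[of i] by auto
   note 1 = this
   have "norm (y (s (Suc i)) - y u) <= ep" using u sub[of i] s(4,5)[of "Suc i"] 1 by (intro mod) auto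
   then show "norm (?A i u) <= C * ep" using C by (intro order_trans[OF rot_norm[OF c]] mult_left_mono)
   show "norm (?B i u) <= C * (1 / 2 ^ p) * norm (f u)" using 1 C by (intro order_trans[OF rot_lipschitz[OF m c]] mult_right_mono mult_left_mono) auto
  next
   fix i
   show "set_integrable lborel {s i..s (Suc i)} (%_. C * ep)" "set_integrable lborel {s i..s (Suc i)} (%u. C * (1 / 2 ^ p) * norm (f u))"
    by (rule set_integrable_subset[OF _ _ sub[of i]], auto intro!: i4 i3)+
  qed
  also have "... = ?I 0 t (%_. C * ep) + ?I 0 t (%u. C * (1 / 2 ^ p) * norm (f u))"
   unfolding sum.distrib using i3 by (intro arg_cong2[of _ _ _ _ "(+)"] tel i4 s set_integrable_mult_right) auto
  also have "... = C * ep * t + C * (1 / 2 ^ p) * ?M" using t by (simp add: set_integral_mult_right set_lebesgue_integral_def)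
  finally show ?thesis .
 qed
 show ?thesis
 proof (rule LIM_zero_cancel, rule tendsto_norm_zero_cancel, rule LIMSEQ_I)
  fix e :: real assume e: "0 < e"
  define ep where "ep = e / (2 * (C * t + 1))"
  have Ct: "0 < C * t + 1" using C t by (simp add: add_nonneg_pos)
  then have ep: "0 < ep" using e by (simp add: ep_def)
  obtain d where d: "0 < d" "!!a b. a : {0..t} ==> b : {0..t} ==> dist b a < d ==> dist (y b) (y a) < ep"
   using uc ep unfolding uniformly_continuous_on_def by blast
  have l1: "(%p. 1 / 2 ^ p :: real) ----> 0" by (rule LIMSEQ_divide_realpow_zero) simp
  have "(%p. C * (1 / 2 ^ p) * ?M) ----> C * 0 * ?M" by (intro tendsto_intros l1)
  then have "eventually (%p. C * (1 / 2 ^ p) * ?M < e / 2) sequentially" using e by (intro order_tendstoD) auto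
  moreover have "eventually (%p. 1 / 2 ^ p < d) sequentially" using l1 d(1) by (rule order_tendstoD)
  ultimately have "eventually (%p. norm (norm (?S p - ?G) - 0) < e) sequentially"
  proof eventually_elim
   case (elim p)
   note 1 = elim(1) and 2 = elim(2)
   have "norm (?S p - ?G) <= C * ep * t + C * (1 / 2 ^ p) * ?M" by (rule est) (use d(2) 2 in \<open>force simp: dist_norm\<close>)
   moreover have "C * ep * t <= e / 2"
   proof -
    have "C * t * ep <= (C * t + 1) * ep" using ep by (intro mult_right_mono) auto
    also have "... = e / 2" using Ct unfolding ep_def by (metis less_numeral_extra(3) mult.commute nonzero_mult_divide_mult_cancel_right times_divide_eq_right)
    finally show ?thesis by (simp add: mult.commute mult.left_commute)
   qed
   ultimately have "norm (?S p - ?G) < e" using 1 by linarith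
   then show ?case by (simp only: diff_0_right real_norm_def abs_norm_cancel)
  qed
  then show "EX N. ALL p>=N. norm (norm (?S p - ?G) - 0) < e" by (simp add: eventually_sequentially)
 qed
qed

context wiener begin

text \<open>The product rule for a deterministic rotation of finite variation, which has no
  correction term: if \<open>dy = f dt + Y dW\<close>, then \<open>J\<close> is the increment of the
  rotated \<open>y\<close> minus its drift terms. \<open>rot_summation\<close> is the pathwise half
  of the argument and \<open>ito_transform\<close> the probabilistic one.\<close>

lemma ito_rot: fixes Y y :: "real => 'a => 'i::countable ell2" assumes I: "!!r. 0 <= r ==> r <= t ==> ito r Y (I r)" and t: "0 <= t"
  and m: "bdd_by C m" and c: "bdd_by C (%k. \<i> * of_real (c k) * m k)"
  and path: "AE w in M. continuous_on {0..} (%r. y r w) & set_integrable lborel {0..t} (%u. f u w)"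
  and eq: "!!r. 0 <= r ==> r <= t ==> AE w in M. I r w = y r w - y 0 w - (LINT u:{0..r}|lborel. f u w)"
  and J: "J : borel_measurable M" "AE w in M. J w = rot m c t (y t w) - rot m c 0 (y 0 w)
   - (LINT u:{0..t}|lborel. rot (%k. \<i> * of_real (c k) * m k) c u (y u w)) - (LINT u:{0..t}|lborel. rot m c u (f u w))"
 shows "ito t (%u w. rot m c u (Y u w)) J"
proof (rule ito_transform[OF I t rot_linear[OF m] rot_lipschitz[OF m c] J(1)])
 have "AE w in M. ALL i p. I (min t (real i / 2 ^ p)) w = y (min t (real i / 2 ^ p)) w - y 0 w - (LINT u:{0..min t (real i / 2 ^ p)}|lborel. f u w)"
  using t by (auto simp: AE_all_countable intro!: eq)
 then show "AE w in M. (%p. \<Sum>i<nat \<lceil>t * 2 ^ p\<rceil>. rot m c (real i / 2 ^ p)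
   (I (min t (real (Suc i) / 2 ^ p)) w - I (real i / 2 ^ p) w)) ----> J w"
  using path J(2)
 proof eventually_elim
  case (elim w)
  note I = elim(1) and p = elim(2) and J = elim(3)
  define z where "z r = y r w - y 0 w - (LINT u:{0..r}|lborel. f u w)" for r
  have eq: "(\<Sum>i<nat \<lceil>t * 2 ^ p\<rceil>. rot m c (real i / 2 ^ p) (I (min t (real (Suc i) / 2 ^ p)) w - I (real i / 2 ^ p) w))
   = (\<Sum>i<nat \<lceil>t * 2 ^ p\<rceil>. rot m c (real i / 2 ^ p) (z (min t (real (Suc i) / 2 ^ p)) - z (real i / 2 ^ p)))" for p
  proof (rule sum.cong[OF refl])
   fix i assume "i : {..<nat \<lceil>t * 2 ^ p\<rceil>}"
   then have "min t (real i / 2 ^ p) = real i / 2 ^ p" using less_nat_ceiling_iff[OF t, of i p] by simp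
   then have "I (real i / 2 ^ p) w = z (real i / 2 ^ p)" using I[rule_format, of i p] by (simp add: z_def)
   then show "rot m c (real i / 2 ^ p) (I (min t (real (Suc i) / 2 ^ p)) w - I (real i / 2 ^ p) w)
    = rot m c (real i / 2 ^ p) (z (min t (real (Suc i) / 2 ^ p)) - z (real i / 2 ^ p))" using I[rule_format, of "Suc i" p] by (simp only: z_def)
  qed
  show ?case
   unfolding eq J using p by (intro rot_summation[OF m c _ _ t]) (auto simp: z_def)
 qed
qed

end

section \<open>Summability of the Sobolev weights\<close>

text \<open>The finite set is enlarged to a full box, where the sum of products factorises.\<close>

lemma sum_prod_le: fixes a :: "int => real" assumes a: "!!n. 0 <= a n" "a summable_on UNIV" and F: "finite (F :: (int ^ 'd::finite) set)"
 shows "(\<Sum>k\<in>F. \<Prod>i\<in>UNIV. a (k $ i)) <= (infsum a UNIV) ^ CARD('d)"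
proof -
 define N where "N = (%(k, i). k $ i) ` (F \<times> UNIV)"
 have N: "finite N" using F by (simp add: N_def)
 have "(\<Sum>k\<in>F. \<Prod>i\<in>UNIV. a (k $ i)) = (\<Sum>p\<in>($) ` F. \<Prod>i\<in>UNIV. a (p i))"
  by (subst sum.reindex) (auto intro: inj_onI simp: vec_eq_iff o_def)
 also have "... <= (\<Sum>p\<in>Pi\<^sub>E (UNIV :: 'd set) (%_. N). \<Prod>i\<in>UNIV. a (p i))"
  by (rule sum_mono2) (auto intro!: finite_PiE N prod_nonneg a simp: PiE_iff, auto simp: N_def)
 also have "... = (\<Prod>i\<in>(UNIV::'d set). \<Sum>n\<in>N. a n)" by (rule prod_sum_PiE[symmetric]) (auto simp: N)
 also have "... <= (infsum a UNIV) ^ CARD('d)" unfolding prod_constant by (intro power_mono finite_sum_le_infsum a N sum_nonneg) auto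
 finally show ?thesis .
qed

lemma summable_int_powr: assumes "1 / 2 < e" shows "(%n::int. (1 + (real_of_int n)^2) powr (- e)) summable_on UNIV"
proof -
 let ?a = "%n::int. (1 + (real_of_int n)^2) powr (- e)"
 have "summable (%m::nat. ?a (int m))"
 proof (rule summable_comparison_test_ev)
  show "summable (%m. real m powr (- 2 * e))" using assms by (simp add: summable_real_powr_iff)
  show "eventually (%m. norm (?a (int m)) <= real m powr (- 2 * e)) sequentially" using eventually_gt_at_top[of 0]
  proof eventually_elim
   fix m :: nat assume m: "0 < m"
   have "?a (int m) <= ((real m)^2) powr (- e)" using m assms by (intro powr_mono2') auto
   also have "... = real m powr (- 2 * e)" using m by (simp add: powr_powr flip: powr_numeral)
   finally show "norm (?a (int m)) <= real m powr (- 2 * e)" by simp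
  qed
 qed
 then have 1: "(%m::nat. ?a (int m)) summable_on UNIV" by (subst summable_on_UNIV_nonneg_real_iff) auto
 have "?a summable_on range int" using 1 by (subst summable_on_reindex) (auto simp: o_def)
 moreover have "?a summable_on range (%m. - int m)" using 1 by (subst summable_on_reindex) (auto simp: o_def inj_def)
 ultimately have "?a summable_on range int \<union> range (%m. - int m)" by (rule summable_on_union)
 moreover have "n : range int \<union> range (%m. - int m)" for n by (cases n rule: int_cases2) auto
 ultimately show ?thesis by (metis UNIV_eq_I)
qed

text \<open>The weight is distributed evenly over the coordinates: it is a product of
  \<open>CARD('d)\<close> equal factors with exponent \<open>e\<close>, and each is at most the
  corresponding one-dimensional weight. The condition on \<open>s\<close> says exactly that
  \<open>e > 1 / 2\<close>.\<close>

lemma japanese_summable: assumes s: "real CARD('d) / 2 < s" shows "(%k::int ^ 'd::finite. japanese k powr (- 2 * s)) summable_on UNIV"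
proof -
 define e where "e = s / real CARD('d)"
 have e: "1 / 2 < e" using s by (simp add: e_def field_simps)
 let ?a = "%n::int. (1 + (real_of_int n)^2) powr (- e)"
 have le: "japanese k powr (- 2 * s) <= (\<Prod>i\<in>UNIV. ?a (k $ i))" for k :: "int ^ 'd"
 proof -
  have pos: "0 < 1 + (norm (freq k))^2" by (simp add: add_pos_nonneg)
  have "japanese k powr (- 2 * s) = (1 + (norm (freq k))^2) powr (- s)" using pos by (simp add: japanese_def powr_half_sqrt[symmetric] powr_powr)
  also have "... = ((1 + (norm (freq k))^2) powr (- e)) ^ CARD('d)" using pos by (simp add: powr_powr e_def flip: powr_realpow)
  also have "... = (\<Prod>i\<in>(UNIV::'d set). (1 + (norm (freq k))^2) powr (- e))" by simp
  also have "... <= (\<Prod>i\<in>UNIV. ?a (k $ i))"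
  proof (intro prod_mono conjI powr_mono2')
   fix i
   have "(real_of_int (k $ i))^2 <= (norm (freq k))^2"
    using component_le_norm_cart[of "freq k" i] by (intro power2_le_iff_abs_le[THEN iffD2]) (auto simp: freq_def)
   then show "1 + (real_of_int (k $ i))^2 <= 1 + (norm (freq k))^2" by simp
  qed (use e in \<open>auto simp: add_pos_nonneg\<close>)
  finally show ?thesis .
 qed
 show ?thesis
 proof (rule nonneg_bdd_above_summable_on)
  show "bdd_above (sum (%k::int ^ 'd. japanese k powr (- 2 * s)) ` {F. F \<subseteq> UNIV & finite F})"
  proof (rule bdd_aboveI2)
   fix F :: "(int ^ 'd) set" assume F: "F : {F. F \<subseteq> UNIV & finite F}"
   have "(\<Sum>k\<in>F. japanese k powr (- 2 * s)) <= (\<Sum>k\<in>F. \<Prod>i\<in>UNIV. ?a (k $ i))" by (intro sum_mono le)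
   also have "... <= (infsum ?a UNIV) ^ CARD('d)" using F by (intro sum_prod_le summable_int_powr e) auto
   finally show "(\<Sum>k\<in>F. japanese k powr (- 2 * s)) <= (infsum ?a UNIV) ^ CARD('d)" .
  qed
 qed auto
qed

section \<open>Interpolation and the local Lipschitz property of the nonlinearity\<close>

lemma poly_map_of_real: "poly (map_poly of_real p) (of_real x :: complex) = of_real (poly p x)" by (induction p) (auto simp: map_poly_pCons)

text \<open>Lagrange interpolation at the nodes \<open>0, \<dots>, n\<close>.\<close>

lemma interpolation: fixes n :: nat obtains l :: "nat => real poly" where "!!p t. degree (p :: complex poly) <= n ==>
  poly p (of_real t) - poly p 0 = (\<Sum>i\<le>n. of_real (t * poly (l i) t) * poly p (of_nat i))"
proof -
 define L where "L i = (\<Prod>j\<in>{..n} - {i}. smult (1 / (real i - real j)) [:- real j, 1:])" for i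
 have Ldeg: "degree (L i) <= n" if "i <= n" for i
 proof -
  have "degree (L i) <= (\<Sum>j\<in>{..n} - {i}. degree (smult (1 / (real i - real j)) [:- real j, 1:]))"
   unfolding L_def by (rule degree_prod_sum_le[unfolded o_def]) simp
  also have "... <= (\<Sum>j\<in>{..n} - {i}. 1)" by (intro sum_mono order_trans[OF degree_smult_le]) simp
  also have "... = n" using that by simp
  finally show ?thesis .
 qed
 have Lval: "poly (L i) (real j) = (if i = j then 1 else 0)" if "i <= n" "j <= n" for i j
 proof (cases "i = j")
  case True
  have "(\<Prod>k\<in>{..n} - {j}. (1 / (real j - real k)) * (real j - real k)) = (\<Prod>k\<in>{..n} - {j}. 1)" by (rule prod.cong) auto
  then show ?thesis using True by (simp add: L_def poly_prod right_diff_distrib)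
 next
  case False
  then show ?thesis using that by (auto simp: L_def poly_prod)
 qed
 have id: "poly p (of_real t) = (\<Sum>i\<le>n. of_real (poly (L i) t) * poly p (of_nat i))" if p: "degree p <= n" for p :: "complex poly" and t
 proof -
  define q where "q = (\<Sum>i\<le>n. smult (poly p (of_nat i)) (map_poly of_real (L i)))"
  have "p = q"
  proof (rule ccontr)
   assume ne: "p ~= q"
   have val: "poly (p - q) (of_nat j) = 0" if j: "j <= n" for j
   proof -
    have "poly q (of_real (real j)) = (\<Sum>i\<le>n. poly p (of_nat i) * of_real (poly (L i) (real j)))"
     unfolding q_def poly_sum poly_smult poly_map_of_real by simp
    also have "... = (\<Sum>i\<le>n. if i = j then poly p (of_nat i) else 0)" using j by (intro sum.cong) (auto simp: Lval)
    finally show ?thesis using j by simp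
   qed
   have "degree q <= n" unfolding q_def
    by (intro degree_sum_le order_trans[OF degree_smult_le]) (auto intro: order_trans[OF map_poly_degree_leq] Ldeg)
   then have "degree (p - q) <= n" using p by (rule_tac degree_diff_le)
   moreover have "card (of_nat ` {..n} :: complex set) = Suc n" by (subst card_image) (auto simp: inj_on_def)
   moreover have "card (of_nat ` {..n} :: complex set) <= card {x. poly (p - q) x = 0}" using val ne by (intro card_mono poly_roots_finite) auto
   moreover have "card {x. poly (p - q) x = 0} <= degree (p - q)" using ne by (intro card_poly_roots_bound) auto
   ultimately show False by linarith
  qed
  then have "poly p (of_real t) = poly q (of_real t)" by simp
  also have "... = (\<Sum>i\<le>n. of_real (poly (L i) t) * poly p (of_nat i))"
   unfolding q_def poly_sum poly_smult poly_map_of_real by (simp add: mult.commute)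
  finally show ?thesis .
 qed
 \<comment> \<open>Splitting off the constant term leaves a factor \<open>t\<close>; it is this
   factor that turns values at fixed nodes into a bound proportional to the distance.\<close>
 have "EX l. ALL t. poly (L i) t - poly (L i) 0 = t * poly l t" for i by (cases "L i") (auto intro!: exI)
 then obtain l where l: "!!i t. poly (L i) t - poly (L i) 0 = t * poly (l i) t" by metis
 have "poly p (of_real t) - poly p 0 = (\<Sum>i\<le>n. of_real (t * poly (l i) t) * poly p (of_nat i))"
  if p: "degree p <= n" for p :: "complex poly" and t using id[OF p, of t] id[OF p, of 0] by (simp add: l[symmetric] left_diff_distrib sum_subtractf)
 then show thesis by (rule that)
qed

locale nls = fixes s K :: real and \<sigma> :: nat and \<alpha> :: complex and \<phi> :: "'d::finite coeffs => 'd coeffs"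
 assumes s: "real CARD('d) / 2 < s" and K0: "0 < K" and K: "ALL u::'d coeffs. u : sob s & Linf_norm (fourier_fun u) < \<infinity> -->
   power_nonlin \<sigma> u : sob s &
   sob_norm s (power_nonlin \<sigma> u) <= K * real_of_ereal (Linf_norm (fourier_fun u)) ^ (2 * \<sigma>) * sob_norm s u"
  and a: "\<phi> : sob s \<rightarrow> sob s" "bounded_on_balls s s \<phi>"
  and d: "EX \<psi> :: real => real => real. (ALL R. EX C. ALL x:{0..R}. ALL y:{0..R}. \<psi> x y <= C) &
   (ALL u:sob s. ALL v:sob s. sob_dist s (\<phi> u) (\<phi> v) <= \<psi> (sob_norm s u) (sob_norm s v) * sob_dist s u v)"
begin

definition "ff x = fourier_fun (of_ell2 s (x :: (int ^ 'd) ell2))"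
definition "c0 = (2 * pi) powr (- (real CARD('d) / 2))"
text \<open>The constant of the Sobolev embedding into bounded functions, by Cauchy-Schwarz on the
  Fourier coefficients; \<open>c0\<close> is the normalisation of the exponentials.\<close>

definition "Z = c0 * sqrt (\<Sum>\<^sub>\<infinity>k::int ^ 'd. japanese k powr (- 2 * s))"

lemma c0: "0 <= c0" by (simp add: c0_def)

lemma sobolev_sum: fixes x :: "(int ^ 'd) ell2" assumes "finite F" shows "(\<Sum>k\<in>F. cmod (of_ell2 s x k) * c0) <= Z * norm x"
proof -
 have "(\<Sum>k\<in>F. cmod (of_ell2 s x k)) <= sqrt (\<Sum>\<^sub>\<infinity>k::int ^ 'd. japanese k powr (- 2 * s)) * norm x"
 proof (rule power2_le_imp_le)
  have "(\<Sum>k\<in>F. cmod (of_ell2 s x k))^2 = (\<Sum>k\<in>F. japanese k powr (- s) * cmod (ell2_nth x k))^2" by (simp add: of_ell2_def norm_mult)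
  also have "... <= (\<Sum>k\<in>F. (japanese k powr (- s))^2) * (\<Sum>k\<in>F. (cmod (ell2_nth x k))^2)" by (rule Cauchy_Schwarz_ineq_sum)
  also have "... <= (\<Sum>\<^sub>\<infinity>k::int ^ 'd. japanese k powr (- 2 * s)) * (norm x)^2"
   using finite_sum_le_infsum[OF japanese_summable[OF s] assms] sum_le_norm_ell2_sq[OF assms, of x]
   by (intro mult_mono infsum_nonneg sum_nonneg) (auto simp: japanese_powr_sq)
  also have "... = (sqrt (\<Sum>\<^sub>\<infinity>k::int ^ 'd. japanese k powr (- 2 * s)) * norm x)^2" by (simp add: power_mult_distrib infsum_nonneg)
  finally show "(\<Sum>k\<in>F. cmod (of_ell2 s x k))^2 <= (sqrt (\<Sum>\<^sub>\<infinity>k::int ^ 'd. japanese k powr (- 2 * s)) * norm x)^2" .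
 qed (simp add: infsum_nonneg)
 from mult_right_mono[OF this c0] show ?thesis unfolding Z_def sum_distrib_right[symmetric] by (simp add: mult_ac)
qed

lemma ff_eq: "ff x y = (\<Sum>\<^sub>\<infinity>k. of_ell2 s x k * (complex_of_real c0 * cis (freq k \<bullet> y)))"
 by (simp add: ff_def fourier_fun_def c0_def)

lemma ff_norm: "cmod (of_ell2 s x k * (complex_of_real c0 * cis (freq k \<bullet> y))) = cmod (of_ell2 s x k) * c0" for x :: "(int ^ 'd) ell2"
 using c0 by (simp add: norm_mult)

lemma ff_dom: "(%k. cmod (of_ell2 s x k) * c0) summable_on UNIV" for x :: "(int ^ 'd) ell2"
 by (rule nonneg_bdd_above_summable_on) (auto intro!: bdd_aboveI2 sobolev_sum simp: c0)

lemma ff_summable: "(%k. cmod (of_ell2 s x k * (complex_of_real c0 * cis (freq k \<bullet> y)))) summable_on UNIV" for x :: "(int ^ 'd) ell2"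
 unfolding ff_norm by (rule ff_dom)

lemma ff_bound: "cmod (ff x y) <= Z * norm x"
proof -
 have "cmod (ff x y) <= (\<Sum>\<^sub>\<infinity>k. cmod (of_ell2 s x k) * c0)"
  unfolding ff_eq using norm_infsum_bound[OF ff_summable[of x y]] by (simp add: ff_norm)
 also have "... <= Z * norm x" by (intro infsum_le_finite_sums ff_dom sobolev_sum)
 finally show ?thesis .
qed

lemma Z: "0 <= Z" by (simp add: Z_def c0 infsum_nonneg)

lemma ff_continuous: "continuous_on UNIV (ff x)"
proof -
 have "uniform_limit UNIV (%F y. \<Sum>k\<in>F. of_ell2 s x k * (complex_of_real c0 * cis (freq k \<bullet> y))) (ff x) (finite_subsets_at_top UNIV)"
  unfolding ff_eq[abs_def] by (rule Weierstrass_m_test_general[OF _ ff_dom[of x]]) (simp add: ff_norm)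
 then show ?thesis by (rule uniform_limit_theorem[rotated]) (auto intro!: always_eventually continuous_intros)
qed

lemma ff_linear: "ff (x + t *R h) y = ff x y + of_real t * ff h y"
proof -
 let ?e = "%k. complex_of_real c0 * cis (freq k \<bullet> y)"
 have "(\<Sum>\<^sub>\<infinity>k. of_ell2 s x k * ?e k + of_real t * (of_ell2 s h k * ?e k))
  = (\<Sum>\<^sub>\<infinity>k. of_ell2 s x k * ?e k) + (\<Sum>\<^sub>\<infinity>k. of_real t * (of_ell2 s h k * ?e k))"
  by (rule infsum_add[OF abs_summable_summable[OF ff_summable] summable_on_cmult_right[OF abs_summable_summable[OF ff_summable]]])
 also have "(\<Sum>\<^sub>\<infinity>k. of_real t * (of_ell2 s h k * ?e k)) = of_real t * (\<Sum>\<^sub>\<infinity>k. of_ell2 s h k * ?e k)" by (rule infsum_cmult_right')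
 also have "(%k. of_ell2 s x k * ?e k + of_real t * (of_ell2 s h k * ?e k)) = (%k. of_ell2 s (x + t *R h) k * ?e k)"
  by (simp add: of_ell2_def plus_ell2.rep_eq scaleR_ell2.rep_eq scaleR_conv_of_real distrib_left distrib_right mult_ac)
 finally show ?thesis by (simp only: ff_eq)
qed

definition "Linf x = real_of_ereal (Linf_norm (ff x))"

lemma Linf: "Linf_norm (ff x) < \<infinity>" "0 <= Linf x" "Linf x <= Z * norm x"
proof -
 have m: "(%y. ereal (cmod (ff x y))) : borel_measurable (lebesgue_on cell)"
  by (intro borel_measurable_ereal continuous_imp_measurable_on_sets_lebesgue continuous_on_norm continuous_on_subset[OF ff_continuous])
   (auto simp: cell_def)
 have le: "Linf_norm (ff x) <= ereal (Z * norm x)" unfolding Linf_norm_def by (rule esssup_I[OF m]) (auto intro!: AE_I2 ff_bound)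
 then show "Linf_norm (ff x) < \<infinity>" by (rule le_less_trans) simp
 have "real_of_ereal (Linf_norm (ff x)) <= Z * norm x" using le Z by (cases "Linf_norm (ff x)") auto
 then show "Linf x <= Z * norm x" by (simp add: Linf_def)
 show "0 <= Linf x"
 proof (cases "emeasure (lebesgue_on cell) (space (lebesgue_on (cell :: (real ^ 'd) set))) = 0")
  case True
  \<comment> \<open>On a null space the essential supremum is minus infinity, which
    \<open>real_of_ereal\<close> maps to 0, so the measure of the cell need not be computed.\<close>
  then show ?thesis using esssup_zero_space[OF True m] by (simp add: Linf_def Linf_norm_def)
 next
  case False
  have "(0::ereal) = esssup (lebesgue_on cell) (%y::real ^ 'd. 0)" using esssup_const[OF False] by simp
  also have "... <= Linf_norm (ff x)" unfolding Linf_norm_def by (rule esssup_mono) auto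
  finally show ?thesis by (simp add: Linf_def real_of_ereal_pos)
 qed
qed

definition N :: "(int ^ 'd) ell2 => (int ^ 'd) ell2" where "N x = to_ell2 s (power_nonlin \<sigma> (of_ell2 s x))"
definition G :: "(int ^ 'd) ell2 => (int ^ 'd) ell2" where "G x = to_ell2 s (\<phi> (of_ell2 s x))"

lemma fixes x :: "(int ^ 'd) ell2" shows nonlin_sob: "power_nonlin \<sigma> (of_ell2 s x) : sob s"
  and N_norm: "norm (N x) <= K * Linf x ^ (2 * \<sigma>) * norm x"
proof -
 have "power_nonlin \<sigma> (of_ell2 s x) : sob s &
  sob_norm s (power_nonlin \<sigma> (of_ell2 s x)) <= K * Linf x ^ (2 * \<sigma>) * sob_norm s (of_ell2 s x)"
  using K[rule_format, of "of_ell2 s x"] Linf(1)[of x] by (simp add: ff_def Linf_def of_ell2_in_sob)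
 then show "power_nonlin \<sigma> (of_ell2 s x) : sob s" "norm (N x) <= K * Linf x ^ (2 * \<sigma>) * norm x"
  using norm_to_ell2[OF of_ell2_in_sob, of s x] by (auto simp: N_def norm_to_ell2 to_ell2_of_ell2)
qed

lemma N_bound: assumes "norm x <= R" shows "norm (N x) <= K * (Z * R) ^ (2 * \<sigma>) * R"
proof -
 have R: "0 <= R" using assms norm_ge_zero order_trans by blast
 have "Linf x <= Z * R" using Linf(3)[of x] mult_left_mono[OF assms Z] by linarith
 then have "K * Linf x ^ (2 * \<sigma>) * norm x <= K * (Z * R) ^ (2 * \<sigma>) * R"
  using K0 Linf(2)[of x] R Z assms by (intro mult_mono power_mono) auto
 then show ?thesis using N_norm[of x] by linarith
qed

text \<open>Along a line the nonlinearity is a polynomial, so its values at finitely many points, which the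
  hypothesis on \<open>K\<close> controls, bound its increments: this is where local Lipschitz continuity comes from.\<close>

lemma N_interpolation: obtains l :: "nat => real poly" where
  "!!x h t. N (x + t *R h) - N x = (\<Sum>i\<le>2 * \<sigma> + 1. (t * poly (l i) t) *R N (x + real i *R h))"
proof -
 obtain l :: "nat => real poly" where l: "!!p t. degree (p :: complex poly) <= 2 * \<sigma> + 1 ==>
  poly p (of_real t) - poly p 0 = (\<Sum>i\<le>2 * \<sigma> + 1. of_real (t * poly (l i) t) * poly p (of_nat i))"
  by (rule interpolation[of "2 * \<sigma> + 1"]) blast
 define F where "F x y = complex_of_real (cmod (ff x y) ^ (2 * \<sigma>)) * ff x y" for x :: "(int ^ 'd) ell2" and y
 have F: "F (x + t *R h) y - F x y = (\<Sum>i\<le>2 * \<sigma> + 1. of_real (t * poly (l i) t) * F (x + real i *R h) y)" for x h t y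
 proof -
  \<comment> \<open>The nonlinearity equals \<open>v ^ Suc \<sigma> * cnj v ^ \<sigma>\<close>. For
    real parameters the conjugate of an affine function is affine with conjugated coefficients, so
    the restriction to a line is a genuine polynomial.\<close>
  define p where "p = [:ff x y, ff h y:] ^ Suc \<sigma> * [:cnj (ff x y), cnj (ff h y):] ^ \<sigma>"
  have "degree p <= 1 * Suc \<sigma> + 1 * \<sigma>" unfolding p_def
   by (intro order_trans[OF degree_mult_le] add_mono order_trans[OF degree_power_le] mult_right_mono) auto
  then have deg: "degree p <= 2 * \<sigma> + 1" by simp
  have val: "poly p (of_real q) = F (x + q *R h) y" for q :: real
  proof -
   let ?v = "ff x y + of_real q * ff h y"
   have "complex_of_real (cmod ?v ^ (2 * \<sigma>)) = (?v * cnj ?v) ^ \<sigma>"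
    by (simp only: complex_norm_square[symmetric] power_mult of_real_power)
   moreover have "poly p (of_real q) = ?v ^ Suc \<sigma> * cnj ?v ^ \<sigma>" unfolding p_def poly_mult poly_power by simp
   ultimately show ?thesis unfolding F_def ff_linear by (simp only: power_mult_distrib power_Suc mult_ac)
  qed
  have "poly p (of_nat i) = F (x + real i *R h) y" for i using val[of "real i"] by simp
  then show ?thesis using l[OF deg, of t] val[of 0] val[of t] by (simp only: of_real_0 scaleR_zero_left add_0_right)
 qed
 have int: "integrable (lebesgue_on cell) (%y. F x y * cis (- (freq k \<bullet> y)))" for x k unfolding cell_def F_def
  by (intro continuous_imp_integrable continuous_intros continuous_on_subset[OF ff_continuous]) auto
 have pn: "power_nonlin \<sigma> (of_ell2 s x) = fourier_coeff (F x)" for x by (simp add: power_nonlin_def F_def[abs_def] ff_def)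
 have pc: "power_nonlin \<sigma> (of_ell2 s (x + t *R h)) k - power_nonlin \<sigma> (of_ell2 s x) k
  = (\<Sum>i\<le>2 * \<sigma> + 1. of_real (t * poly (l i) t) * power_nonlin \<sigma> (of_ell2 s (x + real i *R h)) k)" for x h :: "(int ^ 'd) ell2" and t k
 proof -
  have "(LINT y|lebesgue_on cell. F (x + t *R h) y * cis (- (freq k \<bullet> y))) - (LINT y|lebesgue_on cell. F x y * cis (- (freq k \<bullet> y)))
   = (LINT y|lebesgue_on cell. (\<Sum>i\<le>2 * \<sigma> + 1. of_real (t * poly (l i) t) * (F (x + real i *R h) y * cis (- (freq k \<bullet> y)))))"
   unfolding Bochner_Integration.integral_diff[OF int int, symmetric] left_diff_distrib[symmetric] F sum_distrib_right mult.assoc ..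
  also have "... = (\<Sum>i\<le>2 * \<sigma> + 1. of_real (t * poly (l i) t) * (LINT y|lebesgue_on cell. F (x + real i *R h) y * cis (- (freq k \<bullet> y))))"
   using int by (subst Bochner_Integration.integral_sum) auto
  finally show ?thesis unfolding pn fourier_coeff_def right_diff_distrib[symmetric] by (simp only: sum_distrib_left mult_ac)
 qed
 have nth_sum: "ell2_nth (\<Sum>i\<in>S. f i) k = (\<Sum>i\<in>S. ell2_nth (f i) k)" for S :: "nat set" and f :: "nat => (int ^ 'd) ell2" and k
  by (rule linear_sum[OF bounded_linear.linear[OF ell2_nth_linear]])
 show thesis
 proof (rule that, rule ell2_eqI)
  fix x h t k
  show "ell2_nth (N (x + t *R h) - N x) k = ell2_nth (\<Sum>i\<le>2 * \<sigma> + 1. (t * poly (l i) t) *R N (x + real i *R h)) k"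
   unfolding minus_ell2.rep_eq nth_sum scaleR_ell2.rep_eq N_def ell2_nth_to_ell2[OF nonlin_sob] right_diff_distrib[symmetric] pc
    sum_distrib_left scaleR_conv_of_real by (simp only: mult_ac)
 qed
qed

text \<open>The direction is normalised to a unit vector \<open>h\<close>, so that
  \<open>norm (x - y)\<close> becomes the parameter \<open>t <= 2 * R\<close> and appears as a
  factor, while the nodes \<open>y + real i *R h\<close> stay in the ball of radius
  \<open>R + n\<close>. Negative radii make the claim vacuous.\<close>

lemma N_lipschitz: "EX L>=0. ALL x y. norm x <= R --> norm y <= R --> norm (N x - N y) <= L * norm (x - y)"
proof (cases "0 <= R")
 case R: True
 obtain l where l: "!!x h t. N (x + t *R h) - N x = (\<Sum>i\<le>2 * \<sigma> + 1. (t * poly (l i) t) *R N (x + real i *R h))"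
  by (rule N_interpolation) blast
 define n where "n = 2 * \<sigma> + 1"
 have "EX B. ALL t:{0..2 * R}. \<bar>poly (l i) t\<bar> <= B" for i
  using compact_continuous_image[of "{0..2 * R}" "poly (l i)"] by (auto dest!: compact_imp_bounded simp: bounded_iff continuous_on_poly continuous_on_id)
 then obtain B where B: "!!i t. t : {0..2 * R} ==> \<bar>poly (l i) t\<bar> <= B i" by metis
 have B0: "0 <= B i" for i using B[of 0 i] R by auto
 define Q where "Q = K * (Z * (R + real n)) ^ (2 * \<sigma>) * (R + real n)"
 have Q: "0 <= Q" using K0 Z R by (simp add: Q_def)
 have "norm (N x - N y) <= (\<Sum>i\<le>n. B i * Q) * norm (x - y)" if xy: "norm x <= R" "norm y <= R" for x y
 proof (cases "x = y")
  case False
  define t where "t = norm (x - y)"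
  define h where "h = (1 / t) *R (x - y)"
  have t: "0 < t" "t <= 2 * R" using False norm_triangle_ineq4[of x y] xy by (auto simp: t_def)
  have h: "norm h = 1" "x = y + t *R h" using t by (simp_all add: h_def t_def)
  have "norm (N x - N y) = norm (\<Sum>i\<le>n. (t * poly (l i) t) *R N (y + real i *R h))" using l[of y t h] h(2) by (simp add: n_def)
  also have "... <= (\<Sum>i\<le>n. t * (B i * Q))"
  proof (rule order_trans[OF norm_sum sum_mono])
   fix i assume i: "i : {..n}"
   have "norm (y + real i *R h) <= R + real n" using norm_triangle_ineq[of y "real i *R h"] xy i h(1) by (simp add: order_trans)
   then have "norm (N (y + real i *R h)) <= Q" unfolding Q_def by (rule N_bound)
   then have "\<bar>poly (l i) t\<bar> * norm (N (y + real i *R h)) <= B i * Q" using B[of t i] t B0[of i] by (intro mult_mono) auto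
   then have "t * (\<bar>poly (l i) t\<bar> * norm (N (y + real i *R h))) <= t * (B i * Q)" using t by (intro mult_left_mono) auto
   then show "norm ((t * poly (l i) t) *R N (y + real i *R h)) <= t * (B i * Q)" using t by (simp add: abs_mult mult.assoc)
  qed
  also have "... = (\<Sum>i\<le>n. B i * Q) * norm (x - y)" unfolding t_def sum_distrib_left[symmetric] by (rule mult.commute)
  finally show ?thesis .
 qed simp
 moreover have "0 <= (\<Sum>i\<le>n. B i * Q)" by (intro sum_nonneg mult_nonneg_nonneg B0 Q)
 ultimately show ?thesis by blast
next
 case False
 then have "\<not> norm x <= R" for x :: "(int ^ 'd) ell2" using norm_ge_zero[of x] by linarith
 then show ?thesis by (intro exI[of _ 0]) blast
qed

lemma phi_sob: "\<phi> (of_ell2 s x) : sob s" using a(1) of_ell2_in_sob by blast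

lemma G_bounded: "EX C>=0. ALL x. norm x <= R --> norm (G x) <= C"
proof -
 obtain C where C: "ALL u:sob s. sob_norm s u <= R --> sob_norm s (\<phi> u) <= C" using a(2) unfolding bounded_on_balls_def by blast
 have "norm (G x) <= \<bar>C\<bar>" if "norm x <= R" for x
  using C of_ell2_in_sob[of s x] that norm_to_ell2[OF of_ell2_in_sob, of s x] norm_to_ell2[OF phi_sob, of x] by (force simp: G_def to_ell2_of_ell2)
 then show ?thesis by (intro exI[of _ "\<bar>C\<bar>"]) auto
qed

lemma G_lipschitz: "EX L>=0. ALL x y. norm x <= R --> norm y <= R --> norm (G x - G y) <= L * norm (x - y)"
proof -
 obtain \<psi> :: "real => real => real" where p: "ALL R. EX C. ALL x:{0..R}. ALL y:{0..R}. \<psi> x y <= C"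
  "!!u v. u : sob s ==> v : sob s ==> sob_dist s (\<phi> u) (\<phi> v) <= \<psi> (sob_norm s u) (sob_norm s v) * sob_dist s u v" using d by blast
 obtain C where C: "ALL x:{0..R}. ALL y:{0..R}. \<psi> x y <= C" using p(1) by blast
 have n: "sob_norm s (of_ell2 s x) = norm x" for x :: "(int ^ 'd) ell2" using norm_to_ell2[OF of_ell2_in_sob, of s x] by (simp add: to_ell2_of_ell2)
 have "norm (G x - G y) <= \<bar>C\<bar> * norm (x - y)" if xy: "norm x <= R" "norm y <= R" for x y
 proof -
  have "norm (G x - G y) <= \<psi> (norm x) (norm y) * norm (x - y)" using p(2)[OF of_ell2_in_sob[of s x] of_ell2_in_sob[of s y]]
   by (simp add: n sob_dist_eq phi_sob of_ell2_in_sob to_ell2_of_ell2 dist_norm G_def)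
  also have "... <= \<bar>C\<bar> * norm (x - y)" using C xy by (intro mult_right_mono) (force intro: order_trans[OF _ abs_ge_self])+
  finally show ?thesis .
 qed
 then show ?thesis by (intro exI[of _ "\<bar>C\<bar>"]) auto
qed

end

section \<open>The twisted equation and existence\<close>

lemma ell2_norm_cong: "(!!k. cmod (ell2_nth x k) = cmod (ell2_nth y k)) ==> norm x = norm y"
 using ell2_norm_mono[of x 1 y] ell2_norm_mono[of y 1 x] by simp

text \<open>The imaginary part of a hermitian product is the real product with \<open>\<i>\<close>
  times the second factor. This recovers the complex pairing of weak continuity from the real inner
  product on coordinates.\<close>

lemma Re_sob_inner: fixes u v :: "'d::finite coeffs" assumes "u : sob r" "v : sob r"
 shows "sob_inner r u v = Complex (to_ell2 r u \<bullet> to_ell2 r v) (to_ell2 r u \<bullet> ell2_mult (%_. \<i>) (to_ell2 r v))"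
proof -
 let ?x = "to_ell2 r u" and ?y = "to_ell2 r v"
 have b: "bdd_by 1 (%_::int ^ 'd. \<i>)" by (simp add: bdd_by_def)
 have eq: "complex_of_real (japanese k powr (2 * r)) * u k * cnj (v k)
  = of_real (ell2_nth ?x k \<bullet> ell2_nth ?y k) + \<i> * of_real (ell2_nth ?x k \<bullet> ell2_nth (ell2_mult (%_. \<i>) ?y) k)" for k
 proof -
  have "complex_of_real (japanese k powr (2 * r)) * u k * cnj (v k) = ell2_nth ?x k * cnj (ell2_nth ?y k)"
   by (simp add: ell2_nth_to_ell2 assms power2_eq_square flip: japanese_powr_sq)
  also have "p * cnj q = of_real (p \<bullet> q) + \<i> * of_real (p \<bullet> (\<i> * q))" for p q
   by (simp add: complex_eq_iff inner_complex_def algebra_simps)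
  finally show ?thesis by (simp only: ell2_mult_nth[OF b])
 qed
 have "sob_inner r u v = (\<Sum>\<^sub>\<infinity>k. complex_of_real (ell2_nth ?x k \<bullet> ell2_nth ?y k))
  + (\<Sum>\<^sub>\<infinity>k. \<i> * complex_of_real (ell2_nth ?x k \<bullet> ell2_nth (ell2_mult (%_. \<i>) ?y) k))" unfolding sob_inner_def eq
  by (intro infsum_add summable_on_cmult_right summable_on_of_real ell2_inner_summable)
 also have "... = of_real (?x \<bullet> ?y) + \<i> * of_real (?x \<bullet> ell2_mult (%_. \<i>) ?y)"
  by (simp add: inner_ell2_def infsum_cmult_right' infsumI[OF has_sum_of_real[OF has_sum_infsum[OF ell2_inner_summable]]])
 finally show ?thesis by (simp add: complex_eq_iff)
qed

lemma sob_continuous_iff: "sob_continuous r f \<longleftrightarrow> (ALL t>=0. f t : sob r) & continuous_on {0..} (%t. to_ell2 r (f t))"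
proof -
 interpret Metric_space "sob r" "sob_dist r :: 'd::finite coeffs => _" by (rule Metric_space_sob)
 let ?X = "top_of_set {0::real..}"
 have in_X: "eventually (%q. q : topspace ?X) (atin ?X t)" for t :: real
  by (cases "t : topspace ?X") (auto simp: eventually_atin intro!: exI[of _ "topspace ?X"])
 have lhs: "sob_continuous r f \<longleftrightarrow> (ALL t>=0. f t : sob r & (ALL e>0. eventually (%q. f q : sob r & sob_dist r (f q) (f t) < e) (atin ?X t)))"
  unfolding sob_continuous_def sob_topology_def continuous_map_atin limitin_metric by auto
 have rhs: "continuous_on {0..} (%t. to_ell2 r (f t)) \<longleftrightarrow> (ALL t>=0. ALL e>0. eventually (%q. dist (to_ell2 r (f q)) (to_ell2 r (f t)) < e) (atin ?X t))"
  unfolding continuous_map_iff_continuous[symmetric] continuous_map_atin limitin_canonical_iff tendsto_iff by auto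
 have eq: "eventually (%q. f q : sob r & sob_dist r (f q) (f t) < e) (atin ?X t)
  \<longleftrightarrow> eventually (%q. dist (to_ell2 r (f q)) (to_ell2 r (f t)) < e) (atin ?X t)" if "ALL t>=0. f t : sob r" "0 <= t" for t e
  by (rule eventually_cong[OF in_X]) (use that in \<open>auto simp: sob_dist_eq\<close>)
 show ?thesis unfolding lhs rhs using eq by blast
qed

lemma rot_isometry: shows rot_1_norm: "norm (rot (%_. 1) c t x) = norm x"
  and rot_1_inner: "rot (%_. 1) c t x \<bullet> rot (%_. 1) c t y = x \<bullet> y"
proof -
 have b: "bdd_by 1 (%_. 1)" by (simp add: bdd_by_def)
 show "norm (rot (%_. 1) c t x) = norm x" by (rule ell2_norm_cong) (simp add: rot_nth[OF b] norm_mult)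
 have "(cis h * p) \<bullet> (cis h * q) = p \<bullet> q" for h p q
 proof -
  have in_Re: "v \<bullet> w = Re (cnj v * w)" for v w by (simp add: inner_complex_def)
  have eq: "cnj (cis h * p) * (cis h * q) = (cis (- h) * cis h) * (cnj p * q)" by (simp only: complex_cnj_mult cis_cnj mult_ac)
  show ?thesis unfolding in_Re eq cis_mult by simp
 qed
 then show "rot (%_. 1) c t x \<bullet> rot (%_. 1) c t y = x \<bullet> y" by (simp add: inner_ell2_def rot_nth[OF b])
qed

lemma Lipschitz_on_balls_continuous: fixes F :: "'b::real_normed_vector => 'c::real_normed_vector"
 assumes "!!R. EX L>=0. ALL x y. norm x <= R --> norm y <= R --> norm (F x - F y) <= L * norm (x - y)" shows "continuous_on UNIV F"
proof (rule continuous_at_imp_continuous_on, rule ballI)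
 fix x :: 'b
 obtain L where L: "0 <= L" "ALL y z. norm y <= norm x + 1 --> norm z <= norm x + 1 --> norm (F y - F z) <= L * norm (y - z)" using assms by blast
 have "L-lipschitz_on (ball x 1) F"
 proof (rule lipschitz_onI)
  have "norm y <= norm x + 1" if "y : ball x 1" for y using norm_triangle_ineq2[of y x] that by (simp add: dist_norm norm_minus_commute)
  then show "dist (F y) (F z) <= L * dist y z" if "y : ball x 1" "z : ball x 1" for y z using L that by (simp add: dist_norm)
 qed (fact L)
 then have "continuous_on (ball x 1) F" by (rule lipschitz_on_continuous_on)
 then show "isCont F x" by (simp add: continuous_on_eq_continuous_at)
qed

lemma set_integral_singleton: "(LINT r:{a}|lborel. f r) = 0" for a :: real and f :: "real => 'b::{banach, second_countable_topology}"
 unfolding set_lebesgue_integral_def by (rule integral_eq_zero_AE) (use AE_lborel_singleton[of a] in eventually_elim, auto simp: indicator_def)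

locale nls_sde = nls s K \<sigma> \<alpha> \<phi> + wiener M \<F> W
 for s K :: real and \<sigma> :: nat and \<alpha> :: complex and \<phi> :: "'d::finite coeffs => 'd coeffs"
  and M :: "'a measure" and \<F> :: "real => 'a measure" and W :: "real => 'a => real"
begin

definition "cc k = (norm (freq (k :: int ^ 'd)))^2"
text \<open>The embedding of \<open>H^s\<close> into \<open>H^-s-1\<close> in the coordinates
  \<open>to_ell2\<close> of the two spaces: the quotient of the weights with exponents
  \<open>- s - 1\<close> and \<open>s\<close>.\<close>

definition "lam k = complex_of_real (japanese (k :: int ^ 'd) powr (- 2 * s - 1))"

lemma cc_nonneg: "0 <= cc k" by (simp add: cc_def)

abbreviation "S == rot (%_. 1) cc"
abbreviation "S' == rot (%_. 1) (%k. - cc k)"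

text \<open>The equation reads du = i (A u - \<alpha> F(u)) dt + \<phi>(u) dW, and
  \<open>S t\<close> is the flow exp(i t A). For \<open>w = S' t u\<close> the Laplacian cancels and
  these coefficients remain.\<close>

definition "bb t x = ell2_mult (%_. - \<i> * \<alpha>) (S' t (N (S t x)))"
definition "gg t x = S' t (G (S t x))"

lemma bdd_1: "bdd_by 1 (%_. 1)" and bdd_\<alpha>: "bdd_by (cmod \<alpha>) (%_. - \<i> * \<alpha>)" by (auto simp: bdd_by_def norm_mult)

lemma japanese_ge_1: "1 <= japanese k" by (simp add: japanese_def)

text \<open>The dimension is at least 1, hence \<open>1 <= 2 * s\<close>, so \<open>lam\<close>
  compensates the two derivatives of the Laplacian with the exponent \<open>1 - 2 * s\<close> left
  over.\<close>

lemma bdd_lam: "bdd_by 1 lam" and bdd_cc_lam: "bdd_by 1 (%k. \<i> * of_real (cc k) * lam k)"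
proof -
 have s0: "1 <= 2 * s" using s by (simp add: field_simps) (metis of_nat_1 of_nat_le_iff One_nat_def Suc_leI zero_less_card_finite order_trans less_imp_le)
 have "japanese k powr (- 2 * s - 1) <= japanese k powr 0" for k :: "int ^ 'd" using s0 japanese_ge_1 by (intro powr_mono) auto
 then show "bdd_by 1 lam" by (simp add: bdd_by_def lam_def)
 have "cc k * japanese k powr (- 2 * s - 1) <= 1" for k
 proof -
  have "cc k <= (japanese k)^2" by (simp add: cc_def japanese_def)
  also have "... = japanese k powr 2" using japanese_pos[of k] by simp
  finally have "cc k * japanese k powr (- 2 * s - 1) <= japanese k powr 2 * japanese k powr (- 2 * s - 1)" by (intro mult_right_mono) auto
  also have "... = japanese k powr (1 - 2 * s)" by (simp flip: powr_add)
  also have "... <= japanese k powr 0" using s0 japanese_ge_1 by (intro powr_mono) auto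
  finally show ?thesis by simp
 qed
 then show "bdd_by 1 (%k. \<i> * of_real (cc k) * lam k)" by (auto simp: bdd_by_def norm_mult lam_def cc_nonneg)
qed

lemma N_cont: "continuous_on UNIV N" and G_cont: "continuous_on UNIV G" using Lipschitz_on_balls_continuous N_lipschitz G_lipschitz by blast+

lemma bb_cont: "continuous_on UNIV (case_prod bb)" and gg_cont: "continuous_on UNIV (case_prod gg)"
proof -
 have S: "continuous_on UNIV (%z::real \<times> (int ^ 'd) ell2. S (fst z) (snd z))" by (intro rot_continuous[OF bdd_1] continuous_intros)
 have c: "continuous_on UNIV (%z::real \<times> (int ^ 'd) ell2. S' (fst z) (F (S (fst z) (snd z))))" if "continuous_on UNIV F" for F
  by (intro rot_continuous[OF bdd_1] continuous_intros continuous_on_compose2[OF that S]) auto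
 show "continuous_on UNIV (case_prod gg)" using c[OF G_cont] by (simp add: gg_def case_prod_beta)
 show "continuous_on UNIV (case_prod bb)"
  using bounded_linear.continuous_on[OF ell2_mult_linear[OF bdd_\<alpha>] c[OF N_cont]] by (simp add: bb_def case_prod_beta)
qed

lemma S_S': "S t (S' t x) = x" and S'_S: "S' t (S t x) = x" by (rule ell2_eqI, simp add: rot_nth[OF bdd_1] cis_mult flip: mult.assoc)+

lemma nl_norm: shows bb_norm: "norm (bb t x) <= cmod \<alpha> * norm (N (S t x))"
  and bb_diff: "norm (bb t x - bb t y) <= cmod \<alpha> * norm (N (S t x) - N (S t y))" and gg_norm: "norm (gg t x) = norm (G (S t x))"
  and gg_diff: "norm (gg t x - gg t y) = norm (G (S t x) - G (S t y))" and bb_inner: "x \<bullet> bb t x <= cmod \<alpha> * norm x * norm (N (S t x))"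
  and gg_inner: "x \<bullet> gg t x = S t x \<bullet> G (S t x)"
proof -
 have 1: "norm (ell2_mult (%_. - \<i> * \<alpha>) (S' t z)) <= cmod \<alpha> * norm z" for z
  using ell2_mult_norm[OF bdd_\<alpha>, of "S' t z"] by (simp add: rot_1_norm)
 show "norm (bb t x) <= cmod \<alpha> * norm (N (S t x))" unfolding bb_def by (rule 1)
 then have "norm x * norm (bb t x) <= norm x * (cmod \<alpha> * norm (N (S t x)))" by (rule mult_left_mono) simp
 then show "x \<bullet> bb t x <= cmod \<alpha> * norm x * norm (N (S t x))"
  using norm_cauchy_schwarz[of x "bb t x"] by (simp add: mult.left_commute mult.assoc)
 show "norm (bb t x - bb t y) <= cmod \<alpha> * norm (N (S t x) - N (S t y))"
  unfolding bb_def linear_simps(2)[OF ell2_mult_linear[OF bdd_\<alpha>], symmetric] linear_simps(2)[OF rot_linear[OF bdd_1], symmetric] by (rule 1)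
 show "norm (gg t x) = norm (G (S t x))" by (simp add: gg_def rot_1_norm)
 show "norm (gg t x - gg t y) = norm (G (S t x) - G (S t y))" by (simp add: gg_def rot_1_norm flip: linear_simps(2)[OF rot_linear[OF bdd_1]])
 show "x \<bullet> gg t x = S t x \<bullet> G (S t x)" using rot_1_inner[of cc t x "gg t x"] by (simp add: gg_def S_S')
qed

lemma to_ell2_of_s: "to_ell2 (- s - 1) (of_ell2 s x) = ell2_mult lam x" and of_s_sob: "of_ell2 s x : sob (- s - 1)" for x :: "(int ^ 'd) ell2"
proof -
 have "of_ell2 s x = of_ell2 (- s - 1) (ell2_mult lam x)"
  by (auto simp: of_ell2_def ell2_mult_nth[OF bdd_lam] lam_def fun_eq_iff simp flip: powr_add of_real_mult mult.assoc)
 then show "to_ell2 (- s - 1) (of_ell2 s x) = ell2_mult lam x" "of_ell2 s x : sob (- s - 1)" by (simp_all add: to_ell2_of_ell2 of_ell2_in_sob)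
qed

lemma sob_s_sob: "u : sob s ==> u : sob (- s - 1)" and to_ell2_s: "u : sob s ==> to_ell2 (- s - 1) u = ell2_mult lam (to_ell2 s u)"
 for u :: "'d coeffs" using to_ell2_of_s[of "to_ell2 s u"] of_s_sob[of "to_ell2 s u"] by (simp_all add: of_ell2_to_ell2)

text \<open>A u - \<alpha> F(u) in \<open>H^-s-1\<close> coordinates, as a function of the
  \<open>H^s\<close> coordinates of u. Both multipliers are bounded, so the unbounded operator has
  become a continuous map.\<close>

definition "drift_op x = ell2_mult (%k. of_real (cc k) * lam k) x - ell2_mult (%k. \<alpha> * lam k) (N x)"

lemma bdd_drift: "bdd_by 1 (%k. of_real (cc k) * lam k)" "bdd_by (cmod \<alpha>) (%k. \<alpha> * lam k)"
 using bdd_cc_lam mult_left_mono[of "cmod (lam k)" 1 "cmod \<alpha>" for k] bdd_lam by (auto simp: bdd_by_def norm_mult)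

lemma drift_op: fixes u :: "'d coeffs" assumes "u : sob s"
 shows "(%k. neg_laplace u k - \<alpha> * power_nonlin \<sigma> u k) = of_ell2 (- s - 1) (drift_op (to_ell2 s u))"
proof
 fix k :: "int ^ 'd"
 have p: "power_nonlin \<sigma> u : sob s" using nonlin_sob[of "to_ell2 s u"] assms by (simp add: of_ell2_to_ell2)
 have j: "japanese k powr (- (- s - 1)) * (japanese k powr (- 2 * s - 1) * japanese k powr s) = 1" by (simp flip: powr_add)
 have "of_ell2 (- s - 1) (drift_op (to_ell2 s u)) k
  = complex_of_real (japanese k powr (- (- s - 1)) * (japanese k powr (- 2 * s - 1) * japanese k powr s)) * (of_real (cc k) * u k - \<alpha> * power_nonlin \<sigma> u k)"
  unfolding drift_op_def N_def of_ell2_to_ell2[OF assms]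
  unfolding of_ell2_def minus_ell2.rep_eq ell2_mult_nth[OF bdd_drift(1)] ell2_mult_nth[OF bdd_drift(2)]
   ell2_nth_to_ell2[OF assms] ell2_nth_to_ell2[OF p]
  unfolding lam_def of_real_mult by (simp add: algebra_simps)
 then show "neg_laplace u k - \<alpha> * power_nonlin \<sigma> u k = of_ell2 (- s - 1) (drift_op (to_ell2 s u)) k"
  unfolding j by (simp add: neg_laplace_def cc_def)
qed

lemma drift_op_cont: "continuous_on UNIV drift_op" unfolding drift_op_def
 by (intro continuous_on_diff bounded_linear.continuous_on[OF ell2_mult_linear[OF bdd_drift(1)]]
  bounded_linear.continuous_on[OF ell2_mult_linear[OF bdd_drift(2)]] continuous_on_id N_cont)

lemma twisted_Lipschitz: "EX L>=0. ALL t x y. norm x <= R --> norm y <= R -->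
 norm (bb t x - bb t y) <= L * norm (x - y) & norm (gg t x - gg t y) <= L * norm (x - y)"
proof -
 obtain LN where LN: "0 <= LN" "!!x y. norm x <= R ==> norm y <= R ==> norm (N x - N y) <= LN * norm (x - y)" using N_lipschitz by blast
 obtain LG where LG: "0 <= LG" "!!x y. norm x <= R ==> norm y <= R ==> norm (G x - G y) <= LG * norm (x - y)" using G_lipschitz by blast
 have Sd: "norm (S t x - S t y) = norm (x - y)" for t x y by (simp add: rot_1_norm flip: linear_simps(2)[OF rot_linear[OF bdd_1]])
 have "norm (bb t x - bb t y) <= (cmod \<alpha> * LN + LG) * norm (x - y) & norm (gg t x - gg t y) <= (cmod \<alpha> * LN + LG) * norm (x - y)"
  if "norm x <= R" "norm y <= R" for t x y
 proof
  have "cmod \<alpha> * norm (N (S t x) - N (S t y)) <= cmod \<alpha> * (LN * norm (x - y))"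
   using LN(2)[of "S t x" "S t y"] that by (intro mult_left_mono) (auto simp: rot_1_norm Sd)
  moreover have g: "norm (gg t x - gg t y) <= LG * norm (x - y)" using LG(2)[of "S t x" "S t y"] that by (simp add: gg_diff rot_1_norm Sd)
  moreover have "0 <= LG * norm (x - y)" "0 <= cmod \<alpha> * (LN * norm (x - y))" using LG(1) LN(1) by auto
  ultimately show "norm (bb t x - bb t y) <= (cmod \<alpha> * LN + LG) * norm (x - y)" "norm (gg t x - gg t y) <= (cmod \<alpha> * LN + LG) * norm (x - y)"
   using bb_diff[of t x y] unfolding distrib_right mult.assoc by linarith+
 qed
 then show ?thesis using LN LG by (intro exI[of _ "cmod \<alpha> * LN + LG"]) auto
qed

lemma twisted_bounded: "EX C>=0. ALL t x. norm x <= R --> norm (bb t x) <= C & norm (gg t x) <= C"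
proof -
 obtain CG where CG: "0 <= CG" "!!x. norm x <= R ==> norm (G x) <= CG" using G_bounded by blast
 define CN where "CN = cmod \<alpha> * \<bar>K * (Z * R) ^ (2 * \<sigma>) * R\<bar>"
 have "norm (bb t x) <= CN + CG & norm (gg t x) <= CN + CG" if x: "norm x <= R" for t x
 proof
  have "cmod \<alpha> * norm (N (S t x)) <= CN" unfolding CN_def using N_bound[of "S t x" R] x by (intro mult_left_mono) (auto simp: rot_1_norm)
  then show "norm (bb t x) <= CN + CG" using bb_norm[of t x] CG by linarith
  show "norm (gg t x) <= CN + CG" using CG(2)[of "S t x"] x by (simp add: gg_norm rot_1_norm CN_def add_increasing)
 qed
 then show ?thesis using CG by (intro exI[of _ "CN + CG"]) (auto simp: CN_def)
qed

lemma rot_mult: "bdd_by C m ==> rot m c t x = ell2_mult m (rot (%_. 1) c t x)"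
 by (rule ell2_eqI) (simp add: rot_nth[of C] rot_nth[OF bdd_1] ell2_mult_nth[of C])

lemma Lam_gg: "rot lam cc t (gg t x) = ell2_mult lam (G (S t x))" by (simp add: rot_mult[OF bdd_lam] gg_def S_S')

lemma Lam_bb: "rot lam cc t (bb t x) = ell2_mult (%k. - \<i> * (\<alpha> * lam k)) (N (S t x))"
proof -
 have b: "bdd_by (cmod \<alpha>) (%k. - \<i> * (\<alpha> * lam k))" using bdd_drift(2) by (simp add: bdd_by_def norm_mult)
 show ?thesis
 proof (rule ell2_eqI)
  fix k
  have "cis (cc k * t) * cis (- cc k * t) = 1" by (simp add: cis_mult)
  then show "ell2_nth (rot lam cc t (bb t x)) k = ell2_nth (ell2_mult (%k. - \<i> * (\<alpha> * lam k)) (N (S t x))) k"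
   unfolding bb_def rot_nth[OF bdd_lam] ell2_mult_nth[OF bdd_\<alpha>] rot_nth[OF bdd_1] ell2_mult_nth[OF b] by algebra
 qed
qed

text \<open>The time derivative of the rotation supplies the Laplacian and the twisted drift
  supplies the nonlinearity, so that together they restore the drift of the original
  equation.\<close>

lemma drift_split: "rot (%k. \<i> * of_real (cc k) * lam k) cc t x + rot lam cc t (bb t x) = ell2_mult (%_. \<i>) (drift_op (S t x))"
proof -
 have b: "bdd_by (cmod \<alpha>) (%k. - \<i> * (\<alpha> * lam k))" using bdd_drift(2) by (simp add: bdd_by_def norm_mult)
 have i: "bdd_by 1 (%_. \<i>)" by (simp add: bdd_by_def)
 show ?thesis unfolding Lam_bb rot_mult[OF bdd_cc_lam] drift_op_def
  by (rule ell2_eqI, unfold plus_ell2.rep_eq minus_ell2.rep_eq ell2_mult_nth[OF b] ell2_mult_nth[OF bdd_cc_lam] ell2_mult_nth[OF i]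
   ell2_mult_nth[OF bdd_drift(1)] ell2_mult_nth[OF bdd_drift(2)]) (simp add: algebra_simps)
qed

lemma ito_at_0: fixes Y :: "real => 'a => 'b::{sep_inner, banach}" assumes I: "ito 0 Y I" shows "AE w in M. I w = 0"
proof -
 have [measurable]: "I : borel_measurable M" by (rule ito_measurable[OF I])
 have "(EE w. nsq (I w)) <= 0" using ito_bound[OF I cutoff_const] by (simp add: energy_at_0)
 then have "AE w in M. nsq (I w) = 0" by (subst (asm) le_zero_eq, subst (asm) nn_integral_0_iff_AE) auto
 then show ?thesis by eventually_elim simp
qed

lemma to_ell2_of: fixes x :: "(int ^ 'd) ell2" assumes "r <= q"
 shows "to_ell2 r (of_ell2 q x) = ell2_mult (%k. of_real (japanese k powr (r - q))) x" and "of_ell2 q x : sob r"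
  and "bdd_by 1 (%k :: int ^ 'd. complex_of_real (japanese k powr (r - q)))"
proof -
 have "japanese k powr (r - q) <= japanese k powr 0" for k :: "int ^ 'd" using assms japanese_ge_1 by (intro powr_mono) auto
 then show b: "bdd_by 1 (%k :: int ^ 'd. complex_of_real (japanese k powr (r - q)))" by (simp add: bdd_by_def)
 have "of_ell2 q x = of_ell2 r (ell2_mult (%k. of_real (japanese k powr (r - q))) x)"
  by (auto simp: of_ell2_def ell2_mult_nth[OF b] fun_eq_iff simp flip: powr_add of_real_mult mult.assoc)
 then show "to_ell2 r (of_ell2 q x) = ell2_mult (%k. of_real (japanese k powr (r - q))) x" "of_ell2 q x : sob r"
  by (simp_all add: to_ell2_of_ell2 of_ell2_in_sob)
qed

theorem strong_solution_exists: assumes r: "1 < r" and e: "!!u. u : sob s ==> r <= sob_norm s u ==>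
   cmod \<alpha> * K * real_of_ereal (Linf_norm (fourier_fun u)) ^ (2 * \<sigma>) + 1 / 2 * ((sob_norm s (\<phi> u))^2 / (sob_norm s u)^2)
    - (Re (sob_inner s u (\<phi> u)))^2 / (sob_norm s u) ^ 4 <= B"
  and u0: "u0 : sob s"
 obtains u where "strong_solution M \<F> W s \<sigma> \<alpha> \<phi> u0 u" "!!om. om : space M ==> sob_continuous s (%t. u t om)"
proof -
 have "ALL R. EX L. 0 <= L & (ALL t x y. norm x <= R --> norm y <= R -->
   norm (bb t x - bb t y) <= L * norm (x - y) & norm (gg t x - gg t y) <= L * norm (x - y))"
  using twisted_Lipschitz by auto
 from choice[OF this] obtain Lip where Lip: "ALL R. 0 <= Lip R & (ALL t x y. norm x <= R --> norm y <= R -->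
   norm (bb t x - bb t y) <= Lip R * norm (x - y) & norm (gg t x - gg t y) <= Lip R * norm (x - y))" ..
 have "ALL R. EX C. 0 <= C & (ALL t x. norm x <= R --> norm (bb t x) <= C & norm (gg t x) <= C)" using twisted_bounded by auto
 from choice[OF this] obtain Bd where Bd: "ALL R. 0 <= Bd R & (ALL t x. norm x <= R --> norm (bb t x) <= Bd R & norm (gg t x) <= Bd R)" ..
 define x0 where "x0 = to_ell2 s u0"
 \<comment> \<open>Twice (e), multiplied by the squared norm and taken at the rotated point
   \<open>S t x\<close>, is the Lyapunov inequality; hence \<open>2 * B\<close>.\<close>
 interpret lyapunov_sde M \<F> W bb gg x0 Lip Bd r "2 * B"
 proof
  fix x :: "(int ^ 'd) ell2" and t assume x: "r <= norm x"
  let ?y = "S t x"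
  define u where "u = of_ell2 s ?y"
  have u: "u : sob s" "sob_norm s u = norm x" "sob_norm s (\<phi> u) = norm (gg t x)" "Re (sob_inner s u (\<phi> u)) = x \<bullet> gg t x"
   "real_of_ereal (Linf_norm (fourier_fun u)) = Linf ?y"
   using norm_to_ell2[OF of_ell2_in_sob, of s ?y] norm_to_ell2[OF phi_sob, of ?y] Re_sob_inner[OF of_ell2_in_sob phi_sob, of ?y ?y]
   by (simp_all add: u_def of_ell2_in_sob to_ell2_of_ell2 rot_1_norm gg_norm G_def gg_inner Linf_def ff_def)
  define n where "n = norm x"
  have n: "0 < n" using x r unfolding n_def by linarith
  have "x \<bullet> bb t x <= cmod \<alpha> * n * (K * Linf ?y ^ (2 * \<sigma>) * n)"
   using bb_inner[of x t] mult_left_mono[OF N_norm[of ?y], of "cmod \<alpha> * n"] n by (simp add: n_def rot_1_norm)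
  moreover have "n^2 * (cmod \<alpha> * K * Linf ?y ^ (2 * \<sigma>) + 1 / 2 * ((norm (gg t x))^2 / n^2) - (x \<bullet> gg t x)^2 / n ^ 4) <= n^2 * B"
   using e[OF u(1)] x unfolding u n_def[symmetric] by (intro mult_left_mono) auto
  then have "cmod \<alpha> * K * Linf ?y ^ (2 * \<sigma>) * n^2 + 1 / 2 * (norm (gg t x))^2 - (x \<bullet> gg t x)^2 / n^2 <= B * n^2"
   using n by (simp add: distrib_left right_diff_distrib mult_ac power2_eq_square power4_eq_xxxx)
  ultimately show "2 * (x \<bullet> bb t x) + (norm (gg t x))^2 - 2 * (x \<bullet> gg t x)^2 / (norm x)^2 <= 2 * B * (norm x)^2"
   unfolding n_def[symmetric] by (simp add: power2_eq_square mult_ac)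
 qed (use bb_cont gg_cont Lip Bd r in auto)
 obtain w where w: "regular w" and ito_w: "!!t. 0 <= t ==> ito t (%rh om. gg rh (w rh om)) (%om. w t om - x0 - (LINT rh:{0..t}|lborel. bb rh (w rh om)))"
  by (rule global_solution) blast
 define y where "y t om = S t (w t om)" for t om
 have jc: "continuous_on UNIV (%(t, x). S t (x :: (int ^ 'd) ell2))" unfolding case_prod_beta by (intro rot_continuous[OF bdd_1] continuous_intros)
 have y: "regular y" unfolding y_def by (rule regular_compose[OF w jc])
 have reg: "regular (%rh om. F (y rh om))" if "continuous_on UNIV F" for F :: "(int ^ 'd) ell2 => (int ^ 'd) ell2"
  by (rule regular_compose[OF y, of "%_. F"]) (auto simp: case_prod_beta intro!: continuous_on_compose2[OF that] continuous_intros)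
 define u where "u t om = of_ell2 s (y t om)" for t om
 have us: "u t om : sob s" and tu: "to_ell2 s (u t om) = y t om" for t om by (simp_all add: u_def of_ell2_in_sob to_ell2_of_ell2)
 have cont: "sob_continuous s (%t. u t om)" if "om : space M" for om using us regular_continuous[OF y that] by (simp add: sob_continuous_iff tu)
 have bi: "bdd_by 1 (%_::int ^ 'd. \<i>)" by (simp add: bdd_by_def)
 let ?Lam = "ell2_mult lam"
 note linL = ell2_mult_linear[OF bdd_lam] and lini = ell2_mult_linear[OF bi]
 \<comment> \<open>The equation in \<open>H^-s-1\<close> solved for its stochastic integral. With
   this choice it holds for every outcome, and what has to be shown is that \<open>J t\<close> is
   the Ito integral of the noise.\<close>
 define J where "J t om = ?Lam (y t om) - ?Lam x0 - ell2_mult (%_. \<i>) (LINT rh:{0..t}|lborel. drift_op (y rh om))" for t om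
 have dr: "set_integrable lborel {0..t} (%rh. drift_op (y rh om))" if "om : space M" for t om
  by (rule set_integrable_continuous_halfline[OF regular_continuous[OF reg[OF drift_op_cont] that]])
 have w0: "AE om in M. w 0 om = x0"
 proof -
  from ito_at_0[OF ito_w[OF order_refl]] show ?thesis by (simp add: set_integral_singleton)
 qed
 have ito_J: "ito t (%rh om. ?Lam (G (y rh om))) (J t)" if t: "0 <= t" for t
 proof -
  \<comment> \<open>The smoothing symbol \<open>lam\<close> makes the rotation differentiable in
    time, so \<open>ito_rot\<close> can undo the twist inside the integral.\<close>
  have "ito t (%rh om. rot lam cc rh (gg rh (w rh om))) (J t)"
  proof (rule ito_rot[OF ito_w t bdd_lam bdd_cc_lam])
   have b: "set_integrable lborel {0..t} (%rh. bb rh (w rh om))" if "om : space M" for om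
    by (rule set_integrable_continuous_halfline[OF regular_continuous[OF regular_compose[OF w bb_cont] that]])
   show "AE om in M. continuous_on {0..} (%r. w r om) & set_integrable lborel {0..t} (%rh. bb rh (w rh om))"
    using b regular_continuous[OF w] by (intro AE_I2) blast
   show "AE om in M. w r om - x0 - (LINT rh:{0..r}|lborel. bb rh (w rh om)) = w r om - w 0 om - (LINT rh:{0..r}|lborel. bb rh (w rh om))" for r
    using w0 by eventually_elim simp
   have [measurable]: "?Lam : borel_measurable borel" "ell2_mult (%_::int ^ 'd. \<i>) : borel_measurable borel"
    by (rule borel_measurable_continuous_onI[OF linear_continuous_on[OF linL]] borel_measurable_continuous_onI[OF linear_continuous_on[OF lini]])+
   have [measurable]: "y t : borel_measurable (\<F> t)" "(%om. LINT rh:{0..t}|lborel. drift_op (y rh om)) : borel_measurable (\<F> t)"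
    using adaptedD[OF regular_adapted[OF y] t order_refl] path_integral_measurable[OF regular_prog[OF reg[OF drift_op_cont]] t] by auto
   have "J t : borel_measurable (\<F> t)" unfolding J_def[abs_def] by measurable
   then show "J t : borel_measurable M" by (rule F_M[OF _ t])
   show "AE om in M. J t om = rot lam cc t (w t om) - rot lam cc 0 (w 0 om)
    - (LINT rh:{0..t}|lborel. rot (%k. \<i> * of_real (cc k) * lam k) cc rh (w rh om)) - (LINT rh:{0..t}|lborel. rot lam cc rh (bb rh (w rh om)))"
    using w0 AE_space
   proof eventually_elim
    case (elim om)
    note w0 = elim(1) and om = elim(2)
    have i1: "set_integrable lborel {0..t} (%rh. rot (%k. \<i> * of_real (cc k) * lam k) cc rh (w rh om))"
     by (intro rot_integrable[OF bdd_cc_lam] set_integrable_continuous_halfline regular_continuous[OF w om])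
    have i2: "set_integrable lborel {0..t} (%rh. rot lam cc rh (bb rh (w rh om)))" by (rule rot_integrable[OF bdd_lam b[OF om]])
    have "(LINT rh:{0..t}|lborel. rot (%k. \<i> * of_real (cc k) * lam k) cc rh (w rh om)) + (LINT rh:{0..t}|lborel. rot lam cc rh (bb rh (w rh om)))
     = (LINT rh:{0..t}|lborel. ell2_mult (%_. \<i>) (drift_op (y rh om)))" unfolding set_integral_add(2)[OF i1 i2, symmetric] drift_split y_def ..
    also have "... = ell2_mult (%_. \<i>) (LINT rh:{0..t}|lborel. drift_op (y rh om))"
     using integral_bounded_linear[OF lini dr[OF om, of t, unfolded set_integrable_def]]
     by (simp add: set_lebesgue_integral_def linear_simps[OF lini])
    moreover have "rot (%_. 1) cc 0 x = x" for x by (rule ell2_eqI) (simp add: rot_nth[OF bdd_1])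
    ultimately show ?case
     unfolding J_def rot_mult[OF bdd_lam, of cc t] rot_mult[OF bdd_lam, of cc 0] w0 y_def by (simp add: algebra_simps)
   qed
  qed
  then show ?thesis by (simp add: Lam_gg y_def)
 qed
 have "strong_solution M \<F> W s \<sigma> \<alpha> \<phi> u0 u" unfolding strong_solution_def
 proof (intro conjI ballI allI impI)
  have "0 <= real CARD('d) / 2" by simp
  then have s0: "0 <= s" using s by linarith
  note e0 = to_ell2_of[OF s0]
  have t0: "to_ell2 0 (u t om) = ell2_mult (%k. of_real (japanese k powr (0 - s))) (y t om)" for t om unfolding u_def by (rule e0(1))
  note r0 = reg[OF bounded_linear.continuous_on[OF ell2_mult_linear[OF e0(3)] continuous_on_id]]
  show "sob_continuous 0 (%t. u t om)" if "om : space M" for om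
   unfolding sob_continuous_iff t0 using regular_continuous[OF r0 that] e0(2) by (simp add: u_def)
  show "(%om. to_ell2 0 (u t om)) : borel_measurable (\<F> t)" if "0 <= t" for t
   unfolding t0 by (rule adaptedD[OF regular_adapted[OF r0] that order_refl])
  show "AE om in M. sob_weakly_continuous s (%t. u t om)"
  proof (rule AE_I2)
   fix om assume "om : space M"
   note c = regular_continuous[OF y this]
   show "sob_weakly_continuous s (%t. u t om)" unfolding sob_weakly_continuous_def using us
    by (auto simp: Re_sob_inner tu Complex_eq intro!: continuous_intros c)
  qed
  fix t :: real assume t: "0 <= t"
  let ?f = "%rh om k. neg_laplace (u rh om) k - \<alpha> * power_nonlin \<sigma> (u rh om) k"
  have f: "?f rh om = of_ell2 (- s - 1) (drift_op (y rh om))" for rh om using drift_op[OF us] by (simp add: tu)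
  show "EX I. sob_has_ito_integral (- s - 1) M \<F> W t (%rh om. \<phi> (u rh om)) I & (AE om in M. sob_integrable (- s - 1) {0..t} (%rh. ?f rh om) &
    u t om = (%k. u0 k + \<i> * sob_integral (- s - 1) {0..t} (%rh. ?f rh om) k + I om k))"
  proof (intro exI[of _ "%om. of_ell2 (- s - 1) (J t om)"] conjI)
   have ph: "\<phi> (u rh om) : sob s" for rh om using a(1) us by blast
   have Yt: "to_ell2 (- s - 1) (\<phi> (u rh om)) = ?Lam (G (y rh om))" for rh om unfolding to_ell2_s[OF ph] by (simp add: G_def u_def)
   note rG = reg[OF bounded_linear.continuous_on[OF linL G_cont]]
   show "sob_has_ito_integral (- s - 1) M \<F> W t (%rh om. \<phi> (u rh om)) (%om. of_ell2 (- s - 1) (J t om))"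
    unfolding sob_has_ito_integral_def Yt to_ell2_of_ell2
    using ito_imp_has_ito[OF ito_J[OF t] regular_adapted[OF rG] regular_continuous[OF rG]] sob_s_sob[OF ph] of_ell2_in_sob by auto
   show "AE om in M. sob_integrable (- s - 1) {0..t} (%rh. ?f rh om) &
    u t om = (%k. u0 k + \<i> * sob_integral (- s - 1) {0..t} (%rh. ?f rh om) k + of_ell2 (- s - 1) (J t om) k)"
   proof (intro AE_I2 conjI)
    fix om assume om: "om : space M"
    show "sob_integrable (- s - 1) {0..t} (%rh. ?f rh om)" unfolding sob_integrable_def f to_ell2_of_ell2 using dr[OF om] of_ell2_in_sob by auto
    let ?I = "LINT rh:{0..t}|lborel. drift_op (y rh om)"
    have lin: "of_ell2 (- s - 1) (x + z) k = of_ell2 (- s - 1) x k + of_ell2 (- s - 1) z k"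
     "of_ell2 (- s - 1) (ell2_mult (%_. \<i>) x) k = \<i> * of_ell2 (- s - 1) x k" for x z and k :: "int ^ 'd"
     by (simp_all add: of_ell2_def plus_ell2.rep_eq ell2_mult_nth[OF bi] distrib_left)
    have "u t om = of_ell2 (- s - 1) (?Lam (y t om))" using of_ell2_to_ell2[OF sob_s_sob[OF us[of t om]]] to_ell2_s[OF us[of t om]] by (simp add: tu)
    also have "?Lam (y t om) = ?Lam x0 + ell2_mult (%_. \<i>) ?I + J t om" by (simp add: J_def)
    also have "of_ell2 (- s - 1) ... = (%k. of_ell2 (- s - 1) (?Lam x0) k + \<i> * of_ell2 (- s - 1) ?I k + of_ell2 (- s - 1) (J t om) k)"
     by (rule ext) (simp only: lin)
    also have "of_ell2 (- s - 1) (?Lam x0) = u0" using of_ell2_to_ell2[OF sob_s_sob[OF u0]] to_ell2_s[OF u0] by (simp add: x0_def)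
    also have "of_ell2 (- s - 1) ?I = sob_integral (- s - 1) {0..t} (%rh. ?f rh om)" unfolding sob_integral_def f to_ell2_of_ell2 ..
    finally show "u t om = (%k. u0 k + \<i> * sob_integral (- s - 1) {0..t} (%rh. ?f rh om) k + of_ell2 (- s - 1) (J t om) k)" .
   qed
  qed
 qed
 then show thesis using cont that by blast
qed

end

section \<open>Strong solutions as Ito processes and uniqueness\<close>

text \<open>Uniform boundedness by Baire's theorem: the closed sets \<open>A c\<close> exhaust the
  space, so one of them contains a ball, and testing with a vector of length \<open>e / 2\<close>
  along \<open>y t\<close> from its centre bounds the norm.\<close>

lemma weakly_continuous_bounded: fixes y :: "real => 'b::{real_inner, complete_space}" assumes y: "!!z. continuous_on {0..} (%t. y t \<bullet> z)"
 shows "EX c::nat. ALL t:{0..T}. norm (y t) <= real c"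
proof -
 define A where "A c = {z. ALL t:{0..T}. \<bar>y t \<bullet> z\<bar> <= real c}" for c :: nat
 have closed: "closed (A c)" for c
 proof -
  have "A c = (\<Inter>t\<in>{0..T}. {z. \<bar>y t \<bullet> z\<bar> <= real c})" by (auto simp: A_def)
  then show ?thesis by (simp only:) (intro closed_INT ballI closed_Collect_le continuous_intros)
 qed
 have UN: "(\<Union>c. A c) = UNIV"
 proof (rule UNIV_eq_I[symmetric])
  fix z
  have "compact ((%t. y t \<bullet> z) ` {0..T})" by (intro compact_continuous_image continuous_on_subset[OF y]) auto
  from compact_imp_bounded[OF this] obtain B where B: "ALL t:{0..T}. \<bar>y t \<bullet> z\<bar> <= B" by (auto simp: bounded_iff)
  obtain c :: nat where "B <= real c" using real_arch_simple by blast
  then show "z : (\<Union>c. A c)" using B by (auto simp: A_def intro!: exI[of _ c])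
 qed
 have "EX c. interior (A c) ~= {}"
 proof (rule ccontr)
  assume "\<not> ?thesis"
  then have "euclidean interior_of \<Union>(range A) = {}"
   using closed by (intro Baire_category_alt) (auto simp: completely_metrizable_space_euclidean)
  then show False using UN by simp
 qed
 then obtain c z0 e where e: "0 < e" "ball z0 e \<subseteq> A c" by (metis ex_in_conv mem_interior)
 have "norm (y t) <= 4 * real c / e" if t: "t : {0..T}" for t
 proof (cases "y t = 0")
  case False
  define z where "z = (e / (2 * norm (y t))) *R y t"
  have "z0 + z : ball z0 e" "z0 : ball z0 e" using e False by (auto simp: z_def dist_norm)
  then have "\<bar>y t \<bullet> (z0 + z)\<bar> <= real c" "\<bar>y t \<bullet> z0\<bar> <= real c" using e t unfolding A_def by blast+
  then have "y t \<bullet> z <= 2 * real c" by (simp add: inner_add_right)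
  moreover have "y t \<bullet> z = e / 2 * norm (y t)" using False by (simp add: z_def power2_norm_eq_inner[symmetric] power2_eq_square)
  ultimately show ?thesis using e by (simp add: field_simps)
 qed (use e in auto)
 moreover obtain c' :: nat where "4 * real c / e <= real c'" using real_arch_simple by blast
 ultimately show ?thesis by (meson order_trans)
qed

context nls_sde begin

definition "low n k = (norm (freq (k :: int ^ 'd)) <= real n)"
definition "cutm n k = (if low n k then 1 else 0 :: complex)"
text \<open>Raising the regularity by \<open>r\<close> is unbounded, but on the modes up to
  \<open>n\<close> it is a bounded multiplier. It recovers low modes in \<open>H^s\<close>
  coordinates from coordinates of a weaker space.\<close>

definition "upm r n k = (if low n k then complex_of_real (japanese k powr r) else 0)"

lemma bdd_cut: "bdd_by 1 (cutm n)" by (simp add: bdd_by_def cutm_def)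

lemma bdd_up: "0 <= r ==> EX C. bdd_by C (upm r n) & bdd_by C (%k. \<i> * of_real (- cc k) * upm r n k)"
proof -
 assume r: "0 <= r"
 define C where "C = (1 + (real n)^2) * sqrt (1 + (real n)^2) powr r"
 have C1: "1 <= 1 + (real n)^2" by simp
 have *: "japanese k powr r <= sqrt (1 + (real n)^2) powr r" "cc k <= 1 + (real n)^2" if "low n k" for k
 proof -
  have "(norm (freq k))^2 <= (real n)^2" using that by (intro power_mono) (auto simp: low_def)
  then have q: "1 + (norm (freq k))^2 <= 1 + (real n)^2" by linarith
  show "japanese k powr r <= sqrt (1 + (real n)^2) powr r"
   unfolding japanese_def using r by (intro powr_mono2 real_sqrt_le_mono q) (auto simp: add_nonneg_nonneg)
  show "cc k <= 1 + (real n)^2" unfolding cc_def using q by linarith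
 qed
 have "japanese k powr r <= C" "cc k * japanese k powr r <= C" if "low n k" for k
 proof -
  show "cc k * japanese k powr r <= C" unfolding C_def using *[OF that] by (intro mult_mono) auto
  have "1 * japanese k powr r <= C" unfolding C_def using *[OF that] C1 by (intro mult_mono) auto
  then show "japanese k powr r <= C" by simp
 qed
 moreover have "0 <= C" by (simp add: C_def)
 ultimately have "bdd_by C (upm r n)" "bdd_by C (%k. \<i> * of_real (- cc k) * upm r n k)" by (auto simp: bdd_by_def upm_def norm_mult cc_nonneg)
 then show ?thesis by blast
qed

lemma up_to_ell2: "bdd_by C (upm (s - r) n) ==> u : sob s ==> u : sob r ==> ell2_mult (upm (s - r) n) (to_ell2 r u) = ell2_mult (cutm n) (to_ell2 s u)"
 by (rule ell2_eqI) (auto simp: ell2_mult_nth[of C] ell2_mult_nth[OF bdd_cut] ell2_nth_to_ell2 upm_def cutm_def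
   simp flip: powr_add of_real_mult mult.assoc)

lemma cut_lim: "(%n. ell2_mult (cutm n) x) ----> x"
proof -
 have b1: "bdd_by 1 (%_::int ^ 'd. 1)" by (simp add: bdd_by_def)
 have "(%n. cutm n k) ----> 1" for k
 proof (rule tendsto_eventually)
  obtain m :: nat where "norm (freq k) <= real m" using real_arch_simple by blast
  then show "eventually (%n. cutm n k = 1) sequentially" by (intro eventually_sequentiallyI[of m]) (auto simp: cutm_def low_def intro: order_trans)
 qed
 then have "(%n. ell2_mult (cutm n) x) ----> ell2_mult (%_. 1) x" by (rule ell2_mult_tendsto[OF bdd_cut b1])
 moreover have "ell2_mult (%_. 1) x = x" by (rule ell2_eqI) (simp add: ell2_mult_nth[OF b1])
 ultimately show ?thesis by simp
qed

text \<open>Adaptedness and continuity of all paths are given in \<open>L^2\<close> only. The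
  \<open>H^s\<close> coordinates are rebuilt from the \<open>L^2\<close> coordinates as a limit of
  bounded multipliers, which yields a progressive process that equals the true coordinates on every
  path lying in \<open>H^s\<close>.\<close>

definition "Hs v t w = lim (%n. ell2_mult (upm s n) (to_ell2 0 (v t w)))"
definition "NA x = ell2_mult (%_. - \<i> * \<alpha>) (N x)"
text \<open>The value that the equation, twisted and cut at frequency \<open>n\<close>, assigns to
  its stochastic integral.\<close>

definition "JJ v x0 n t w = ell2_mult (cutm n) (S' t (Hs v t w)) - ell2_mult (cutm n) x0
 - (LINT r:{0..t}|lborel. ell2_mult (cutm n) (S' r (NA (Hs v r w))))"

lemma s_pos: "0 <= s"
proof -
 have "0 <= real CARD('d) / 2" by simp
 then show ?thesis using s by linarith
qed

lemma prog_lim: fixes f :: "nat => real => 'a => 'b::{banach, second_countable_topology}" assumes "!!n. prog (f n)"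
 shows "prog (%t w. lim (%n. f n t w))" unfolding progressively_measurable_def
proof (intro allI impI)
 fix t :: real assume "0 <= t"
 then have "case_prod (f n) : borel_measurable (restrict_space borel {0..t} \<Otimes>\<^sub>M \<F> t)" for n
  using assms unfolding progressively_measurable_def by blast
 from borel_measurable_lim_metric[of "%n. case_prod (f n)", OF this]
 show "(%(t, w). lim (%n. f n t w)) : borel_measurable (restrict_space borel {0..t} \<Otimes>\<^sub>M \<F> t)" by (simp add: case_prod_beta')
qed

lemma prog_adapted: assumes "prog Y" and t: "0 <= t" shows "Y t : borel_measurable (\<F> t)"
proof -
 have "(%w. (t, w)) : measurable (\<F> t) (restrict_space borel {0..t} \<Otimes>\<^sub>M \<F> t)"
  using t by (intro measurable_Pair1') (simp add: space_restrict_space)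
 from measurable_compose[OF this assms(1)[unfolded progressively_measurable_def, rule_format, OF t]]
 show ?thesis by simp
qed

lemma NA_cont: "continuous_on UNIV NA" unfolding NA_def by (intro bounded_linear.continuous_on[OF ell2_mult_linear[OF bdd_\<alpha>]] N_cont)

lemma cut_prog: assumes F: "continuous_on UNIV F" and v: "prog (Hs v)" shows "prog (%r w. ell2_mult (cutm n) (S' r (F (Hs v r w))))"
proof (rule prog_compose2[OF prog_deterministic[of "%r. r"] v, of "%r x. ell2_mult (cutm n) (S' r (F x))"])
 show "(%(r, x). ell2_mult (cutm n) (S' r (F x))) : borel_measurable (borel \<Otimes>\<^sub>M borel)" unfolding borel_prod case_prod_beta
  by (intro borel_measurable_continuous_onI bounded_linear.continuous_on[OF ell2_mult_linear[OF bdd_cut]] rot_continuous[OF bdd_1]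
   continuous_on_compose2[OF F] continuous_intros) auto
qed simp

text \<open>Weak continuity gives boundedness in \<open>H^s\<close> on bounded time intervals for
  almost every path. The equation, known in the weak space, is lifted mode by mode below the cutoff
  and twisted, which leaves \<open>NA\<close> as the only drift because the rotation absorbs the
  Laplacian.\<close>

lemma strong_solution_facts: assumes v: "strong_solution M \<F> W s \<sigma> \<alpha> \<phi> u0 v" and u0: "u0 : sob s"
 shows L2_regular: "regular (%t om. to_ell2 0 (v t om))" and L2_sob: "0 <= t ==> om : space M ==> v t om : sob 0" and Hs_prog: "prog (Hs v)"
  and Hs_eq: "AE om in M. ALL t>=0. v t om : sob s & Hs v t om = to_ell2 s (v t om)"
  and Hs_bounded: "AE om in M. ALL T. EX c::nat. ALL t:{0..T}. norm (Hs v t om) <= real c"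
  and Hs_ito: "0 <= t ==> ito t (%u om. ell2_mult (cutm n) (S' u (G (Hs v u om)))) (JJ v (to_ell2 s u0) n t)"
proof -
 note vd = v[unfolded strong_solution_def sob_continuous_iff]
 show reg: "regular (%t om. to_ell2 0 (v t om))" using vd by (simp add: regular_def adapted_def)
 show v0: "v t om : sob 0" if "0 <= t" "om : space M" for t om using vd that by blast
 have upc: "EX C. bdd_by C (upm s n)" for n using bdd_up[OF s_pos] by blast
 have reg_lin: "regular (%t om. f (to_ell2 0 (v t om)))" if "bounded_linear f" for f :: "(int ^ 'd) ell2 => (int ^ 'd) ell2"
  by (rule regular_compose[OF reg, of "%_. f"])
   (auto simp: case_prod_beta intro!: continuous_on_compose2[OF linear_continuous_on[OF that, of UNIV]] continuous_intros)
 show Hp: "prog (Hs v)" unfolding Hs_def using upc by (intro prog_lim regular_prog reg_lin) (auto intro: ell2_mult_linear)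
 have wc: "AE om in M. sob_weakly_continuous s (%t. v t om)" using vd by blast
 show He: "AE om in M. ALL t>=0. v t om : sob s & Hs v t om = to_ell2 s (v t om)" using wc AE_space
 proof eventually_elim
  case (elim om)
  note w = elim(1) and om = elim(2)
  show ?case
  proof (intro allI impI conjI)
   fix t :: real assume t: "0 <= t"
   show vs: "v t om : sob s" using w t by (simp add: sob_weakly_continuous_def)
   have "ell2_mult (upm s n) (to_ell2 0 (v t om)) = ell2_mult (cutm n) (to_ell2 s (v t om))" for n
    using upc[of n] up_to_ell2[of _ 0 n "v t om"] vs v0[OF t om] by auto
   then show "Hs v t om = to_ell2 s (v t om)" unfolding Hs_def using limI[OF cut_lim] by simp
  qed
 qed
 show Hb: "AE om in M. ALL T. EX c::nat. ALL t:{0..T}. norm (Hs v t om) <= real c" using wc He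
 proof eventually_elim
  case (elim om)
  note w = elim(1) and e = elim(2)
  have "continuous_on {0..} (%t. Hs v t om \<bullet> z)" for z
  proof -
   have "continuous_on {0..} (%t. Re (sob_inner s (v t om) (of_ell2 s z)))"
    using w of_ell2_in_sob by (intro continuous_on_Re) (auto simp: sob_weakly_continuous_def)
   then show ?thesis by (rule continuous_on_eq) (use e in \<open>auto simp: Re_sob_inner of_ell2_in_sob to_ell2_of_ell2\<close>)
  qed
  then show ?case by (intro allI weakly_continuous_bounded)
 qed
 have gp: "prog (%u om. F (Hs v u om))" if "continuous_on UNIV F" for F :: "(int ^ 'd) ell2 => (int ^ 'd) ell2"
  by (rule prog_compose[OF Hp borel_measurable_continuous_onI[OF that]])
 have bi: "bdd_by 1 (%_::int ^ 'd. \<i>)" by (simp add: bdd_by_def)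
 note lini = ell2_mult_linear[OF bi] and linL = ell2_mult_linear[OF bdd_lam]
 define x0 where "x0 = to_ell2 s u0"
 let ?dr = "%u om. ell2_mult (%_. \<i>) (drift_op (Hs v u om))"
 have drp: "prog ?dr" by (rule gp) (intro bounded_linear.continuous_on[OF lini] drift_op_cont)
 have "- s - 1 <= 0" using s_pos by simp
 note e0 = to_ell2_of[OF this]
 define y where "y t om = to_ell2 (- s - 1) (v t om)" for t om
 have y0: "y t om = ell2_mult (%k. of_real (japanese k powr (- s - 1 - 0))) (to_ell2 0 (v t om))" if "0 <= t" "om : space M" for t om
  using e0(1)[of "to_ell2 0 (v t om)"] v0[OF that] by (simp add: y_def of_ell2_to_ell2)
 have ycont: "continuous_on {0..} (%t. y t om)" if "om : space M" for om
  by (rule continuous_on_eq[OF regular_continuous[OF reg_lin[OF ell2_mult_linear[OF e0(3)]] that]]) (use y0 that in auto)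
 have ym: "y t : borel_measurable M" if "0 <= t" for t
  by (rule measurable_cong[THEN iffD2, OF _ adapted_M[OF regular_adapted[OF reg_lin[OF ell2_mult_linear[OF e0(3)]]] that]]) (use y0 that in auto)
 define I where "I t om = y t om - ell2_mult lam x0 - (LINT u:{0..t}|lborel. ?dr u om)" for t om
 have ito_I: "ito t (%u om. ell2_mult lam (G (Hs v u om))) (I t)"
  and di: "AE om in M. set_integrable lborel {0..t} (%u. drift_op (Hs v u om))" if t: "0 <= t" for t
 proof -
  let ?f = "%u om k. neg_laplace (v u om) k - \<alpha> * power_nonlin \<sigma> (v u om) k"
  obtain I' where I': "sob_has_ito_integral (- s - 1) M \<F> W t (%u om. \<phi> (v u om)) I'"
   and eq: "AE om in M. sob_integrable (- s - 1) {0..t} (%u. ?f u om) &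
    v t om = (%k. u0 k + \<i> * sob_integral (- s - 1) {0..t} (%u. ?f u om) k + I' om k)"
   using vd t by blast
  have f: "AE om in M. ALL u>=0. ?f u om = of_ell2 (- s - 1) (drift_op (Hs v u om))" using He by eventually_elim (simp add: drift_op)
  have d0: "AE om in M. set_integrable lborel {0..t} (%u. drift_op (Hs v u om))" using eq f
  proof eventually_elim
   case (elim om)
   note e = elim(1) and f = elim(2)
   have "set_integrable lborel {0..t} (%u. to_ell2 (- s - 1) (?f u om))" using e by (simp add: sob_integrable_def)
   also have "?this \<longleftrightarrow> set_integrable lborel {0..t} (%u. drift_op (Hs v u om))"
    by (rule set_integrable_cong) (use f in \<open>auto simp: to_ell2_of_ell2\<close>)
   finally show ?case .
  qed
  then show "AE om in M. set_integrable lborel {0..t} (%u. drift_op (Hs v u om))" .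
  obtain Y where Y: "ito t Y (%om. to_ell2 (- s - 1) (I' om))" "AE om in M. ALL u:{0..t}. to_ell2 (- s - 1) (\<phi> (v u om)) = Y u om"
   using I' has_ito_imp_ito[OF _ t] unfolding sob_has_ito_integral_def by blast
  show "ito t (%u om. ell2_mult lam (G (Hs v u om))) (I t)"
  proof (rule ito_cong_AE[OF Y(1)])
   show "prog (%u om. ell2_mult lam (G (Hs v u om)))" by (rule gp) (intro bounded_linear.continuous_on[OF linL] G_cont)
   show "I t : borel_measurable M" unfolding I_def[abs_def]
    by (intro borel_measurable_diff ym t borel_measurable_const F_M[OF path_integral_measurable[OF drp t] t])
   show "AE om in M. (ALL u. 0 < u --> u <= t --> Y u om = ell2_mult lam (G (Hs v u om))) & to_ell2 (- s - 1) (I' om) = I t om" using Y(2) He eq f d0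
   proof eventually_elim
    case (elim om)
    note Y = elim(1) and h = elim(2) and e = elim(3) and f = elim(4) and d = elim(5)
    have "Y u om = ell2_mult lam (G (Hs v u om))" if "0 < u" "u <= t" for u
    proof -
     have vs: "v u om : sob s" "Hs v u om = to_ell2 s (v u om)" using h that by auto
     have "\<phi> (v u om) : sob s" using a(1) vs(1) by blast
     from to_ell2_s[OF this] show ?thesis using Y that vs by (simp add: G_def of_ell2_to_ell2)
    qed
    moreover have "to_ell2 (- s - 1) (I' om) = I t om"
    proof -
     let ?d = "LINT u:{0..t}|lborel. drift_op (Hs v u om)"
     have si: "sob_integral (- s - 1) {0..t} (%u. ?f u om) = of_ell2 (- s - 1) ?d"
      unfolding sob_integral_def using f by (intro arg_cong[of _ _ "of_ell2 (- s - 1)"] set_lebesgue_integral_cong) (auto simp: to_ell2_of_ell2)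
     have "I' om k = v t om k - u0 k - \<i> * of_ell2 (- s - 1) ?d k" for k using fun_cong[OF conjunct2[OF e], of k] unfolding si by simp
     moreover have "of_ell2 (- s - 1) (I t om) k = v t om k - u0 k - \<i> * of_ell2 (- s - 1) ?d k" for k
     proof -
      have vs: "v t om : sob (- s - 1)" "u0 : sob (- s - 1)" using h t u0 sob_s_sob by auto
      have "(LINT u:{0..t}|lborel. ?dr u om) = ell2_mult (%_. \<i>) ?d" using integral_bounded_linear[OF lini d[unfolded set_integrable_def]]
       by (simp add: set_lebesgue_integral_def linear_simps[OF lini])
      then have "I t om = to_ell2 (- s - 1) (v t om) - to_ell2 (- s - 1) u0 - ell2_mult (%_. \<i>) ?d"
       by (simp add: I_def y_def x0_def to_ell2_s[OF u0])
      moreover have "of_ell2 (- s - 1) (to_ell2 (- s - 1) (v t om)) k = v t om k" "of_ell2 (- s - 1) (to_ell2 (- s - 1) u0) k = u0 k"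
       using vs by (simp_all add: of_ell2_to_ell2)
      ultimately show ?thesis by (simp add: of_ell2_def minus_ell2.rep_eq ell2_mult_nth[OF bi] right_diff_distrib mult_ac)
     qed
     ultimately have "I' om = of_ell2 (- s - 1) (I t om)" by auto
     then show ?thesis by (simp add: to_ell2_of_ell2)
    qed
    ultimately show ?case by blast
   qed
  qed
 qed
 have y_0: "AE om in M. y 0 om = ell2_mult lam x0"
 proof -
  from ito_at_0[OF ito_I[OF order_refl]] show ?thesis by (simp add: I_def set_integral_singleton)
 qed
 show "ito t (%u om. ell2_mult (cutm n) (S' u (G (Hs v u om)))) (JJ v (to_ell2 s u0) n t)" if t: "0 <= t"
 proof -
  \<comment> \<open>The exponent \<open>2 * s + 1\<close> cancels \<open>lam\<close> on the low
    modes. The frequencies now carry a minus sign, since the solution is being twisted; in the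
    existence proof the twist was undone.\<close>
  have "0 <= s - (- s - 1)" using s_pos by simp
  from bdd_up[OF this] obtain C where C: "bdd_by C (upm (s - (- s - 1)) n)" "bdd_by C (%k. \<i> * of_real (- cc k) * upm (s - (- s - 1)) n k)" by blast
  let ?m = "upm (s - (- s - 1)) n" and ?c = "%k. - cc k"
  have mlam: "?m k * lam k = cutm n k" for k by (simp add: upm_def lam_def cutm_def flip: powr_add of_real_mult)
  have rl: "rot ?m ?c u (ell2_mult lam x) = ell2_mult (cutm n) (S' u x)" for u x
   by (rule ell2_eqI, unfold rot_nth[OF C(1)] rot_nth[OF bdd_1] ell2_mult_nth[OF bdd_lam] ell2_mult_nth[OF bdd_cut] mlam[symmetric])
    (simp add: mult_ac)
  have rd: "rot (%k. \<i> * of_real (?c k) * ?m k) ?c u (ell2_mult lam x) + rot ?m ?c u (ell2_mult (%_. \<i>) (drift_op x)) = ell2_mult (cutm n) (S' u (NA x))" for u x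
   unfolding drift_op_def NA_def
   by (rule ell2_eqI, unfold plus_ell2.rep_eq minus_ell2.rep_eq rot_nth[OF C(1)] rot_nth[OF C(2)] rot_nth[OF bdd_1] ell2_mult_nth[OF bdd_lam]
    ell2_mult_nth[OF bdd_cut] ell2_mult_nth[OF bi] ell2_mult_nth[OF bdd_drift(1)] ell2_mult_nth[OF bdd_drift(2)] ell2_mult_nth[OF bdd_\<alpha>] mlam[symmetric])
    (simp add: algebra_simps)
  have "ito t (%u om. rot ?m ?c u (ell2_mult lam (G (Hs v u om)))) (JJ v (to_ell2 s u0) n t)"
  proof (rule ito_rot[OF ito_I t C])
   show "AE om in M. continuous_on {0..} (%r. y r om) & set_integrable lborel {0..t} (%u. ?dr u om)" using di[OF t] AE_space
    by eventually_elim (use ycont in \<open>auto intro: integrable_bounded_linear[OF lini] simp: set_integrable_def linear_simps[OF lini, symmetric]\<close>)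
   show "AE om in M. I r om = y r om - y 0 om - (LINT u:{0..r}|lborel. ?dr u om)" for r using y_0 by eventually_elim (simp add: I_def)
   have [measurable]: "(%om. ell2_mult (cutm n) (S' t (Hs v t om))) : borel_measurable M"
    by (rule F_M[OF prog_adapted[OF cut_prog[OF continuous_on_id Hp] t] t])
   have "(%om. LINT u:{0..t}|lborel. ell2_mult (cutm n) (S' u (NA (Hs v u om)))) : borel_measurable M"
    by (rule F_M[OF path_integral_measurable[OF cut_prog[OF NA_cont Hp] t] t])
   then show "JJ v (to_ell2 s u0) n t : borel_measurable M" unfolding JJ_def[abs_def] by measurable
   show "AE om in M. JJ v (to_ell2 s u0) n t om = rot ?m ?c t (y t om) - rot ?m ?c 0 (y 0 om)
    - (LINT u:{0..t}|lborel. rot (%k. \<i> * of_real (?c k) * ?m k) ?c u (y u om)) - (LINT u:{0..t}|lborel. rot ?m ?c u (?dr u om))"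
    using y_0 He di[OF t] AE_space
   proof eventually_elim
    case (elim om)
    note y0 = elim(1) and h = elim(2) and d = elim(3) and om = elim(4)
    have yh: "y r om = ell2_mult lam (Hs v r om)" if "0 <= r" for r using h that by (simp add: y_def to_ell2_s)
    have i1: "set_integrable lborel {0..t} (%u. rot (%k. \<i> * of_real (?c k) * ?m k) ?c u (y u om))"
     by (intro rot_integrable[OF C(2)] set_integrable_continuous_halfline ycont om)
    have i2: "set_integrable lborel {0..t} (%u. rot ?m ?c u (?dr u om))" using integrable_bounded_linear[OF lini d[unfolded set_integrable_def]]
     by (intro rot_integrable[OF C(1)]) (simp add: set_integrable_def linear_simps[OF lini])
    have "(LINT u:{0..t}|lborel. rot (%k. \<i> * of_real (?c k) * ?m k) ?c u (y u om)) + (LINT u:{0..t}|lborel. rot ?m ?c u (?dr u om))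
     = (LINT u:{0..t}|lborel. ell2_mult (cutm n) (S' u (NA (Hs v u om))))" unfolding set_integral_add(2)[OF i1 i2, symmetric]
     by (rule set_lebesgue_integral_cong) (use yh in \<open>simp, metis (no_types, lifting) atLeastAtMost_iff rd\<close>)
    moreover have "S' 0 x = x" for x by (rule ell2_eqI) (simp add: rot_nth[OF bdd_1])
    ultimately show ?case
     unfolding JJ_def y0 yh[OF t] rl x0_def by (simp add: algebra_simps)
   qed
  qed
  then show ?thesis by (simp only: rl)
 qed
qed

text \<open>Cutting and twisting do not increase norms, so the differences of the cut coefficients
  obey the Lipschitz bounds of \<open>NA\<close> and \<open>G\<close> uniformly in \<open>n\<close>,
  against the full difference \<open>?D\<close>. That is precisely the form
  \<open>local_gronwall\<close> accepts.\<close>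

theorem strong_solution_unique:
 assumes v1: "strong_solution M \<F> W s \<sigma> \<alpha> \<phi> u0 v1" and v2: "strong_solution M \<F> W s \<sigma> \<alpha> \<phi> u0 v2" and u0: "u0 : sob s"
 shows "AE w in M. ALL t>=0. v1 t w = v2 t w"
proof -
 note f1 = strong_solution_facts[OF v1 u0] and f2 = strong_solution_facts[OF v2 u0]
 define x0 where "x0 = to_ell2 s u0"
 \<comment> \<open>The \<open>H^s\<close> norm is the supremum over \<open>n\<close> of these
   functions, each continuous in time, so the condition is closed in time although the norm itself
   need not be continuous; hence \<open>cutoff_pred\<close> applies.\<close>
 define P where "P c q w \<longleftrightarrow> (ALL n. norm (ell2_mult (upm s n) (to_ell2 0 (v1 q w))) <= real c & norm (ell2_mult (upm s n) (to_ell2 0 (v2 q w))) <= real c)"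
  for c :: nat and q w
 define th where "th c t w = (if ALL q:{0..t}. P c q w then 1 else 0 :: real)" for c t w
 have upl: "bounded_linear (ell2_mult (upm s n))" for n using bdd_up[OF s_pos] ell2_mult_linear by blast
 have rn: "regular (%t w. norm (ell2_mult (upm s n) (to_ell2 0 (v t w))))" if "regular (%t w. to_ell2 0 (v t w))" for n and v :: "real => 'a => 'd coeffs"
  by (rule regular_compose[OF that, of "%_ x. norm (ell2_mult (upm s n) x)"])
   (auto simp: case_prod_beta intro!: continuous_on_compose2[OF linear_continuous_on[OF upl, of UNIV]] continuous_intros)
 have th: "cutoff (th c)" for c unfolding th_def
 proof (rule cutoff_pred)
  fix q :: real assume q: "0 <= q"
  have [measurable]: "(%w. norm (ell2_mult (upm s n) (to_ell2 0 (v1 q w)))) : borel_measurable (\<F> q)"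
   "(%w. norm (ell2_mult (upm s n) (to_ell2 0 (v2 q w)))) : borel_measurable (\<F> q)" for n
   using adaptedD[OF regular_adapted[OF rn[OF f1(1)]] q order_refl] adaptedD[OF regular_adapted[OF rn[OF f2(1)]] q order_refl] by auto
  show "Measurable.pred (\<F> q) (P c q)" unfolding P_def[abs_def] by measurable
 next
  fix w assume w: "w : space M"
  have cl: "closed {q. 0 <= q & norm (ell2_mult (upm s n) (to_ell2 0 (v q w))) <= real c}"
   if "regular (%t w. to_ell2 0 (v t w))" for n and v :: "real => 'a => 'd coeffs"
  proof -
   have "closed ({0..} \<inter> (%q. norm (ell2_mult (upm s n) (to_ell2 0 (v q w)))) -` {..real c})"
    by (intro continuous_closed_preimage regular_continuous[OF rn[OF that] w]) auto
   also have "... = {q. 0 <= q & norm (ell2_mult (upm s n) (to_ell2 0 (v q w))) <= real c}" by auto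
   finally show ?thesis .
  qed
  have "{q. 0 <= q & P c q w} = (\<Inter>n. {q. 0 <= q & norm (ell2_mult (upm s n) (to_ell2 0 (v1 q w))) <= real c}
   \<inter> {q. 0 <= q & norm (ell2_mult (upm s n) (to_ell2 0 (v2 q w))) <= real c})" by (auto simp: P_def)
  then show "closed {q. 0 <= q & P c q w}" using cl[OF f1(1)] cl[OF f2(1)] by (simp only:) (intro closed_INT ballI closed_Int)
 qed
 have upH: "ell2_mult (upm s n) (to_ell2 0 u) = ell2_mult (cutm n) (to_ell2 s u)" if "u : sob s" for n u
  using bdd_up[OF s_pos, of n] up_to_ell2[of _ 0 n u] that to_ell2_of(2)[OF s_pos, of "to_ell2 s u"] by (auto simp: of_ell2_to_ell2)
 have cutn: "norm (ell2_mult (cutm n) x) <= norm x" for n x using ell2_mult_norm[OF bdd_cut, of n x] by simp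
 have good: "AE w in M. ALL t>=0. ALL c. P c t w \<longleftrightarrow> norm (Hs v1 t w) <= real c & norm (Hs v2 t w) <= real c" using f1(4) f2(4)
 proof eventually_elim
  case (elim w)
  note h = elim
  have iff: "(ALL n. norm (ell2_mult (cutm n) x) <= real c) \<longleftrightarrow> norm x <= real c" for x and c :: nat
   using tendsto_upperbound[OF tendsto_norm[OF cut_lim[of x]] always_eventually, of "real c"] by (auto intro: order_trans[OF cutn])
  show ?case
   using h by (simp add: P_def upH all_conj_distrib iff)
 qed
 let ?D = "%t w. Hs v1 t w - Hs v2 t w"
 let ?T = "%n F rh x. ell2_mult (cutm n) (S' rh (F x))"
 have Tdiff: "norm (?T n F rh x - ?T n F rh y) <= norm (F x - F y)" for n F rh x y
  using cutn[of n "S' rh (F x - F y)"] by (simp add: linear_simps[OF ell2_mult_linear[OF bdd_cut]] linear_simps[OF rot_linear[OF bdd_1]] rot_1_norm[of _ _ "F x - F y", unfolded linear_simps[OF rot_linear[OF bdd_1]]])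
 have f_int: "AE w in M. ALL t. set_integrable lborel {0..t} (%rh. ?T n NA rh (Hs v rh w))"
  if p: "prog (Hs v)" and b: "AE w in M. ALL T. EX c::nat. ALL t:{0..T}. norm (Hs v t w) <= real c" for v n using b AE_space
 proof eventually_elim
  case (elim w)
  note b = elim(1) and w = elim(2)
  show ?case
  proof
   fix t :: real
   obtain c :: nat where c: "ALL q:{0..t}. norm (Hs v q w) <= real c" using b by blast
   define B where "B = cmod \<alpha> * (K * (Z * real c) ^ (2 * \<sigma>) * real c)"
   have bnd: "norm (?T n NA rh (Hs v rh w)) <= B" if "rh : {0..t}" for rh
   proof -
    have "norm (?T n NA rh (Hs v rh w)) <= norm (NA (Hs v rh w))" using cutn[of n "S' rh (NA (Hs v rh w))"] by (simp add: rot_1_norm)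
    also have "... <= cmod \<alpha> * norm (N (Hs v rh w))" unfolding NA_def by (rule ell2_mult_norm[OF bdd_\<alpha>])
    also have "... <= B" unfolding B_def using c that by (intro mult_left_mono N_bound) auto
    finally show ?thesis .
   qed
   show "set_integrable lborel {0..t} (%rh. ?T n NA rh (Hs v rh w))"
   proof (cases "0 <= t")
    case True
    have "(%rh. ?T n NA rh (Hs v rh w)) : borel_measurable (restrict_space borel {0..t})" by (rule prog_section[OF cut_prog[OF NA_cont p] w True])
    then have m: "set_borel_measurable lborel {0..t} (%rh. ?T n NA rh (Hs v rh w))"
     by (simp add: set_borel_measurable_def borel_measurable_restrict_space_iff)
    show ?thesis by (rule set_integrable_bound[OF set_integrable_continuous_halfline[OF continuous_on_const[of _ B]] m])
      (use bnd in \<open>auto intro!: AE_I2 order_trans[OF _ abs_ge_self]\<close>)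
   qed (simp add: set_integrable_def)
  qed
 qed
 have D0: "AE w in M. th c t w *R ?D t w = 0" if t: "0 <= t" for c t
 proof -
  obtain LN where LN: "0 <= LN" "!!x y. norm x <= real c ==> norm y <= real c ==> norm (N x - N y) <= LN * norm (x - y)" using N_lipschitz by blast
  obtain LG where LG: "0 <= LG" "!!x y. norm x <= real c ==> norm y <= real c ==> norm (G x - G y) <= LG * norm (x - y)" using G_lipschitz by blast
  define L where "L = cmod \<alpha> * LN + LG"
  have L: "norm (NA x - NA y) <= L * norm (x - y)" "norm (G x - G y) <= L * norm (x - y)" if "norm x <= real c" "norm y <= real c" for x y
  proof -
   have "norm (NA x - NA y) <= cmod \<alpha> * norm (N x - N y)"
    unfolding NA_def linear_simps(2)[OF ell2_mult_linear[OF bdd_\<alpha>], symmetric] by (rule ell2_mult_norm[OF bdd_\<alpha>])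
   also have "... <= cmod \<alpha> * (LN * norm (x - y))" by (intro mult_left_mono LN that) auto
   also have "... <= L * norm (x - y)" using LG(1) by (simp add: L_def distrib_right)
   finally show "norm (NA x - NA y) <= L * norm (x - y)" .
   have "LG * norm (x - y) <= L * norm (x - y)" using LN(1) by (intro mult_right_mono) (auto simp: L_def)
   then show "norm (G x - G y) <= L * norm (x - y)" using LG(2)[OF that] by linarith
  qed
  let ?f = "%n rh w. ?T n NA rh (Hs v1 rh w) - ?T n NA rh (Hs v2 rh w)"
  let ?h = "%n rh w. ?T n G rh (Hs v1 rh w) - ?T n G rh (Hs v2 rh w)"
  let ?J = "%n t w. JJ v1 x0 n t w - JJ v2 x0 n t w"
  have Lip: "AE w in M. ALL rh:{0..t}. norm (th c rh w *R (?T n F rh (Hs v1 rh w) - ?T n F rh (Hs v2 rh w))) <= L * norm (th c rh w *R ?D rh w)"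
   if F: "!!x y. norm x <= real c ==> norm y <= real c ==> norm (F x - F y) <= L * norm (x - y)" for F n using good
  proof (eventually_elim, intro ballI)
   fix w rh assume g: "ALL t>=0. ALL c. P c t w \<longleftrightarrow> norm (Hs v1 t w) <= real c & norm (Hs v2 t w) <= real c" and rh: "rh : {0..t}"
   show "norm (th c rh w *R (?T n F rh (Hs v1 rh w) - ?T n F rh (Hs v2 rh w))) <= L * norm (th c rh w *R ?D rh w)"
   proof (cases "ALL q:{0..rh}. P c q w")
    case True
    then have "P c rh w" using rh by auto
    then have "norm (F (Hs v1 rh w) - F (Hs v2 rh w)) <= L * norm (?D rh w)" using g rh by (intro F) auto
    then show ?thesis using True order_trans[OF Tdiff] by (simp add: th_def)
   next
    case False
    then have "th c rh w = 0" unfolding th_def by auto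
    then show ?thesis by simp
   qed
  qed
  \<comment> \<open>By the form of \<open>JJ\<close> the initial data and the drifts cancel, and the
    cut and twisted difference remains; its norm tends to that of \<open>?D\<close> because
    \<open>S'\<close> is an isometry.\<close>
  have eq: "AE w in M. (LINT rh:{0..r}|lborel. ?f n rh w) + ?J n r w = ell2_mult (cutm n) (S' r (?D r w))" for n r
   using f_int[OF f1(3) f1(5), of n] f_int[OF f2(3) f2(5), of n]
  proof eventually_elim
   case (elim w)
   note i = elim
   show ?case
    unfolding set_integral_diff(2)[OF i(1)[rule_format] i(2)[rule_format]] JJ_def
    by (simp add: linear_simps[OF ell2_mult_linear[OF bdd_cut]] linear_simps[OF rot_linear[OF bdd_1]])
  qed
  show ?thesis
  proof (rule local_gronwall[where f="?f" and h="?h" and J="?J" and T=t and L=L, OF th prog_diff[OF f1(3) f2(3)] prog_diff[OF cut_prog[OF NA_cont f1(3)] cut_prog[OF NA_cont f2(3)]]])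
   show "ito r (?h n) (?J n r)" if "0 <= r" for n r unfolding x0_def by (intro ito_diff f1(6)[OF that] f2(6)[OF that])
   show "AE w in M. set_integrable lborel {0..t} (%rh. ?f n rh w)" for n
    using f_int[OF f1(3) f1(5), of n] f_int[OF f2(3) f2(5), of n] by eventually_elim (auto intro: set_integral_diff)
   show "AE w in M. (%n. norm ((LINT rh:{0..r}|lborel. ?f n rh w) + ?J n r w)) ----> norm (?D r w)" for r
   proof -
    have "AE w in M. ALL n. (LINT rh:{0..r}|lborel. ?f n rh w) + ?J n r w = ell2_mult (cutm n) (S' r (?D r w))"
     unfolding AE_all_countable using eq by blast
    then show ?thesis
    proof eventually_elim
     case (elim w)
     note e = elim
     show ?case
      unfolding e[rule_format] using tendsto_norm[OF cut_lim[of "S' r (?D r w)"]] by (simp only: rot_1_norm)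
    qed
   qed
   show "AE w in M. ALL rh:{0..t}. norm (th c rh w *R ?f n rh w) <= L * norm (th c rh w *R ?D rh w)" for n by (rule Lip[OF L(1)])
   show "AE w in M. ALL rh:{0..t}. norm (th c rh w *R ?h n rh w) <= L * norm (th c rh w *R ?D rh w)" for n by (rule Lip[OF L(2)])
   show "(EE w. nsq (th c r w *R ?D r w)) <= ennreal ((2 * real c)^2)" if r: "0 <= r" for r
   proof -
    have "(EE w. nsq (th c r w *R ?D r w)) <= (EE w. ennreal ((2 * real c)^2))"
    proof (rule nn_integral_mono_AE, use good in eventually_elim)
     fix w assume g: "ALL t>=0. ALL c. P c t w \<longleftrightarrow> norm (Hs v1 t w) <= real c & norm (Hs v2 t w) <= real c"
     have "norm (th c r w *R ?D r w) <= 2 * real c"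
     proof (cases "ALL q:{0..r}. P c q w")
      case True
      then have "norm (Hs v1 r w) <= real c" "norm (Hs v2 r w) <= real c" using g r by auto
      then show ?thesis using True norm_triangle_ineq4[of "Hs v1 r w" "Hs v2 r w"] by (simp add: th_def)
     next
      case False
      then have "th c r w = 0" unfolding th_def by auto
      then show ?thesis by simp
     qed
     then show "nsq (th c r w *R ?D r w) <= ennreal ((2 * real c)^2)" by (intro ennreal_leI power_mono) auto
    qed
    then show ?thesis by (simp add: emeasure_space_1)
   qed
  qed (use t in auto)
 qed
 have "AE w in M. v1 t w = v2 t w" if t: "0 <= t" for t
 proof -
  have "AE w in M. ALL c. th c t w *R ?D t w = 0" unfolding AE_all_countable using D0[OF t] by blast
  then show ?thesis using good f1(4) f2(4) f1(5) f2(5)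
  proof eventually_elim
   case (elim w)
   note z = elim(1) and g = elim(2) and h = elim(3,4) and b = elim(5,6)
   obtain c1 c2 :: nat where c: "ALL q:{0..t}. norm (Hs v1 q w) <= real c1" "ALL q:{0..t}. norm (Hs v2 q w) <= real c2" using b by blast
   have "P (c1 + c2) q w" if "q : {0..t}" for q using c that g by force
   then have "?D t w = 0" using z[rule_format, of "c1 + c2"] by (simp add: th_def)
   then show ?case using h t by (metis eq_iff_diff_eq_0 of_ell2_to_ell2)
  qed
 qed
 then have "AE w in M. ALL t>=0. ALL p. v1 (kap p t) w = v2 (kap p t) w" by (rule AE_kap)
 then show ?thesis using AE_space
 proof (eventually_elim, intro allI impI)
  fix w and t :: real assume e: "ALL t>=0. ALL p. v1 (kap p t) w = v2 (kap p t) w" and w: "w : space M" and t: "0 <= t"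
  have "(%p. to_ell2 0 (v1 (kap p t) w)) ----> to_ell2 0 (v1 t w)" by (rule kap_tendsto[OF regular_continuous[OF f1(1) w] t])
  moreover have "(%p. to_ell2 0 (v2 (kap p t) w)) ----> to_ell2 0 (v2 t w)" by (rule kap_tendsto[OF regular_continuous[OF f2(1) w] t])
  ultimately have "to_ell2 0 (v1 t w) = to_ell2 0 (v2 t w)" using e t LIMSEQ_unique by simp
  then show "v1 t w = v2 t w" using f1(2)[OF t w] f2(2)[OF t w] by (metis of_ell2_to_ell2)
 qed
qed

end

section \<open>Moments of Brownian motion and the conclusion\<close>

text \<open>A weight measurable at time \<open>r\<close> generates a sub-algebra of
  \<open>\<F> r\<close>, hence is independent of the increment, and the mean of the product
  factorises.\<close>

lemma brownian_increment_moment: assumes "prob_space M" "standard_filtration M \<F>" and W: "brownian_motion M \<F> W" and rt: "0 <= r" "r < t"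
  and ze: "ze : borel_measurable (\<F> r)" "integrable M ze" and p: "has_bochner_integral lborel (%x. normal_density 0 (sqrt (t - r)) x * x ^ p) m"
 shows "has_bochner_integral M (%w. ze w * (W t w - W r w) ^ p) (m * prob_space.expectation M ze)"
proof -
 interpret prob_space M by fact
 let ?d = "%w. W t w - W r w"
 have D: "distributed M lborel ?d (normal_density 0 (sqrt (t - r)))" and ind: "indep_set (sets (\<F> r)) (sets (vimage_algebra (space M) ?d borel))"
  using W rt by (auto simp: brownian_motion_def)
 have [measurable]: "?d : borel_measurable M" using distributed_measurable[OF D] by simp
 have i: "integrable M (%w. ?d w ^ p)" "expectation (%w. ?d w ^ p) = m"
  using p distributed_integrable[OF D, of "%x. x ^ p"] distributed_integral[OF D, of "%x. x ^ p"] by (auto simp: has_bochner_integral_iff)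
 have sub: "subalgebra M (\<F> r)" using assms(2) rt by (simp add: standard_filtration_def)
 have "indep_var borel ze borel ?d" unfolding indep_var_eq
 proof (intro conjI)
  show "ze : borel_measurable M" by (rule measurable_from_subalg[OF sub ze(1)])
  have 1: "sigma_sets (space M) {ze -` A \<inter> space M |A. A : sets borel} \<subseteq> sets (\<F> r)"
  proof -
   have sp: "space (\<F> r) = space M" using sub by (simp add: subalgebra_def)
   have "{ze -` A \<inter> space M |A. A : sets borel} \<subseteq> sets (\<F> r)" using measurable_sets[OF ze(1)] unfolding sp by auto
   from sets.sigma_sets_subset[OF this] show ?thesis unfolding sp .
  qed
  have 2: "sigma_sets (space M) {?d -` A \<inter> space M |A. A : sets borel} \<subseteq> sets (vimage_algebra (space M) ?d borel)"
   by (simp add: sets_vimage_algebra)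
  show "indep_set (sigma_sets (space M) {ze -` A \<inter> space M |A. A : sets borel}) (sigma_sets (space M) {?d -` A \<inter> space M |A. A : sets borel})"
   using ind 1 2 unfolding indep_sets2_eq by (meson subset_iff)
 qed measurable
 then have "indep_var borel (id \<circ> ze) borel ((%x. x ^ p) \<circ> ?d)" by (rule indep_var_compose) auto
 then have v: "indep_var borel ze borel (%w. ?d w ^ p)" by (simp add: o_def)
 show ?thesis using indep_var_integrable[OF v ze(2) i(1)] indep_var_lebesgue_integral[OF v ze(2) i(1)] i(2)
  by (simp add: has_bochner_integral_iff mult.commute)
qed

text \<open>Setting \<open>W\<close> to 0 on the null set of discontinuous paths keeps it adapted,
  as null sets belong to \<open>\<F> 0\<close>, and does not change any moment.\<close>

lemma brownian_motion_wiener: assumes M: "prob_space M" and F: "standard_filtration M \<F>" and W: "brownian_motion M \<F> W"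
 obtains W' where "wiener M \<F> W'" "AE w in M. ALL t. W t w = W' t w"
proof -
 interpret prob_space M by (rule M)
 have "AE w in M. continuous_on {0..} (%t. W t w)" using W by (simp add: brownian_motion_def)
 then obtain N where N: "N : null_sets M" "!!w. w : space M - N ==> continuous_on {0..} (%t. W t w)" by (rule AE_E3) blast
 define W' where "W' t w = (if w : N then 0 else W t w)" for t w
 have ae: "AE w in M. ALL t. W t w = W' t w" using AE_not_in[OF N(1)] by eventually_elim (simp add: W'_def)
 have sub: "subalgebra M (\<F> t)" if "0 <= t" for t using F that by (simp add: standard_filtration_def)
 have Wm: "W t : borel_measurable (\<F> t)" if "0 <= t" for t using W that by (simp add: brownian_motion_def)
 have W'm: "W' t : borel_measurable (\<F> t)" if t: "0 <= t" for t
 proof -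
  have "N : sets (\<F> t)" using F N(1) t unfolding standard_filtration_def by blast
  then have [measurable]: "{w:space (\<F> t). w : N} : sets (\<F> t)" using sets.sets_into_space by (auto simp: Collect_conj_eq Int_absorb1)
  note [measurable] = Wm[OF t]
  show ?thesis unfolding W'_def[abs_def] by measurable
 qed
 have mom: "has_bochner_integral M (%w. ze w * (W' t w - W' r w) ^ p) (m * expectation ze)"
  if rt: "0 <= r" "r <= t" and ze: "ze : borel_measurable (\<F> r)" "integrable M ze" and p0: "p ~= 0" "r = t ==> m = 0"
   and p: "r < t ==> has_bochner_integral lborel (%x. normal_density 0 (sqrt (t - r)) x * x ^ p) m" for r t ze p m
 proof (cases "r = t")
  case True
  then show ?thesis using p0 by (simp add: zero_power has_bochner_integral_zero)
 next
  case False
  from rt have t: "0 <= t" by simp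
  note m = measurable_from_subalg[OF sub[OF rt(1)] ze(1)] measurable_from_subalg[OF sub[OF rt(1)] W'm[OF rt(1)]]
   measurable_from_subalg[OF sub[OF t] W'm[OF t]] measurable_from_subalg[OF sub[OF rt(1)] Wm[OF rt(1)]] measurable_from_subalg[OF sub[OF t] Wm[OF t]]
  from False rt have 1: "has_bochner_integral M (%w. ze w * (W t w - W r w) ^ p) (m * expectation ze)"
   by (intro brownian_increment_moment[OF M F W _ _ ze p]) auto
  have "AE w in M. ze w * (W t w - W r w) ^ p = ze w * (W' t w - W' r w) ^ p" using ae by eventually_elim simp
  then have "has_bochner_integral M (%w. ze w * (W t w - W r w) ^ p) (m * expectation ze)
   \<longleftrightarrow> has_bochner_integral M (%w. ze w * (W' t w - W' r w) ^ p) (m * expectation ze)"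
   by (rule has_bochner_integral_cong_AE[rotated 2]) (intro borel_measurable_times borel_measurable_power borel_measurable_diff m refl)+
  then show ?thesis using 1 by simp
 qed
 have "wiener M \<F> W'"
 proof (unfold_locales)
  show "standard_filtration M \<F>" by (rule F)
  show "W' t : borel_measurable (\<F> t)" if "0 <= t" for t by (rule W'm[OF that])
  show "continuous_on {0..} (%t. W' t w)" if "w : space M" for w using N(2)[of w] that by (cases "w : N") (auto simp: W'_def)
  fix r t :: real assume rt: "0 <= r" "r <= t"
  \<comment> \<open>For \<open>k\<close> = 1, 2 and 3 the factor
    \<open>fact (2 * k) / (2 ^ k * fact k)\<close> takes the values 1, 3 and 15. The formula needs
    \<open>r < t\<close>; equal times are covered by \<open>mom\<close>.\<close>
  have even: "has_bochner_integral lborel (%x. normal_density 0 (sqrt (t - r)) x * x ^ p) m"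
   if "r < t" "p = 2 * k" "m = fact (2 * k) * (t - r) ^ k / (2 ^ k * fact k)" for p k m
  proof -
   have "fact (2 * k) / ((2 / (sqrt (t - r))^2) ^ k * fact k) = fact (2 * k) * (t - r) ^ k / (2 ^ k * fact k)" using that by (simp add: power_divide)
   then show ?thesis using normal_moment_even[of "sqrt (t - r)" 0 k] that by simp
  qed
  show "has_bochner_integral M (%w. ze w * (W' t w - W' r w)) 0" if "ze : borel_measurable (\<F> r)" "integrable M ze" for ze
   using mom[OF rt that, of 1 0] normal_moment_odd[of "sqrt (t - r)" 0 0] by simp
  show "has_bochner_integral M (%w. ze w * (W' t w - W' r w)^2) ((t - r) * expectation ze)" if "ze : borel_measurable (\<F> r)" "integrable M ze" for ze
  proof -
   have e: "has_bochner_integral lborel (%x. normal_density 0 (sqrt (t - r)) x * x ^ 2) (t - r)" if "r < t"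
    by (rule even[OF that, of _ 1]) (simp_all add: fact_numeral)
   have "has_bochner_integral M (%w. ze w * (W' t w - W' r w) ^ 2) ((t - r) * expectation ze)"
    by (rule mom[OF rt _ _ _ _ e]) (use that in simp_all)
   then show ?thesis by (simp)
  qed
  show "has_bochner_integral M (%w. (W' t w - W' r w) ^ 4) (3 * (t - r) ^ 2)"
  proof -
   have e: "has_bochner_integral lborel (%x. normal_density 0 (sqrt (t - r)) x * x ^ 4) (3 * (t - r) ^ 2)" if "r < t"
    by (rule even[OF that, of _ 2]) (simp_all add: fact_numeral)
   have "has_bochner_integral M (%w. 1 * (W' t w - W' r w) ^ 4) ((3 * (t - r) ^ 2) * expectation (%w. 1))"
    by (rule mom[OF rt _ _ _ _ e]) (use rt in simp_all)
   then show ?thesis by (simp add: prob_space)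
  qed
  show "has_bochner_integral M (%w. (W' t w - W' r w) ^ 6) (15 * (t - r) ^ 3)"
  proof -
   have e: "has_bochner_integral lborel (%x. normal_density 0 (sqrt (t - r)) x * x ^ 6) (15 * (t - r) ^ 3)" if "r < t"
    by (rule even[OF that, of _ 3]) (simp_all add: fact_numeral)
   have "has_bochner_integral M (%w. 1 * (W' t w - W' r w) ^ 6) ((15 * (t - r) ^ 3) * expectation (%w. 1))"
    by (rule mom[OF rt _ _ _ _ e]) (use rt in simp_all)
   then show ?thesis by (simp add: prob_space)
  qed
 qed
 then show thesis using ae that by blast
qed

text \<open>The driving process occurs only in measures of events built from elementary integrals,
  and these agree for two versions of it; adaptedness of \<open>V\<close> makes the events
  measurable.\<close>

lemma (in wiener) has_ito_cong: fixes X :: "real => 'a => 'b::{banach, second_countable_topology}"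
 assumes V: "!!t. 0 <= t ==> V t : borel_measurable (\<F> t)" and eq: "AE w in M. ALL t. V t w = W t w" and t: "0 <= t"
 shows "has_ito_integral M \<F> V t X I \<longleftrightarrow> has_ito_integral M \<F> W t X I"
proof -
 have "measure M {w:space M. e < norm (elementary_integral V n ta xi t w - I w)}
  = measure M {w:space M. e < norm (elementary_integral W n ta xi t w - I w)}"
  if I[measurable]: "I : borel_measurable M" and el: "elementary M \<F> n ta xi" for n ta e and xi :: "nat => 'a => 'b"
 proof -
  have U: "elementary_integral U n ta xi t : borel_measurable M" if U: "!!t. 0 <= t ==> U t : borel_measurable (\<F> t)" for U
   unfolding elementary_integral_def[abs_def]
  proof (intro borel_measurable_sum borel_measurable_scaleR borel_measurable_diff)
   fix i assume "i : {..<n}"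
   then have i: "i < n" by simp
   note ta = elementary_sorted[OF el, of i] elementary_sorted[OF el, of "Suc i"]
   show "U (min t (ta (Suc i))) : borel_measurable M" "U (min t (ta i)) : borel_measurable M" using i ta t by (auto intro!: F_M[OF U])
   have "xi i : borel_measurable (\<F> (ta i))" using el i by (simp add: elementary_def)
   then show "xi i : borel_measurable M" using ta(1) i by (auto intro: F_M)
  qed
  note [measurable] = U[OF V] U[OF W_adapted]
  show ?thesis
  proof (rule measure_eq_AE)
   show "AE w in M. (w : {w:space M. e < norm (elementary_integral V n ta xi t w - I w)})
    = (w : {w:space M. e < norm (elementary_integral W n ta xi t w - I w)})" using eq by eventually_elim (simp add: elementary_integral_def)
  qed measurable
 qed
 then show ?thesis unfolding has_ito_integral_def by (intro conj_cong ex_cong1 refl) auto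
qed

theorem theorem2p8:
  fixes M :: "'a measure" and \<F> :: "real \<Rightarrow> 'a measure" and W :: "real \<Rightarrow> 'a \<Rightarrow> real"
    and \<sigma> :: nat and \<alpha> :: complex and s s' K :: real
    and \<phi> :: "'d::finite coeffs \<Rightarrow> 'd coeffs"
    and u0 :: "'d coeffs"
  assumes "\<sigma> \<ge> 1" and "s > s'" and "s' > real CARD('d) / 2"
    and "K > 0"
    and K: "\<forall>u::'d coeffs. u \<in> sob s \<and> Linf_norm (fourier_fun u) < \<infinity> \<longrightarrow>
      power_nonlin \<sigma> u \<in> sob s \<and>
      sob_norm s (power_nonlin \<sigma> u)
        \<le> K * real_of_ereal (Linf_norm (fourier_fun u)) ^ (2 * \<sigma>) * sob_norm s u"
    and "prob_space M" and "standard_filtration M \<F>" and "brownian_motion M \<F> W"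
    and \<phi>: "\<phi> \<in> sob s' \<rightarrow> sob (- s - 1)"
    and a: "\<phi> \<in> sob s \<rightarrow> sob s" "bounded_on_balls s s \<phi>"
    and b: "continuous_map (sob_topology s') (sob_topology (- s - 1)) \<phi>"
      "bounded_on_balls s' (- s - 1) \<phi>"
    and c: "\<forall>n\<ge>1. locally_lipschitz_trig n (\<lambda>u. trig_proj n (\<phi> u))"
    and d: "\<exists>\<psi> :: real \<Rightarrow> real \<Rightarrow> real.
      (\<forall>x\<ge>0. \<forall>y\<ge>0. \<psi> x y \<ge> 0) \<and>
      case_prod \<psi> \<in> borel_measurable (restrict_space borel ({0..} \<times> {0..})) \<and>
      (\<forall>R. \<exists>C. \<forall>x\<in>{0..R}. \<forall>y\<in>{0..R}. \<psi> x y \<le> C) \<and>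
      (\<forall>u\<in>sob s. \<forall>v\<in>sob s.
        sob_dist s (\<phi> u) (\<phi> v) \<le> \<psi> (sob_norm s u) (sob_norm s v) * sob_dist s u v)"
    and e: "\<exists>r>1. \<exists>B. \<forall>u\<in>sob s. sob_norm s u \<ge> r \<longrightarrow>
      cmod \<alpha> * K * real_of_ereal (Linf_norm (fourier_fun u)) ^ (2 * \<sigma>)
        + 1 / 2 * ((sob_norm s (\<phi> u))\<^sup>2 / (sob_norm s u)\<^sup>2)
        - (Re (sob_inner s u (\<phi> u)))\<^sup>2 / (sob_norm s u) ^ 4 \<le> B"
    and u0: "u0 \<in> sob s"
  shows "\<exists>u. strong_solution M \<F> W s \<sigma> \<alpha> \<phi> u0 u \<and>
      (AE \<omega> in M. sob_continuous s (\<lambda>t. u t \<omega>)) \<and>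
      (\<forall>v. strong_solution M \<F> W s \<sigma> \<alpha> \<phi> u0 v \<longrightarrow>
        (AE \<omega> in M. \<forall>t\<ge>0. v t \<omega> = u t \<omega>))"
proof -
 obtain W' where W': "wiener M \<F> W'" and eq: "AE \<omega> in M. ALL t. W t \<omega> = W' t \<omega>"
  using brownian_motion_wiener[OF \<open>prob_space M\<close> \<open>standard_filtration M \<F>\<close> \<open>brownian_motion M \<F> W\<close>] by blast
 interpret wiener M \<F> W' by (rule W')
 interpret nls_sde s K \<sigma> \<alpha> \<phi> M \<F> W'
 proof unfold_locales
  show "real CARD('d) / 2 < s" using assms(2,3) by linarith
  show "EX \<psi> :: real => real => real. (ALL R. EX C. ALL x:{0..R}. ALL y:{0..R}. \<psi> x y <= C) &
   (ALL u:sob s. ALL v:sob s. sob_dist s (\<phi> u) (\<phi> v) <= \<psi> (sob_norm s u) (sob_norm s v) * sob_dist s u v)" using d by blast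
 qed (fact K a \<open>K > 0\<close>)+
 have "W t : borel_measurable (\<F> t)" if "0 <= t" for t using \<open>brownian_motion M \<F> W\<close> that by (simp add: brownian_motion_def)
 then have iff: "strong_solution M \<F> W s \<sigma> \<alpha> \<phi> u0 v \<longleftrightarrow> strong_solution M \<F> W' s \<sigma> \<alpha> \<phi> u0 v" for v
  unfolding strong_solution_def sob_has_ito_integral_def by (simp add: has_ito_cong eq cong: conj_cong)
 from e obtain r B where "1 < r" and B: "!!u. u : sob s ==> r <= sob_norm s u ==>
   cmod \<alpha> * K * real_of_ereal (Linf_norm (fourier_fun u)) ^ (2 * \<sigma>) + 1 / 2 * ((sob_norm s (\<phi> u))^2 / (sob_norm s u)^2)
    - (Re (sob_inner s u (\<phi> u)))^2 / (sob_norm s u) ^ 4 <= B" by blast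
 obtain u where u: "strong_solution M \<F> W' s \<sigma> \<alpha> \<phi> u0 u" "!!\<omega>. \<omega> : space M ==> sob_continuous s (%t. u t \<omega>)"
  by (rule strong_solution_exists[OF \<open>1 < r\<close> B u0]) blast+
 show ?thesis unfolding iff using u strong_solution_unique[OF _ u(1) u0] by (intro exI[of _ u]) (auto intro: AE_I2)
qed

end
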